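(* Let $\xi_1\in\mathfrak B_1$ be the bimould with depth-one component $1$ and all other components $0$, and for $r\ge0$ let $\partial_{2r+1}:\mathfrak B\to\mathfrak B$ be the map $\partial_{2r+1}(A)=\mathrm{uri}(\check\delta^r(\xi_1),A)$. For every $r\ge1$, one has $$\ker(\partial_{2r+1})=\mathbb Q\,\check\delta^r(\xi_1).$$
   Context: **Bimoulds.** A bimould is a family $A=(A_r)_{r\ge0}$ with $A_r=A_r(X_1,\dots,X_r\mid Y_1,\dots,Y_r)\in\mathbb Q[[X_1,Y_1,\dots,X_r,Y_r]]$ (component of depth $r$); we also allow components in $\mathcal L_r=\mathbb Q[[X_1,Y_1,\dots,X_r,Y_r]]\left[\tfrac1{X_i},\tfrac1{X_i-X_j}\mid 1\le i\ne j\le r\right]$. $\mathrm{BARI}^{\mathrm{loc}}$ is the space of families with $A_0=0$, $A_r\in\mathcal L_r$. $\mathrm{BARI}^{\mathrm{pol}}$ is its subspace of families with polynomial components, only finitely many of them nonzero. A bimould is normalized if $A_0=1$. Write $Y_{a:b}=Y_a+\dots+Y_b$. **Flexion operations.** $\mathrm{mu}(A,B)_r=\sum_{i=0}^rA_i(X_1,\dots,X_i\mid Y_1,\dots,Y_i)\,B_{r-i}(X_{i+1},\dots,X_r\mid Y_{i+1},\dots,Y_r)$. For $B$ with $B_0=0$, $$\mathrm{amit}(B)(A)_r=\sum_{1\le a<b\le r}A_{r-b+a}(X_1,\dots,X_{a-1},X_b,X_{b+1},\dots,X_r\mid Y_1,\dots,Y_{a-1},Y_{a:b},Y_{b+1},\dots,Y_r)\,B_{b-a}(X_a-X_b,\dots,X_{b-1}-X_b\mid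 Y_a,\dots,Y_{b-1}),$$ $$\mathrm{anit}(B)(A)_r=\sum_{1\le a<b\le r}A_{r-b+a}(X_1,\dots,X_{a-1},X_a,X_{b+1},\dots,X_r\mid Y_1,\dots,Y_{a-1},Y_{a:b},Y_{b+1},\dots,Y_r)\,B_{b-a}(X_{a+1}-X_a,\dots,X_b-X_a\mid Y_{a+1},\dots,Y_b),$$ $\mathrm{arit}(B)=\mathrm{amit}(B)-\mathrm{anit}(B)$, $\mathrm{preari}(A,B)=\mathrm{arit}(B)(A)+\mathrm{mu}(A,B)$, $\mathrm{ari}(A,B)=\mathrm{preari}(A,B)-\mathrm{preari}(B,A)$. For normalized $C$, $\mathrm{ganit}_C(A)_0=A_0$ and for $r\ge1$ $$\mathrm{ganit}_C(A)_r=\sum_{s\ge1}\ \sum_{0=q_0<q_1<\dots<q_s=r}A_s(X_{q_0+1},\dots,X_{q_{s-1}+1}\mid Y_{q_0+1:q_1},\dots,Y_{q_{s-1}+1:q_s})\prod_{i=1}^sC_{q_i-q_{i-1}-1}(X_{q_{i-1}+2}-X_{q_{i-1}+1},\dots,X_{q_i}-X_{q_{i-1}+1}\mid Y_{q_{i-1}+2},\dots,Y_{q_i}).$$ Let $\mathrm{pic},\mathrm{poc}$ be the normalized bimoulds with $\mathrm{pic}_r=\frac1{X_1\cdots X_r}$, $\mathrm{poc}_r=-\frac1{X_1(X_1-X_2)\cdots(X_{r-1}-X_r)}$ for $r\ge1$. The operators $\mathrm{ganit}_{\mathrm{pic}}$ and $\mathrm{ganit}_{\mathrm{poc}}$ are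 mutually inverse, and $$\mathrm{uri}(A,B)=\mathrm{ganit}_{\mathrm{pic}}\bigl(\mathrm{ari}(\mathrm{ganit}_{\mathrm{poc}}A,\mathrm{ganit}_{\mathrm{poc}}B)\bigr)$$ is a Lie bracket on $\mathrm{BARI}^{\mathrm{loc}}$. **The space $\mathfrak B$.** Expand a polynomial bimould as $A_r=\sum_{k_i\ge1,m_i\ge0}a_A\binom{k_1,\dots,k_r}{m_1,\dots,m_r}\prod_{i=1}^r\frac{X_i^{k_i-1}Y_i^{m_i}}{m_i!}$. The coefficient map of $A$ is the linear map on the span of words in letters $y_{k,m}$ ($k\ge1,m\ge0$) sending $y_{k_1,m_1}\cdots y_{k_r,m_r}$ to $a_A\binom{k_1,\dots,k_r}{m_1,\dots,m_r}$. The bi-stuffle product is given by $1*w=w*1=w$ and $y_{k,m}u*y_{l,n}v=y_{k,m}(u*y_{l,n}v)+y_{l,n}(y_{k,m}u*v)+y_{k+l,m+n}(u*v)$. $A$ is alternil if its coefficient map vanishes on $u*v$ for all nonempty words $u,v$. Swap: $\mathrm{swap}(A)_r(X\mid Y)=A_r(Y_1+\dots+Y_r,\dots,Y_1+Y_2,Y_1\mid X_r,X_{r-1}-X_r,\dots,X_1-X_2)$. Then $\mathfrak B$ is the set of $A\in\mathrm{BARI}^{\mathrm{pol}}$ that are alternil, satisfy $\mathrm{swap}(A)=A$, and $A_1(-X_1\mid-Y_1)=A_1(X_1\mid Y_1)$. $\mathfrak B_k$ is its weight $k$ part: those $A$ for which each $A_r$ is homogeneous of degree $k-r$. It is known that $\mathfrak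 B=\bigoplus_{k\ge1}\mathfrak B_k$ is a weight-graded Lie algebra under $\mathrm{uri}$. **The operator $\check\delta$.** Let $E$ be the bimould with $E_1=-\frac{X_1+Y_1}2$, $E_2=\frac14$ and all other components zero. Put $(QA)_r=\bigl(\sum_{i=1}^rX_iY_i\bigr)A_r$ and $\check\delta(A)=\mathrm{ganit}_{\mathrm{pic}}\bigl(Q(\mathrm{ganit}_{\mathrm{poc}}(A))\bigr)+\mathrm{uri}(A,E)$. The operator $\check\delta$ maps $\mathfrak B$ to itself. *)

theory Defs
  imports
    "HOL-Library.Poly_Mapping"
    "HOL-Computational_Algebra.Formal_Power_Series"
    "HOL-Computational_Algebra.Polynomial_Factorial"
begin

section \<open>Power series in the variables \<open>X\<^sub>1, Y\<^sub>1, X\<^sub>2, Y\<^sub>2, \<dots>\<close>\<close>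

text \<open>Indices start at 1; \<open>VX 0\<close> and \<open>VY 0\<close> are never used.\<close>

datatype var = VX nat | VY nat

text \<open>The order on variables is only there to obtain that the polynomial ring is an integral
  domain.\<close>

fun var_code :: "var \<Rightarrow> nat" where
  "var_code (VX i) = 2 * i"
| "var_code (VY i) = 2 * i + 1"

lemma var_code_inject: "var_code u = var_code v \<longleftrightarrow> u = v"
  by (cases u; cases v) (simp_all, presburger+)

instantiation var :: linorder
begin

definition less_eq_var :: "var \<Rightarrow> var \<Rightarrow> bool" where
  "less_eq_var u v \<longleftrightarrow> var_code u \<le> var_code v"

definition less_var :: "var \<Rightarrow> var \<Rightarrow> bool" where
  "less_var u v \<longleftrightarrow> var_code u < var_code v"

instance
  by standard (auto simp: less_eq_var_def less_var_def simp flip: var_code_inject)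

end

type_synonym monom = "var \<Rightarrow>\<^sub>0 nat"
type_synonym rpoly = "monom \<Rightarrow>\<^sub>0 rat"

definition mdeg :: "monom \<Rightarrow> nat" where
  "mdeg m = (\<Sum>v\<in>Poly_Mapping.keys m. Poly_Mapping.lookup m v)"

lemma mdeg_superset:
  assumes "finite S" "Poly_Mapping.keys m \<subseteq> S"
  shows "mdeg m = (\<Sum>v\<in>S. Poly_Mapping.lookup m v)"
  unfolding mdeg_def
  by (rule sum.mono_neutral_left) (use assms in \<open>auto simp: in_keys_iff\<close>)

lemma mdeg_add: "mdeg (m + n) = mdeg m + mdeg n"
proof -
  let ?S = "Poly_Mapping.keys m \<union> Poly_Mapping.keys n"
  have "mdeg (m + n) = (\<Sum>v\<in>?S. Poly_Mapping.lookup (m + n) v)"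
    by (rule mdeg_superset) (simp_all add: Poly_Mapping.keys_add)
  also have "\<dots> = (\<Sum>v\<in>?S. Poly_Mapping.lookup m v) + (\<Sum>v\<in>?S. Poly_Mapping.lookup n v)"
    by (simp add: lookup_add sum.distrib)
  also have "\<dots> = mdeg m + mdeg n"
    by (subst (1 2) mdeg_superset[where S = ?S]) simp_all
  finally show ?thesis .
qed

lemma mdeg_zero [simp]: "mdeg 0 = 0"
  by (simp add: mdeg_def)

lemma mdeg_single [simp]: "mdeg (Poly_Mapping.single v k) = k"
  by (simp add: mdeg_def)

definition homog :: "nat \<Rightarrow> rpoly \<Rightarrow> bool" where
  "homog d p \<longleftrightarrow> (\<forall>m\<in>Poly_Mapping.keys p. mdeg m = d)"

lemma homog_zero [simp]: "homog d 0"
  by (simp add: homog_def)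

lemma homog_one: "homog 0 1"
  by (simp add: homog_def)

lemma homog_single: "mdeg m = d \<Longrightarrow> homog d (Poly_Mapping.single m c)"
  by (simp add: homog_def)

lemma homog_add: "homog d p \<Longrightarrow> homog d q \<Longrightarrow> homog d (p + q)"
  using Poly_Mapping.keys_add[of p q] by (auto simp: homog_def)

lemma homog_uminus: "homog d p \<Longrightarrow> homog d (- p)"
  by (simp add: homog_def keys_def)

lemma homog_minus: "homog d p \<Longrightarrow> homog d q \<Longrightarrow> homog d (p - q)"
  using homog_add[of d p "- q"] homog_uminus[of d q] by simp

lemma homog_sum: "(\<And>i. i \<in> I \<Longrightarrow> homog d (f i)) \<Longrightarrow> homog d (sum f I)"
  by (induction I rule: infinite_finite_induct) (auto intro: homog_add)

lemma homog_mult: "homog d p \<Longrightarrow> homog e q \<Longrightarrow> homog (d + e) (p * q)"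
  using keys_mult[of p q] by (fastforce simp: homog_def mdeg_add)

lemma homog_power: "homog d p \<Longrightarrow> homog (d * n) (p ^ n)"
  by (induction n) (auto intro: homog_mult homog_one)

lemma homog_prod:
  assumes "finite I" "\<And>i. i \<in> I \<Longrightarrow> homog (d i) (f i)"
  shows "homog (\<Sum>i\<in>I. d i) (\<Prod>i\<in>I. f i)"
  using assms by (induction I rule: finite_induct) (auto intro: homog_mult homog_one)

lemma homog_fps_mult:
  assumes "\<forall>d. homog d (fps_nth F d)" "\<forall>d. homog d (fps_nth G d)"
  shows "homog d (fps_nth (F * G) d)"
proof -
  have "homog d (fps_nth F i * fps_nth G (d - i))" if "i \<in> {0..d}" for i
    using homog_mult[of i "fps_nth F i" "d - i" "fps_nth G (d - i)"] assms that by simp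
  then show ?thesis
    unfolding fps_mult_nth by (rule homog_sum)
qed

text \<open>The library has no power series in several variables. Here a series \<open>f\<close> is the sequence of
  its homogeneous parts \<open>f\<^sub>d\<close>, stored as \<open>\<Sum>\<^sub>d f\<^sub>d T\<^sup>d\<close>, so that the ring operations are inherited
  from univariate series over the polynomial ring. For finitely many variables this is the usual
  ring of formal power series, see \<open>pcoeff_mult\<close> and \<open>pser_ex_of_coeffs\<close> below.\<close>

typedef pser = "{F :: rpoly fps. \<forall>d. homog d (fps_nth F d)}"
  by (rule exI[of _ 0]) simp

setup_lifting type_definition_pser

instantiation pser :: comm_ring_1
begin

lift_definition zero_pser :: pser is 0 by simp
lift_definition one_pser :: pser is 1 by (simp add: homog_one)
lift_definition plus_pser :: "pser \<Rightarrow> pser \<Rightarrow> pser" is "(+)" by (simp add: homog_add)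
lift_definition minus_pser :: "pser \<Rightarrow> pser \<Rightarrow> pser" is "(-)" by (simp add: homog_minus)
lift_definition uminus_pser :: "pser \<Rightarrow> pser" is uminus by (simp add: homog_uminus)
lift_definition times_pser :: "pser \<Rightarrow> pser \<Rightarrow> pser" is "(*)" by (simp add: homog_fps_mult)

instance
  by (standard; transfer; simp add: algebra_simps)

end

instance pser :: idom
  by (standard; transfer; simp)

lift_definition pcoeff :: "pser \<Rightarrow> monom \<Rightarrow> rat" is
  "\<lambda>F m. Poly_Mapping.lookup (fps_nth F (mdeg m)) m" .

lift_definition pconst :: "rat \<Rightarrow> pser" is "\<lambda>c. fps_const (Poly_Mapping.single 0 c)"
  by (simp add: homog_def)

lift_definition pvar :: "var \<Rightarrow> pser" is
  "\<lambda>v. fps_const (Poly_Mapping.single (Poly_Mapping.single v 1) 1) * fps_X"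
  by (auto simp: homog_def)

lemma pser_eqI:
  assumes "\<And>m. pcoeff f m = pcoeff g m"
  shows "f = g"
  using assms
proof (transfer, goal_cases)
  case (1 F G)
  have "Poly_Mapping.lookup (fps_nth F d) m = Poly_Mapping.lookup (fps_nth G d) m" for d m
  proof (cases "mdeg m = d")
    case False
    then have "m \<notin> Poly_Mapping.keys (fps_nth F d)" "m \<notin> Poly_Mapping.keys (fps_nth G d)"
      using 1 by (auto simp: homog_def)
    then show ?thesis by (simp add: in_keys_iff)
  qed (use 1 in auto)
  then show ?case by (intro fps_ext poly_mapping_eqI)
qed

lemma pcoeff_pvar: "pcoeff (pvar v) m = (if m = Poly_Mapping.single v 1 then 1 else 0)"
  by transfer (auto simp: lookup_single when_def)

lemma finite_monom_le:
  assumes "finite V"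
  shows "finite {m :: monom. Poly_Mapping.keys m \<subseteq> V \<and> mdeg m \<le> d}" (is "finite ?M")
proof -
  let ?F = "{f :: var \<Rightarrow> nat. \<forall>v. (v \<in> V \<longrightarrow> f v \<in> {..d}) \<and> (v \<notin> V \<longrightarrow> f v = 0)}"
  have inj: "inj_on Poly_Mapping.lookup ?M"
    by (rule inj_onI) (simp only: poly_mapping_eq_iff)
  have sub: "Poly_Mapping.lookup ` ?M \<subseteq> ?F"
  proof (intro image_subsetI CollectI allI conjI impI)
    fix m v
    assume m: "m \<in> ?M"
    show "Poly_Mapping.lookup m v \<in> {..d}"
    proof (cases "v \<in> Poly_Mapping.keys m")
      case True
      have "Poly_Mapping.lookup m v \<le> mdeg m"
        unfolding mdeg_def by (rule member_le_sum[OF True]) simp_all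
      with m show ?thesis by simp
    qed (simp add: in_keys_iff)
    show "Poly_Mapping.lookup m v = 0" if "v \<notin> V"
    proof -
      have "v \<notin> Poly_Mapping.keys m" using m that by blast
      then show ?thesis by (simp add: in_keys_iff)
    qed
  qed
  have fin: "finite ?F"
    by (rule finite_set_of_finite_funs) (simp_all add: assms)
  show ?thesis by (rule inj_on_finite[OF inj sub fin])
qed

lemma pcoeff_mult:
  "pcoeff (f * g) m = (\<Sum>(a, b) | a + b = m. pcoeff f a * pcoeff g b)"
proof -
  let ?l = Poly_Mapping.lookup
  define F G where FG: "F = Rep_pser f" "G = Rep_pser g"
  let ?P = "{(a, b). a + b = m}"
  have keys: "Poly_Mapping.keys a \<subseteq> Poly_Mapping.keys m" if "a + b = m" for a b :: monom
    using that by (auto simp: in_keys_iff lookup_add)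
  have fin: "finite ?P"
  proof (rule finite_subset)
    let ?M = "{a :: monom. Poly_Mapping.keys a \<subseteq> Poly_Mapping.keys m \<and> mdeg a \<le> mdeg m}"
    show "?P \<subseteq> ?M \<times> ?M"
    proof clarify
      fix a b :: monom
      assume m: "m = a + b"
      have "Poly_Mapping.keys b \<subseteq> Poly_Mapping.keys m"
        by (rule keys[of b a]) (simp add: m add.commute)
      moreover have "Poly_Mapping.keys a \<subseteq> Poly_Mapping.keys m"
        by (rule keys[of a b]) (simp add: m)
      ultimately show "a \<in> {c. Poly_Mapping.keys c \<subseteq> Poly_Mapping.keys (a + b) \<and> mdeg c \<le> mdeg (a + b)}
          \<and> b \<in> {c. Poly_Mapping.keys c \<subseteq> Poly_Mapping.keys (a + b) \<and> mdeg c \<le> mdeg (a + b)}"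
        by (simp add: m mdeg_add)
    qed
    show "finite (?M \<times> ?M)"
      by (intro finite_cartesian_product finite_monom_le) simp_all
  qed
  have mult: "?l (p * q) m = (\<Sum>(a, b)\<in>?P. ?l p a * ?l q b)" for p q :: rpoly
  proof -
    have "?l (p * q) m = (\<Sum>(a, b). ?l p a * ?l q b when m = a + b)"
      by (simp add: times_poly_mapping.rep_eq prod_fun_unfold_prod)
    also have "\<dots> = (\<Sum>(a, b)\<in>?P. ?l p a * ?l q b when m = a + b)"
      by (rule Sum_any.expand_superset) (use fin in \<open>auto simp: when_def split: if_splits\<close>)
    also have "\<dots> = (\<Sum>(a, b)\<in>?P. ?l p a * ?l q b)"
      by (rule sum.cong) auto
    finally show ?thesis .
  qed
  have zero: "?l (fps_nth F i) a = 0" "?l (fps_nth G i) a = 0" if "mdeg a \<noteq> i" for i a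
  proof -
    have "a \<notin> Poly_Mapping.keys (fps_nth F i)" "a \<notin> Poly_Mapping.keys (fps_nth G i)"
      using Rep_pser[of f] Rep_pser[of g] that unfolding FG homog_def by blast+
    then show "?l (fps_nth F i) a = 0" "?l (fps_nth G i) a = 0"
      by (simp_all add: in_keys_iff)
  qed
  have "?l (fps_nth (F * G) (mdeg m)) m
      = (\<Sum>i=0..mdeg m. \<Sum>(a, b)\<in>?P. ?l (fps_nth F i) a * ?l (fps_nth G (mdeg m - i)) b)"
    by (simp add: fps_mult_nth lookup_sum mult)
  also have "\<dots> = (\<Sum>(a, b)\<in>?P. \<Sum>i=0..mdeg m.
      ?l (fps_nth F i) a * ?l (fps_nth G (mdeg m - i)) b)"
    by (subst sum.swap) (simp add: case_prod_unfold)
  also have "\<dots> = (\<Sum>(a, b)\<in>?P. ?l (fps_nth F (mdeg a)) a * ?l (fps_nth G (mdeg b)) b)"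
  proof (rule sum.cong, simp, clarify)
    fix a b :: monom
    assume m: "m = a + b"
    have "(\<Sum>i=0..mdeg (a + b). ?l (fps_nth F i) a * ?l (fps_nth G (mdeg (a + b) - i)) b)
        = (\<Sum>i\<in>{mdeg a}. ?l (fps_nth F i) a * ?l (fps_nth G (mdeg (a + b) - i)) b)"
      by (rule sum.mono_neutral_right) (auto simp: mdeg_add zero)
    then show "(\<Sum>i=0..mdeg (a + b). ?l (fps_nth F i) a * ?l (fps_nth G (mdeg (a + b) - i)) b)
        = ?l (fps_nth F (mdeg a)) a * ?l (fps_nth G (mdeg b)) b"
      by (simp add: mdeg_add)
  qed
  finally show ?thesis by (simp add: pcoeff.rep_eq times_pser.rep_eq FG)
qed

lemma pser_ex_of_coeffs:
  assumes "finite V" "\<And>m. c m \<noteq> 0 \<Longrightarrow> Poly_Mapping.keys m \<subseteq> V"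
  shows "\<exists>f. \<forall>m. pcoeff f m = c m"
proof -
  define p where "p d = Abs_poly_mapping (\<lambda>m. if mdeg m = d then c m else 0)" for d
  have fin: "finite {m. (if mdeg m = d then c m else 0) \<noteq> 0}" for d
    by (rule finite_subset[OF _ finite_monom_le[OF assms(1), of d]])
      (use assms(2) in \<open>auto split: if_splits\<close>)
  have p: "Poly_Mapping.lookup (p d) m = (if mdeg m = d then c m else 0)" for d m
    unfolding p_def by (subst lookup_Abs_poly_mapping[OF fin]) simp
  have "homog d (p d)" for d
    by (auto simp: homog_def in_keys_iff p split: if_splits)
  then have "pcoeff (Abs_pser (Abs_fps p)) m = c m" for m
    by (simp add: pcoeff.rep_eq Abs_pser_inverse p)
  then show ?thesis by blast
qed


section \<open>Substitution of linear forms\<close>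

type_synonym linform = "var \<Rightarrow>\<^sub>0 rat"

definition xf :: "nat \<Rightarrow> linform" where "xf i = Poly_Mapping.single (VX i) 1"
definition yf :: "nat \<Rightarrow> linform" where "yf i = Poly_Mapping.single (VY i) 1"

text \<open>\<open>Y\<^sub>a\<^sub>:\<^sub>b\<close>\<close>

definition yspan :: "nat \<Rightarrow> nat \<Rightarrow> linform" where "yspan a b = (\<Sum>i=a..b. yf i)"

definition lin_poly :: "linform \<Rightarrow> rpoly" where
  "lin_poly l = (\<Sum>v\<in>Poly_Mapping.keys l.
     Poly_Mapping.single (Poly_Mapping.single v 1) (Poly_Mapping.lookup l v))"

definition monom_subst :: "(var \<Rightarrow> linform) \<Rightarrow> monom \<Rightarrow> rpoly" where
  "monom_subst \<sigma> m = (\<Prod>v\<in>Poly_Mapping.keys m. lin_poly (\<sigma> v) ^ Poly_Mapping.lookup m v)"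

definition poly_subst :: "(var \<Rightarrow> linform) \<Rightarrow> rpoly \<Rightarrow> rpoly" where
  "poly_subst \<sigma> p = (\<Sum>m\<in>Poly_Mapping.keys p.
     Poly_Mapping.single 0 (Poly_Mapping.lookup p m) * monom_subst \<sigma> m)"

lemma homog_lin_poly: "homog 1 (lin_poly l)"
  unfolding lin_poly_def by (intro homog_sum homog_single) simp

lemma homog_monom_subst: "homog (mdeg m) (monom_subst \<sigma> m)"
  unfolding monom_subst_def mdeg_def
  by (rule homog_prod) (use homog_power[OF homog_lin_poly] in auto)

lemma homog_poly_subst: "homog d p \<Longrightarrow> homog d (poly_subst \<sigma> p)"
  unfolding poly_subst_def
  using homog_mult[OF homog_single[of 0 0] homog_monom_subst]
  by (intro homog_sum) (auto simp: homog_def)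

lift_definition pser_subst :: "(var \<Rightarrow> linform) \<Rightarrow> pser \<Rightarrow> pser" is
  "\<lambda>\<sigma> F. Abs_fps (\<lambda>d. poly_subst \<sigma> (fps_nth F d))"
  by (simp add: homog_poly_subst)

lemma poly_subst_superset:
  assumes "finite S" "Poly_Mapping.keys p \<subseteq> S"
  shows "poly_subst \<sigma> p
    = (\<Sum>m\<in>S. Poly_Mapping.single 0 (Poly_Mapping.lookup p m) * monom_subst \<sigma> m)"
  unfolding poly_subst_def
  by (rule sum.mono_neutral_left) (use assms in \<open>auto simp: in_keys_iff\<close>)

lemma poly_subst_zero [simp]: "poly_subst \<sigma> 0 = 0"
  by (simp add: poly_subst_def)

lemma poly_subst_add: "poly_subst \<sigma> (p + q) = poly_subst \<sigma> p + poly_subst \<sigma> q"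
proof -
  let ?S = "Poly_Mapping.keys p \<union> Poly_Mapping.keys q"
  have "poly_subst \<sigma> (p + q)
      = (\<Sum>m\<in>?S. Poly_Mapping.single 0 (Poly_Mapping.lookup (p + q) m) * monom_subst \<sigma> m)"
    by (rule poly_subst_superset) (simp_all add: Poly_Mapping.keys_add)
  also have "\<dots> = (\<Sum>m\<in>?S. Poly_Mapping.single 0 (Poly_Mapping.lookup p m) * monom_subst \<sigma> m)
      + (\<Sum>m\<in>?S. Poly_Mapping.single 0 (Poly_Mapping.lookup q m) * monom_subst \<sigma> m)"
    by (simp add: lookup_add single_add distrib_right sum.distrib)
  also have "\<dots> = poly_subst \<sigma> p + poly_subst \<sigma> q"
    by (subst (1 2) poly_subst_superset[where S = ?S]) simp_all
  finally show ?thesis .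
qed

lemma poly_subst_sum: "poly_subst \<sigma> (sum f I) = (\<Sum>i\<in>I. poly_subst \<sigma> (f i))"
  by (induction I rule: infinite_finite_induct) (simp_all add: poly_subst_add)

lemma poly_subst_single:
  "poly_subst \<sigma> (Poly_Mapping.single m c) = Poly_Mapping.single 0 c * monom_subst \<sigma> m"
  by (subst poly_subst_superset[where S = "{m}"]) simp_all

lemma monom_subst_add: "monom_subst \<sigma> (m + n) = monom_subst \<sigma> m * monom_subst \<sigma> n"
proof -
  let ?S = "Poly_Mapping.keys m \<union> Poly_Mapping.keys n"
  have *: "monom_subst \<sigma> k = (\<Prod>v\<in>?S. lin_poly (\<sigma> v) ^ Poly_Mapping.lookup k v)"
    if "Poly_Mapping.keys k \<subseteq> ?S" for k
    unfolding monom_subst_def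
    by (rule prod.mono_neutral_left) (use that in \<open>auto simp: in_keys_iff\<close>)
  show ?thesis
    by (subst (1 2 3) *) (auto simp: lookup_add power_add prod.distrib dest: Poly_Mapping.keys_add[THEN subsetD])
qed

lemma rpoly_expand:
  "(p :: rpoly) = (\<Sum>m\<in>Poly_Mapping.keys p. Poly_Mapping.single m (Poly_Mapping.lookup p m))"
  by (rule poly_mapping_eqI)
    (simp add: lookup_sum lookup_single when_def in_keys_iff)

lemma poly_subst_mult: "poly_subst \<sigma> (p * q) = poly_subst \<sigma> p * poly_subst \<sigma> q"
proof -
  let ?s = "\<lambda>p m. Poly_Mapping.single m (Poly_Mapping.lookup p m) :: rpoly"
  have "p * q = (\<Sum>m\<in>Poly_Mapping.keys p. \<Sum>n\<in>Poly_Mapping.keys q. ?s p m * ?s q n)"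
    by (subst rpoly_expand[of p], subst rpoly_expand[of q]) (simp add: sum_product)
  then have "poly_subst \<sigma> (p * q)
      = (\<Sum>m\<in>Poly_Mapping.keys p. \<Sum>n\<in>Poly_Mapping.keys q. poly_subst \<sigma> (?s p m * ?s q n))"
    by (simp add: poly_subst_sum)
  also have "\<dots> = (\<Sum>m\<in>Poly_Mapping.keys p. \<Sum>n\<in>Poly_Mapping.keys q.
      poly_subst \<sigma> (?s p m) * poly_subst \<sigma> (?s q n))"
  proof (intro sum.cong refl)
    fix m n
    have "Poly_Mapping.single 0 (Poly_Mapping.lookup p m * Poly_Mapping.lookup q n)
        = (Poly_Mapping.single 0 (Poly_Mapping.lookup p m)
           * Poly_Mapping.single 0 (Poly_Mapping.lookup q n) :: rpoly)"
      by (simp add: mult_single)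
    then show "poly_subst \<sigma> (?s p m * ?s q n) = poly_subst \<sigma> (?s p m) * poly_subst \<sigma> (?s q n)"
      by (simp add: mult_single poly_subst_single monom_subst_add ac_simps)
  qed
  also have "\<dots> = (\<Sum>m\<in>Poly_Mapping.keys p. poly_subst \<sigma> (?s p m))
      * (\<Sum>n\<in>Poly_Mapping.keys q. poly_subst \<sigma> (?s q n))"
    by (simp add: sum_product)
  also have "\<dots> = poly_subst \<sigma> p * poly_subst \<sigma> q"
    by (simp add: poly_subst_sum[symmetric] rpoly_expand[symmetric])
  finally show ?thesis .
qed

lemma pser_subst_mult: "pser_subst \<sigma> (f * g) = pser_subst \<sigma> f * pser_subst \<sigma> g"
  by transfer (auto simp: fps_eq_iff fps_mult_nth poly_subst_sum poly_subst_mult)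

lemma pser_subst_zero: "pser_subst \<sigma> 0 = 0"
  by transfer (simp add: fps_eq_iff)

text \<open>Substitution in a fraction; a junk value results if all denominators are killed by \<open>\<sigma>\<close>.
  All substitutions made below are by linearly independent forms, which kill no denominator.\<close>

definition fract_subst :: "(var \<Rightarrow> linform) \<Rightarrow> pser fract \<Rightarrow> pser fract" where
  "fract_subst \<sigma> a = (THE b. \<exists>p d. pser_subst \<sigma> d \<noteq> 0 \<and> a = Fract p d
     \<and> b = Fract (pser_subst \<sigma> p) (pser_subst \<sigma> d))"

lemma fract_subst_Fract:
  assumes "pser_subst \<sigma> d \<noteq> 0"
  shows "fract_subst \<sigma> (Fract p d) = Fract (pser_subst \<sigma> p) (pser_subst \<sigma> d)"
  unfolding fract_subst_def
proof (rule the_equality)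
  show "\<exists>p' d'. pser_subst \<sigma> d' \<noteq> 0 \<and> Fract p d = Fract p' d'
      \<and> Fract (pser_subst \<sigma> p) (pser_subst \<sigma> d) = Fract (pser_subst \<sigma> p') (pser_subst \<sigma> d')"
    using assms by blast
next
  fix b
  assume "\<exists>p' d'. pser_subst \<sigma> d' \<noteq> 0 \<and> Fract p d = Fract p' d'
      \<and> b = Fract (pser_subst \<sigma> p') (pser_subst \<sigma> d')"
  then obtain p' d' where *: "pser_subst \<sigma> d' \<noteq> 0" "Fract p d = Fract p' d'"
      "b = Fract (pser_subst \<sigma> p') (pser_subst \<sigma> d')" by blast
  have "d \<noteq> 0" "d' \<noteq> 0" using assms *(1) by (auto simp: pser_subst_zero)
  then have "p * d' = p' * d" using *(2) by (simp add: eq_fract)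
  then have "pser_subst \<sigma> p * pser_subst \<sigma> d' = pser_subst \<sigma> p' * pser_subst \<sigma> d"
    by (metis pser_subst_mult)
  then show "b = Fract (pser_subst \<sigma> p) (pser_subst \<sigma> d)"
    using assms * by (simp add: eq_fract)
qed


section \<open>Bimoulds\<close>

text \<open>All components live in the fraction field of the ring of power series in all variables;
  \<open>Loc r\<close> is \<open>\<L>\<^sub>r\<close>.\<close>

type_synonym bimould = "nat \<Rightarrow> pser fract"

definition fX :: "nat \<Rightarrow> pser fract" where "fX i = to_fract (pvar (VX i))"
definition fY :: "nat \<Rightarrow> pser fract" where "fY i = to_fract (pvar (VY i))"

definition PS :: "nat \<Rightarrow> pser set" where
  "PS r = {f. \<forall>m. pcoeff f m \<noteq> 0 \<longrightarrow> Poly_Mapping.keys m \<subseteq> VX ` {1..r} \<union> VY ` {1..r}}"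

inductive_set Den :: "nat \<Rightarrow> pser set" for r :: nat where
  one: "1 \<in> Den r"
| var: "d \<in> Den r \<Longrightarrow> i \<in> {1..r} \<Longrightarrow> d * pvar (VX i) \<in> Den r"
| diff: "d \<in> Den r \<Longrightarrow> i \<in> {1..r} \<Longrightarrow> j \<in> {1..r} \<Longrightarrow> i \<noteq> j
    \<Longrightarrow> d * (pvar (VX i) - pvar (VX j)) \<in> Den r"

definition Loc :: "nat \<Rightarrow> pser fract set" where
  "Loc r = {Fract p d | p d. p \<in> PS r \<and> d \<in> Den r}"

definition polynomial_pser :: "pser \<Rightarrow> bool" where
  "polynomial_pser f \<longleftrightarrow> finite {m. pcoeff f m \<noteq> 0}"

definition BARI_loc :: "bimould set" where
  "BARI_loc = {A. A 0 = 0 \<and> (\<forall>r. A r \<in> Loc r)}"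

definition BARI_pol :: "bimould set" where
  "BARI_pol = {A \<in> BARI_loc. (\<forall>r. \<exists>p. p \<in> PS r \<and> polynomial_pser p \<and> A r = to_fract p)
     \<and> finite {r. A r \<noteq> 0}}"

definition bzero :: bimould where "bzero = (\<lambda>r. 0)"
definition bplus :: "bimould \<Rightarrow> bimould \<Rightarrow> bimould" where "bplus A B = (\<lambda>r. A r + B r)"
definition bminus :: "bimould \<Rightarrow> bimould \<Rightarrow> bimould" where "bminus A B = (\<lambda>r. A r - B r)"
definition bscale :: "rat \<Rightarrow> bimould \<Rightarrow> bimould" where
  "bscale c A = (\<lambda>r. to_fract (pconst c) * A r)"

text \<open>\<open>bapp A [x\<^sub>1,\<dots>,x\<^sub>s] [y\<^sub>1,\<dots>,y\<^sub>s]\<close> is \<open>A\<^sub>s(x\<^sub>1,\<dots>,x\<^sub>s | y\<^sub>1,\<dots>,y\<^sub>s)\<close>: the depth is the length of the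
  argument lists.\<close>

fun arg_subst :: "linform list \<Rightarrow> linform list \<Rightarrow> var \<Rightarrow> linform" where
  "arg_subst xs ys (VX i) = (if i \<in> {1..length xs} then xs ! (i - 1) else 0)"
| "arg_subst xs ys (VY i) = (if i \<in> {1..length ys} then ys ! (i - 1) else 0)"

definition bapp :: "bimould \<Rightarrow> linform list \<Rightarrow> linform list \<Rightarrow> pser fract" where
  "bapp A xs ys = fract_subst (arg_subst xs ys) (A (length xs))"


section \<open>Flexion operations\<close>

definition mu :: "bimould \<Rightarrow> bimould \<Rightarrow> bimould" where
  "mu A B r = (\<Sum>i=0..r. bapp A (map xf [1..<i+1]) (map yf [1..<i+1])
                       * bapp B (map xf [i+1..<r+1]) (map yf [i+1..<r+1]))"

definition amit :: "bimould \<Rightarrow> bimould \<Rightarrow> bimould" where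
  "amit B A r = (\<Sum>(a, b) | 1 \<le> a \<and> a < b \<and> b \<le> r.
     bapp A (map xf [1..<a] @ map xf [b..<r+1])
            (map yf [1..<a] @ [yspan a b] @ map yf [b+1..<r+1])
   * bapp B (map (\<lambda>i. xf i - xf b) [a..<b]) (map yf [a..<b]))"

definition anit :: "bimould \<Rightarrow> bimould \<Rightarrow> bimould" where
  "anit B A r = (\<Sum>(a, b) | 1 \<le> a \<and> a < b \<and> b \<le> r.
     bapp A (map xf [1..<a+1] @ map xf [b+1..<r+1])
            (map yf [1..<a] @ [yspan a b] @ map yf [b+1..<r+1])
   * bapp B (map (\<lambda>i. xf i - xf a) [a+1..<b+1]) (map yf [a+1..<b+1]))"

definition arit :: "bimould \<Rightarrow> bimould \<Rightarrow> bimould" where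
  "arit B A = bminus (amit B A) (anit B A)"

definition preari :: "bimould \<Rightarrow> bimould \<Rightarrow> bimould" where
  "preari A B = bplus (arit B A) (mu A B)"

definition ari :: "bimould \<Rightarrow> bimould \<Rightarrow> bimould" where
  "ari A B = bminus (preari A B) (preari B A)"

text \<open>The sequences \<open>0 = q\<^sub>0 < q\<^sub>1 < \<dots> < q\<^sub>s = r\<close>, as lists of length \<open>s + 1\<close>.\<close>

definition cuts :: "nat \<Rightarrow> nat \<Rightarrow> nat list set" where
  "cuts s r = {q. length q = s + 1 \<and> q ! 0 = 0 \<and> q ! s = r \<and> sorted_wrt (<) q}"

text \<open>The sum over \<open>s\<close> stops at \<open>r\<close> since \<open>cuts s r\<close> is empty for \<open>s > r\<close>.\<close>

definition ganit :: "bimould \<Rightarrow> bimould \<Rightarrow> bimould" where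
  "ganit C A r = (if r = 0 then A 0 else
     (\<Sum>s=1..r. \<Sum>q\<in>cuts s r.
        bapp A (map (\<lambda>i. xf (q ! (i - 1) + 1)) [1..<s+1])
               (map (\<lambda>i. yspan (q ! (i - 1) + 1) (q ! i)) [1..<s+1])
      * (\<Prod>i=1..s.
          bapp C (map (\<lambda>j. xf j - xf (q ! (i - 1) + 1)) [q ! (i - 1) + 2..<q ! i + 1])
                 (map yf [q ! (i - 1) + 2..<q ! i + 1]))))"

definition pic :: bimould where
  "pic r = 1 / (\<Prod>i=1..r. fX i)"

definition poc :: bimould where
  "poc r = (if r = 0 then 1 else - 1 / (fX 1 * (\<Prod>i=1..<r. fX i - fX (i + 1))))"

definition uri :: "bimould \<Rightarrow> bimould \<Rightarrow> bimould" where
  "uri A B = ganit pic (ari (ganit poc A) (ganit poc B))"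


section \<open>The space \<open>\<BB>\<close>\<close>

text \<open>The letter \<open>y\<^sub>k\<^sub>,\<^sub>m\<close> is the pair \<open>(k, m)\<close>, where \<open>k \<ge> 1\<close>.\<close>

type_synonym word = "(nat \<times> nat) list"

definition Words :: "word set" where
  "Words = lists {(k, m). k \<ge> 1}"

definition prepend :: "nat \<times> nat \<Rightarrow> (word \<Rightarrow>\<^sub>0 rat) \<Rightarrow> (word \<Rightarrow>\<^sub>0 rat)" where
  "prepend a P = (\<Sum>w\<in>Poly_Mapping.keys P. Poly_Mapping.single (a # w) (Poly_Mapping.lookup P w))"

fun bistuffle :: "word \<Rightarrow> word \<Rightarrow> (word \<Rightarrow>\<^sub>0 rat)" where
  "bistuffle [] w = Poly_Mapping.single w 1"
| "bistuffle w [] = Poly_Mapping.single w 1"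
| "bistuffle ((k, m) # u) ((l, n) # v) =
     prepend (k, m) (bistuffle u ((l, n) # v))
   + prepend (l, n) (bistuffle ((k, m) # u) v)
   + prepend (k + l, m + n) (bistuffle u v)"

text \<open>The coefficient of \<open>\<Prod>\<^sub>i X\<^sub>i\<^bsup>k\<^sub>i-1\<^esup> Y\<^sub>i\<^bsup>m\<^sub>i\<^esup> / m\<^sub>i!\<close> in \<open>A\<^sub>r\<close>, for \<open>A\<^sub>r\<close> a power series.\<close>

definition word_coeff :: "bimould \<Rightarrow> word \<Rightarrow> rat" where
  "word_coeff A w = (\<Prod>i<length w. fact (snd (w ! i)))
     * pcoeff (THE f. A (length w) = to_fract f)
         (\<Sum>i<length w. Poly_Mapping.single (VX (i + 1)) (fst (w ! i) - 1)
                      + Poly_Mapping.single (VY (i + 1)) (snd (w ! i)))"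

definition coeff_map :: "bimould \<Rightarrow> (word \<Rightarrow>\<^sub>0 rat) \<Rightarrow> rat" where
  "coeff_map A P = (\<Sum>w\<in>Poly_Mapping.keys P. Poly_Mapping.lookup P w * word_coeff A w)"

definition alternil :: "bimould \<Rightarrow> bool" where
  "alternil A \<longleftrightarrow> (\<forall>u\<in>Words. \<forall>v\<in>Words. u \<noteq> [] \<longrightarrow> v \<noteq> [] \<longrightarrow> coeff_map A (bistuffle u v) = 0)"

definition swap :: "bimould \<Rightarrow> bimould" where
  "swap A r = bapp A (map (\<lambda>i. yspan 1 i) (rev [1..<r+1]))
                     (map (\<lambda>i. if i = r then xf r else xf i - xf (i + 1)) (rev [1..<r+1]))"

definition frakB :: "bimould set" where
  "frakB = {A \<in> BARI_pol. alternil A \<and> swap A = A \<and> bapp A [- xf 1] [- yf 1] = A 1}"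


section \<open>The operators \<open>\<delta>\<close> and \<open>\<partial>\<close>\<close>

definition Ebim :: bimould where
  "Ebim r = (if r = 1 then - (fX 1 + fY 1) / 2 else if r = 2 then 1 / 4 else 0)"

definition Qop :: "bimould \<Rightarrow> bimould" where
  "Qop A r = (\<Sum>i=1..r. fX i * fY i) * A r"

definition delta_check :: "bimould \<Rightarrow> bimould" where
  "delta_check A = bplus (ganit pic (Qop (ganit poc A))) (uri A Ebim)"

definition xi1 :: bimould where
  "xi1 r = (if r = 1 then 1 else 0)"

text \<open>\<open>partial_odd r\<close> is \<open>\<partial>\<^sub>2\<^sub>r\<^sub>+\<^sub>1\<close>, regarded as a map on all bimoulds; \<open>ker_on\<close> restricts it.\<close>

definition partial_odd :: "nat \<Rightarrow> bimould \<Rightarrow> bimould" where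
  "partial_odd r A = uri ((delta_check ^^ r) xi1) A"

definition ker_on :: "bimould set \<Rightarrow> (bimould \<Rightarrow> bimould) \<Rightarrow> bimould set" where
  "ker_on V f = {A \<in> V. f A = bzero}"

end

theory Submission
  imports Defs "HOL-Library.Sublist"
begin

text \<open>
  Evaluating the components of a bimould at rational points turns it into a function on words
  in letters \<open>(x, y)\<close>, and all operations become finite sums over factorizations of the word.
  Only the rational functions in play matter, so it suffices to work on words with distinct
  nonzero \<open>x\<close>-coordinates.

  For a bimould \<open>A\<close> let \<open>R\<^sub>A\<close> be the operator \<open>f \<mapsto> arit(A) f + mu(f, A)\<close>. Then \<open>R\<^sub>A 1 = A\<close>,
  \<open>[R\<^sub>A, R\<^sub>B] = R\<close> of \<open>ari(B, A)\<close>, and \<open>[Q, R\<^sub>A] = R\<close> of \<open>Q A\<close>. Hence, before the conjugation by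
  \<open>ganit\<close> of \<open>pic\<close>, the map \<open>\<delta>\<close> is the commutator with \<open>Q + R\<close>, where \<open>R\<close> belongs to \<open>E\<close>.
  Conjugation by \<open>ganit\<close> of \<open>pic\<close> turns this operator into an explicit one with
  polynomial coefficients, and fixes the operator of \<open>\<xi>\<^sub>1\<close> in the sense that it becomes
  \<open>R\<close> of \<open>\<xi>\<^sub>1\<close> itself. So \<open>\<delta>\<^sup>k \<xi>\<^sub>1\<close> is an iterated commutator of two polynomial operators, applied to
  the unit. Both operators are derivations for the quasi-shuffle relations and commute with the
  swap, which gives that \<open>\<delta>\<^sup>k \<xi>\<^sub>1\<close> is polynomial, alternil and swap invariant; its depth one
  component is \<open>(X\<^sub>1 Y\<^sub>1)\<^sup>k\<close>.

  Now let \<open>uri(\<delta>\<^sup>m \<xi>\<^sub>1, A) = 0\<close>. The operator \<open>ganit\<close> of \<open>poc\<close> does not change the component \<open>b\<close> of lowest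
  depth \<open>d\<close>, and the part of depth \<open>d + 1\<close> of the equation only involves \<open>b\<close> and \<open>(X\<^sub>1 Y\<^sub>1)\<^sup>m\<close>. It is
  bihomogeneous, so the bihomogeneous parts of \<open>b\<close> solve it separately, and the swap exchanges the
  two degrees. Comparing the leading coefficients in \<open>Y\<^sub>1\<close> gives a recursion which forces
  the leading coefficient of a part of positive \<open>Y\<close>-degree to be a multiple of
  \<open>(X\<^sub>1 - X\<^sub>2)\<^sup>m \<dots> (X\<^sub>d - 0)\<^sup>m\<close> (\<open>kernel_shape\<close>), so both degrees are \<open>d m\<close>. If \<open>d \<ge> 2\<close>, a telescoping sum of
  the equation along points in geometric position shows that the multiple is zero
  (\<open>kernel_depth_ge_2\<close>). If \<open>d = 1\<close>, then \<open>b\<close> is a multiple of \<open>(X\<^sub>1 Y\<^sub>1)\<^sup>m\<close>. Subtracting this multiple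
  of \<open>\<delta>\<^sup>m \<xi>\<^sub>1\<close> from \<open>A\<close> leaves an element of the kernel without depth one part, which vanishes.
\<close>

section \<open>Finite linear functionals and operators on functions of words\<close>

text \<open>All operators below are pointwise finite linear combinations of values. This makes
  interchanging two of them unconditional.\<close>

definition finl :: "(('a \<Rightarrow> rat) \<Rightarrow> rat) \<Rightarrow> bool" where
  "finl L \<longleftrightarrow> (\<exists>xs. \<forall>f. L f = (\<Sum>(k, a)\<leftarrow>xs. k * f a))"

lemma finl_eval: "finl (\<lambda>f. f a)"
  unfolding finl_def by (rule exI[of _ "[(1, a)]"]) simp

lemma finl_zero: "finl (\<lambda>f. 0)"
  unfolding finl_def by (rule exI[of _ "[]"]) simp

lemma finl_add: assumes "finl L" "finl M" shows "finl (\<lambda>f. L f + M f)"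
proof -
  obtain xs ys where "\<forall>f. L f = (\<Sum>(k, a)\<leftarrow>xs. k * f a)" "\<forall>f. M f = (\<Sum>(k, a)\<leftarrow>ys. k * f a)"
    using assms unfolding finl_def by blast
  then show ?thesis unfolding finl_def by (intro exI[of _ "xs @ ys"]) simp
qed

lemma finl_cmult: assumes "finl L" shows "finl (\<lambda>f. k * L f)"
proof -
  obtain xs where "\<forall>f. L f = (\<Sum>(k, a)\<leftarrow>xs. k * f a)" using assms unfolding finl_def by blast
  then show ?thesis unfolding finl_def
    by (intro exI[of _ "map (\<lambda>(l, a). (k * l, a)) xs"])
      (simp add: sum_list_const_mult[symmetric] o_def case_prod_unfold mult.assoc)
qed

lemma finl_cmult2: "finl L \<Longrightarrow> finl (\<lambda>f. L f * k)"
  using finl_cmult[of L k] by (simp add: mult.commute)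

lemma finl_diff: "finl L \<Longrightarrow> finl M \<Longrightarrow> finl (\<lambda>f. L f - M f)"
  using finl_add[OF _ finl_cmult, of L M "-1"] by simp

lemma finl_sum: "(\<And>i. i \<in> I \<Longrightarrow> finl (L i)) \<Longrightarrow> finl (\<lambda>f. \<Sum>i\<in>I. L i f)"
  by (induction I rule: infinite_finite_induct) (auto intro: finl_zero finl_add)

lemma finl_sum_list: "(\<And>i. i \<in> set is \<Longrightarrow> finl (L i)) \<Longrightarrow> finl (\<lambda>f. \<Sum>i\<leftarrow>is. L i f)"
  by (induction "is") (auto intro: finl_zero finl_add)

lemma finl_comp:
  assumes "finl L" "\<And>a. finl (\<lambda>f. T f a)"
  shows "finl (\<lambda>f. L (T f))"
proof -
  obtain xs where "\<forall>f. L f = (\<Sum>(k, a)\<leftarrow>xs. k * f a)" using assms(1) unfolding finl_def by blast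
  then have "(\<lambda>f. L (T f)) = (\<lambda>f. \<Sum>p\<leftarrow>xs. fst p * T f (snd p))"
    by (simp add: case_prod_unfold)
  then show ?thesis by (simp add: finl_sum_list finl_cmult assms(2))
qed

lemma finlD:
  assumes "finl L"
  shows "L (\<lambda>a. f a + g a) = L f + L g" "L (\<lambda>a. k * f a) = k * L f" "L (\<lambda>a. 0) = 0"
    "L (\<lambda>a. f a - g a) = L f - L g" "L (\<lambda>a. f a * k) = L f * k"
proof -
  obtain xs where *: "\<forall>f. L f = (\<Sum>(k, a)\<leftarrow>xs. k * f a)" using assms unfolding finl_def by blast
  show "L (\<lambda>a. f a + g a) = L f + L g" "L (\<lambda>a. k * f a) = k * L f" "L (\<lambda>a. 0) = 0"
    "L (\<lambda>a. f a - g a) = L f - L g" "L (\<lambda>a. f a * k) = L f * k"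
    unfolding *[rule_format]
    by (induction xs) (auto simp: algebra_simps)
qed

lemma finl_sumD:
  assumes "finl L"
  shows "L (\<lambda>a. \<Sum>i\<in>I. f i a) = (\<Sum>i\<in>I. L (f i))"
  by (induction I rule: infinite_finite_induct) (simp_all add: finlD[OF assms])

lemma finl_swap:
  assumes "finl L" "finl M"
  shows "L (\<lambda>a. M (\<lambda>b. F a b)) = M (\<lambda>b. L (\<lambda>a. F a b))"
proof -
  obtain xs where *: "\<forall>f. L f = (\<Sum>(k, a)\<leftarrow>xs. k * f a)" using assms(1) unfolding finl_def by blast
  show ?thesis unfolding *[rule_format]
    by (induction xs) (auto simp: finlD[OF assms(2)])
qed

text \<open>Only finitely many values matter, so such a functional is determined by the indicator
  functions.\<close>

lemma finl_basis:
  assumes "finl L" "\<And>u. L (\<lambda>v. of_bool (v = u)) = M (\<lambda>v. of_bool (v = u))" "finl M"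
  shows "L f = M f"
proof -
  define N where "N = (\<lambda>f. L f - M f)"
  have "finl N" unfolding N_def by (intro finl_diff assms)
  then obtain xs where *: "\<forall>f. N f = (\<Sum>(k, a)\<leftarrow>xs. k * f a)" unfolding finl_def by blast
  let ?A = "snd ` set xs"
  have f: "(\<Sum>u\<in>?A. f u * of_bool (v = u)) = f v" if "v \<in> ?A" for v
  proof -
    have "(\<Sum>u\<in>?A. f u * of_bool (v = u)) = (\<Sum>u\<in>{v}. f u * of_bool (v = u))"
      by (rule sum.mono_neutral_right) (use that in auto)
    then show ?thesis by simp
  qed
  have "N f = N (\<lambda>v. \<Sum>u\<in>?A. f u * of_bool (v = u))"
    unfolding *[rule_format]
  proof (rule arg_cong[where f = sum_list], rule map_cong[OF refl], clarify)
    fix k a assume "(k, a) \<in> set xs"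
    then have "a \<in> ?A" by force
    then show "k * f a = k * (\<Sum>u\<in>?A. f u * of_bool (a = u))" by (simp only: f)
  qed
  also have "\<dots> = (\<Sum>u\<in>?A. f u * N (\<lambda>v. of_bool (v = u)))"
    by (simp only: finl_sumD[OF \<open>finl N\<close>] finlD(2)[OF \<open>finl N\<close>])
  also have "\<dots> = 0" using assms(2) by (simp add: N_def)
  finally show ?thesis by (simp add: N_def)
qed

type_synonym pt = "rat \<times> rat"

definition lmu :: "('a list \<Rightarrow> rat) \<Rightarrow> ('a list \<Rightarrow> rat) \<Rightarrow> 'a list \<Rightarrow> rat" where
  "lmu f g w = (\<Sum>i\<le>length w. f (take i w) * g (drop i w))"

lemma lmu_Nil [simp]: "lmu f g [] = f [] * g []"
  by (simp add: lmu_def)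

lemma lmu_Cons: "lmu f g (c # w) = f [] * g (c # w) + lmu (\<lambda>v. f (c # v)) g w"
  unfolding lmu_def by (simp add: sum.atMost_Suc_shift del: sum.atMost_Suc)

lemma lmu_lin:
  "lmu (\<lambda>v. f v + f' v) g w = lmu f g w + lmu f' g w"
  "lmu f (\<lambda>v. g v + g' v) w = lmu f g w + lmu f g' w"
  "lmu (\<lambda>v. f v - f' v) g w = lmu f g w - lmu f' g w"
  "lmu f (\<lambda>v. g v - g' v) w = lmu f g w - lmu f g' w"
  "lmu (\<lambda>v. k * f v) g w = k * lmu f g w"
  "lmu f (\<lambda>v. k * g v) w = k * lmu f g w"
  by (simp_all add: lmu_def algebra_simps sum.distrib sum_subtractf sum_distrib_left)

lemma lmu_cong:
  assumes "\<And>i. i \<le> length w \<Longrightarrow> f (take i w) = f' (take i w)"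
    "\<And>i. i \<le> length w \<Longrightarrow> g (drop i w) = g' (drop i w)"
  shows "lmu f g w = lmu f' g' w"
  unfolding lmu_def using assms by (auto intro!: sum.cong)

lemma sum_triangle:
  "(\<Sum>j\<le>n. \<Sum>i\<le>n - j. h j (j + i)) = (\<Sum>k\<le>n. \<Sum>j\<le>k. h j (k :: nat) :: 'a :: comm_monoid_add)"
proof -
  have "(\<Sum>j\<le>n. \<Sum>i\<le>n - j. h j (j + i)) = (\<Sum>(j, i)\<in>(SIGMA j:{..n}. {..n - j}). h j (j + i))"
    by (simp add: sum.Sigma)
  also have "\<dots> = (\<Sum>(k, j)\<in>(SIGMA k:{..n}. {..k}). h j k)"
    by (rule sum.reindex_bij_witness[of _ "\<lambda>(k, j). (j, k - j)" "\<lambda>(j, i). (j + i, j)"]) auto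
  also have "\<dots> = (\<Sum>k\<le>n. \<Sum>j\<le>k. h j k)"
    by (simp add: sum.Sigma)
  finally show ?thesis .
qed

lemma lmu_prefix_sum:
  assumes "\<And>m. finl (K m)"
  shows "(\<Sum>j\<le>length w. K (take j w) (\<lambda>l. lmu (F l) g (drop j w)))
    = lmu (\<lambda>v. \<Sum>j\<le>length v. K (take j v) (\<lambda>l. F l (drop j v))) g w"
proof -
  have "(\<Sum>j\<le>length w. K (take j w) (\<lambda>l. lmu (F l) g (drop j w)))
    = (\<Sum>j\<le>length w. \<Sum>i\<le>length w - j. K (take j w) (\<lambda>l. F l (take ((j + i) - j) (drop j w))) * g (drop (j + i) w))"
    unfolding lmu_def by (simp add: finl_sumD[OF assms] finlD[OF assms] add.commute)
  also have "\<dots> = (\<Sum>k\<le>length w. \<Sum>j\<le>k. K (take j w) (\<lambda>l. F l (take (k - j) (drop j w))) * g (drop k w))"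
    by (rule sum_triangle)
  also have "\<dots> = lmu (\<lambda>v. \<Sum>j\<le>length v. K (take j v) (\<lambda>l. F l (drop j v))) g w"
    unfolding lmu_def sum_distrib_right
    by (intro sum.cong) (auto simp: min_absorb1 min_absorb2 drop_take)
  finally show ?thesis .
qed

lemma lmu_assoc: "lmu (lmu f g) h w = lmu f (lmu g h) w"
  using lmu_prefix_sum[of "\<lambda>m \<phi>. f m * \<phi> (0::nat)" w "\<lambda>_. g" h]
  by (simp add: finl_cmult finl_eval lmu_def[of f "lmu g h"] lmu_def[of f g, abs_def])

text \<open>The unit of concatenation; together with functions supported in length one it generates
  everything under concatenation.\<close>

definition unitf :: "'a list \<Rightarrow> rat" where "unitf w = of_bool (w = [])"

definition dep1 :: "('a \<Rightarrow> rat) \<Rightarrow> 'a list \<Rightarrow> rat" where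
  "dep1 \<phi> w = (case w of [l] \<Rightarrow> \<phi> l | _ \<Rightarrow> 0)"

lemma dep1_simps [simp]: "dep1 \<phi> [] = 0" "dep1 \<phi> [l] = \<phi> l" "dep1 \<phi> (a # b # w) = 0"
  by (simp_all add: dep1_def)

lemma dep1_Cons: "dep1 \<phi> (c # w) = \<phi> c * unitf w"
  by (cases w) (auto simp: unitf_def)

lemma unitf_simps [simp]: "unitf [] = 1" "unitf (a # w) = 0"
  by (simp_all add: unitf_def)

lemma lmu_unitf [simp]: "lmu unitf g w = g w" "lmu f unitf w = f w"
proof -
  show "lmu unitf g w = g w"
    by (cases w) (simp_all add: lmu_Cons lmu_lin(5)[of 0 "\<lambda>_. 0", simplified])
  show "lmu f unitf w = f w"
    by (induction w arbitrary: f) (simp_all add: lmu_Cons)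
qed

text \<open>An indicator function of a word is a product of functions supported in length one. Hence
  two maps that agree on these, on the unit, and respect products in the same way are equal. Most
  identities below are reduced to length one by this principle.\<close>

lemma eq_on_generators:
  assumes fin: "\<And>i. i \<in> X \<Longrightarrow> finl (\<lambda>f. S f i)" "\<And>i. i \<in> X \<Longrightarrow> finl (\<lambda>f. T f i)"
    and one: "\<And>i. i \<in> X \<Longrightarrow> S unitf i = T unitf i"
    and dep1: "\<And>\<phi> i. i \<in> X \<Longrightarrow> S (dep1 \<phi>) i = T (dep1 \<phi>) i"
    and mu: "\<And>f g i. (\<And>i. i \<in> X \<Longrightarrow> S f i = T f i) \<Longrightarrow> (\<And>i. i \<in> X \<Longrightarrow> S g i = T g i) \<Longrightarrow> i \<in> X
      \<Longrightarrow> S (lmu f g) i = T (lmu f g) i"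
    and i: "i \<in> X"
  shows "S f i = T f i"
proof (rule finl_basis[OF fin(1)[OF i] _ fin(2)[OF i]])
  fix u
  have "\<forall>i\<in>X. S (\<lambda>v. of_bool (v = u)) i = T (\<lambda>v. of_bool (v = u)) i"
  proof (induction u)
    case Nil
    have "(\<lambda>v. of_bool (v = [])) = unitf" by (simp add: unitf_def fun_eq_iff)
    then show ?case using one by metis
  next
    case (Cons c u)
    have "(\<lambda>v. of_bool (v = c # u)) = lmu (dep1 (\<lambda>l. of_bool (l = c))) (\<lambda>v. of_bool (v = u))"
    proof
      fix v show "of_bool (v = c # u) = lmu (dep1 (\<lambda>l. of_bool (l = c))) (\<lambda>v. of_bool (v = u)) v"
        by (cases v) (auto simp: lmu_Cons dep1_Cons lmu_lin)
    qed
    then show ?case using mu[OF dep1] Cons by auto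
  qed
  then show "S (\<lambda>v. of_bool (v = u)) i = T (\<lambda>v. of_bool (v = u)) i" using i by blast
qed

type_synonym ker = "pt list \<Rightarrow> (pt \<Rightarrow> rat) \<Rightarrow> rat"

text \<open>The derivation of the concatenation algebra whose value on a function supported in
  length one is given by the kernel: every factor of the word is contracted to one letter in
  turn.\<close>

fun der :: "ker \<Rightarrow> (pt list \<Rightarrow> rat) \<Rightarrow> pt list \<Rightarrow> rat" where
  "der K f [] = 0"
| "der K f (c # w) = der K (\<lambda>v. f (c # v)) w
     + (\<Sum>j\<le>length w. K (c # take j w) (\<lambda>l. f (l # drop j w)))"

text \<open>The algebra endomorphism belonging to a kernel: the word is cut into factors, all of
  which are contracted.\<close>

function gan :: "ker \<Rightarrow> (pt list \<Rightarrow> rat) \<Rightarrow> pt list \<Rightarrow> rat" where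
  "gan K f [] = f []"
| "gan K f (c # w) = (\<Sum>j\<le>length w. K (c # take j w) (\<lambda>l. gan K (\<lambda>v. f (l # v)) (drop j w)))"
  by pat_completeness auto
termination by (relation "measure (\<lambda>(K, f, w). length w)") auto

lemma finl_der:
  assumes "\<And>m. finl (K m)" shows "finl (\<lambda>f. der K f w)"
proof (induction w)
  case (Cons c w)
  show ?case
    by (simp, intro finl_add finl_sum finl_comp[OF Cons] finl_comp[OF assms] finl_eval)
qed (simp add: finl_zero)

lemma finl_gan:
  assumes "\<And>m. finl (K m)" shows "finl (\<lambda>f. gan K f w)"
proof (induction "length w" arbitrary: w rule: less_induct)
  case less
  show ?case
  proof (cases w)
    case (Cons c v)
    show ?thesis unfolding Cons
      by (simp, intro finl_sum finl_comp[OF assms] finl_comp[OF less[of "drop _ v"]] finl_eval)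
        (simp add: Cons)
  qed (simp add: finl_eval)
qed

lemma lmu_ConsL: "(\<lambda>v. lmu f g (c # v)) = (\<lambda>v. f [] * g (c # v) + lmu (\<lambda>v. f (c # v)) g v)"
  by (simp add: lmu_Cons fun_eq_iff)

lemma der_lmu:
  assumes "\<And>m. finl (K m)"
  shows "der K (lmu f g) w = lmu (der K f) g w + lmu f (der K g) w"
proof (induction w arbitrary: f)
  case (Cons c w)
  note lin = finlD[OF finl_der[OF assms]] finlD[OF assms]
  have K: "(\<Sum>j\<le>length w. K (c # take j w) (\<lambda>l. lmu (\<lambda>v. f (l # v)) g (drop j w)))
      = lmu (\<lambda>v. \<Sum>j\<le>length v. K (c # take j v) (\<lambda>l. f (l # drop j v))) g w"
    by (rule lmu_prefix_sum) (rule assms)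
  show ?case
    by (simp add: lmu_Cons lmu_ConsL lin Cons K sum.distrib lmu_lin algebra_simps sum_distrib_left)
qed simp

lemma gan_lmu:
  assumes "\<And>m. finl (K m)"
  shows "gan K (lmu f g) w = lmu (gan K f) (gan K g) w"
proof (induction "length w" arbitrary: w f rule: less_induct)
  case less
  note lin = finlD[OF finl_gan[OF assms]] finlD[OF assms]
  show ?case
  proof (cases w)
    case (Cons c v)
    have K: "(\<Sum>j\<le>length v. K (c # take j v) (\<lambda>l. lmu (gan K (\<lambda>v. f (l # v))) (gan K g) (drop j v)))
        = lmu (\<lambda>u. \<Sum>j\<le>length u. K (c # take j u) (\<lambda>l. gan K (\<lambda>v. f (l # v)) (drop j u))) (gan K g) v"
      by (rule lmu_prefix_sum) (rule assms)
    show ?thesis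
      by (simp add: Cons lmu_Cons lmu_ConsL lin sum.distrib less sum_distrib_left K)
  qed simp
qed

lemma der_dep1:
  assumes "\<And>m. finl (K m)" "w \<noteq> []"
  shows "der K (dep1 \<phi>) w = K w \<phi>"
proof -
  obtain c v where w: "w = c # v" using assms(2) by (cases w) auto
  have u: "der K unitf v = 0" for v
    by (induction v) (simp_all add: finlD[OF assms(1)] finlD[OF finl_der[OF assms(1)]])
  have "(\<Sum>j\<le>length v. K (c # take j v) (\<lambda>l. dep1 \<phi> (l # drop j v)))
      = (\<Sum>j\<in>{length v}. K (c # take j v) (\<lambda>l. dep1 \<phi> (l # drop j v)))"
    by (rule sum.mono_neutral_right) (auto simp: dep1_Cons unitf_def finlD[OF assms(1)])
  then show ?thesis
    by (simp add: w dep1_Cons finlD[OF finl_der[OF assms(1)]] u)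
qed

lemma der_unitf: "(\<And>m. finl (K m)) \<Longrightarrow> der K unitf v = 0"
  by (induction v) (simp_all add: finlD finlD[OF finl_der])

lemma gan_unitf: "(\<And>m. finl (K m)) \<Longrightarrow> gan K unitf v = unitf v"
  by (cases v) (simp_all add: finlD finlD[OF finl_gan])

lemma gan_dep1:
  assumes "\<And>m. finl (K m)" "w \<noteq> []"
  shows "gan K (dep1 \<phi>) w = K w \<phi>"
proof -
  obtain c v where w: "w = c # v" using assms(2) by (cases w) auto
  have "gan K (dep1 \<phi>) w = (\<Sum>j\<le>length v. K (c # take j v) (\<lambda>l. \<phi> l * unitf (drop j v)))"
    by (simp add: w dep1_Cons finlD[OF finl_gan[OF assms(1)]] gan_unitf[OF assms(1)])
  also have "\<dots> = (\<Sum>j\<in>{length v}. K (c # take j v) (\<lambda>l. \<phi> l * unitf (drop j v)))"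
    by (rule sum.mono_neutral_right) (auto simp: unitf_def finlD[OF assms(1)])
  finally show ?thesis by (simp add: w)
qed

lemma der_snoc:
  "der K f (v @ [c]) = der K (\<lambda>u. f (u @ [c])) v
     + (\<Sum>i\<le>length v. K (drop i v @ [c]) (\<lambda>l. f (take i v @ [l])))"
proof (induction v arbitrary: f)
  case (Cons a v)
  have "(\<Sum>i\<le>length (a # v). K (drop i (a # v) @ [c]) (\<lambda>l. f (take i (a # v) @ [l])))
     = K (a # v @ [c]) (\<lambda>l. f [l]) + (\<Sum>i\<le>length v. K (drop i v @ [c]) (\<lambda>l. f (a # take i v @ [l])))"
    by (simp add: sum.atMost_Suc_shift del: sum.atMost_Suc)
  then show ?case by (simp add: Cons)
qed simp

lemma gan_snoc:
  assumes "\<And>m. finl (K m)"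
  shows "gan K f (v @ [c]) = (\<Sum>i\<le>length v. K (drop i v @ [c]) (\<lambda>l. gan K (\<lambda>u. f (u @ [l])) (take i v)))"
proof (induction "length v" arbitrary: v f rule: less_induct)
  case less
  show ?case
  proof (cases v)
    case (Cons a u)
    have IH: "gan K f (drop j u @ [c]) = (\<Sum>i\<le>length u - j. K (drop (j + i) u @ [c]) (\<lambda>l. gan K (\<lambda>u. f (u @ [l])) (take i (drop j u))))"
      for f j using less[of "drop j u"] by (simp add: Cons add.commute)
    have "gan K f (v @ [c]) = K (a # u @ [c]) (\<lambda>l. f [l])
       + (\<Sum>j\<le>length u. K (a # take j u) (\<lambda>l. gan K (\<lambda>v. f (l # v)) (drop j u @ [c])))"
      by (simp add: Cons)
    also have "(\<Sum>j\<le>length u. K (a # take j u) (\<lambda>l. gan K (\<lambda>v. f (l # v)) (drop j u @ [c])))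
       = (\<Sum>j\<le>length u. \<Sum>i\<le>length u - j. K (a # take j u) (\<lambda>l. K (drop (j + i) u @ [c])
            (\<lambda>l'. gan K (\<lambda>v. f (l # v @ [l'])) (take (j + i - j) (drop j u)))))"
      by (simp add: IH finl_sumD[OF assms])
    also have "\<dots> = (\<Sum>k\<le>length u. \<Sum>j\<le>k. K (a # take j u) (\<lambda>l. K (drop k u @ [c])
            (\<lambda>l'. gan K (\<lambda>v. f (l # v @ [l'])) (take (k - j) (drop j u)))))"
      by (rule sum_triangle)
    also have "\<dots> = (\<Sum>k\<le>length u. K (drop k u @ [c]) (\<lambda>l'. gan K (\<lambda>v. f (v @ [l'])) (take (Suc k) v)))"
      by (intro sum.cong)
        (auto simp: Cons finl_sumD[OF assms] min_def drop_take
          finl_swap[OF assms assms, of "a # take _ u" "drop _ u @ [c]"])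
    finally show ?thesis
      by (simp add: Cons sum.atMost_Suc_shift del: sum.atMost_Suc)
  qed simp
qed

section \<open>Flexion operations on functions of words of points\<close>

definition ysum :: "pt list \<Rightarrow> rat" where "ysum w = sum_list (map snd w)"

lemma ysum_simps [simp]: "ysum [] = 0" "ysum (c # w) = snd c + ysum w" "ysum (u @ w) = ysum u + ysum w"
  by (simp_all add: ysum_def)

definition tr :: "rat \<Rightarrow> pt list \<Rightarrow> pt list" where "tr z w = map (\<lambda>l. (fst l - z, snd l)) w"

lemma tr_simps [simp]: "tr z [] = []" "tr z (c # w) = (fst c - z, snd c) # tr z w"
  "tr z (u @ w) = tr z u @ tr z w" "length (tr z w) = length w" "ysum (tr z w) = ysum w"
  "tr a (tr b w) = tr (a + b) w" "tr z w = [] \<longleftrightarrow> w = []"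
  by (simp_all add: tr_def ysum_def o_def algebra_simps)

lemma tr_take_drop: "take i (tr z w) = tr z (take i w)" "drop i (tr z w) = tr z (drop i w)"
  "butlast (tr z w) = tr z (butlast w)" "tl (tr z w) = tr z (tl w)"
  by (simp_all add: tr_def take_map drop_map map_butlast map_tl)

lemma fst_hd_last_tr: "w \<noteq> [] \<Longrightarrow> fst (last (tr z w)) = fst (last w) - z"
  "w \<noteq> [] \<Longrightarrow> fst (hd (tr z w)) = fst (hd w) - z"
  by (simp_all add: tr_def last_map hd_map)

text \<open>The words obtained by contracting factors: a letter of the result keeps one of the
  \<open>x\<close>-coordinates and collects the \<open>y\<close>-coordinates of its factor.\<close>

definition coarse :: "pt list \<Rightarrow> pt list \<Rightarrow> bool" where
  "coarse w u \<longleftrightarrow> subseq (map fst u) (map fst w) \<and> ysum u = ysum w \<and> (u = [] \<longleftrightarrow> w = [])"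

text \<open>Kernels that only read their argument at contractions of the given factor.\<close>

definition localK :: "ker \<Rightarrow> bool" where
  "localK K \<longleftrightarrow> (\<forall>m \<phi> \<psi>. m \<noteq> [] \<longrightarrow> (\<forall>l. fst l \<in> fst ` set m \<longrightarrow> snd l = ysum m \<longrightarrow> \<phi> l = \<psi> l) \<longrightarrow> K m \<phi> = K m \<psi>)"

lemma localKD:
  "localK K \<Longrightarrow> m \<noteq> [] \<Longrightarrow> (\<And>l. fst l \<in> fst ` set m \<Longrightarrow> snd l = ysum m \<Longrightarrow> \<phi> l = \<psi> l) \<Longrightarrow> K m \<phi> = K m \<psi>"
  unfolding localK_def by blast

lemma ysum_take_drop: "ysum (take j w) + ysum (drop j w) = ysum w"
  by (metis append_take_drop_id ysum_simps(3))

lemma coarse_block: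
  assumes "fst l \<in> fst ` set m" "snd l = ysum m" "m \<noteq> []" "subseq (map fst u) (map fst v)" "ysum u = ysum v"
  shows "coarse (m @ v) (l # u)"
proof -
  have "subseq [fst l] (map fst m)"
    using assms(1) by (simp add: subseq_singleton_left)
  then have "subseq ([fst l] @ map fst u) (map fst m @ map fst v)"
    by (rule list_emb_append_mono) (rule assms(4))
  then show ?thesis using assms by (simp add: coarse_def)
qed

lemma coarse_Cons: "coarse w u \<Longrightarrow> coarse (c # w) (c # u)"
  by (simp add: coarse_def)

lemma der_cong:
  assumes "localK K" "\<And>u. coarse w u \<Longrightarrow> f u = g u"
  shows "der K f w = der K g w"
  using assms(2)
proof (induction w arbitrary: f g)
  case (Cons c w)
  have "der K (\<lambda>v. f (c # v)) w = der K (\<lambda>v. g (c # v)) w"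
    by (rule Cons) (auto intro: Cons.prems coarse_Cons)
  moreover have "K (c # take j w) (\<lambda>l. f (l # drop j w)) = K (c # take j w) (\<lambda>l. g (l # drop j w))" for j
  proof (rule localKD[OF assms(1)])
    fix l assume "fst l \<in> fst ` set (c # take j w)" "snd l = ysum (c # take j w)"
    then have "coarse ((c # take j w) @ drop j w) (l # drop j w)" by (intro coarse_block) auto
    then show "f (l # drop j w) = g (l # drop j w)" by (intro Cons.prems) simp
  qed simp
  ultimately show ?case by simp
qed simp

lemma gan_cong:
  assumes "localK K" "\<And>u. coarse w u \<Longrightarrow> f u = g u"
  shows "gan K f w = gan K g w"
  using assms(2)
proof (induction "length w" arbitrary: w f g rule: less_induct)
  case less
  show ?case
  proof (cases w)
    case Nil
    then show ?thesis using less.prems[of "[]"] by (simp add: coarse_def)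
  next
    case (Cons c v)
    have "K (c # take j v) (\<lambda>l. gan K (\<lambda>v. f (l # v)) (drop j v))
        = K (c # take j v) (\<lambda>l. gan K (\<lambda>v. g (l # v)) (drop j v))" for j
    proof (rule localKD[OF assms(1)])
      fix l assume l: "fst l \<in> fst ` set (c # take j v)" "snd l = ysum (c # take j v)"
      show "gan K (\<lambda>v. f (l # v)) (drop j v) = gan K (\<lambda>v. g (l # v)) (drop j v)"
      proof (rule less.hyps)
        fix u assume "coarse (drop j v) u"
        then have "coarse ((c # take j v) @ drop j v) (l # u)"
          using l by (intro coarse_block) (auto simp: coarse_def)
        then show "f (l # u) = g (l # u)" by (intro less.prems) (simp add: Cons)
      qed (simp add: Cons)
    qed simp
    then show ?thesis by (simp add: Cons)
  qed
qed

lemma coarse_ysum: "coarse w u \<Longrightarrow> ysum u = ysum w" by (simp add: coarse_def)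

lemma der_ysum: "localK K \<Longrightarrow> der K (\<lambda>u. \<Psi> (ysum u) u) w = der K (\<Psi> (ysum w)) w"
  by (rule der_cong) (simp_all add: coarse_ysum)

lemma gan_ysum: "localK K \<Longrightarrow> gan K (\<lambda>u. \<Psi> (ysum u) u) w = gan K (\<Psi> (ysum w)) w"
  by (rule gan_cong) (simp_all add: coarse_ysum)

text \<open>Kernels compatible with translation of the \<open>x\<close>-coordinates.\<close>

definition trK :: "ker \<Rightarrow> bool" where
  "trK K \<longleftrightarrow> (\<forall>z m \<phi>. m \<noteq> [] \<longrightarrow> K (tr z m) \<phi> = K m (\<lambda>l. \<phi> (fst l - z, snd l)))"

lemma der_tr: "trK K \<Longrightarrow> der K f (tr z w) = der K (\<lambda>u. f (tr z u)) w"
proof (induction w arbitrary: f)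
  case (Cons c w)
  have "K ((fst c - z, snd c) # tr z v) \<phi> = K (c # v) (\<lambda>l. \<phi> (fst l - z, snd l))" for v \<phi>
    using Cons(2)[unfolded trK_def, rule_format, of "c # v" z] by simp
  then show ?case by (simp add: Cons tr_take_drop)
qed simp

lemma gan_tr: "trK K \<Longrightarrow> gan K f (tr z w) = gan K (\<lambda>u. f (tr z u)) w"
proof (induction "length w" arbitrary: f w rule: less_induct)
  case less
  show ?case
  proof (cases w)
    case (Cons c w')
    have "K ((fst c - z, snd c) # tr z v) \<phi> = K (c # v) (\<lambda>l. \<phi> (fst l - z, snd l))" for v \<phi>
      using less(2)[unfolded trK_def, rule_format, of "c # v" z] by simp
    then show ?thesis by (simp add: Cons tr_take_drop less)
  qed simp
qed

text \<open>The two summands are the contractions to the last and to the first letter in the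
  definitions of amit and anit.\<close>

definition karit :: "(pt list \<Rightarrow> rat) \<Rightarrow> ker" where
  "karit B m \<phi> = \<phi> (fst (last m), ysum m) * B (tr (fst (last m)) (butlast m))
     - \<phi> (fst (hd m), ysum m) * B (tr (fst (hd m)) (tl m))"

text \<open>Contraction to the first letter. As a derivation this is anit, as an endomorphism it is
  ganit.\<close>

definition kan :: "(pt list \<Rightarrow> rat) \<Rightarrow> ker" where
  "kan C m \<phi> = \<phi> (fst (hd m), ysum m) * C (tr (fst (hd m)) (tl m))"

definition kQ :: ker where
  "kQ m \<phi> = dep1 (\<lambda>l. fst l * snd l * \<phi> l) m"

lemma finl_karit [simp]: "finl (karit B m)"
  unfolding karit_def by (intro finl_diff finl_cmult2 finl_eval)

lemma finl_kan [simp]: "finl (kan B m)"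
  unfolding kan_def by (intro finl_diff finl_cmult2 finl_eval)

lemma finl_kQ [simp]: "finl (kQ m)"
proof (cases "\<exists>l. m = [l]")
  case True
  then obtain l where "m = [l]" by blast
  then have "kQ m = (\<lambda>\<phi>. fst l * snd l * \<phi> l)" by (simp add: kQ_def fun_eq_iff)
  then show ?thesis by (simp add: finl_cmult finl_eval del: mult.assoc)
next
  case False
  then have "kQ m = (\<lambda>\<phi>. 0)" unfolding kQ_def dep1_def by (auto split: list.splits)
  then show ?thesis by (simp add: finl_zero)
qed

lemma local_karit [simp]: "localK (karit B)"
  by (auto simp: localK_def karit_def)

lemma local_kan [simp]: "localK (kan B)"
  by (auto simp: localK_def kan_def)

lemma local_kQ [simp]: "localK kQ"
  by (auto simp: localK_def kQ_def dep1_def split: list.splits)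

lemma trK_karit [simp]: "trK (karit B)"
  by (auto simp: trK_def karit_def fst_hd_last_tr tr_take_drop)

lemma trK_kan [simp]: "trK (kan B)"
  by (auto simp: trK_def kan_def fst_hd_last_tr tr_take_drop)

definition larit :: "(pt list \<Rightarrow> rat) \<Rightarrow> (pt list \<Rightarrow> rat) \<Rightarrow> pt list \<Rightarrow> rat" where
  "larit B = der (karit B)"

definition lari :: "(pt list \<Rightarrow> rat) \<Rightarrow> (pt list \<Rightarrow> rat) \<Rightarrow> pt list \<Rightarrow> rat" where
  "lari A B w = larit B A w + lmu A B w - (larit A B w + lmu B A w)"

definition qf :: "pt list \<Rightarrow> rat" where "qf w = (\<Sum>l\<leftarrow>w. fst l * snd l)"

definition lQ :: "(pt list \<Rightarrow> rat) \<Rightarrow> pt list \<Rightarrow> rat" where "lQ f w = qf w * f w"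

lemma der_kQ: "der kQ f w = lQ f w"
proof (induction w arbitrary: f)
  case (Cons c w)
  have "(\<Sum>j\<le>length w. kQ (c # take j w) (\<lambda>l. f (l # drop j w)))
     = (\<Sum>j\<in>{0}. kQ (c # take j w) (\<lambda>l. f (l # drop j w)))"
    by (rule sum.mono_neutral_right) (auto simp: kQ_def dep1_Cons unitf_def)
  also have "\<dots> = fst c * snd c * f (c # w)" by (simp add: kQ_def)
  finally show ?case by (simp add: Cons lQ_def qf_def algebra_simps)
qed (simp add: lQ_def qf_def)

lemma karit_last_sum:
  "der (karit A) (\<lambda>u. \<phi> (fst (last u), ysum u) * B (tr (fst (last u)) (butlast u))) w
    = \<phi> (fst (last w), ysum w) * (larit A B (tr (fst (last w)) (butlast w)) + lmu B A (tr (fst (last w)) (butlast w)))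
      - (\<Sum>i<length w. \<phi> (fst (w ! i), ysum w) * B (tr (fst (w ! i)) (take i w)) * A (tr (fst (w ! i)) (drop (Suc i) w)))"
  if "w \<noteq> []"
proof -
  obtain v c where w: "w = v @ [c]" using \<open>w \<noteq> []\<close> by (metis rev_exhaust)
  have 1: "der (karit A) (\<lambda>u. \<phi> (fst c, ysum u + snd c) * B (tr (fst c) u)) v
      = \<phi> (fst c, ysum w) * larit A B (tr (fst c) v)"
    by (subst der_ysum[where \<Psi> = "\<lambda>s u. \<phi> (fst c, s + snd c) * B (tr (fst c) u)"])
      (simp_all add: finlD[OF finl_der] w larit_def der_tr)
  have 2: "(\<Sum>i\<le>length v. \<phi> (fst c, ysum w) * B (tr (fst c) (take i v)) * A (tr (fst c) (drop i v)))
      = \<phi> (fst c, ysum w) * lmu B A (tr (fst c) v)"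
    by (simp add: lmu_def sum_distrib_left tr_take_drop mult.assoc)
  have 3: "karit A (drop i v @ [c]) (\<lambda>l. \<phi> (fst l, ysum (take i v) + snd l) * B (tr (fst l) (take i v)))
     = \<phi> (fst c, ysum w) * B (tr (fst c) (take i v)) * A (tr (fst c) (drop i v))
      - \<phi> (fst (w ! i), ysum w) * B (tr (fst (w ! i)) (take i w)) * A (tr (fst (w ! i)) (drop (Suc i) w))"
    if "i \<le> length v" for i
  proof -
    have d: "drop i v @ [c] = drop i w" and iw: "i < length w" using that by (simp_all add: w)
    have "hd (drop i v @ [c]) = w ! i" "take i v = take i w" "tl (drop i v @ [c]) = drop (Suc i) w"
      using that iw unfolding d by (simp_all add: hd_drop_conv_nth tl_drop drop_Suc) (simp_all add: w)
    then show ?thesis using ysum_take_drop[of i v]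
      by (simp add: karit_def w add.assoc[symmetric])
  qed
  have "der (karit A) (\<lambda>u. \<phi> (fst (last u), ysum u) * B (tr (fst (last u)) (butlast u))) w
    = der (karit A) (\<lambda>u. \<phi> (fst c, ysum u + snd c) * B (tr (fst c) u)) v
      + (\<Sum>i\<le>length v. karit A (drop i v @ [c]) (\<lambda>l. \<phi> (fst l, ysum (take i v) + snd l) * B (tr (fst l) (take i v))))"
    by (simp add: w der_snoc)
  also have "\<dots> = \<phi> (fst c, ysum w) * larit A B (tr (fst c) v) + (\<phi> (fst c, ysum w) * lmu B A (tr (fst c) v)
     - (\<Sum>i\<le>length v. \<phi> (fst (w ! i), ysum w) * B (tr (fst (w ! i)) (take i w)) * A (tr (fst (w ! i)) (drop (Suc i) w))))"
    unfolding 1 2[symmetric] by (subst sum.cong[OF refl 3]) (simp_all add: sum_subtractf)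
  finally show ?thesis
    by (simp add: w lessThan_Suc_atMost distrib_left del: sum.lessThan_Suc sum.atMost_Suc)
qed

lemma karit_hd_sum:
  "der (karit A) (\<lambda>u. \<phi> (fst (hd u), ysum u) * B (tr (fst (hd u)) (tl u))) w
    = \<phi> (fst (hd w), ysum w) * (larit A B (tr (fst (hd w)) (tl w)) - lmu A B (tr (fst (hd w)) (tl w)))
      + (\<Sum>i<length w. \<phi> (fst (w ! i), ysum w) * A (tr (fst (w ! i)) (take i w)) * B (tr (fst (w ! i)) (drop (Suc i) w)))"
  if "w \<noteq> []"
proof -
  obtain c v where w: "w = c # v" using \<open>w \<noteq> []\<close> by (metis list.exhaust)
  have 1: "der (karit A) (\<lambda>u. \<phi> (fst c, snd c + ysum u) * B (tr (fst c) u)) v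
      = \<phi> (fst c, ysum w) * larit A B (tr (fst c) v)"
    by (subst der_ysum[where \<Psi> = "\<lambda>s u. \<phi> (fst c, snd c + s) * B (tr (fst c) u)"])
      (simp_all add: finlD[OF finl_der] w larit_def der_tr)
  have 2: "(\<Sum>i\<le>length v. \<phi> (fst c, ysum w) * A (tr (fst c) (take i v)) * B (tr (fst c) (drop i v)))
      = \<phi> (fst c, ysum w) * lmu A B (tr (fst c) v)"
    by (simp add: lmu_def sum_distrib_left tr_take_drop mult.assoc)
  have 3: "karit A (c # take i v) (\<lambda>l. \<phi> (fst l, snd l + ysum (drop i v)) * B (tr (fst l) (drop i v)))
     = \<phi> (fst (w ! i), ysum w) * A (tr (fst (w ! i)) (take i w)) * B (tr (fst (w ! i)) (drop (Suc i) w))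
      - \<phi> (fst c, ysum w) * A (tr (fst c) (take i v)) * B (tr (fst c) (drop i v))"
    if "i \<le> length v" for i
  proof -
    have "last (c # take i v) = w ! i" "butlast (c # take i v) = take i w"
      using that by (auto simp: w last_conv_nth butlast_conv_take nth_Cons' take_Cons' min_def)
    then show ?thesis using ysum_take_drop[of i v]
      by (simp add: karit_def w add.assoc del: butlast.simps last.simps)
  qed
  have "der (karit A) (\<lambda>u. \<phi> (fst (hd u), ysum u) * B (tr (fst (hd u)) (tl u))) w
    = der (karit A) (\<lambda>u. \<phi> (fst c, snd c + ysum u) * B (tr (fst c) u)) v
      + (\<Sum>i\<le>length v. karit A (c # take i v) (\<lambda>l. \<phi> (fst l, snd l + ysum (drop i v)) * B (tr (fst l) (drop i v))))"
    by (simp add: w)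
  also have "\<dots> = \<phi> (fst c, ysum w) * larit A B (tr (fst c) v)
     + ((\<Sum>i\<le>length v. \<phi> (fst (w ! i), ysum w) * A (tr (fst (w ! i)) (take i w)) * B (tr (fst (w ! i)) (drop (Suc i) w)))
        - \<phi> (fst c, ysum w) * lmu A B (tr (fst c) v))"
    unfolding 1 2[symmetric] by (subst sum.cong[OF refl 3]) (simp_all add: sum_subtractf)
  finally show ?thesis
    by (simp add: w lessThan_Suc_atMost right_diff_distrib del: sum.lessThan_Suc sum.atMost_Suc)
qed

lemma larit_lmu: "larit A (lmu f g) = (\<lambda>w. lmu (larit A f) g w + lmu f (larit A g) w)"
  by (simp add: larit_def der_lmu fun_eq_iff)

lemma finl_larit [simp]: "finl (\<lambda>f. larit B f w)"
  unfolding larit_def by (rule finl_der) simp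

lemma finl_lQ [simp]: "finl (\<lambda>f. lQ f w)"
  unfolding lQ_def by (intro finl_cmult finl_eval)

lemmas larit_lin = finlD[OF finl_larit]

lemma lQ_lmu: "lQ (lmu f g) = (\<lambda>w. lmu (lQ f) g w + lmu f (lQ g) w)"
  using der_lmu[of kQ f g] by (simp add: der_kQ[abs_def] fun_eq_iff)

text \<open>Composing two contractions: the terms in which the two contracted blocks interact are
  the ones that do not cancel in a commutator.\<close>

lemma larit_larit_dep1:
  assumes "w \<noteq> []"
  shows "larit A (larit B (dep1 \<phi>)) w
    = \<phi> (fst (last w), ysum w) * (larit A B (tr (fst (last w)) (butlast w)) + lmu B A (tr (fst (last w)) (butlast w)))
    - \<phi> (fst (hd w), ysum w) * (larit A B (tr (fst (hd w)) (tl w)) - lmu A B (tr (fst (hd w)) (tl w)))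
    - (\<Sum>i<length w. \<phi> (fst (w ! i), ysum w) * B (tr (fst (w ! i)) (take i w)) * A (tr (fst (w ! i)) (drop (Suc i) w)))
    - (\<Sum>i<length w. \<phi> (fst (w ! i), ysum w) * A (tr (fst (w ! i)) (take i w)) * B (tr (fst (w ! i)) (drop (Suc i) w)))"
proof -
  have "larit A (larit B (dep1 \<phi>)) w = der (karit A) (\<lambda>u. \<phi> (fst (last u), ysum u) * B (tr (fst (last u)) (butlast u))
      - \<phi> (fst (hd u), ysum u) * B (tr (fst (hd u)) (tl u))) w"
    unfolding larit_def by (rule der_cong) (use assms in \<open>auto simp: coarse_def der_dep1 karit_def\<close>)
  then show ?thesis
    using assms by (simp add: finlD[OF finl_der] karit_last_sum karit_hd_sum)
qed

lemma larit_unitf [simp]: "larit B unitf w = 0"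
  unfolding larit_def by (rule der_unitf) simp

lemma larit_Nil [simp]: "larit B f [] = 0"
  by (simp add: larit_def)

lemma lQ_unitf [simp]: "lQ unitf w = 0"
  by (cases w) (simp_all add: lQ_def qf_def)

text \<open>Both sides are derivations, so length one suffices.\<close>

lemma larit_commutator: "larit A (larit B f) w - larit B (larit A f) w = larit (lari B A) f w"
proof (rule eq_on_generators[where X = UNIV and S = "\<lambda>f w. larit A (larit B f) w - larit B (larit A f) w"])
  show "finl (\<lambda>f. larit A (larit B f) i - larit B (larit A f) i)" for i
    by (intro finl_diff finl_comp[OF finl_larit]) (simp_all add: finl_eval)
  show "larit A (larit B (dep1 \<phi>)) i - larit B (larit A (dep1 \<phi>)) i = larit (lari B A) (dep1 \<phi>) i" for \<phi> i
  proof (cases "i = []")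
    case False
    then have "larit (lari B A) (dep1 \<phi>) i = karit (lari B A) i \<phi>"
      by (simp add: larit_def der_dep1)
    then show ?thesis using False
      by (simp add: larit_larit_dep1 karit_def lari_def algebra_simps)
  qed simp
  show "larit A (larit B unitf) i - larit B (larit A unitf) i = larit (lari B A) unitf i" for i
    by (simp add: larit_lin larit_unitf[abs_def])
  show "larit A (larit B (lmu f g)) i - larit B (larit A (lmu f g)) i = larit (lari B A) (lmu f g) i"
    if f: "\<And>i. i \<in> UNIV \<Longrightarrow> larit A (larit B f) i - larit B (larit A f) i = larit (lari B A) f i"
      and g: "\<And>i. i \<in> UNIV \<Longrightarrow> larit A (larit B g) i - larit B (larit A g) i = larit (lari B A) g i" for f g i
  proof -
    have fg: "larit (lari B A) f = (\<lambda>i. larit A (larit B f) i - larit B (larit A f) i)"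
      "larit (lari B A) g = (\<lambda>i. larit A (larit B g) i - larit B (larit A g) i)"
      using f g by (simp_all add: fun_eq_iff)
    show ?thesis by (simp add: larit_lmu larit_lin fg lmu_lin)
  qed
qed simp_all

lemma qf_simps [simp]: "qf [] = 0" "qf (c # w) = fst c * snd c + qf w" "qf (u @ v) = qf u + qf v"
  by (simp_all add: qf_def)

lemma q_tr: "qf (tr z w) = qf w - z * ysum w"
  by (induction w) (simp_all add: algebra_simps)

text \<open>The defect of \<open>Q\<close> being translation invariant is a multiple of the total
  \<open>y\<close>-coordinate, and the total does not change under contraction.\<close>

lemma lQ_larit: "lQ (larit A f) w - larit A (lQ f) w = larit (lQ A) f w"
proof (rule eq_on_generators[where X = UNIV and S = "\<lambda>f w. lQ (larit A f) w - larit A (lQ f) w"])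
  show "finl (\<lambda>f. lQ (larit A f) i - larit A (lQ f) i)" for i
    by (intro finl_diff finl_comp[OF finl_larit] finl_comp[OF finl_lQ]) (simp_all add: finl_eval)
  show "lQ (larit A (dep1 \<phi>)) i - larit A (lQ (dep1 \<phi>)) i = larit (lQ A) (dep1 \<phi>) i" for \<phi> i
  proof (cases "i = []")
    case False
    have Qd: "lQ (dep1 \<phi>) = dep1 (\<lambda>l. fst l * snd l * \<phi> l)"
      by (auto simp: lQ_def dep1_def qf_def fun_eq_iff split: list.splits)
    obtain c v where w: "i = c # v" using False by (metis list.exhaust)
    obtain c' v' where w': "i = v' @ [c']" using False by (metis rev_exhaust)
    have q: "qf (tr (fst (hd i)) (tl i)) = qf i - fst (hd i) * ysum i"
      "qf (tr (fst (last i)) (butlast i)) = qf i - fst (last i) * ysum i"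
      subgoal by (simp add: w q_tr algebra_simps)
      subgoal by (simp add: w' q_tr algebra_simps)
      done
    show ?thesis
      unfolding Qd larit_def using False
      by (simp add: lQ_def der_dep1 karit_def q algebra_simps)
  qed (simp add: lQ_def)
  show "lQ (larit A unitf) i - larit A (lQ unitf) i = larit (lQ A) unitf i" for i
    by (simp add: larit_lin larit_unitf[abs_def] lQ_unitf[abs_def] lQ_def[of "\<lambda>_. 0"])
  show "lQ (larit A (lmu f g)) i - larit A (lQ (lmu f g)) i = larit (lQ A) (lmu f g) i"
    if f: "\<And>i. i \<in> UNIV \<Longrightarrow> lQ (larit A f) i - larit A (lQ f) i = larit (lQ A) f i"
      and g: "\<And>i. i \<in> UNIV \<Longrightarrow> lQ (larit A g) i - larit A (lQ g) i = larit (lQ A) g i" for f g i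
  proof -
    have fg: "larit (lQ A) f = (\<lambda>i. lQ (larit A f) i - larit A (lQ f) i)"
      "larit (lQ A) g = (\<lambda>i. lQ (larit A g) i - larit A (lQ g) i)"
      using f g by (simp_all add: fun_eq_iff)
    show ?thesis
      by (simp add: larit_lmu lQ_lmu larit_lin finlD[OF finl_lQ] fg lmu_lin)
  qed
qed simp_all

text \<open>The operators \<open>R\<^sub>A\<close>: preari with \<open>A\<close> as second
  argument.\<close>

definition rmul :: "(pt list \<Rightarrow> rat) \<Rightarrow> (pt list \<Rightarrow> rat) \<Rightarrow> pt list \<Rightarrow> rat" where
  "rmul A f w = larit A f w + lmu f A w"

lemma rmul_unitf [simp]: "rmul A unitf = A"
  by (simp add: rmul_def fun_eq_iff)

lemma finl_lmu1 [simp]: "finl (\<lambda>f. lmu f A w)"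
  unfolding lmu_def by (intro finl_sum finl_cmult2 finl_eval)

lemma finl_rmul [simp]: "finl (\<lambda>f. rmul A f w)"
  unfolding rmul_def by (intro finl_add) simp_all

text \<open>The Lie bracket ari is thereby a bracket of operators, and nothing about it has to be
  proved by manipulating flexions.\<close>

lemma rmul_commutator: "rmul A (rmul B f) w - rmul B (rmul A f) w = rmul (lari B A) f w"
proof -
  have a: "larit (lari B A) f = (\<lambda>w. larit A (larit B f) w - larit B (larit A f) w)"
    by (simp add: larit_commutator fun_eq_iff)
  have l: "lari B A = (\<lambda>w. larit A B w + lmu B A w - (larit B A w + lmu A B w))"
    by (simp add: lari_def fun_eq_iff)
  have "lmu f (lari B A) w = lmu f (larit A B) w + lmu (lmu f B) A w - (lmu f (larit B A) w + lmu (lmu f A) B w)"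
    unfolding l lmu_lin lmu_assoc by simp
  then show ?thesis
    unfolding rmul_def[of "lari B A"] a
    by (simp add: rmul_def[abs_def] larit_lin larit_lmu lmu_lin)
qed

lemma lQ_rmul: "lQ (rmul A f) w - rmul A (lQ f) w = rmul (lQ A) f w"
proof -
  have "lQ (rmul A f) w = lQ (larit A f) w + lQ (lmu f A) w"
    by (simp add: rmul_def lQ_def algebra_simps)
  then show ?thesis
    unfolding rmul_def using lQ_larit[of A f w] by (simp add: lQ_lmu)
qed

section \<open>Generic words and the operators of pic and poc\<close>

text \<open>Points at which neither pic nor poc has a pole. The property is inherited by
  contractions.\<close>

definition gen :: "pt list \<Rightarrow> bool" where
  "gen w \<longleftrightarrow> distinct (map fst w) \<and> 0 \<notin> fst ` set w"

lemma gen_Nil [simp]: "gen []" by (simp add: gen_def)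

lemma subseq_distinct_subset: "subseq xs ys \<Longrightarrow> distinct ys \<Longrightarrow> distinct xs \<and> set xs \<subseteq> set ys"
  by (induction rule: list_emb.induct) auto

lemma gen_coarse: "gen w \<Longrightarrow> coarse w u \<Longrightarrow> gen u"
  unfolding gen_def coarse_def using subseq_distinct_subset[of "map fst u" "map fst w"] by auto

lemma gen_take_drop: "gen w \<Longrightarrow> gen (take i w)" "gen w \<Longrightarrow> gen (drop i w)"
  unfolding gen_def by (auto simp: take_map[symmetric] drop_map[symmetric] dest: in_set_takeD in_set_dropD)

lemma gen_appendD: "gen (u @ v) \<Longrightarrow> gen u \<and> gen v" "gen (c # v) \<Longrightarrow> gen v"
  by (auto simp: gen_def)

lemma gen_tr: "x \<notin> fst ` set w \<Longrightarrow> distinct (map fst w) \<Longrightarrow> gen (tr x w)"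
proof -
  assume *: "x \<notin> fst ` set w" "distinct (map fst w)"
  have "map fst (tr x w) = map (\<lambda>a. a - x) (map fst w)" by (simp add: tr_def)
  then have "distinct (map fst (tr x w))" using *(2) by (simp only: distinct_map) (simp add: inj_on_def)
  moreover have "0 \<notin> fst ` set (tr x w)" using *(1) by (auto simp: tr_def image_iff)
  ultimately show ?thesis by (simp add: gen_def)
qed

lemma gen_tr_hd: "distinct (map fst (c # w)) \<Longrightarrow> gen (tr (fst c) w)"
  by (rule gen_tr) auto

lemma gen_tr_nth:
  assumes "gen w" "i < length w"
  shows "gen (tr (fst (w ! i)) (take i w))" "gen (tr (fst (w ! i)) (drop (Suc i) w))"
proof -
  have "distinct (map fst (take i w @ w ! i # drop (Suc i) w))"
    using assms by (simp only: id_take_nth_drop[symmetric] gen_def)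
  then show "gen (tr (fst (w ! i)) (take i w))" "gen (tr (fst (w ! i)) (drop (Suc i) w))"
    by (auto intro!: gen_tr)
qed

definition eqg :: "(pt list \<Rightarrow> rat) \<Rightarrow> (pt list \<Rightarrow> rat) \<Rightarrow> bool" where
  "eqg f g \<longleftrightarrow> (\<forall>w. gen w \<longrightarrow> f w = g w)"

lemma eqgD: "eqg f g \<Longrightarrow> gen w \<Longrightarrow> f w = g w" by (simp add: eqg_def)

definition lpic :: "pt list \<Rightarrow> rat" where "lpic w = (\<Prod>l\<leftarrow>w. 1 / fst l)"

lemma lpic_simps [simp]: "lpic [] = 1" "lpic (c # w) = lpic w / fst c" "lpic (u @ w) = lpic u * lpic w"
  by (simp_all add: lpic_def)

text \<open>The chain \<open>1 / ((x\<^sub>1 - x\<^sub>2) \<dots> (x\<^sub>r\<^sub>-\<^sub>1 -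
  x\<^sub>r))\<close> occurring in poc.\<close>

fun lkap :: "pt list \<Rightarrow> rat" where
  "lkap [] = 1" | "lkap [c] = 1" | "lkap (c # d # w) = lkap (d # w) / (fst c - fst d)"

definition lpoc :: "pt list \<Rightarrow> rat" where
  "lpoc w = (if w = [] then 1 else - lkap w / fst (hd w))"

definition gpic :: "(pt list \<Rightarrow> rat) \<Rightarrow> pt list \<Rightarrow> rat" where "gpic = gan (kan lpic)"
definition gpoc :: "(pt list \<Rightarrow> rat) \<Rightarrow> pt list \<Rightarrow> rat" where "gpoc = gan (kan lpoc)"

lemma finl_gpic [simp]: "finl (\<lambda>f. gpic f w)" "finl (\<lambda>f. gpoc f w)"
  unfolding gpic_def gpoc_def by (intro finl_gan finl_kan)+

lemma gkan_Cons: "gan (kan C) f (c # w) = (\<Sum>j\<le>length w. C (tr (fst c) (take j w))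
    * gan (kan C) (\<lambda>v. f ((fst c, snd c + ysum (take j w)) # v)) (drop j w))"
  by (simp add: kan_def mult.commute)

lemma gkan_hd:
  "gan (kan C) (\<lambda>u. \<phi> (fst (hd u), ysum u) * B (tr (fst (hd u)) (tl u))) (c # w)
    = \<phi> (fst c, ysum (c # w)) * lmu C (gan (kan C) B) (tr (fst c) w)"
proof -
  have "gan (kan C) (\<lambda>v. \<phi> (fst c, snd c + ysum (take j w) + ysum v) * B (tr (fst c) v)) (drop j w)
      = \<phi> (fst c, ysum (c # w)) * gan (kan C) B (tr (fst c) (drop j w))" for j
    using ysum_take_drop[of j w]
    by (subst gan_ysum[where \<Psi> = "\<lambda>s v. \<phi> (fst c, snd c + ysum (take j w) + s) * B (tr (fst c) v)"])
      (simp_all add: finlD[OF finl_gan] gan_tr add.assoc)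
  then show ?thesis
    by (simp add: gkan_Cons lmu_def sum_distrib_left tr_take_drop mult_ac del: gan.simps)
qed

lemma gkan_dep1: "w \<noteq> [] \<Longrightarrow> gan (kan C) (dep1 \<phi>) w = \<phi> (fst (hd w), ysum w) * C (tr (fst (hd w)) (tl w))"
  by (simp add: gan_dep1 kan_def)

lemma coarse_length: "coarse w u \<Longrightarrow> length u \<le> length w"
  unfolding coarse_def using list_emb_length by fastforce

text \<open>Every term except the one without contraction evaluates the function on a shorter
  word.\<close>

lemma gkan_leading:
  assumes "C [] = 1" "\<And>u. coarse w u \<Longrightarrow> length u < length w \<Longrightarrow> f u = 0"
  shows "gan (kan C) f w = f w"
  using assms(2)
proof (induction w arbitrary: f)
  case (Cons c w)
  have 1: "gan (kan C) (\<lambda>v. f (c # v)) w = f (c # w)"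
    by (rule Cons.IH) (auto intro: Cons.prems coarse_Cons)
  have 2: "gan (kan C) (\<lambda>v. f ((fst c, snd c + ysum (take j w)) # v)) (drop j w) = 0"
    if "j \<le> length w" "j \<noteq> 0" for j
  proof -
    have "gan (kan C) (\<lambda>v. f ((fst c, snd c + ysum (take j w)) # v)) (drop j w) = gan (kan C) (\<lambda>v. 0) (drop j w)"
    proof (rule gan_cong)
      fix u assume u: "coarse (drop j w) u"
      have "coarse ((c # take j w) @ drop j w) ((fst c, snd c + ysum (take j w)) # u)"
        by (rule coarse_block) (use u in \<open>auto simp: coarse_def\<close>)
      moreover have "length u < length w" using coarse_length[OF u] that by simp
      ultimately show "f ((fst c, snd c + ysum (take j w)) # u) = 0" by (intro Cons.prems) auto
    qed simp
    then show ?thesis by (simp add: finlD[OF finl_gan])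
  qed
  have "gan (kan C) f (c # w) = (\<Sum>j\<in>{0}. C (tr (fst c) (take j w))
    * gan (kan C) (\<lambda>v. f ((fst c, snd c + ysum (take j w)) # v)) (drop j w))"
    unfolding gkan_Cons by (rule sum.mono_neutral_right) (auto simp: 2)
  then show ?case by (simp add: assms(1) 1)
qed simp

text \<open>By triangularity: the component of least depth is not changed.\<close>

lemma gpic_inj:
  assumes "eqg (gpic f) (gpic g)" shows "eqg f g"
proof -
  have "gen w \<Longrightarrow> f w - g w = 0" for w
  proof (induction "length w" arbitrary: w rule: less_induct)
    case less
    have "gpic (\<lambda>v. f v - g v) w = f w - g w"
      unfolding gpic_def by (rule gkan_leading) (use less gen_coarse in auto)
    then show ?case using assms less(2) by (simp add: finlD[OF finl_gpic(1)] eqg_def)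
  qed
  then show ?thesis by (simp add: eqg_def)
qed

text \<open>The partial fraction identity behind the inverse relation of pic and poc.\<close>

lemma gpic_lkap:
  "distinct (map fst (c # w)) \<Longrightarrow> gpic lkap (c # w) = unitf w"
proof (induction "length w" arbitrary: c w rule: less_induct)
  case less
  have 1: "gpic (\<lambda>v. lkap ((a, b) # v)) (d # u) = gpic lkap (d # u) / (a - fst d)" for a b d u
    unfolding gpic_def gkan_Cons sum_divide_distrib
    by (intro sum.cong) (simp_all add: finlD[OF finl_gan] divide_inverse del: gan.simps)
  show ?case
  proof (cases w rule: rev_cases)
    case Nil
    then show ?thesis by (simp add: gpic_def gkan_Cons del: gan.simps(2))
  next
    case (snoc v e)
    have 2: "gpic (\<lambda>u. lkap ((fst c, b) # u)) (drop j w) = (if j = length v then 1 / (fst c - fst e) else 0)"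
      if "j < length w" for j b
    proof -
      obtain d u where du: "drop j w = d # u" using \<open>j < length w\<close> by (cases "drop j w") auto
      have "distinct (map fst (drop j w))" using less(2) by (simp add: drop_map[symmetric])
      then have "gpic lkap (d # u) = unitf u" by (intro less(1)) (use du that in \<open>auto dest: arg_cong[of _ _ length]\<close>)
      then show ?thesis using du that snoc
        by (cases "j = length v") (auto simp: 1 unitf_def)
    qed
    have "gpic lkap (c # w) = (\<Sum>j\<le>length w. lpic (tr (fst c) (take j w))
        * gpic (\<lambda>v. lkap ((fst c, snd c + ysum (take j w)) # v)) (drop j w))"
      by (simp add: gpic_def gkan_Cons del: gan.simps)
    also have "\<dots> = (\<Sum>j<length w. lpic (tr (fst c) (take j w)) * (if j = length v then 1 / (fst c - fst e) else 0))
        + lpic (tr (fst c) w)"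
      by (simp add: lessThan_Suc_atMost[symmetric] 2) (simp add: gpic_def)
    also have "\<dots> = 0" using less(2) by (simp add: snoc field_simps)
    finally show ?thesis by (simp add: snoc unitf_def)
  qed
qed

lemma lmu_snoc_dep1: "lmu f (dep1 \<psi>) (v @ [c]) = f v * \<psi> c"
  by (induction v arbitrary: f) (simp_all add: lmu_Cons dep1_Cons unitf_def)

lemma lmu_lpic_gpic_lpoc:
  assumes "gen w" shows "lmu lpic (gpic lpoc) w = unitf w"
proof -
  have 1: "gpic lpoc v = unitf v + dep1 (\<lambda>l. - 1 / fst l) v" if "gen v" for v
  proof (cases v)
    case Nil
    then show ?thesis by (simp add: gpic_def lpoc_def)
  next
    case (Cons c u)
    have "gpic lpoc (c # u) = - (gpic lkap (c # u) / fst c)"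
      unfolding gpic_def gkan_Cons sum_divide_distrib sum_negf[symmetric]
      by (intro sum.cong) (simp_all add: lpoc_def finlD[OF finl_gan] finlD(2)[OF finl_gan, of _ "-1", simplified] divide_inverse del: gan.simps)
    also have "gpic lkap (c # u) = unitf u" by (rule gpic_lkap) (use that Cons in \<open>simp add: gen_def\<close>)
    finally show ?thesis by (simp add: Cons dep1_Cons)
  qed
  have "lmu lpic (gpic lpoc) w = lmu lpic (\<lambda>v. unitf v + dep1 (\<lambda>l. - 1 / fst l) v) w"
    by (rule lmu_cong) (simp_all add: 1 gen_take_drop assms)
  also have "\<dots> = unitf w"
    by (cases w rule: rev_cases) (simp_all add: lmu_lin lmu_snoc_dep1, simp_all add: unitf_def)
  finally show ?thesis .
qed

lemma gpic_lmu: "gpic (lmu f g) = lmu (gpic f) (gpic g)" "gpoc (lmu f g) = lmu (gpoc f) (gpoc g)"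
  unfolding gpic_def gpoc_def by (simp_all add: gan_lmu fun_eq_iff)

lemma gpic_unitf [simp]: "gpic unitf = unitf" "gpoc unitf = unitf"
  unfolding gpic_def gpoc_def by (simp_all add: gan_unitf fun_eq_iff)

lemma lmu_eqg:
  assumes "gen w" "eqg f f'" "eqg g g'" shows "lmu f g w = lmu f' g' w"
  by (rule lmu_cong) (use assms gen_take_drop in \<open>auto simp: eqg_def\<close>)

lemma gpic_eqg: "eqg f g \<Longrightarrow> eqg (gpic f) (gpic g)" "eqg f g \<Longrightarrow> eqg (gpoc f) (gpoc g)"
  unfolding eqg_def gpic_def gpoc_def by (auto intro!: gan_cong dest: gen_coarse)

text \<open>Both sides are multiplicative, so length one suffices; there the claim is the inverse
  relation between pic and poc.\<close>

lemma gpic_gpoc: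
  assumes "gen w" shows "gpic (gpoc f) w = f w"
proof (rule eq_on_generators[where X = "{w. gen w}" and S = "\<lambda>f. gpic (gpoc f)" and T = "\<lambda>f. f"])
  show "finl (\<lambda>f. gpic (gpoc f) i)" for i by (rule finl_comp) simp_all
  show "gpic (gpoc (dep1 \<phi>)) i = dep1 \<phi> i" if "i \<in> {w. gen w}" for \<phi> i
  proof (cases i)
    case Nil
    then show ?thesis by (simp add: gpic_def gpoc_def)
  next
    case (Cons c v)
    have "gpic (gpoc (dep1 \<phi>)) i = gpic (\<lambda>u. \<phi> (fst (hd u), ysum u) * lpoc (tr (fst (hd u)) (tl u))) i"
      unfolding gpic_def by (rule gan_cong) (auto simp: gpoc_def gkan_dep1 coarse_def Cons)
    also have "\<dots> = \<phi> (fst c, ysum i) * unitf v"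
    proof -
      have "gen (tr (fst c) v)" by (rule gen_tr_hd) (use that in \<open>simp add: gen_def Cons\<close>)
      from lmu_lpic_gpic_lpoc[OF this] show ?thesis
        unfolding gpic_def Cons gkan_hd by (simp only:) (simp add: unitf_def)
    qed
    finally show ?thesis by (cases v) (simp_all add: Cons)
  qed
  show "gpic (gpoc (lmu f g)) i = lmu f g i" if "\<And>i. i \<in> {w. gen w} \<Longrightarrow> gpic (gpoc f) i = f i"
    "\<And>i. i \<in> {w. gen w} \<Longrightarrow> gpic (gpoc g) i = g i" "i \<in> {w. gen w}" for f g i
    unfolding gpic_lmu using that by (intro lmu_eqg) (auto simp: eqg_def)
qed (simp_all add: finl_eval assms)

lemma der_add: "der (\<lambda>m \<phi>. K m \<phi> + K' m \<phi>) f w = der K f w + der K' f w"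
  by (induction w arbitrary: f) (simp_all add: sum.distrib)

lemma der_short_Cons:
  assumes "\<And>m \<phi>. length m > 3 \<Longrightarrow> K m \<phi> = 0"
  shows "der K f (a # b # c # w) = der K (\<lambda>v. f (a # v)) (b # c # w) + K [a] (\<lambda>l. f (l # b # c # w))
     + K [a, b] (\<lambda>l. f (l # c # w)) + K [a, b, c] (\<lambda>l. f (l # w))"
proof -
  have "(\<Sum>j\<le>length (b # c # w). K (a # take j (b # c # w)) (\<lambda>l. f (l # drop j (b # c # w))))
      = (\<Sum>j\<in>{0,1,2}. K (a # take j (b # c # w)) (\<lambda>l. f (l # drop j (b # c # w))))"
    by (rule sum.mono_neutral_right) (auto intro!: assms)
  then show ?thesis by (simp add: numeral_2_eq_2)
qed

definition lxi :: "pt list \<Rightarrow> rat" where "lxi = dep1 (\<lambda>l. 1)"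

definition lE :: "pt list \<Rightarrow> rat" where
  "lE w = (case w of [l] \<Rightarrow> - (fst l + snd l) / 2 | [a, b] \<Rightarrow> 1 / 4 | _ \<Rightarrow> 0)"

lemma lE_simps [simp]: "lE [] = 0" "lE [l] = - (fst l + snd l) / 2" "lE [a, b] = 1 / 4" "lE (a # b # c # w) = 0"
  by (simp_all add: lE_def)

lemma lxi_simps [simp]: "lxi [] = 0" "lxi [l] = 1" "lxi (a # b # w) = 0"
  by (simp_all add: lxi_def)

text \<open>The correction term that conjugation by the operator of pic adds to
  \<open>Q\<close>.\<close>

definition lT :: "pt list \<Rightarrow> rat" where "lT = dep1 (\<lambda>l. - snd l)"

lemma lT_simps [simp]: "lT [] = 0" "lT [l] = - snd l" "lT (a # b # w) = 0"
  by (simp_all add: lT_def)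

lemma long_list: "length m > 3 \<Longrightarrow> \<exists>a b c d v. m = a # b # c # d # v"
  by (auto simp: Suc_le_eq[symmetric] eval_nat_numeral Suc_le_length_iff)

text \<open>The kernel of the derivation part of the conjugated operator. Although pic has poles,
  the coefficients are polynomial.\<close>

definition kD :: ker where "kD m \<phi> = kQ m \<phi> + kan lT m \<phi> + karit lE m \<phi>"

text \<open>The operator conjugate to \<open>Q + R\<close>, where \<open>R\<close> belongs to
  \<open>E\<close>.\<close>

definition ld0 :: "(pt list \<Rightarrow> rat) \<Rightarrow> pt list \<Rightarrow> rat" where
  "ld0 f w = der kD f w + lmu f lE w"

lemma finl_kD [simp]: "finl (kD m)" unfolding kD_def by (intro finl_add) simp_all
lemma local_kD [simp]: "localK kD"
  unfolding localK_def kD_def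
  by (intro allI impI arg_cong2[where f = "(+)"] localKD[OF local_kQ] localKD[OF local_kan] localKD[OF local_karit]) auto

lemma kD_simps: "kD [a] \<phi> = fst a * snd a * \<phi> a"
  "kD [a, b] \<phi> = - (fst a - fst b + snd a) / 2 * \<phi> (fst b, snd a + snd b)
     + (fst b - fst a - snd b) / 2 * \<phi> (fst a, snd a + snd b)"
  "kD [a, b, c] \<phi> = (\<phi> (fst c, snd a + snd b + snd c) - \<phi> (fst a, snd a + snd b + snd c)) / 4"
  by (simp_all add: kD_def kQ_def kan_def karit_def field_simps)

lemma kD_long: "length m > 3 \<Longrightarrow> kD m \<phi> = 0"
proof -
  assume "length m > 3"
  then obtain a b c d v where m: "m = a # b # c # d # v" using long_list by blast
  moreover have "lE (tr x (butlast (a # b # c # d # v))) = 0" for x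
    by (cases v) (simp_all)
  ultimately show ?thesis by (simp add: kD_def kQ_def kan_def karit_def)
qed

lemma kxi_simps: "karit lxi [a] \<phi> = 0" "karit lxi [a, b] \<phi> = \<phi> (fst b, snd a + snd b) - \<phi> (fst a, snd a + snd b)"
  "karit lxi (a # b # c # w) \<phi> = 0"
proof -
  have "lxi (tr x (butlast (a # b # c # w))) = 0" for x
    by (cases w) simp_all
  then show "karit lxi (a # b # c # w) \<phi> = 0" by (simp add: karit_def)
qed (simp_all add: karit_def)

lemma kxi_long: "length m > 3 \<Longrightarrow> karit lxi m \<phi> = 0"
  by (auto dest!: long_list simp: kxi_simps)

text \<open>The quotient of \<open>mu(pic, E)\<close> by \<open>- pic\<close>, in coordinates
  translated by \<open>x\<close>. It depends on the last two letters only, which is why the poles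
  disappear.\<close>

fun bk :: "rat \<Rightarrow> pt list \<Rightarrow> rat" where
  "bk x [] = 0"
| "bk x [a] = (fst a - x + snd a) * (fst a - x) / 2"
| "bk x [a, b] = (fst b - x + snd b) * (fst b - x) / 2 - (fst a - x) * (fst b - x) / 4"
| "bk x (a # b # c # w) = bk x (b # c # w)"

lemma lmu_lpic_lE:
  assumes "x \<notin> fst ` set w"
  shows "lmu lpic lE (tr x w) = - lpic (tr x w) * bk x w"
  using assms
proof (induction x w rule: bk.induct)
  case (4 x a b c w)
  have f: "(\<lambda>v. lpic ((fst a - x, snd a) # v)) = (\<lambda>v. (1 / (fst a - x)) * lpic v)"
    by (simp add: fun_eq_iff)
  have "lmu lpic lE (tr x (a # b # c # w)) = lpic [] * lE ((fst a - x, snd a) # tr x (b # c # w))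
      + lmu (\<lambda>v. lpic ((fst a - x, snd a) # v)) lE (tr x (b # c # w))"
    by (simp only: tr_simps(2)[of x a] lmu_Cons[of lpic lE "(fst a - x, snd a)"])
  then have "lmu lpic lE (tr x (a # b # c # w)) = (1 / (fst a - x)) * lmu lpic lE (tr x (b # c # w))"
    unfolding f lmu_lin(5) by simp
  also have "lmu lpic lE (tr x (b # c # w)) = - lpic (tr x (b # c # w)) * bk x (b # c # w)"
    by (rule 4(1)) (use 4(2) in simp)
  finally show ?case by (simp only: bk.simps) simp
next
  case (3 x a b)
  obtain A ya B yb where a: "a = (x + A, ya)" and b: "b = (x + B, yb)"
    by (metis add.commute diff_add_cancel prod.exhaust)
  then show ?case using 3 by (simp add: lmu_Cons field_simps)
qed (simp_all add: lmu_Cons field_simps)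

text \<open>Logarithmic derivative of pic: the contributions of the contracted factors telescope
  along the word.\<close>

lemma der_kD_lpic_tr:
  assumes "x \<notin> fst ` set (a # w)"
  shows "der kD (\<lambda>v. \<psi> (ysum v) * lpic (tr x v)) (a # w) = \<psi> (ysum (a # w)) * lpic (tr x (a # w)) *
     (x * ysum (a # w) + bk x (a # w) + (snd a - (fst a - x)) * (fst a - x) / 2
       + (case w of [] \<Rightarrow> 0 | b # _ \<Rightarrow> (fst a - x) * (fst b - x) / 4))"
  using assms
proof (induction w arbitrary: a \<psi>)
  case Nil
  then show ?case by (simp add: kD_simps field_simps)
next
  case (Cons b w)
  have IH: "der kD (\<lambda>v. \<psi> (snd a + ysum v) * (lpic (tr x v) / (fst a - x))) (b # w) = \<psi> (snd a + ysum (b # w)) * lpic (tr x (b # w)) / (fst a - x) *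
     (x * ysum (b # w) + bk x (b # w) + (snd b - (fst b - x)) * (fst b - x) / 2
       + (case w of [] \<Rightarrow> 0 | c # _ \<Rightarrow> (fst b - x) * (fst c - x) / 4))"
    using Cons(1)[of b "\<lambda>s. \<psi> (snd a + s) / (fst a - x)"] Cons(2) by simp
  obtain A ya B yb where a: "a = (x + A, ya)" and b: "b = (x + B, yb)"
    by (metis add.commute diff_add_cancel prod.exhaust)
  have nz: "A \<noteq> 0" "B \<noteq> 0" using Cons(2) by (auto simp: a b)
  have nzc: "c \<in> set w \<Longrightarrow> fst c \<noteq> x" for c using Cons(2) by (auto simp: image_iff)
  show ?case
  proof (cases w)
    case Nil
    show ?thesis
      using IH unfolding Nil a b
      by (simp add: kD_simps add.assoc) (use nz in \<open>simp add: field_simps\<close>)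
  next
    case (Cons c v)
    obtain C yc where c: "c = (x + C, yc)" by (metis add.commute diff_add_cancel prod.exhaust)
    have nz: "A \<noteq> 0" "B \<noteq> 0" "C \<noteq> 0" using nz nzc[of c] by (auto simp: c Cons)
    define R where "R = \<psi> (ya + (yb + (yc + ysum v))) * lpic (tr x v) / (A * B * C)"
    have R: "\<psi> (ya + (yb + (yc + ysum v))) * lpic (tr x v) = A * B * C * R" using nz by (simp add: R_def)
    have R': "\<psi> (ya + (yb + (yc + ysum v))) * (lpic (tr x v) / k) = A * B * C * R / k" for k
      using R by simp
    show ?thesis
      using IH unfolding Cons a b c
      apply (subst der_short_Cons)
      apply (erule kD_long)
      apply (simp add: kD_simps add.assoc R R' nz del: der.simps)
      apply (simp add: algebra_simps del: der.simps)
      apply (simp add: field_simps del: der.simps)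
      done
  qed
qed

section \<open>Conjugation by the operator of pic\<close>

lemma nat_cases3: "(i::nat) = 0 \<or> i = 1 \<or> (\<exists>k. i = Suc (Suc k))"
  by (cases i; cases "i - 1") auto

text \<open>A telescoping sum, as contracting two neighbours changes pic by a difference of two
  neighbouring coordinates.\<close>

lemma der_xi_lpic_tr:
  assumes "x \<notin> fst ` set (a # w)"
  shows "der (karit lxi) (\<lambda>v. \<psi> (ysum v) * lpic (tr x v)) (a # w)
    = \<psi> (ysum (a # w)) * lpic (tr x (a # w)) * (fst a - fst (last (a # w)))"
  using assms
proof (induction w arbitrary: a \<psi>)
  case Nil
  then show ?case by (simp add: kxi_simps)
next
  case (Cons b w)
  have IH: "der (karit lxi) (\<lambda>v. \<psi> (snd a + ysum v) * (lpic (tr x v) / (fst a - x))) (b # w)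
      = \<psi> (snd a + ysum (b # w)) * lpic (tr x (b # w)) / (fst a - x) * (fst b - fst (last (b # w)))"
    using Cons(1)[of b "\<lambda>s. \<psi> (snd a + s) / (fst a - x)"] Cons(2) by simp
  obtain A ya B yb where a: "a = (x + A, ya)" and b: "b = (x + B, yb)"
    by (metis add.commute diff_add_cancel prod.exhaust)
  have nz: "A \<noteq> 0" "B \<noteq> 0" using Cons(2) by (auto simp: a b)
  show ?case
  proof (cases w)
    case Nil
    show ?thesis
      using IH unfolding Nil a b
      by (simp add: kxi_simps add.assoc) (use nz in \<open>simp add: field_simps\<close>)
  next
    case (Cons c v)
    obtain C yc where c: "c = (x + C, yc)" by (metis add.commute diff_add_cancel prod.exhaust)
    have nz: "A \<noteq> 0" "B \<noteq> 0" "C \<noteq> 0" using nz Cons.prems Cons by (auto simp: c image_iff)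
    define R where "R = \<psi> (ya + (yb + (yc + ysum v))) * lpic (tr x v) / (A * B * C)"
    have R: "\<psi> (ya + (yb + (yc + ysum v))) * lpic (tr x v) = A * B * C * R" using nz by (simp add: R_def)
    have R': "\<psi> (ya + (yb + (yc + ysum v))) * (lpic (tr x v) / k) = A * B * C * R / k" for k
      using R by simp
    obtain e where e: "fst (last (c # v)) = e" by blast
    have e': "fst (last (a # b # c # v)) = e" "fst (last (b # c # v)) = e" by (simp_all add: e[symmetric])
    show ?thesis
      using IH unfolding Cons e' unfolding a b c
      apply (subst der_short_Cons)
       apply (erule kxi_long)
      apply (simp add: kxi_simps add.assoc R R' nz del: der.simps last.simps)
      apply (simp add: algebra_simps del: der.simps)
      done
  qed
qed

text \<open>The effect of the conjugation on a derivation of arit type, on functions supported in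
  length one.\<close>

lemma gpic_larit_dep1:
  assumes "eqg (gpic B) E" "gen w" "w \<noteq> []"
  shows "gpic (larit B (dep1 \<phi>)) w
    = (\<Sum>i<length w. \<phi> (fst (w ! i), ysum w) * (E (tr (fst (w ! i)) (take i w)) * lpic (tr (fst (w ! i)) (drop (Suc i) w))))
      - \<phi> (fst (hd w), ysum w) * lmu lpic E (tr (fst (hd w)) (tl w))"
proof -
  have 1: "gpic (larit B (dep1 \<phi>)) w = gan (kan lpic) (\<lambda>u. \<phi> (fst (last u), ysum u) * B (tr (fst (last u)) (butlast u))
      - \<phi> (fst (hd u), ysum u) * B (tr (fst (hd u)) (tl u))) w"
    unfolding gpic_def by (rule gan_cong) (use assms in \<open>auto simp: larit_def coarse_def der_dep1 karit_def\<close>)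
  have hd: "gan (kan lpic) (\<lambda>u. \<phi> (fst (hd u), ysum u) * B (tr (fst (hd u)) (tl u))) w
      = \<phi> (fst (hd w), ysum w) * lmu lpic E (tr (fst (hd w)) (tl w))"
  proof -
    obtain c v where w: "w = c # v" using assms(3) by (cases w) auto
    have "gen (tr (fst c) v)" by (rule gen_tr_hd) (use assms w in \<open>simp add: gen_def\<close>)
    then have "lmu lpic (gan (kan lpic) B) (tr (fst c) v) = lmu lpic E (tr (fst c) v)"
      by (rule lmu_eqg) (use assms in \<open>simp_all add: eqg_def gpic_def\<close>)
    then show ?thesis unfolding w gkan_hd by simp
  qed
  obtain v c where w: "w = v @ [c]" using assms(3) by (metis rev_exhaust)
  have last: "kan lpic (drop i v @ [c]) (\<lambda>l. gan (kan lpic) (\<lambda>u. \<phi> (fst l, ysum u + snd l) * B (tr (fst l) u)) (take i v))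
      = \<phi> (fst (w ! i), ysum w) * (E (tr (fst (w ! i)) (take i w)) * lpic (tr (fst (w ! i)) (drop (Suc i) w)))"
    if "i \<le> length v" for i
  proof -
    have i: "i < length w" and d: "drop i v @ [c] = drop i w" and t: "take i v = take i w" using that by (simp_all add: w)
    have "gan (kan lpic) (\<lambda>u. \<phi> (x, ysum u + y) * B (tr x u)) u = \<phi> (x, ysum u + y) * gan (kan lpic) B (tr x u)" for x y u
      by (subst gan_ysum[where \<Psi> = "\<lambda>s u. \<phi> (x, s + y) * B (tr x u)"]) (simp_all add: finlD[OF finl_gan] gan_tr)
    moreover have "gan (kan lpic) B (tr (fst (w ! i)) (take i w)) = E (tr (fst (w ! i)) (take i w))"
      using assms(1) gen_tr_nth(1)[OF assms(2) i] by (simp add: eqg_def gpic_def)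
    ultimately show ?thesis
      using i ysum_take_drop[of i w] unfolding d t
      by (simp add: kan_def hd_drop_conv_nth tl_drop drop_Suc)
  qed
  have "gan (kan lpic) (\<lambda>u. \<phi> (fst (last u), ysum u) * B (tr (fst (last u)) (butlast u))) w
     = (\<Sum>i\<le>length v. kan lpic (drop i v @ [c]) (\<lambda>l. gan (kan lpic) (\<lambda>u. \<phi> (fst l, ysum u + snd l) * B (tr (fst l) u)) (take i v)))"
    unfolding w by (subst gan_snoc) simp_all
  also have "\<dots> = (\<Sum>i<length w. \<phi> (fst (w ! i), ysum w) * (E (tr (fst (w ! i)) (take i w)) * lpic (tr (fst (w ! i)) (drop (Suc i) w))))"
  proof -
    have "{..length v} = {..<length w}" by (auto simp: w)
    then show ?thesis by (intro sum.cong) (simp_all only:, rule last, auto)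
  qed
  finally show ?thesis using hd by (simp add: 1 finlD[OF finl_gan])
qed

text \<open>The operator of pic intertwines the two operators, on generic words.\<close>

definition conjugate :: "((pt list \<Rightarrow> rat) \<Rightarrow> pt list \<Rightarrow> rat) \<Rightarrow> ((pt list \<Rightarrow> rat) \<Rightarrow> pt list \<Rightarrow> rat) \<Rightarrow> bool" where
  "conjugate S T \<longleftrightarrow> (\<forall>f. eqg (gpic (S f)) (T (gpic f)))"

text \<open>Conjugation by an algebra map sends derivations to derivations, so length one
  suffices.\<close>

lemma conjugate_der:
  assumes K: "\<And>m. finl (K m)" and K': "\<And>m. finl (K' m)" "localK K'"
    and dep1: "\<And>\<phi> w. gen w \<Longrightarrow> w \<noteq> [] \<Longrightarrow> gpic (der K (dep1 \<phi>)) w = der K' (gpic (dep1 \<phi>)) w"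
  shows "conjugate (der K) (der K')"
proof -
  have "gpic (der K f) w = der K' (gpic f) w" if "gen w" for f w
  proof (rule eq_on_generators[where X = "{w. gen w}" and S = "\<lambda>f. gpic (der K f)" and T = "\<lambda>f. der K' (gpic f)"])
    show "finl (\<lambda>f. gpic (der K f) i)" "finl (\<lambda>f. der K' (gpic f) i)" for i
      by (rule finl_comp[OF finl_gpic(1) finl_der[OF K]] finl_comp[OF finl_der[OF K'(1)] finl_gpic(1)])+
    show "gpic (der K unitf) i = der K' (gpic unitf) i" for i
    proof -
      have "der K unitf = (\<lambda>_. 0)" by (rule ext) (rule der_unitf[OF K])
      then show ?thesis using der_unitf[OF K'(1)] by (simp add: finlD[OF finl_gpic(1)])
    qed
    show "gpic (der K (dep1 \<phi>)) i = der K' (gpic (dep1 \<phi>)) i" if "i \<in> {w. gen w}" for \<phi> i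
      using dep1[of i] that by (cases "i = []") (auto simp: gpic_def)
    show "gpic (der K (lmu f g)) i = der K' (gpic (lmu f g)) i"
      if f: "\<And>i. i \<in> {w. gen w} \<Longrightarrow> gpic (der K f) i = der K' (gpic f) i"
        and g: "\<And>i. i \<in> {w. gen w} \<Longrightarrow> gpic (der K g) i = der K' (gpic g) i" and i: "i \<in> {w. gen w}" for f g i
    proof -
      have "gpic (der K (lmu f g)) i = gpic (\<lambda>w. lmu (der K f) g w + lmu f (der K g) w) i"
        by (subst ext[OF der_lmu[OF K]]) simp
      also have "\<dots> = lmu (gpic (der K f)) (gpic g) i + lmu (gpic f) (gpic (der K g)) i"
        by (simp add: finlD[OF finl_gpic(1)] gpic_lmu)
      also have "\<dots> = lmu (der K' (gpic f)) (gpic g) i + lmu (gpic f) (der K' (gpic g)) i"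
        using f g i by (intro arg_cong2[where f = "(+)"] lmu_eqg) (auto simp: eqg_def)
      also have "\<dots> = der K' (gpic (lmu f g)) i"
        by (simp add: gpic_lmu der_lmu[OF K'(1)])
      finally show ?thesis .
    qed
  qed (use that in simp)
  then show ?thesis by (simp add: conjugate_def eqg_def)
qed

lemma gpic_dep1_Cons: "gpic (dep1 \<phi>) (c # w) = \<phi> (fst c, ysum (c # w)) * lpic (tr (fst c) w)"
  by (simp add: gpic_def gkan_dep1 del: gan.simps)

lemma gen_ConsD: "gen (c # w) \<Longrightarrow> fst c \<notin> fst ` set w" by (simp add: gen_def)

lemma conjugate_larit_xi:
  assumes "eqg (gpic B) lxi"
  shows "conjugate (larit B) (larit lxi)"
  unfolding larit_def
proof (rule conjugate_der)
  fix \<phi> :: "pt \<Rightarrow> rat" and w assume w: "gen w" "w \<noteq> []"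
  obtain c v where cv: "w = c # v" using w(2) by (cases w) auto
  have tail: "der (karit lxi) (\<lambda>v. gpic (dep1 \<phi>) (c # v)) v = (if v = [] then 0 else
     \<phi> (fst c, ysum w) * lpic (tr (fst c) v) * (fst (hd v) - fst (last v)))"
  proof (cases v)
    case (Cons a u)
    have "fst c \<notin> fst ` set v" using w cv gen_ConsD by blast
    then show ?thesis
      using der_xi_lpic_tr[of "fst c" a u "\<lambda>s. \<phi> (fst c, snd c + s)"]
      by (simp add: gpic_dep1_Cons Cons cv del: der.simps)
  qed simp
  have R: "lmu lpic lxi (tr x u) = (if u = [] then 0 else lpic (tr x (butlast u)))" for x u
    by (cases u rule: rev_cases) (simp_all add: lxi_def lmu_snoc_dep1)
  have L: "gpic (der (karit B) (dep1 \<phi>)) w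
    = (\<Sum>i<length w. \<phi> (fst (w ! i), ysum w) * (lxi (tr (fst (w ! i)) (take i w)) * lpic (tr (fst (w ! i)) (drop (Suc i) w))))
      - \<phi> (fst c, ysum w) * lmu lpic lxi (tr (fst c) v)"
    using gpic_larit_dep1[OF assms w, of \<phi>] by (simp add: larit_def cv)
  show "gpic (der (karit B) (dep1 \<phi>)) w = der (karit lxi) (gpic (dep1 \<phi>)) w"
  proof (cases v)
    case Nil
    then show ?thesis unfolding L R using tail by (simp add: cv kxi_simps)
  next
    case (Cons a u)
    have "(\<Sum>i<length w. \<phi> (fst (w ! i), ysum w) * (lxi (tr (fst (w ! i)) (take i w)) * lpic (tr (fst (w ! i)) (drop (Suc i) w))))
       = (\<Sum>i\<in>{1}. \<phi> (fst (w ! i), ysum w) * (lxi (tr (fst (w ! i)) (take i w)) * lpic (tr (fst (w ! i)) (drop (Suc i) w))))"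
    proof (rule sum.mono_neutral_right)
      show "\<forall>i\<in>{..<length w} - {1}. \<phi> (fst (w ! i), ysum w) * (lxi (tr (fst (w ! i)) (take i w)) * lpic (tr (fst (w ! i)) (drop (Suc i) w))) = 0"
      proof
        fix i assume "i \<in> {..<length w} - {1}"
        then have "i = 0 \<or> (\<exists>k. i = Suc (Suc k))" using nat_cases3[of i] by auto
        then show "\<phi> (fst (w ! i), ysum w) * (lxi (tr (fst (w ! i)) (take i w)) * lpic (tr (fst (w ! i)) (drop (Suc i) w))) = 0"
          by (auto simp: cv Cons)
      qed
    qed (auto simp: cv Cons)
    then have L': "gpic (der (karit B) (dep1 \<phi>)) w = \<phi> (fst a, ysum w) * lpic (tr (fst a) u)
       - \<phi> (fst c, ysum w) * lpic (tr (fst c) (butlast v))"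
      unfolding L R by (simp add: cv Cons)
    have "(\<Sum>j\<le>length v. karit lxi (c # take j v) (\<lambda>l. gpic (dep1 \<phi>) (l # drop j v)))
       = (\<Sum>j\<in>{0,1}. karit lxi (c # take j v) (\<lambda>l. gpic (dep1 \<phi>) (l # drop j v)))"
    proof (rule sum.mono_neutral_right)
      show "\<forall>j\<in>{..length v} - {0, 1}. karit lxi (c # take j v) (\<lambda>l. gpic (dep1 \<phi>) (l # drop j v)) = 0"
      proof
        fix j assume "j \<in> {..length v} - {0, 1}"
        then obtain k where k: "j = Suc (Suc k)" "Suc (Suc k) \<le> length v"
          using nat_cases3[of j] by auto
        then obtain b t where "u = b # t" using Cons by (cases u) auto
        then show "karit lxi (c # take j v) (\<lambda>l. gpic (dep1 \<phi>) (l # drop j v)) = 0"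
          by (simp add: k Cons kxi_simps)
      qed
    qed (auto simp: Cons)
    then have "der (karit lxi) (gpic (dep1 \<phi>)) w = \<phi> (fst c, ysum w) * lpic (tr (fst c) v) * (fst (hd v) - fst (last v))
       + (\<phi> (fst a, ysum w) * lpic (tr (fst a) u) - \<phi> (fst c, ysum w) * lpic (tr (fst c) u))"
      using tail by (simp add: cv Cons kxi_simps gpic_dep1_Cons add.assoc)
    moreover have "\<phi> (fst c, ysum w) * lpic (tr (fst c) v) * (fst (hd v) - fst (last v)) - \<phi> (fst c, ysum w) * lpic (tr (fst c) u)
        = - \<phi> (fst c, ysum w) * lpic (tr (fst c) (butlast v))"
    proof -
      have nz: "fst a \<noteq> fst c" "fst (last v) \<noteq> fst c"
        using gen_ConsD[of c v] w(1) last_in_set[of v] by (auto simp: cv Cons image_iff simp del: last_in_set last.simps)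
      have e: "lpic (tr (fst c) v) = lpic (tr (fst c) (butlast v)) / (fst (last v) - fst c)"
        by (subst append_butlast_last_id[of v, symmetric]) (simp_all add: Cons del: append_butlast_last_id)
      have e': "lpic (tr (fst c) u) = lpic (tr (fst c) v) * (fst a - fst c)"
        using nz by (simp add: Cons)
      have eN: "lpic (tr (fst c) (butlast v)) = lpic (tr (fst c) v) * (fst (last v) - fst c)"
        unfolding e using nz by simp
      have hd: "fst (hd v) = fst a" by (simp add: Cons)
      have ring: "p * M * (A - L) - p * (M * (A - x)) = - p * (M * (L - x))" for p M A L x :: rat
        by (simp add: algebra_simps)
      show ?thesis unfolding e' eN hd by (rule ring)
    qed
    ultimately show ?thesis unfolding L' by linarith
  qed
qed simp_all

text \<open>This is where the choice of \<open>E\<close> enters: with these coefficients the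
  non-polynomial terms cancel.\<close>

lemma conjugate_lQ_larit_E:
  assumes "eqg (gpic B) lE"
  shows "conjugate (der (\<lambda>m \<phi>. kQ m \<phi> + karit B m \<phi>)) (der kD)"
proof (rule conjugate_der)
  fix \<phi> :: "pt \<Rightarrow> rat" and w assume w: "gen w" "w \<noteq> []"
  obtain c v where cv: "w = c # v" using w(2) by (cases w) auto
  have x: "fst c \<notin> fst ` set v" using w cv gen_ConsD by blast
  let ?P = "\<phi> (fst c, ysum w)"
  have tail: "der kD (\<lambda>v. gpic (dep1 \<phi>) (c # v)) v = (case v of [] \<Rightarrow> 0 | a # u \<Rightarrow> ?P * lpic (tr (fst c) v) *
     (fst c * ysum v + bk (fst c) v + (snd a - (fst a - fst c)) * (fst a - fst c) / 2
       + (case u of [] \<Rightarrow> 0 | b # _ \<Rightarrow> (fst a - fst c) * (fst b - fst c) / 4)))"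
  proof (cases v)
    case (Cons a u)
    then show ?thesis
      using der_kD_lpic_tr[of "fst c" a u "\<lambda>s. \<phi> (fst c, snd c + s)"] x
      by (simp add: gpic_dep1_Cons cv del: der.simps split: list.split)
  qed simp
  have R: "lmu lpic lE (tr (fst c) v) = - lpic (tr (fst c) v) * bk (fst c) v"
    by (rule lmu_lpic_lE[OF x])
  have Q: "der kQ (dep1 \<phi>) = dep1 (\<lambda>l. fst l * snd l * \<phi> l)"
    by (auto simp: der_kQ lQ_def dep1_def fun_eq_iff split: list.splits)
  let ?S = "\<lambda>i. \<phi> (fst (w ! i), ysum w) * (lE (tr (fst (w ! i)) (take i w)) * lpic (tr (fst (w ! i)) (drop (Suc i) w)))"
  have L: "gpic (der (\<lambda>m \<phi>. kQ m \<phi> + karit B m \<phi>) (dep1 \<phi>)) w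
    = fst c * ysum w * ?P * lpic (tr (fst c) v) + ((\<Sum>i<length w. ?S i) + ?P * lpic (tr (fst c) v) * bk (fst c) v)"
    using gpic_larit_dep1[OF assms w, of \<phi>]
    by (simp add: larit_def der_add[abs_def] finlD[OF finl_gpic(1)] Q cv gpic_dep1_Cons R[simplified cv])
  show "gpic (der (\<lambda>m \<phi>. kQ m \<phi> + karit B m \<phi>) (dep1 \<phi>)) w = der kD (gpic (dep1 \<phi>)) w"
  proof (cases v)
    case Nil
    then show ?thesis unfolding L by (simp add: cv gpic_dep1_Cons kD_simps)
  next
    case (Cons a u)
    have xa: "fst a \<noteq> fst c" using x by (simp add: Cons)
    show ?thesis
    proof (cases u)
      case Nil
      have "(\<Sum>i<length w. ?S i) = - (fst c - fst a + snd c) / 2 * \<phi> (fst a, ysum w)"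
        by (simp add: cv Cons Nil)
      moreover obtain A ya where a: "a = (fst c + A, ya)" by (metis add.commute diff_add_cancel prod.exhaust)
      moreover have "A \<noteq> 0" using xa a by auto
      ultimately show ?thesis unfolding L using tail
        by (simp add: cv Cons Nil gpic_dep1_Cons kD_simps add.assoc) (simp add: field_simps)
    next
      case (Cons b t)
      have xb: "fst b \<noteq> fst c" "fst a \<noteq> fst b" using x w(1) by (auto simp: cv \<open>v = a # u\<close> Cons gen_def)
      have S: "(\<Sum>i<length w. ?S i) = (\<Sum>i\<in>{1, 2}. ?S i)"
      proof (rule sum.mono_neutral_right)
        show "\<forall>i\<in>{..<length w} - {1, 2}. ?S i = 0"
        proof
          fix i assume i: "i \<in> {..<length w} - {1, 2}"
          then have "i = 0 \<or> (\<exists>k. i = Suc (Suc (Suc k)))"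
            using nat_cases3[of i] nat_cases3[of "i - 1"] by (auto simp: numeral_2_eq_2)
          then show "?S i = 0"
            by (auto simp: cv \<open>v = a # u\<close> Cons)
        qed
      qed (auto simp: cv \<open>v = a # u\<close> Cons)
      have S': "(\<Sum>i<length w. ?S i) = - (fst c - fst a + snd c) / 2 * \<phi> (fst a, ysum w) * lpic (tr (fst a) u)
          + \<phi> (fst b, ysum w) * lpic (tr (fst b) t) / 4"
        unfolding S by (simp add: cv \<open>v = a # u\<close> Cons)
      have e: "lpic (tr (fst c) u) = lpic (tr (fst c) v) * (fst a - fst c)"
        "lpic (tr (fst c) t) = lpic (tr (fst c) v) * (fst a - fst c) * (fst b - fst c)"
        using xa xb by (simp_all add: \<open>v = a # u\<close> Cons)
      have D: "der kD (gpic (dep1 \<phi>)) w = der kD (\<lambda>v. gpic (dep1 \<phi>) (c # v)) v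
         + fst c * snd c * (?P * lpic (tr (fst c) v))
         + (- (fst c - fst a + snd c) / 2 * (\<phi> (fst a, ysum w) * lpic (tr (fst a) u))
            + (fst a - fst c - snd a) / 2 * (?P * lpic (tr (fst c) u)))
         + (\<phi> (fst b, ysum w) * lpic (tr (fst b) t) - ?P * lpic (tr (fst c) t)) / 4"
        unfolding cv \<open>v = a # u\<close> Cons
        apply (subst der_short_Cons)
         apply (erule kD_long)
        apply (simp add: kD_simps gpic_dep1_Cons add.assoc del: der.simps)
        done
      have ysum: "ysum w = snd c + ysum v" by (simp add: cv)
      have ring: "c * (sc + yv) * P * M + (- (c - a + sc) / 2 * fa * la + fb * lb / 4 + P * M * k)
        = P * M * (c * yv + k + (sa - (a - c)) * (a - c) / 2 + (a - c) * (b - c) / 4)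
         + c * sc * (P * M) + (- (c - a + sc) / 2 * (fa * la) + (a - c - sa) / 2 * (P * (M * (a - c))))
         + (fb * lb - P * (M * (a - c) * (b - c))) / 4" for c sc yv P M a fa la fb lb k sa b :: rat
        by (simp add: field_simps)
      have t2: "der kD (\<lambda>v. gpic (dep1 \<phi>) (c # v)) v = ?P * lpic (tr (fst c) v) *
       (fst c * ysum v + bk (fst c) v + (snd a - (fst a - fst c)) * (fst a - fst c) / 2 + (fst a - fst c) * (fst b - fst c) / 4)"
        using tail by (simp only: \<open>v = a # u\<close> Cons list.case)
      show ?thesis unfolding L D S' e t2
        using ring[of "fst c" "snd c" "ysum v" ?P "lpic (tr (fst c) v)" "fst a" "\<phi> (fst a, ysum w)" "lpic (tr (fst a) u)"
          "\<phi> (fst b, ysum w)" "lpic (tr (fst b) t)" "bk (fst c) v" "snd a" "fst b"]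
        unfolding ysum by simp
    qed
  qed
qed (simp_all add: finl_add)

section \<open>Iterated commutators\<close>

lemma eqg_refl [simp]: "eqg f f" by (simp add: eqg_def)
lemma eqg_sym: "eqg f g \<Longrightarrow> eqg g f" by (simp add: eqg_def)
lemma eqg_trans: "eqg f g \<Longrightarrow> eqg g h \<Longrightarrow> eqg f h" by (simp add: eqg_def)

lemma der_eqg: "localK K \<Longrightarrow> eqg f g \<Longrightarrow> eqg (der K f) (der K g)"
  unfolding eqg_def by (auto intro!: der_cong dest: gen_coarse)

lemma rmul_eqg: "eqg f g \<Longrightarrow> eqg (rmul A f) (rmul A g)"
  using der_eqg[OF local_karit, of f g A] lmu_eqg[of _ f g A A]
  by (auto simp: rmul_def larit_def eqg_def)

lemma ld0_eqg: "eqg f g \<Longrightarrow> eqg (ld0 f) (ld0 g)"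
  using der_eqg[OF local_kD, of f g] lmu_eqg[of _ f g lE lE]
  by (auto simp: ld0_def eqg_def)

lemma finl_ld0 [simp]: "finl (\<lambda>f. ld0 f w)"
  unfolding ld0_def by (intro finl_add finl_der) simp_all

definition ldhat :: "(pt list \<Rightarrow> rat) \<Rightarrow> (pt list \<Rightarrow> rat) \<Rightarrow> pt list \<Rightarrow> rat" where
  "ldhat B f w = lQ f w + rmul B f w"

lemma conjugate_rmul_xi:
  assumes "eqg (gpic B) lxi"
  shows "conjugate (rmul B) (rmul lxi)"
  unfolding conjugate_def
proof
  fix f
  have "gpic (rmul B f) w = rmul lxi (gpic f) w" if "gen w" for w
  proof -
    have "gpic (rmul B f) w = gpic (larit B f) w + lmu (gpic f) (gpic B) w"
      by (simp add: rmul_def[abs_def] finlD[OF finl_gpic(1)] gpic_lmu)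
    also have "lmu (gpic f) (gpic B) w = lmu (gpic f) lxi w"
      by (rule lmu_eqg) (use assms that in simp_all)
    also have "gpic (larit B f) w = larit lxi (gpic f) w"
      using conjugate_larit_xi[OF assms] that by (simp add: conjugate_def eqg_def)
    finally show ?thesis unfolding rmul_def[of lxi "gpic f" w] .
  qed
  then show "eqg (gpic (rmul B f)) (rmul lxi (gpic f))" by (simp add: eqg_def)
qed

text \<open>Right multiplication is transported by multiplicativity of the operator of pic.\<close>

lemma conjugate_ldhat:
  assumes "eqg (gpic B) lE"
  shows "conjugate (ldhat B) ld0"
  unfolding conjugate_def
proof
  fix f
  have "gpic (ldhat B f) w = ld0 (gpic f) w" if "gen w" for w
  proof -
    have "ldhat B f = (\<lambda>w. der (\<lambda>m \<phi>. kQ m \<phi> + karit B m \<phi>) f w + lmu f B w)"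
      by (simp add: fun_eq_iff ldhat_def rmul_def larit_def der_add der_kQ)
    then have "gpic (ldhat B f) w = gpic (der (\<lambda>m \<phi>. kQ m \<phi> + karit B m \<phi>) f) w + lmu (gpic f) (gpic B) w"
      by (simp add: finlD[OF finl_gpic(1)] gpic_lmu)
    also have "lmu (gpic f) (gpic B) w = lmu (gpic f) lE w"
      by (rule lmu_eqg) (use assms that in simp_all)
    also have "gpic (der (\<lambda>m \<phi>. kQ m \<phi> + karit B m \<phi>) f) w = der kD (gpic f) w"
      using conjugate_lQ_larit_E[OF assms] that by (simp add: conjugate_def eqg_def)
    finally show ?thesis by (simp add: ld0_def)
  qed
  then show "eqg (gpic (ldhat B f)) (ld0 (gpic f))" by (simp add: eqg_def)
qed

text \<open>The iterated commutators of the polynomial operator with the operator of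
  \<open>\<xi>\<^sub>1\<close>.\<close>

fun opsq :: "nat \<Rightarrow> (pt list \<Rightarrow> rat) \<Rightarrow> pt list \<Rightarrow> rat" where
  "opsq 0 = rmul lxi"
| "opsq (Suc k) = (\<lambda>f w. ld0 (opsq k f) w - opsq k (ld0 f) w)"

lemma opsq_eqg: "eqg f g \<Longrightarrow> eqg (opsq k f) (opsq k g)"
proof (induction k arbitrary: f g)
  case (Suc k)
  from Suc(1)[OF Suc(2)] Suc(1)[OF ld0_eqg[OF Suc(2)]] show ?case
    using ld0_eqg by (simp add: eqg_def)
qed (simp add: rmul_eqg)

lemma finl_opsq [simp]: "finl (\<lambda>f. opsq k f w)"
proof (induction k arbitrary: w)
  case (Suc k)
  show ?case
    unfolding opsq.simps by (intro finl_diff finl_comp[OF finl_ld0 Suc] finl_comp[OF Suc finl_ld0])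
qed simp

definition lEhat :: "pt list \<Rightarrow> rat" where "lEhat = gpoc lE"

text \<open>The iterates of \<open>\<delta>\<close> before conjugation by the operator of
  pic.\<close>

fun hatsq :: "nat \<Rightarrow> pt list \<Rightarrow> rat" where
  "hatsq 0 = gpoc lxi"
| "hatsq (Suc k) = (\<lambda>w. lQ (hatsq k) w + lari (hatsq k) lEhat w)"

lemma karit_add: "karit (\<lambda>v. A v + B v) = (\<lambda>m \<phi>. karit A m \<phi> + karit B m \<phi>)"
  by (simp add: karit_def fun_eq_iff algebra_simps)

lemma karit_cmult: "karit (\<lambda>v. k * A v) = (\<lambda>m \<phi>. k * karit A m \<phi>)"
  by (simp add: karit_def fun_eq_iff algebra_simps)

lemma der_cmult: "der (\<lambda>m \<phi>. k * K m \<phi>) f w = k * der K f w"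
  by (induction w arbitrary: f) (simp_all add: sum_distrib_left algebra_simps)

lemma larit_add: "larit (\<lambda>v. A v + B v) f w = larit A f w + larit B f w"
  by (simp add: larit_def karit_add der_add)

lemma larit_cmult: "larit (\<lambda>v. k * A v) f w = k * larit A f w"
  by (simp add: larit_def karit_cmult der_cmult)

lemma rmul_add: "rmul (\<lambda>v. A v + B v) f w = rmul A f w + rmul B f w"
  by (simp add: rmul_def larit_add lmu_lin)

text \<open>By the commutator rules, one application of \<open>\<delta>\<close> is one
  commutator.\<close>

lemma rmul_hatsq_Suc:
  "rmul (hatsq (Suc k)) f w = ldhat lEhat (rmul (hatsq k) f) w - rmul (hatsq k) (ldhat lEhat f) w"
proof -
  have "rmul (hatsq k) (ldhat lEhat f) w = rmul (hatsq k) (lQ f) w + rmul (hatsq k) (rmul lEhat f) w"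
    by (simp add: ldhat_def[abs_def] finlD[OF finl_rmul])
  then show ?thesis
    unfolding hatsq.simps rmul_add
    by (simp add: lQ_rmul[symmetric] rmul_commutator[symmetric] ldhat_def)
qed

lemma gpic_gpoc_eqg: "eqg (gpic (gpoc f)) f"
  by (simp add: eqg_def gpic_gpoc)

text \<open>Conjugation is compatible with commutators.\<close>

lemma conjugate_opsq: "conjugate (rmul (hatsq k)) (opsq k)"
proof (induction k)
  case 0
  show ?case by (simp add: conjugate_rmul_xi gpic_gpoc_eqg)
next
  case (Suc k)
  have c: "conjugate (ldhat lEhat) ld0"
    unfolding lEhat_def by (rule conjugate_ldhat) (rule gpic_gpoc_eqg)
  show ?case unfolding conjugate_def
  proof
    fix f
    have e: "rmul (hatsq (Suc k)) f = (\<lambda>w. ldhat lEhat (rmul (hatsq k) f) w - rmul (hatsq k) (ldhat lEhat f) w)"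
      by (rule ext) (rule rmul_hatsq_Suc)
    have 1: "eqg (gpic (ldhat lEhat (rmul (hatsq k) f))) (ld0 (opsq k (gpic f)))"
      using c Suc ld0_eqg eqg_trans unfolding conjugate_def by blast
    have 2: "eqg (gpic (rmul (hatsq k) (ldhat lEhat f))) (opsq k (ld0 (gpic f)))"
      using c Suc opsq_eqg eqg_trans unfolding conjugate_def by blast
    show "eqg (gpic (rmul (hatsq (Suc k)) f)) (opsq (Suc k) (gpic f))"
      using 1 2 unfolding e by (simp add: eqg_def finlD[OF finl_gpic(1)])
  qed
qed

definition xisq :: "nat \<Rightarrow> pt list \<Rightarrow> rat" where "xisq k = opsq k unitf"

lemma gpic_hatsq: "eqg (gpic (hatsq k)) (xisq k)"
  using conjugate_opsq[of k] unfolding conjugate_def xisq_def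
  by (metis gpic_unitf(1) rmul_unitf)

lemma der_cong_K:
  assumes "\<And>p m s \<phi>. w = p @ m @ s \<Longrightarrow> m \<noteq> [] \<Longrightarrow> K m \<phi> = K' m \<phi>"
  shows "der K f w = der K' f w"
  using assms
proof (induction w arbitrary: f)
  case (Cons c w)
  have "der K (\<lambda>v. f (c # v)) w = der K' (\<lambda>v. f (c # v)) w"
    by (rule Cons.IH) (use Cons.prems[of "c # _"] in auto)
  moreover have "K (c # take j w) \<phi> = K' (c # take j w) \<phi>" for j \<phi>
    by (rule Cons.prems[of "[]" _ "drop j w"]) auto
  ultimately show ?case by simp
qed simp

lemma gen_factor:
  assumes "gen (p @ m @ s)" "m \<noteq> []"
  shows "gen (tr (fst (last m)) (butlast m))" "gen (tr (fst (hd m)) (tl m))"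
proof -
  have d: "distinct (map fst m)" using assms(1) by (simp add: gen_def)
  have "distinct (map fst (hd m # tl m))" "distinct (map fst (butlast m @ [last m]))"
    using d assms(2) by simp_all
  then show "gen (tr (fst (last m)) (butlast m))" "gen (tr (fst (hd m)) (tl m))"
    by (auto intro!: gen_tr)
qed

lemma larit_eqg:
  assumes "eqg A A'" "eqg f f'" shows "eqg (larit A f) (larit A' f')"
proof -
  have "der (karit A) f w = der (karit A') f w" if "gen w" for w
    by (rule der_cong_K) (use that gen_factor assms(1) in \<open>simp add: karit_def eqg_def\<close>)
  then show ?thesis
    using der_eqg[OF local_karit assms(2), of A'] by (simp add: larit_def eqg_def)
qed

lemma lari_eqg:
  assumes "eqg A A'" "eqg B B'" shows "eqg (lari A B) (lari A' B')"
  using larit_eqg[OF assms(1,2)] larit_eqg[OF assms(2,1)] lmu_eqg[OF _ assms] lmu_eqg[OF _ assms(2,1)]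
  by (auto simp: lari_def eqg_def)

definition luri :: "(pt list \<Rightarrow> rat) \<Rightarrow> (pt list \<Rightarrow> rat) \<Rightarrow> pt list \<Rightarrow> rat" where
  "luri f g = gpic (lari (gpoc f) (gpoc g))"

definition ldelta :: "(pt list \<Rightarrow> rat) \<Rightarrow> pt list \<Rightarrow> rat" where
  "ldelta f w = gpic (lQ (gpoc f)) w + luri f lE w"

lemma gpoc_xisq:
  assumes "eqg f (xisq k)" shows "eqg (gpoc f) (hatsq k)"
proof (rule gpic_inj)
  show "eqg (gpic (gpoc f)) (gpic (hatsq k))"
    using gpic_gpoc_eqg assms gpic_hatsq eqg_trans eqg_sym by blast
qed

lemma ldelta_xisq:
  assumes "eqg f (xisq k)" shows "eqg (ldelta f) (xisq (Suc k))"
proof -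
  have f: "eqg (gpoc f) (hatsq k)" by (rule gpoc_xisq[OF assms])
  have "ldelta f = gpic (\<lambda>w. lQ (gpoc f) w + lari (gpoc f) lEhat w)"
    by (simp add: ldelta_def luri_def finlD[OF finl_gpic(1)] lEhat_def fun_eq_iff)
  moreover have "eqg (\<lambda>w. lQ (gpoc f) w + lari (gpoc f) lEhat w) (hatsq (Suc k))"
    using f lari_eqg[OF f, of lEhat lEhat] by (simp add: eqg_def lQ_def)
  ultimately show ?thesis using gpic_eqg(1) gpic_hatsq[of "Suc k"] eqg_trans by metis
qed

lemma xisq_0: "xisq 0 = lxi" by (simp add: xisq_def)

text \<open>The polynomial description of the iterates: apply the iterated commutator to the unit,
  on which \<open>R\<^sub>A\<close> has value \<open>A\<close>.\<close>

lemma ldelta_iterate: "eqg ((ldelta ^^ k) lxi) (xisq k)"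
  by (induction k) (simp_all add: xisq_0 ldelta_xisq)

section \<open>Quasi-shuffle relations\<close>

text \<open>The value of a function on the quasi-shuffle of two words of points. The contraction of
  two letters is a divided difference, as for generating series of the bi-stuffle product.\<close>

fun qs :: "(pt list \<Rightarrow> rat) \<Rightarrow> pt list \<Rightarrow> pt list \<Rightarrow> rat" where
  "qs f [] v = f v"
| "qs f (a # u) [] = f (a # u)"
| "qs f (a # u) (b # v) = qs (\<lambda>w. f (a # w)) u (b # v) + qs (\<lambda>w. f (b # w)) (a # u) v
     + (qs (\<lambda>w. f ((fst a, snd a + snd b) # w)) u v - qs (\<lambda>w. f ((fst b, snd a + snd b) # w)) u v) / (fst a - fst b)"

lemma qs_Nil2 [simp]: "qs f u [] = f u" by (cases u) simp_all

lemma qs_Nil1 [simp]: "qs f [] = f" by (rule ext) simp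

lemma finl_qs [simp]: "finl (\<lambda>f. qs f u v)"
proof (induction "length u + length v" arbitrary: u v rule: less_induct)
  case less
  show ?case
  proof (cases "u = [] \<or> v = []")
    case False
    then obtain a u' b v' where uv: "u = a # u'" "v = b # v'" by (meson list.exhaust)
    have IH: "finl (\<lambda>f. qs f u' (b # v'))" "finl (\<lambda>f. qs f (a # u') v')" "finl (\<lambda>f. qs f u' v')"
      by (rule less; simp add: uv)+
    show ?thesis unfolding qs.simps divide_inverse uv
      by (intro finl_add finl_diff finl_cmult2 finl_comp[OF IH(1)] finl_comp[OF IH(2)] finl_comp[OF IH(3)] finl_eval)
  qed (auto simp: finl_eval)
qed

lemmas qs_lin = finlD[OF finl_qs]

lemma qs_comm: "qs f u v = qs f v u"
proof (induction f u v rule: qs.induct)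
  case (3 f a u b v)
  have "(y - x) / (fst b - fst a) = (x - y) / (fst a - fst b)" for x y
    by (metis minus_diff_eq minus_divide_divide)
  then show ?case using 3 by (simp add: add.commute)
qed simp_all

lemma qs_zero:
  "(\<And>w. length w \<ge> length u \<Longrightarrow> length w \<ge> length v \<Longrightarrow> f w = 0) \<Longrightarrow> qs f u v = 0"
proof (induction f u v rule: qs.induct)
  case (3 f a u b v)
  have "qs (\<lambda>w. f (a # w)) u (b # v) = 0" "qs (\<lambda>w. f (b # w)) (a # u) v = 0"
    "qs (\<lambda>w. f ((fst a, snd a + snd b) # w)) u v = 0" "qs (\<lambda>w. f ((fst b, snd a + snd b) # w)) u v = 0"
    by (rule 3(1) 3(2) 3(3) 3(4), rule 3(5), simp, simp)+
  then show ?case by simp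
qed simp_all

lemma qs_unitf: "qs unitf u v = unitf u * unitf v"
proof (cases "u = [] \<or> v = []")
  case False
  then have "qs unitf u v = 0" by (intro qs_zero) (auto simp: unitf_def)
  then show ?thesis using False by (simp add: unitf_def)
qed auto

text \<open>The concatenation product of functions of two words.\<close>

definition mu2 :: "(pt list \<Rightarrow> pt list \<Rightarrow> rat) \<Rightarrow> (pt list \<Rightarrow> pt list \<Rightarrow> rat) \<Rightarrow> pt list \<Rightarrow> pt list \<Rightarrow> rat" where
  "mu2 F G u v = (\<Sum>i\<le>length u. \<Sum>j\<le>length v. F (take i u) (take j v) * G (drop i u) (drop j v))"

lemma mu2_Cons:
  "mu2 (qs f) G (a # u) (b # v) = f [] * G (a # u) (b # v)
     + mu2 (qs (\<lambda>w. f (a # w))) G u (b # v) + mu2 (qs (\<lambda>w. f (b # w))) G (a # u) v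
     + (mu2 (qs (\<lambda>w. f ((fst a, snd a + snd b) # w))) G u v
        - mu2 (qs (\<lambda>w. f ((fst b, snd a + snd b) # w))) G u v) / (fst a - fst b)"
  unfolding mu2_def
  by (simp add: sum.atMost_Suc_shift sum.distrib sum_subtractf sum_divide_distrib algebra_simps diff_divide_distrib
      add_divide_distrib del: sum.atMost_Suc)

text \<open>Dual to the fact that deconcatenation is a homomorphism for the quasi-shuffle
  product.\<close>

lemma qs_lmu: "qs (lmu f g) u v = mu2 (qs f) (qs g) u v"
proof (induction "length u + length v" arbitrary: f u v rule: less_induct)
  case less
  show ?case
  proof (cases "u = [] \<or> v = []")
    case True
    then show ?thesis by (auto simp: mu2_def lmu_def)
  next
    case False
    then obtain a u' b v' where uv: "u = a # u'" "v = b # v'" by (meson list.exhaust)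
    have IH: "qs (lmu f g) u' (b # v') = mu2 (qs f) (qs g) u' (b # v')"
      "qs (lmu f g) (a # u') v' = mu2 (qs f) (qs g) (a # u') v'"
      "qs (lmu f g) u' v' = mu2 (qs f) (qs g) u' v'" for f
      by (rule less; simp add: uv)+
    have d: "f [] * x / k - f [] * y / k = f [] * ((x - y) / k)" for x y k
      by (simp add: algebra_simps diff_divide_distrib)
    show ?thesis
      unfolding uv mu2_Cons qs.simps lmu_ConsL qs_lin IH
      by (simp add: algebra_simps add_divide_distrib diff_divide_distrib)
  qed
qed

lemma mu2_cong:
  assumes "\<And>i j. i \<le> length u \<Longrightarrow> j \<le> length v \<Longrightarrow> F (take i u) (take j v) = F' (take i u) (take j v)"
    "\<And>i j. i \<le> length u \<Longrightarrow> j \<le> length v \<Longrightarrow> G (drop i u) (drop j v) = G' (drop i u) (drop j v)"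
  shows "mu2 F G u v = mu2 F' G' u v"
  unfolding mu2_def using assms by (auto intro!: sum.cong)

lemma mu2_add: "mu2 (\<lambda>u v. F u v + F' u v) G u v = mu2 F G u v + mu2 F' G u v"
  "mu2 F (\<lambda>u v. G u v + G' u v) u v = mu2 F G u v + mu2 F G' u v"
  by (simp_all add: mu2_def algebra_simps sum.distrib)

lemma der_mu2:
  assumes "\<And>m. finl (K m)"
  shows "der K (\<lambda>u'. mu2 F G u' v) u = mu2 (\<lambda>u v. der K (\<lambda>u'. F u' v) u) G u v
      + mu2 F (\<lambda>u v. der K (\<lambda>u'. G u' v) u) u v"
    "der K (\<lambda>v'. mu2 F G u v') v = mu2 (\<lambda>u v. der K (\<lambda>v'. F u v') v) G u v
      + mu2 F (\<lambda>u v. der K (\<lambda>v'. G u v') v) u v"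
proof -
  have 1: "mu2 F G u v = (\<Sum>j\<le>length v. lmu (\<lambda>u. F u (take j v)) (\<lambda>u. G u (drop j v)) u)" for F G u
    unfolding mu2_def lmu_def by (rule sum.swap)
  have 2: "mu2 F G u v = (\<Sum>j\<le>length u. lmu (\<lambda>v. F (take j u) v) (\<lambda>v. G (drop j u) v) v)" for F G v
    unfolding mu2_def lmu_def by (rule refl)
  show "der K (\<lambda>u'. mu2 F G u' v) u = mu2 (\<lambda>u v. der K (\<lambda>u'. F u' v) u) G u v
      + mu2 F (\<lambda>u v. der K (\<lambda>u'. G u' v) u) u v"
    unfolding 1 by (simp add: finl_sumD[OF finl_der[OF assms]] der_lmu[OF assms] sum.distrib)
  show "der K (\<lambda>v'. mu2 F G u v') v = mu2 (\<lambda>u v. der K (\<lambda>v'. F u v') v) G u v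
      + mu2 F (\<lambda>u v. der K (\<lambda>v'. G u v') v) u v"
    unfolding 2 by (simp add: finl_sumD[OF finl_der[OF assms]] der_lmu[OF assms] sum.distrib)
qed

definition distx :: "pt list \<Rightarrow> bool" where "distx w \<longleftrightarrow> distinct (map fst w)"

lemma distx_append: "distx (u @ v) \<longleftrightarrow> distx u \<and> distx v \<and> fst ` set u \<inter> fst ` set v = {}"
  by (simp add: distx_def)

text \<open>Operators that are derivations for the quasi-shuffle product of words of points.\<close>

definition qder :: "((pt list \<Rightarrow> rat) \<Rightarrow> pt list \<Rightarrow> rat) \<Rightarrow> bool" where
  "qder T \<longleftrightarrow> (\<forall>f u v. distx (u @ v) \<longrightarrow> qs (T f) u v = T (\<lambda>u'. qs f u' v) u + T (\<lambda>v'. qs f u v') v)"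

lemma distx_split: "distx (u @ v) \<Longrightarrow> distx (take i u @ take j v)" "distx (u @ v) \<Longrightarrow> distx (drop i u @ drop j v)"
  unfolding distx_def
  by (auto simp: take_map[symmetric] drop_map[symmetric] dest!: in_set_takeD in_set_dropD)

text \<open>Compatibility with concatenation reduces the property to functions supported in length
  one.\<close>

lemma qder_der:
  assumes K: "\<And>m. finl (K m)"
    and dep1: "\<And>\<phi> u v. distx (u @ v) \<Longrightarrow> u \<noteq> [] \<Longrightarrow> v \<noteq> [] \<Longrightarrow> qs (der K (dep1 \<phi>)) u v
      = der K (\<lambda>u'. qs (dep1 \<phi>) u' v) u + der K (\<lambda>v'. qs (dep1 \<phi>) u v') v"
  shows "qder (der K)"
proof -
  let ?X = "{(u, v). distx (u @ v)}"
  let ?S = "\<lambda>f (u, v). qs (der K f) u v"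
  let ?T = "\<lambda>f (u, v). der K (\<lambda>u'. qs f u' v) u + der K (\<lambda>v'. qs f u v') v"
  have "?S f i = ?T f i" if "i \<in> ?X" for f i
  proof (rule eq_on_generators[where X = ?X and S = ?S and T = ?T])
    show "finl (\<lambda>f. ?S f i)" for i
      by (cases i) (simp add: finl_comp[OF finl_qs finl_der[OF K]])
    show "finl (\<lambda>f. ?T f i)" for i
      by (cases i) (simp add: finl_add finl_comp[OF finl_der[OF K] finl_qs])
    show "?S unitf i = ?T unitf i" for i
    proof -
      have "der K unitf = (\<lambda>_. 0)" by (rule ext) (rule der_unitf[OF K])
      then show ?thesis
        by (cases i) (simp add: qs_unitf qs_lin finlD[OF finl_der[OF K]])
    qed
    show "?S (dep1 \<phi>) i = ?T (dep1 \<phi>) i" if "i \<in> ?X" for \<phi> i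
      using that dep1 by (cases i; cases "fst i = []"; cases "snd i = []") auto
    show "?S (lmu f g) i = ?T (lmu f g) i"
      if f: "\<And>i. i \<in> ?X \<Longrightarrow> ?S f i = ?T f i" and g: "\<And>i. i \<in> ?X \<Longrightarrow> ?S g i = ?T g i" and i: "i \<in> ?X" for f g i
    proof -
      obtain u v where uv: "i = (u, v)" "distx (u @ v)" using i by auto
      have "der K (lmu f g) = (\<lambda>w. lmu (der K f) g w + lmu f (der K g) w)"
        by (rule ext) (rule der_lmu[OF K])
      then have "qs (der K (lmu f g)) u v = mu2 (qs (der K f)) (qs g) u v + mu2 (qs f) (qs (der K g)) u v"
        by (simp add: qs_lin qs_lmu)
      also have "mu2 (qs (der K f)) (qs g) u v
          = mu2 (\<lambda>u v. der K (\<lambda>u'. qs f u' v) u + der K (\<lambda>v'. qs f u v') v) (qs g) u v"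
        by (rule mu2_cong) (use f[of "(take _ u, take _ v)"] distx_split[OF uv(2)] in auto)
      also have "mu2 (qs f) (qs (der K g)) u v
          = mu2 (qs f) (\<lambda>u v. der K (\<lambda>u'. qs g u' v) u + der K (\<lambda>v'. qs g u v') v) u v"
        by (rule mu2_cong) (use g[of "(drop _ u, drop _ v)"] distx_split[OF uv(2)] in auto)
      finally show ?thesis
        by (simp add: uv qs_lmu der_mu2[OF K] mu2_add)
    qed
  qed (rule that)
  then show ?thesis unfolding qder_def by auto
qed

definition lalternil :: "(pt list \<Rightarrow> rat) \<Rightarrow> bool" where
  "lalternil f \<longleftrightarrow> f [] = 0 \<and> (\<forall>u v. u \<noteq> [] \<longrightarrow> v \<noteq> [] \<longrightarrow> distx (u @ v) \<longrightarrow> qs f u v = 0)"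

text \<open>Right multiplication by a function vanishing on quasi-shuffles is a derivation as
  well.\<close>

lemma qder_add_lmu:
  assumes "qder T" "lalternil A" shows "qder (\<lambda>f w. T f w + lmu f A w)"
  unfolding qder_def
proof (intro allI impI)
  fix f u v assume d: "distx (u @ v)"
  have A: "qs A u v = A u * unitf v + unitf u * A v" if "distx (u @ v)" for u v
    using assms(2) that by (cases "u = []"; cases "v = []") (auto simp: lalternil_def unitf_def)
  have "mu2 (qs f) (qs A) u v = mu2 (qs f) (\<lambda>u v. A u * unitf v + unitf u * A v) u v"
    by (rule mu2_cong) (use A distx_split[OF d] in auto)
  also have "\<dots> = (\<Sum>i\<le>length u. lmu (qs f (take i u)) unitf v * A (drop i u))
     + (\<Sum>j\<le>length v. lmu (\<lambda>u. qs f u (take j v)) unitf u * A (drop j v))"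
  proof -
    have "mu2 (qs f) (\<lambda>u v. A u * unitf v) u v = (\<Sum>i\<le>length u. lmu (qs f (take i u)) unitf v * A (drop i u))"
      by (simp add: mu2_def lmu_def sum_distrib_right sum_distrib_left mult_ac)
    moreover have "mu2 (qs f) (\<lambda>u v. unitf u * A v) u v = (\<Sum>j\<le>length v. lmu (\<lambda>u. qs f u (take j v)) unitf u * A (drop j v))"
      unfolding mu2_def by (subst sum.swap) (simp add: lmu_def sum_distrib_right sum_distrib_left mult_ac)
    ultimately show ?thesis by (simp add: mu2_add)
  qed
  also have "\<dots> = lmu (\<lambda>u'. qs f u' v) A u + lmu (\<lambda>v'. qs f u v') A v"
    by (simp add: lmu_def[of _ A])
  finally show "qs (\<lambda>w. T f w + lmu f A w) u v
      = T (\<lambda>u'. qs f u' v) u + lmu (\<lambda>u'. qs f u' v) A u + (T (\<lambda>v'. qs f u v') v + lmu (\<lambda>v'. qs f u v') A v)"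
    using assms(1) d by (simp add: qder_def qs_lin qs_lmu)
qed

text \<open>A divided difference.\<close>

definition dq :: "(pt \<Rightarrow> rat) \<Rightarrow> pt \<Rightarrow> pt \<Rightarrow> rat" where
  "dq \<phi> a b = (\<phi> (fst a, snd a + snd b) - \<phi> (fst b, snd a + snd b)) / (fst a - fst b)"

lemma dq_comm: "dq \<phi> a b = dq \<phi> b a"
  unfolding dq_def by (metis add.commute minus_diff_eq minus_divide_divide)

lemma qs_dep1_long: "length u > 1 \<or> length v > 1 \<Longrightarrow> u \<noteq> [] \<Longrightarrow> v \<noteq> [] \<Longrightarrow> qs (dep1 \<phi>) u v = 0"
  by (rule qs_zero) (auto simp: dep1_def split: list.splits)

lemma qs_dep1_single: "u \<noteq> [] \<Longrightarrow> qs (dep1 \<phi>) u [b] = dep1 (\<lambda>l. dq \<phi> l b) u"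
proof (cases u)
  case (Cons a u')
  then show ?thesis
    by (cases u') (simp_all add: dq_def qs_dep1_long del: qs.simps(3), simp add: dq_def)
qed simp

lemma der_qs_dep1:
  assumes "\<And>m. finl (K m)" "localK K" "u \<noteq> []" "v \<noteq> []"
  shows "der K (\<lambda>u'. qs (dep1 \<phi>) u' v) u = (if length v = 1 then K u (\<lambda>l. dq \<phi> l (hd v)) else 0)"
proof (cases "length v = 1")
  case True
  then obtain b where v: "v = [b]" by (cases v) auto
  have "der K (\<lambda>u'. qs (dep1 \<phi>) u' v) u = der K (dep1 (\<lambda>l. dq \<phi> l b)) u"
    by (rule der_cong[OF assms(2)]) (use assms(3) in \<open>auto simp: coarse_def v qs_dep1_single\<close>)
  then show ?thesis using assms by (simp add: v der_dep1)
next
  case False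
  have "der K (\<lambda>u'. qs (dep1 \<phi>) u' v) u = der K (\<lambda>_. 0) u"
    by (rule der_cong[OF assms(2)])
      (use assms(3,4) False in \<open>auto simp: coarse_def intro!: qs_dep1_long simp: Suc_lessI\<close>)
  then show ?thesis using False by (simp add: finlD[OF finl_der[OF assms(1)]])
qed

text \<open>If the kernel vanishes on factors with more than three letters, finitely many shapes of
  the two words remain to be checked, since a function supported in length one vanishes on most
  quasi-shuffles.\<close>

lemma qder_der_short:
  assumes K: "\<And>m. finl (K m)" "localK K" and long: "\<And>m \<phi>. length m > 3 \<Longrightarrow> K m \<phi> = 0"
    and short: "\<And>\<phi> u v. distx (u @ v) \<Longrightarrow> u \<noteq> [] \<Longrightarrow> length u \<le> length v \<Longrightarrow> length v \<le> 3 \<Longrightarrow>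
       qs (\<lambda>w. K w \<phi>) u v = (if length v = 1 then K u (\<lambda>l. dq \<phi> l (hd v)) else 0) + (if length u = 1 then K v (\<lambda>l. dq \<phi> (hd u) l) else 0)"
  shows "qder (der K)"
proof (rule qder_der[OF K(1)])
  fix \<phi> u v assume d: "distx (u @ v)" and ne: "u \<noteq> []" "v \<noteq> []"
  have wlog: "qs (der K (dep1 \<phi>)) u v = (if length v = 1 then K u (\<lambda>l. dq \<phi> l (hd v)) else 0)
       + (if length u = 1 then K v (\<lambda>l. dq \<phi> (hd u) l) else 0)"
    if "length u \<le> length v" "distx (u @ v)" "u \<noteq> []" "v \<noteq> []" for u v
  proof -
    have dd: "der K (dep1 \<phi>) w = K w \<phi>" if "w \<noteq> []" for w by (rule der_dep1[OF K(1) that])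
    have "qs (der K (dep1 \<phi>)) u v - qs (\<lambda>w. K w \<phi>) u v = 0"
      unfolding qs_lin(4)[symmetric] by (rule qs_zero, subst dd) (use that in auto)
    then have e: "qs (der K (dep1 \<phi>)) u v = qs (\<lambda>w. K w \<phi>) u v" by simp
    show ?thesis
    proof (cases "length v \<le> 3")
      case True
      then show ?thesis using short[OF that(2,3,1) True, of \<phi>] e by simp
    next
      case False
      then have "qs (\<lambda>w. K w \<phi>) u v = 0" by (intro qs_zero long) auto
      then show ?thesis using False e long[of v] by simp
    qed
  qed
  have e: "(\<lambda>l. dq \<phi> l x) = dq \<phi> x" for x by (rule ext) (rule dq_comm)
  show "qs (der K (dep1 \<phi>)) u v = der K (\<lambda>u'. qs (dep1 \<phi>) u' v) u + der K (\<lambda>v'. qs (dep1 \<phi>) u v') v"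
  proof (cases "length u \<le> length v")
    case True
    then show ?thesis
      using wlog[OF True d ne] der_qs_dep1[OF K ne, of \<phi>] der_qs_dep1[OF K ne(2,1), of \<phi>] by (simp add: qs_comm[of _ u] e)
  next
    case False
    have "distx (v @ u)" using d by (auto simp: distx_def)
    then show ?thesis
      using wlog[of v u] False ne der_qs_dep1[OF K ne, of \<phi>] der_qs_dep1[OF K ne(2,1), of \<phi>] by (simp add: qs_comm[of _ u] e)
  qed
qed

lemma length_shapes:
  assumes "u \<noteq> []" "length u \<le> length v" "length v \<le> 3"
  obtains (s11) a b where "u = [a]" "v = [b]"
  | (s12) a b c where "u = [a]" "v = [b, c]"
  | (s13) a b c d where "u = [a]" "v = [b, c, d]"
  | (s22) a b c d where "u = [a, b]" "v = [c, d]"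
  | (s23) a b c d e where "u = [a, b]" "v = [c, d, e]"
  | (s33) a b c d e f where "u = [a, b, c]" "v = [d, e, f]"
proof -
  have "length u \<in> {1, 2, 3}" "length v \<in> {1, 2, 3}" using assms by (auto simp: numeral_eq_Suc le_Suc_eq)
  then show ?thesis using assms(2) that
    by (auto simp: numeral_eq_Suc length_Suc_conv)
qed

lemma kxi3: "length m \<ge> 3 \<Longrightarrow> karit lxi m \<phi> = 0"
  by (cases m rule: remdups_adj.cases) (auto simp: Suc_le_length_iff numeral_eq_Suc kxi_simps)

lemma qder_larit_xi: "qder (larit lxi)"
  unfolding larit_def
proof (rule qder_der_short)
  fix \<phi> and u v :: "pt list"
  assume d: "distx (u @ v)" and l: "u \<noteq> []" "length u \<le> length v" "length v \<le> 3"
  from l show "qs (\<lambda>w. karit lxi w \<phi>) u v = (if length v = 1 then karit lxi u (\<lambda>l. dq \<phi> l (hd v)) else 0)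
      + (if length u = 1 then karit lxi v (\<lambda>l. dq \<phi> (hd u) l) else 0)"
  proof (cases rule: length_shapes)
    case (s11 a b)
    then show ?thesis by (simp add: kxi_simps ac_simps)
  next
    case (s12 a b c)
    then show ?thesis using d
      by (simp add: kxi_simps dq_def distx_def ac_simps) (simp add: field_simps)
  next
    case (s13 a b c d)
    have "qs (\<lambda>w. karit lxi w \<phi>) u v = 0" by (rule qs_zero) (simp add: kxi3 s13)
    then show ?thesis by (simp add: s13 kxi_simps)
  next
    case (s22 a b c d)
    then show ?thesis
      by (simp add: kxi_simps ac_simps)
  next
    case (s23 a b c d e)
    have "qs (\<lambda>w. karit lxi w \<phi>) u v = 0" by (rule qs_zero) (simp add: kxi3 s23)
    then show ?thesis by (simp add: s23 kxi_simps)
  next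
    case (s33 a b c d e f)
    have "qs (\<lambda>w. karit lxi w \<phi>) u v = 0" by (rule qs_zero) (simp add: kxi3 s33)
    then show ?thesis by (simp add: s33 kxi_simps)
  qed
qed (simp_all add: kxi_long)

lemma kD4: "kD (a # b # c # d # w) \<phi> = 0" by (rule kD_long) simp

lemma div_inv: "x / (a - b) = x * inverse (a - b)" for x a b :: rat by (rule divide_inverse)

text \<open>The finitely many remaining cases are identities of rational functions.\<close>

lemma qder_kD: "qder (der kD)"
proof (rule qder_der_short)
  fix \<phi> and u v :: "pt list"
  assume d: "distx (u @ v)" and l: "u \<noteq> []" "length u \<le> length v" "length v \<le> 3"
  from l show "qs (\<lambda>w. kD w \<phi>) u v = (if length v = 1 then kD u (\<lambda>l. dq \<phi> l (hd v)) else 0)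
      + (if length u = 1 then kD v (\<lambda>l. dq \<phi> (hd u) l) else 0)"
  proof (cases rule: length_shapes)
    case (s11 a b)
    obtain x y ya P where a: "a = (x + P, ya)" "b = (x, y)"
      by (metis add.commute diff_add_cancel prod.exhaust)
    have "P \<noteq> 0" using d by (auto simp: s11 distx_def a)
    then show ?thesis
      by (simp add: s11 a kD_simps dq_def ac_simps) (simp add: field_simps)
  next
    case (s12 a b c)
    obtain x y yb yc P Q where a: "a = (x, y)" "b = (x - P, yb)" "c = (x - Q, yc)"
      by (metis diff_diff_eq2 add_diff_cancel_left' prod.exhaust)
    have "P \<noteq> 0" "Q \<noteq> 0" using d by (auto simp: s12 distx_def a)
    then show ?thesis
      by (simp add: s12 a kD_simps dq_def ac_simps) (simp add: field_simps)
  next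
    case (s13 a b c d)
    then show ?thesis
      by (simp add: kD_simps kD4 dq_def ac_simps) (simp add: algebra_simps add_divide_distrib diff_divide_distrib)
  next
    case (s22 a b c e)
    obtain x y x' y' ya yb P Q where a: "a = (x + P, ya)" "c = (x, y)" "b = (x' + Q, yb)" "e = (x', y')"
      by (metis add.commute diff_add_cancel prod.exhaust)
    have "P \<noteq> 0" "Q \<noteq> 0" using d by (auto simp: s22 distx_def a)
    then show ?thesis
      by (simp add: s22 a kD_simps kD4 dq_def div_inv ac_simps) (simp add: field_simps)
  next
    case (s23 a b c d e)
    then show ?thesis
      by (simp add: kD_simps kD4 ac_simps) (simp add: algebra_simps add_divide_distrib diff_divide_distrib)
  next
    case (s33 a b c d e f)
    then show ?thesis
      by (simp add: kD_simps kD4 ac_simps)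
  qed
qed (simp_all add: kD_long)

lemma lalternil_shortI:
  assumes "f [] = 0" "\<And>w. length w \<ge> 3 \<Longrightarrow> f w = 0"
    "\<And>a b. fst a \<noteq> fst b \<Longrightarrow> qs f [a] [b] = 0" "\<And>a b c. distx [a, b, c] \<Longrightarrow> qs f [a] [b, c] = 0"
    "\<And>a b c d. distx [a, b, c, d] \<Longrightarrow> qs f [a, b] [c, d] = 0"
  shows "lalternil f"
proof -
  have *: "qs f u v = 0" if uv: "u \<noteq> []" "distx (u @ v)" "length u \<le> length v" for u v
  proof (cases "length v \<le> 3")
    case True
    from uv(1,3) True show ?thesis
    proof (cases rule: length_shapes)
      case (s13 a b c d) show ?thesis by (rule qs_zero) (simp add: assms s13)
    next
      case (s23 a b c d e) show ?thesis by (rule qs_zero) (simp add: assms s23)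
    next
      case (s33 a b c d e f) show ?thesis by (rule qs_zero) (simp add: assms s33)
    qed (use uv(2) assms in \<open>simp_all add: distx_def del: qs.simps\<close>)
  next
    case False
    then show ?thesis by (intro qs_zero assms(2)) auto
  qed
  show ?thesis unfolding lalternil_def
  proof (intro conjI allI impI assms(1))
    fix u v assume uv: "u \<noteq> []" "v \<noteq> []" "distx (u @ v)"
    then have "distx (v @ u)" by (auto simp: distx_def)
    then show "qs f u v = 0"
      using *[of u v] *[of v u] uv qs_comm[of f u v] by (cases "length u \<le> length v") auto
  qed
qed

lemma lalternil_lxi: "lalternil lxi"
proof (rule lalternil_shortI)
  show "lxi w = 0" if "3 \<le> length w" for w
    using that by (auto simp: Suc_le_length_iff numeral_eq_Suc)
qed simp_all

lemma lalternil_lE: "lalternil lE"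
proof (rule lalternil_shortI)
  show "lE w = 0" if "3 \<le> length w" for w
    using that by (auto simp: Suc_le_length_iff numeral_eq_Suc)
  show "qs lE [a] [b] = 0" if "fst a \<noteq> fst b" for a b
    using that by (simp add: field_simps)
qed simp_all

lemma qder_rmul_xi: "qder (rmul lxi)"
  using qder_add_lmu[OF qder_larit_xi lalternil_lxi] by (simp add: rmul_def[abs_def])

lemma qder_ld0: "qder ld0"
  using qder_add_lmu[OF qder_kD lalternil_lE] by (simp add: ld0_def[abs_def])

text \<open>Equality on words with distinct \<open>x\<close>-coordinates in a given set. It allows
  the second argument of a quasi-shuffle to be frozen while an operator acts on the first
  one.\<close>

definition eqs :: "rat set \<Rightarrow> (pt list \<Rightarrow> rat) \<Rightarrow> (pt list \<Rightarrow> rat) \<Rightarrow> bool" where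
  "eqs S f g \<longleftrightarrow> (\<forall>w. distx w \<longrightarrow> fst ` set w \<subseteq> S \<longrightarrow> f w = g w)"

lemma eqsD: "eqs S f g \<Longrightarrow> distx w \<Longrightarrow> fst ` set w \<subseteq> S \<Longrightarrow> f w = g w"
  by (simp add: eqs_def)

lemma coarse_distx: "coarse w u \<Longrightarrow> distx w \<Longrightarrow> distx u \<and> fst ` set u \<subseteq> fst ` set w"
  unfolding distx_def coarse_def using subseq_distinct_subset[of "map fst u" "map fst w"] by auto

lemma der_eqs: "localK K \<Longrightarrow> eqs S f g \<Longrightarrow> eqs S (der K f) (der K g)"
  unfolding eqs_def by (auto intro!: der_cong dest: coarse_distx)

lemma lmu_eqs: "eqs S f g \<Longrightarrow> eqs S (lmu f A) (lmu g A)"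
proof -
  assume *: "eqs S f g"
  have t: "distx (take i w) \<and> fst ` set (take i w) \<subseteq> S" if "distx w" "fst ` set w \<subseteq> S" for i w
    using that set_take_subset[of i w] by (auto simp: distx_def take_map[symmetric])
  show ?thesis unfolding eqs_def
  proof (intro allI impI)
    fix w assume "distx w" "fst ` set w \<subseteq> S"
    then have "f (take i w) = g (take i w)" for i using t[of w i] * by (simp add: eqs_def)
    then show "lmu f A w = lmu g A w" by (simp add: lmu_def)
  qed
qed

lemma rmul_eqs: "eqs S f g \<Longrightarrow> eqs S (rmul A f) (rmul A g)"
  using der_eqs[OF local_karit, of S f g A] lmu_eqs[of S f g A]
  by (auto simp: rmul_def larit_def eqs_def)

lemma ld0_eqs: "eqs S f g \<Longrightarrow> eqs S (ld0 f) (ld0 g)"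
  using der_eqs[OF local_kD, of S f g] lmu_eqs[of S f g lE]
  by (auto simp: ld0_def eqs_def)

lemma opsq_eqs: "eqs S f g \<Longrightarrow> eqs S (opsq k f) (opsq k g)"
proof (induction k arbitrary: f g)
  case (Suc k)
  from ld0_eqs[OF Suc(1)[OF Suc(2)]] Suc(1)[OF ld0_eqs[OF Suc(2)]] show ?case
    by (simp add: eqs_def)
qed (simp add: rmul_eqs)

text \<open>Commutators of derivations are derivations.\<close>

lemma qder_commutator:
  assumes T: "qder T" "\<And>w. finl (\<lambda>f. T f w)" "\<And>S f g. eqs S f g \<Longrightarrow> eqs S (T f) (T g)"
    and T': "qder T'" "\<And>w. finl (\<lambda>f. T' f w)" "\<And>S f g. eqs S f g \<Longrightarrow> eqs S (T' f) (T' g)"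
  shows "qder (\<lambda>f w. T (T' f) w - T' (T f) w)"
proof -
  have main: "qs (T (T' f)) u v = T (T' (\<lambda>u''. qs f u'' v)) u + T (\<lambda>u'. T' (\<lambda>v'. qs f u' v') v) u
      + (T (\<lambda>v'. T' (\<lambda>u'. qs f u' v') u) v + T (T' (\<lambda>v''. qs f u v'')) v)"
    if T: "qder T" "\<And>w. finl (\<lambda>f. T f w)" "\<And>S f g. eqs S f g \<Longrightarrow> eqs S (T f) (T g)"
      and T': "qder T'" and d: "distx (u @ v)" for T T' f u v
  proof -
    have du: "distx u" "fst ` set u \<subseteq> - fst ` set v" and dv: "distx v" "fst ` set v \<subseteq> - fst ` set u"
      using d by (auto simp: distx_def)
    have "eqs (- fst ` set v) (\<lambda>u'. qs (T' f) u' v) (\<lambda>u'. T' (\<lambda>u''. qs f u'' v) u' + T' (\<lambda>v'. qs f u' v') v)"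
      unfolding eqs_def
    proof (intro allI impI)
      fix w assume "distx w" "fst ` set w \<subseteq> - fst ` set v"
      then have "distx (w @ v)" using dv(1) by (auto simp: distx_append)
      then show "qs (T' f) w v = T' (\<lambda>u''. qs f u'' v) w + T' (\<lambda>v'. qs f w v') v"
        using T' by (simp add: qder_def)
    qed
    then have "T (\<lambda>u'. qs (T' f) u' v) u = T (\<lambda>u'. T' (\<lambda>u''. qs f u'' v) u' + T' (\<lambda>v'. qs f u' v') v) u"
      by (rule eqsD[OF T(3) du])
    moreover have "eqs (- fst ` set u) (\<lambda>v'. qs (T' f) u v') (\<lambda>v'. T' (\<lambda>u'. qs f u' v') u + T' (\<lambda>v''. qs f u v'') v')"
      unfolding eqs_def
    proof (intro allI impI)
      fix w assume "distx w" "fst ` set w \<subseteq> - fst ` set u"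
      then have "distx (u @ w)" using du(1) by (auto simp: distx_append)
      then show "qs (T' f) u w = T' (\<lambda>u'. qs f u' w) u + T' (\<lambda>v''. qs f u v'') w"
        using T' by (simp add: qder_def)
    qed
    then have "T (\<lambda>v'. qs (T' f) u v') v = T (\<lambda>v'. T' (\<lambda>u'. qs f u' v') u + T' (\<lambda>v''. qs f u v'') v') v"
      by (rule eqsD[OF T(3) dv])
    ultimately show ?thesis
      using T(1) d by (simp add: qder_def finlD[OF T(2)])
  qed
  show ?thesis unfolding qder_def
  proof (intro allI impI)
    fix f u v assume d: "distx (u @ v)"
    show "qs (\<lambda>w. T (T' f) w - T' (T f) w) u v =
      T (T' (\<lambda>u'. qs f u' v)) u - T' (T (\<lambda>u'. qs f u' v)) u + (T (T' (qs f u)) v - T' (T (qs f u)) v)"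
      using main[OF T T'(1) d, of f] main[OF T' T(1) d, of f]
        finl_swap[OF T(2)[of u] T'(2)[of v], of "\<lambda>u' v'. qs f u' v'"]
        finl_swap[OF T(2)[of v] T'(2)[of u], of "\<lambda>v' u'. qs f u' v'"]
      by (simp add: qs_lin)
  qed
qed

lemma qder_opsq: "qder (opsq k)"
proof (induction k)
  case (Suc k)
  show ?case unfolding opsq.simps
    by (rule qder_commutator[OF qder_ld0 _ _ Suc]) (simp_all add: ld0_eqs opsq_eqs)
qed (simp add: qder_rmul_xi)

lemma opsq_Nil: "opsq k f [] = 0"
  by (induction k arbitrary: f) (simp_all add: rmul_def ld0_def)

text \<open>A derivation for the quasi-shuffle product maps the unit to a function vanishing on
  quasi-shuffles of nonempty words.\<close>

lemma lalternil_xisq: "lalternil (xisq k)"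
proof -
  have "qs (xisq k) u v = 0" if "u \<noteq> []" "v \<noteq> []" "distx (u @ v)" for u v
  proof -
    have "(\<lambda>u'. qs unitf u' v) = (\<lambda>_. 0)" "(\<lambda>v'. qs unitf u v') = (\<lambda>_. 0)"
      using that by (simp_all add: qs_unitf unitf_def)
    then show ?thesis
      using qder_opsq[of k] that unfolding qder_def xisq_def by (simp add: finlD[OF finl_opsq])
  qed
  then show ?thesis by (simp add: lalternil_def xisq_def opsq_Nil)
qed

section \<open>Evaluation of polynomials\<close>

abbreviation lookup where "lookup \<equiv> Poly_Mapping.lookup"
abbreviation keys where "keys \<equiv> Poly_Mapping.keys"

definition meval :: "(var \<Rightarrow> rat) \<Rightarrow> monom \<Rightarrow> rat" where
  "meval \<rho> m = (\<Prod>v\<in>keys m. \<rho> v ^ lookup m v)"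

lemma meval_superset: "finite S \<Longrightarrow> keys m \<subseteq> S \<Longrightarrow> meval \<rho> m = (\<Prod>v\<in>S. \<rho> v ^ lookup m v)"
  unfolding meval_def by (rule prod.mono_neutral_left) (auto simp: in_keys_iff)

lemma meval_add: "meval \<rho> (m + n) = meval \<rho> m * meval \<rho> n"
proof -
  have "finite (keys m \<union> keys n)" by simp
  then show ?thesis using Poly_Mapping.keys_add[of m n]
    by (simp add: meval_superset[of "keys m \<union> keys n"] lookup_add power_add prod.distrib)
qed

lemma meval_single: "meval \<rho> (Poly_Mapping.single v k) = \<rho> v ^ k"
  by (cases "k = 0") (simp_all add: meval_def)

lemma meval_zero [simp]: "meval \<rho> 0 = 1" by (simp add: meval_def)

lemma meval_sum: "finite I \<Longrightarrow> meval \<rho> (sum f I) = (\<Prod>i\<in>I. meval \<rho> (f i))"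
  by (induction I rule: finite_induct) (simp_all add: meval_add)

lemma pcoeff_zero [simp]: "pcoeff 0 m = 0" by transfer simp
lemma pcoeff_add: "pcoeff (p + q) m = pcoeff p m + pcoeff q m" by transfer (simp add: lookup_add)
lemma pcoeff_minus: "pcoeff (p - q) m = pcoeff p m - pcoeff q m" by transfer (simp add: lookup_minus)

lemma pcoeff_sum: "pcoeff (sum f I) m = (\<Sum>i\<in>I. pcoeff (f i) m)"
  by (induction I rule: infinite_finite_induct) (simp_all add: pcoeff_add)

text \<open>Meaningful for polynomials only, where the sum over the coefficients is finite.\<close>

definition peval :: "(var \<Rightarrow> rat) \<Rightarrow> pser \<Rightarrow> rat" where
  "peval \<rho> p = (\<Sum>m | pcoeff p m \<noteq> 0. pcoeff p m * meval \<rho> m)"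

lemma peval_superset:
  "finite S \<Longrightarrow> {m. pcoeff p m \<noteq> 0} \<subseteq> S \<Longrightarrow> peval \<rho> p = (\<Sum>m\<in>S. pcoeff p m * meval \<rho> m)"
  unfolding peval_def by (rule sum.mono_neutral_left) auto

lemma peval_zero [simp]: "peval \<rho> 0 = 0" by (simp add: peval_def)

lemma polynomial_add: "polynomial_pser p \<Longrightarrow> polynomial_pser q \<Longrightarrow> polynomial_pser (p + q)"
  unfolding polynomial_pser_def
  by (rule finite_subset[of _ "{m. pcoeff p m \<noteq> 0} \<union> {m. pcoeff q m \<noteq> 0}"]) (auto simp: pcoeff_add)

lemma peval_add:
  "polynomial_pser p \<Longrightarrow> polynomial_pser q \<Longrightarrow> peval \<rho> (p + q) = peval \<rho> p + peval \<rho> q"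
  unfolding polynomial_pser_def
  by (subst (1 2 3) peval_superset[of "{m. pcoeff p m \<noteq> 0} \<union> {m. pcoeff q m \<noteq> 0}"])
    (auto simp: pcoeff_add distrib_right sum.distrib)

lemma polynomial_zero [simp]: "polynomial_pser 0" by (simp add: polynomial_pser_def)

lemma polynomial_sum: "(\<And>i. i \<in> I \<Longrightarrow> polynomial_pser (f i)) \<Longrightarrow> polynomial_pser (sum f I)"
  by (induction I rule: infinite_finite_induct) (auto intro: polynomial_add)

lemma peval_sum: "(\<And>i. i \<in> I \<Longrightarrow> polynomial_pser (f i)) \<Longrightarrow> peval \<rho> (sum f I) = (\<Sum>i\<in>I. peval \<rho> (f i))"
  by (induction I rule: infinite_finite_induct) (auto simp: peval_add polynomial_sum)

lift_definition pmon :: "monom \<Rightarrow> pser" is "\<lambda>m. fps_const (Poly_Mapping.single m 1) * fps_X ^ mdeg m"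
  by (auto simp: homog_def fps_X_power_nth)

lemma pmon_add: "pmon (m + n) = pmon m * pmon n"
proof (transfer, goal_cases)
  case (1 m n)
  have "fps_const (Poly_Mapping.single (m + n) 1 :: rpoly)
      = fps_const (Poly_Mapping.single m 1) * fps_const (Poly_Mapping.single n 1)"
    by (simp add: mult_single)
  then show ?case by (simp only: mdeg_add power_add mult_ac)
qed

lemma pmon_zero: "pmon 0 = 1" by transfer simp

lemma pmon_single: "pmon (Poly_Mapping.single v k) = pvar v ^ k"
proof (induction k)
  case (Suc k)
  have "pmon (Poly_Mapping.single v (Suc 0)) = pvar v" by transfer simp
  moreover have "Poly_Mapping.single v (Suc k) = Poly_Mapping.single v (Suc 0) + Poly_Mapping.single v k"
    by (simp add: single_add[symmetric])
  ultimately show ?case using Suc by (simp add: pmon_add)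
qed (simp add: pmon_zero)

lemma pmon_sum: "finite I \<Longrightarrow> pmon (sum f I) = (\<Prod>i\<in>I. pmon (f i))"
  by (induction I rule: finite_induct) (simp_all add: pmon_add pmon_zero)

lemma monom_expand: "(m :: monom) = (\<Sum>v\<in>keys m. Poly_Mapping.single v (lookup m v))"
  by (rule poly_mapping_eqI) (simp add: lookup_sum lookup_single when_def in_keys_iff)

lemma pmon_prod: "pmon m = (\<Prod>v\<in>keys m. pvar v ^ lookup m v)"
  using arg_cong[OF monom_expand[of m], of pmon] by (simp add: pmon_sum pmon_single)

lemma pcoeff_term: "pcoeff (pconst c * pmon n) m = (if m = n then c else 0)"
proof -
  have "fps_nth (fps_const (Poly_Mapping.single 0 c) * (fps_const (Poly_Mapping.single n 1) * fps_X ^ mdeg n)) (mdeg m)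
      = (if mdeg m = mdeg n then Poly_Mapping.single n c else (0 :: rpoly))"
    by (simp only: fps_mult_left_const_nth fps_X_power_nth) (simp add: mult_single)
  then have "lookup (fps_nth (fps_const (Poly_Mapping.single 0 c) * (fps_const (Poly_Mapping.single n 1) * fps_X ^ mdeg n) :: rpoly fps) (mdeg m)) m
      = (if m = n then c else 0)"
    by (simp only:) (auto simp: lookup_single)
  then show ?thesis by (simp add: pcoeff.rep_eq times_pser.rep_eq pconst.rep_eq pmon.rep_eq)
qed

lemma polynomial_term: "polynomial_pser (pconst c * pmon n)"
  unfolding polynomial_pser_def by (rule finite_subset[of _ "{n}"]) (auto simp: pcoeff_term)

lemma peval_term: "peval \<rho> (pconst c * pmon n) = c * meval \<rho> n"
  by (subst peval_superset[of "{n}"]) (auto simp: pcoeff_term)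

lemma pser_expand:
  "polynomial_pser p \<Longrightarrow> p = (\<Sum>m | pcoeff p m \<noteq> 0. pconst (pcoeff p m) * pmon m)"
  by (rule pser_eqI) (simp add: pcoeff_sum pcoeff_term polynomial_pser_def)

lemma pconst_mult: "pconst (c * d) = pconst c * pconst d"
  by transfer (simp add: mult_single)

lemma pconst_1: "pconst 1 = 1" by transfer simp
lemma pconst_0: "pconst 0 = 0" by transfer simp

lemma mult_expand:
  assumes "polynomial_pser p" "polynomial_pser q"
  shows "p * q = (\<Sum>m | pcoeff p m \<noteq> 0. \<Sum>n | pcoeff q n \<noteq> 0. pconst (pcoeff p m * pcoeff q n) * pmon (m + n))"
  using arg_cong2[OF pser_expand[OF assms(1)] pser_expand[OF assms(2)], of "(*)"]
  by (simp add: sum_product pmon_add pconst_mult mult_ac)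

lemma polynomial_mult: "polynomial_pser p \<Longrightarrow> polynomial_pser q \<Longrightarrow> polynomial_pser (p * q)"
  by (simp add: mult_expand polynomial_sum polynomial_term)

lemma peval_mult:
  assumes "polynomial_pser p" "polynomial_pser q"
  shows "peval \<rho> (p * q) = peval \<rho> p * peval \<rho> q"
proof -
  have "peval \<rho> (p * q) = (\<Sum>m | pcoeff p m \<noteq> 0. \<Sum>n | pcoeff q n \<noteq> 0. pcoeff p m * pcoeff q n * meval \<rho> (m + n))"
    unfolding mult_expand[OF assms] by (simp add: peval_sum polynomial_sum polynomial_term peval_term)
  then show ?thesis by (simp add: peval_def sum_product meval_add mult_ac)
qed

lemma polynomial_pconst [simp]: "polynomial_pser (pconst c)" and peval_pconst [simp]: "peval \<rho> (pconst c) = c"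
  using polynomial_term[of c 0] peval_term[of \<rho> c 0] by (simp_all add: pmon_zero)

lemma polynomial_one [simp]: "polynomial_pser 1" and peval_one [simp]: "peval \<rho> 1 = 1"
  using polynomial_pconst[of 1] peval_pconst[of \<rho> 1] by (simp_all add: pconst_1)

lemma polynomial_pvar [simp]: "polynomial_pser (pvar v)" and peval_pvar [simp]: "peval \<rho> (pvar v) = \<rho> v"
  using polynomial_term[of 1 "Poly_Mapping.single v 1"] peval_term[of \<rho> 1 "Poly_Mapping.single v 1"]
  by (simp_all add: pconst_1 pmon_single meval_single)

lemma pconst_uminus: "pconst (- c) = - pconst c"
  by transfer (simp add: single_uminus)

lemma uminus_pconst: "- p = pconst (-1) * p"
  using pconst_uminus[of 1] by (simp add: pconst_1)

lemma polynomial_uminus: "polynomial_pser p \<Longrightarrow> polynomial_pser (- p)"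
  and peval_uminus: "polynomial_pser p \<Longrightarrow> peval \<rho> (- p) = - peval \<rho> p"
  unfolding uminus_pconst[of p] by (simp_all add: polynomial_mult peval_mult)

lemma polynomial_minus: "polynomial_pser p \<Longrightarrow> polynomial_pser q \<Longrightarrow> polynomial_pser (p - q)"
  and peval_minus: "polynomial_pser p \<Longrightarrow> polynomial_pser q \<Longrightarrow> peval \<rho> (p - q) = peval \<rho> p - peval \<rho> q"
  using polynomial_add[of p "- q"] peval_add[of p "- q" \<rho>] by (simp_all add: polynomial_uminus peval_uminus)

lemma polynomial_prod: "(\<And>i. i \<in> I \<Longrightarrow> polynomial_pser (f i)) \<Longrightarrow> polynomial_pser (prod f I)"
  by (induction I rule: infinite_finite_induct) (auto intro: polynomial_mult)

lemma peval_prod: "(\<And>i. i \<in> I \<Longrightarrow> polynomial_pser (f i)) \<Longrightarrow> peval \<rho> (prod f I) = (\<Prod>i\<in>I. peval \<rho> (f i))"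
  by (induction I rule: infinite_finite_induct) (auto simp: peval_mult polynomial_prod)

lemma polynomial_power: "polynomial_pser p \<Longrightarrow> polynomial_pser (p ^ n)"
  and peval_power: "polynomial_pser p \<Longrightarrow> peval \<rho> (p ^ n) = peval \<rho> p ^ n"
proof -
  assume p: "polynomial_pser p"
  have "polynomial_pser (p ^ n) \<and> peval \<rho> (p ^ n) = peval \<rho> p ^ n"
    using p by (induction n) (auto simp: polynomial_mult peval_mult)
  then show "polynomial_pser (p ^ n)" "peval \<rho> (p ^ n) = peval \<rho> p ^ n" by auto
qed

definition Poly :: "nat \<Rightarrow> pser set" where "Poly r = {p \<in> PS r. polynomial_pser p}"

definition vars :: "nat \<Rightarrow> var set" where "vars r = VX ` {1..r} \<union> VY ` {1..r}"

lemma Poly_iff: "p \<in> Poly r \<longleftrightarrow> polynomial_pser p \<and> (\<forall>m. pcoeff p m \<noteq> 0 \<longrightarrow> keys m \<subseteq> vars r)"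
  by (auto simp: Poly_def PS_def vars_def)

lemma Poly_polynomial: "p \<in> Poly r \<Longrightarrow> polynomial_pser p" by (simp add: Poly_def)

lemma Poly_add: "p \<in> Poly r \<Longrightarrow> q \<in> Poly r \<Longrightarrow> p + q \<in> Poly r"
  unfolding Poly_iff pcoeff_add by (metis polynomial_add add_0)

lemma Poly_zero [simp]: "0 \<in> Poly r" by (simp add: Poly_iff)

lemma Poly_sum: "(\<And>i. i \<in> I \<Longrightarrow> f i \<in> Poly r) \<Longrightarrow> sum f I \<in> Poly r"
  by (induction I rule: infinite_finite_induct) (auto intro: Poly_add)

lemma Poly_term: "keys m \<subseteq> vars r \<Longrightarrow> pconst c * pmon m \<in> Poly r"
  by (simp add: Poly_iff polynomial_term pcoeff_term)

lemma Poly_mult: "p \<in> Poly r \<Longrightarrow> q \<in> Poly r \<Longrightarrow> p * q \<in> Poly r"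
proof -
  assume pq: "p \<in> Poly r" "q \<in> Poly r"
  have "keys (m + n) \<subseteq> vars r" if "pcoeff p m \<noteq> 0" "pcoeff q n \<noteq> 0" for m n
    using that pq Poly_Mapping.keys_add[of m n] unfolding Poly_iff by blast
  then show ?thesis
    unfolding mult_expand[OF pq[THEN Poly_polynomial]] by (auto intro!: Poly_sum Poly_term)
qed

lemma Poly_pconst [simp]: "pconst c \<in> Poly r"
  using Poly_term[of 0 r c] by (simp add: pmon_zero)

lemma Poly_one [simp]: "1 \<in> Poly r"
  using Poly_pconst[of 1] by (simp add: pconst_1)

lemma Poly_pvar: "v \<in> vars r \<Longrightarrow> pvar v \<in> Poly r"
  using Poly_term[of "Poly_Mapping.single v 1" r 1] by (simp add: pmon_single pconst_1)

lemma Poly_uminus: "p \<in> Poly r \<Longrightarrow> - p \<in> Poly r"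
  unfolding uminus_pconst[of p] by (intro Poly_mult) simp_all

lemma Poly_minus: "p \<in> Poly r \<Longrightarrow> q \<in> Poly r \<Longrightarrow> p - q \<in> Poly r"
  using Poly_add[of p r "- q"] by (simp add: Poly_uminus)

lemma Poly_prod: "(\<And>i. i \<in> I \<Longrightarrow> f i \<in> Poly r) \<Longrightarrow> prod f I \<in> Poly r"
  by (induction I rule: infinite_finite_induct) (auto intro: Poly_mult)

lemma Poly_power: "p \<in> Poly r \<Longrightarrow> p ^ n \<in> Poly r"
  by (induction n) (auto intro: Poly_mult)

lift_definition plin :: "linform \<Rightarrow> pser" is "\<lambda>l. fps_const (lin_poly l) * fps_X"
  using homog_lin_poly by (auto simp: homog_def)

definition lev :: "(var \<Rightarrow> rat) \<Rightarrow> linform \<Rightarrow> rat" where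
  "lev \<rho> l = (\<Sum>v\<in>keys l. lookup l v * \<rho> v)"

lemma lev_superset: "finite S \<Longrightarrow> keys l \<subseteq> S \<Longrightarrow> lev \<rho> l = (\<Sum>v\<in>S. lookup l v * \<rho> v)"
  unfolding lev_def by (rule sum.mono_neutral_left) (auto simp: in_keys_iff)

lemma keys_minus_subset: "keys (m - n) \<subseteq> keys m \<union> keys (n :: linform)"
  by (auto simp: in_keys_iff lookup_minus)

lemma lev_add: "lev \<rho> (l + k) = lev \<rho> l + lev \<rho> k"
  and lev_minus: "lev \<rho> (l - k) = lev \<rho> l - lev \<rho> k"
proof -
  let ?S = "keys l \<union> keys k"
  have "finite ?S" by simp
  then show "lev \<rho> (l + k) = lev \<rho> l + lev \<rho> k" "lev \<rho> (l - k) = lev \<rho> l - lev \<rho> k"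
    using Poly_Mapping.keys_add[of l k] keys_minus_subset[of l k]
    by (simp_all add: lev_superset[of ?S] lookup_add lookup_minus algebra_simps sum.distrib sum_subtractf)
qed

lemma lev_zero [simp]: "lev \<rho> 0 = 0" by (simp add: lev_def)

lemma lev_sum: "finite I \<Longrightarrow> lev \<rho> (sum f I) = (\<Sum>i\<in>I. lev \<rho> (f i))"
  by (induction I rule: finite_induct) (simp_all add: lev_add)

lemma lev_uminus: "lev \<rho> (- l) = - lev \<rho> l"
  using lev_minus[of \<rho> 0 l] by simp

lemma lev_xf [simp]: "lev \<rho> (xf i) = \<rho> (VX i)" and lev_yf [simp]: "lev \<rho> (yf i) = \<rho> (VY i)"
  by (simp_all add: lev_def xf_def yf_def)

lemma plin_expand: "plin l = (\<Sum>v\<in>keys l. pconst (lookup l v) * pvar v)"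
proof (rule pser_eqI)
  fix m
  have 1: "pcoeff (plin l) m = (\<Sum>v\<in>keys l. if m = Poly_Mapping.single v (Suc 0) then lookup l v else 0)"
  proof -
    have "lookup (lin_poly l) m = (\<Sum>v\<in>keys l. if m = Poly_Mapping.single v (Suc 0) then lookup l v else 0)"
      by (auto simp: lin_poly_def lookup_sum lookup_single when_def intro!: sum.cong)
    moreover have "(\<Sum>v\<in>keys l. if m = Poly_Mapping.single v (Suc 0) then lookup l v else 0) = 0" if "mdeg m \<noteq> 1"
      by (rule sum.neutral) (use that in auto)
    ultimately show ?thesis
      by (cases "mdeg m = 1") (auto simp: pcoeff.rep_eq plin.rep_eq fps_mult_right_const_nth)
  qed
  have 2: "pcoeff (pconst c * pvar v) m = (if m = Poly_Mapping.single v (Suc 0) then c else 0)" for c v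
    using pcoeff_term[of c "Poly_Mapping.single v 1" m] by (simp add: pmon_single)
  show "pcoeff (plin l) m = pcoeff (\<Sum>v\<in>keys l. pconst (lookup l v) * pvar v) m"
    by (simp add: 1 2 pcoeff_sum)
qed

lemma polynomial_plin [simp]: "polynomial_pser (plin l)" and peval_plin [simp]: "peval \<rho> (plin l) = lev \<rho> l"
  unfolding plin_expand by (simp_all add: polynomial_sum polynomial_mult peval_sum peval_mult lev_def)

lemma Poly_plin: "keys l \<subseteq> vars r \<Longrightarrow> plin l \<in> Poly r"
  unfolding plin_expand by (intro Poly_sum Poly_mult Poly_pconst Poly_pvar) auto

lemma pser_subst_add: "pser_subst \<sigma> (p + q) = pser_subst \<sigma> p + pser_subst \<sigma> q"
  by transfer (simp add: fps_eq_iff poly_subst_add)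

lemma pser_subst_sum: "pser_subst \<sigma> (sum f I) = (\<Sum>i\<in>I. pser_subst \<sigma> (f i))"
  by (induction I rule: infinite_finite_induct) (simp_all add: pser_subst_add pser_subst_zero)

lemma pser_subst_pconst [simp]: "pser_subst \<sigma> (pconst c) = pconst c"
proof (transfer, goal_cases)
  case (1 \<sigma> c)
  have "poly_subst \<sigma> (Poly_Mapping.single 0 c) = Poly_Mapping.single 0 c"
    by (simp add: poly_subst_single monom_subst_def)
  then show ?case by (auto simp: fps_eq_iff)
qed

lemma pser_subst_one [simp]: "pser_subst \<sigma> 1 = 1"
  using pser_subst_pconst[of \<sigma> 1] by (simp add: pconst_1)

lemma pser_subst_pvar [simp]: "pser_subst \<sigma> (pvar v) = plin (\<sigma> v)"
proof (transfer, goal_cases)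
  case (1 \<sigma> v)
  have "poly_subst \<sigma> (Poly_Mapping.single (Poly_Mapping.single v (Suc 0)) 1) = lin_poly (\<sigma> v)"
    by (simp add: poly_subst_single monom_subst_def)
  then show ?case by (auto simp: fps_eq_iff fps_X_mult_right_nth)
qed

lemma pser_subst_prod: "pser_subst \<sigma> (prod f I) = (\<Prod>i\<in>I. pser_subst \<sigma> (f i))"
  by (induction I rule: infinite_finite_induct) (simp_all add: pser_subst_mult)

lemma pser_subst_power: "pser_subst \<sigma> (p ^ n) = pser_subst \<sigma> p ^ n"
  by (induction n) (simp_all add: pser_subst_mult)

lemma pser_subst_minus: "pser_subst \<sigma> (p - q) = pser_subst \<sigma> p - pser_subst \<sigma> q"
  using pser_subst_add[of \<sigma> "p - q" q] by simp

lemma pser_subst_expand: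
  "polynomial_pser p \<Longrightarrow> pser_subst \<sigma> p = (\<Sum>m | pcoeff p m \<noteq> 0. pconst (pcoeff p m) * (\<Prod>v\<in>keys m. plin (\<sigma> v) ^ lookup m v))"
  using arg_cong[OF pser_expand, of p "pser_subst \<sigma>"]
  by (simp add: pser_subst_sum pser_subst_mult pmon_prod pser_subst_prod pser_subst_power)

text \<open>Substitution of linear forms corresponds to evaluation at the values of the
  forms.\<close>

lemma peval_subst:
  assumes "polynomial_pser p"
  shows "peval \<rho> (pser_subst \<sigma> p) = peval (\<lambda>v. lev \<rho> (\<sigma> v)) p"
  unfolding pser_subst_expand[OF assms]
  by (simp add: peval_sum polynomial_mult polynomial_prod polynomial_power peval_mult peval_prod peval_power
      peval_def[of "\<lambda>v. lev \<rho> (\<sigma> v)"] meval_def)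

lemma Poly_subst:
  assumes "p \<in> Poly s" "\<And>v. v \<in> vars s \<Longrightarrow> keys (\<sigma> v) \<subseteq> vars r"
  shows "pser_subst \<sigma> p \<in> Poly r"
  unfolding pser_subst_expand[OF Poly_polynomial[OF assms(1)]]
  using assms by (intro Poly_sum Poly_mult Poly_pconst Poly_prod Poly_power Poly_plin) (auto simp: Poly_iff)

lemma peval_cong:
  assumes "p \<in> Poly r" "\<And>v. v \<in> vars r \<Longrightarrow> \<rho> v = \<rho>' v"
  shows "peval \<rho> p = peval \<rho>' p"
  unfolding peval_def meval_def
  by (intro sum.cong arg_cong2[where f = "(*)"] prod.cong refl) (use assms in \<open>auto simp: Poly_iff subset_iff\<close>)

section \<open>Functions representing elements of the fraction field\<close>

definition envw :: "pt list \<Rightarrow> var \<Rightarrow> rat" where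
  "envw w v = (case v of VX i \<Rightarrow> fst (w ! (i - 1)) | VY i \<Rightarrow> snd (w ! (i - 1)))"

lemma envw_simps [simp]: "envw w (VX i) = fst (w ! (i - 1))" "envw w (VY i) = snd (w ! (i - 1))"
  by (simp_all add: envw_def)

definition good :: "bool \<Rightarrow> pt list \<Rightarrow> bool" where "good b w \<longleftrightarrow> (b \<longrightarrow> gen w)"

text \<open>The flag distinguishes localized components from polynomial ones.\<close>

definition DD :: "bool \<Rightarrow> nat \<Rightarrow> pser set" where "DD b r = (if b then Den r else {1})"

lemma DD_one [simp]: "1 \<in> DD b r" by (simp add: DD_def Den.one)

lemma Den_mult: "d \<in> Den r \<Longrightarrow> e \<in> Den r \<Longrightarrow> d * e \<in> Den r"
  by (rotate_tac, induction e rule: Den.induct) (auto intro: Den.intros simp: mult.assoc[symmetric])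

lemma DD_mult: "d \<in> DD b r \<Longrightarrow> e \<in> DD b r \<Longrightarrow> d * e \<in> DD b r"
  by (auto simp: DD_def Den_mult)

lemma DD_Poly: "d \<in> DD b r \<Longrightarrow> d \<in> Poly r"
proof -
  have "d \<in> Den r \<Longrightarrow> d \<in> Poly r"
    by (induction d rule: Den.induct) (auto intro!: Poly_mult Poly_minus Poly_pvar simp: vars_def)
  then show "d \<in> DD b r \<Longrightarrow> d \<in> Poly r" by (auto simp: DD_def split: if_splits)
qed

lemma gen_nth: "gen w \<Longrightarrow> i \<in> {1..length w} \<Longrightarrow> fst (w ! (i - 1)) \<noteq> 0"
  by (auto simp: gen_def image_iff)

lemma gen_nth_diff:
  "gen w \<Longrightarrow> i \<in> {1..length w} \<Longrightarrow> j \<in> {1..length w} \<Longrightarrow> i \<noteq> j \<Longrightarrow> fst (w ! (i - 1)) \<noteq> fst (w ! (j - 1))"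
proof -
  assume *: "gen w" "i \<in> {1..length w}" "j \<in> {1..length w}" "i \<noteq> j"
  then have "i - 1 < length w" "j - 1 < length w" "i - 1 \<noteq> j - 1" by auto
  then show ?thesis using nth_eq_iff_index_eq[of "map fst w" "i - 1" "j - 1"] *(1) by (auto simp: gen_def)
qed

lemma DD_peval: "d \<in> DD b r \<Longrightarrow> length w = r \<Longrightarrow> good b w \<Longrightarrow> peval (envw w) d \<noteq> 0"
proof -
  have "d \<in> Den r \<Longrightarrow> length w = r \<Longrightarrow> gen w \<Longrightarrow> polynomial_pser d \<and> peval (envw w) d \<noteq> 0"
  proof (induction d rule: Den.induct)
    case (diff d i j)
    then show ?case using gen_nth_diff[of w i j]
      by (simp add: polynomial_mult peval_mult polynomial_minus peval_minus)
  qed (use gen_nth in \<open>auto simp: polynomial_mult peval_mult\<close>)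
  then show "d \<in> DD b r \<Longrightarrow> length w = r \<Longrightarrow> good b w \<Longrightarrow> peval (envw w) d \<noteq> 0"
    by (auto simp: DD_def good_def split: if_splits)
qed

text \<open>The witness that no admissible denominator is zero.\<close>

lemma ex_good: "\<exists>w. length w = r \<and> good b w"
  by (rule exI[of _ "map (\<lambda>i. (of_nat (Suc i), 0)) [0..<r]"])
    (auto simp: good_def gen_def o_def distinct_map inj_on_def)

lemma DD_nz: "d \<in> DD b r \<Longrightarrow> d \<noteq> 0"
  using ex_good[of r b] DD_peval by force

text \<open>A fraction is represented by a function on words of the given length if the latter
  consists of the values of the fraction, at generic points or, if no denominator is allowed, at all
  points.\<close>

definition rep :: "bool \<Rightarrow> nat \<Rightarrow> pser fract \<Rightarrow> (pt list \<Rightarrow> rat) \<Rightarrow> bool" where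
  "rep b r a f \<longleftrightarrow> (\<exists>p d. p \<in> Poly r \<and> d \<in> DD b r \<and> a = Fract p d
     \<and> (\<forall>w. length w = r \<longrightarrow> good b w \<longrightarrow> f w = peval (envw w) p / peval (envw w) d))"

definition repw :: "bool \<Rightarrow> nat \<Rightarrow> pser fract \<Rightarrow> (pt list \<Rightarrow> rat) \<Rightarrow> pser \<Rightarrow> pser \<Rightarrow> bool" where
  "repw b r a f p d \<longleftrightarrow> p \<in> Poly r \<and> d \<in> DD b r \<and> a = Fract p d
     \<and> (\<forall>w. length w = r \<longrightarrow> good b w \<longrightarrow> f w = peval (envw w) p / peval (envw w) d)"

lemma rep_repw: "rep b r a f \<longleftrightarrow> (\<exists>p d. repw b r a f p d)"
  by (simp add: rep_def repw_def)

lemma repwD: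
  assumes "repw b r a f p d"
  shows "p \<in> Poly r" "d \<in> DD b r" "a = Fract p d"
    "\<And>w. length w = r \<Longrightarrow> good b w \<Longrightarrow> f w = peval (envw w) p / peval (envw w) d" "d \<noteq> 0"
    "\<And>w. length w = r \<Longrightarrow> good b w \<Longrightarrow> peval (envw w) d \<noteq> 0" "polynomial_pser p" "polynomial_pser d"
    "d \<in> Poly r"
  using assms DD_nz DD_peval DD_Poly Poly_polynomial unfolding repw_def by blast+

lemma repI: "p \<in> Poly r \<Longrightarrow> d \<in> DD b r \<Longrightarrow> a = Fract p d
    \<Longrightarrow> (\<And>w. length w = r \<Longrightarrow> good b w \<Longrightarrow> f w = peval (envw w) p / peval (envw w) d) \<Longrightarrow> rep b r a f"
  unfolding rep_def by blast

lemma rep_cong: "rep b r a f \<Longrightarrow> (\<And>w. length w = r \<Longrightarrow> good b w \<Longrightarrow> f w = g w) \<Longrightarrow> rep b r a g"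
  unfolding rep_def by (metis (no_types, lifting))

lemma rep_True: "rep False r a f \<Longrightarrow> rep True r a f"
proof -
  assume "rep False r a f"
  then obtain p d where "repw False r a f p d" unfolding rep_repw by blast
  note 1 = repwD[OF this]
  show ?thesis by (rule repI[of p _ d]) (use 1 in \<open>auto simp: DD_def good_def Den.one\<close>)
qed

lemma rep_poly: "p \<in> Poly r \<Longrightarrow> rep b r (to_fract p) (\<lambda>w. peval (envw w) p)"
  by (rule repI[of p _ 1]) (simp_all add: to_fract_def)

lemma rep_add: assumes "rep b r x f" "rep b r y g" shows "rep b r (x + y) (\<lambda>w. f w + g w)"
proof -
  obtain p d where "repw b r x f p d" using assms(1) unfolding rep_repw by blast
  note 1 = repwD[OF this]
  obtain q e where "repw b r y g q e" using assms(2) unfolding rep_repw by blast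
  note 2 = repwD[OF this]
  show ?thesis
  proof (rule repI[of "p * e + q * d" _ "d * e"])
    show "p * e + q * d \<in> Poly r" using 1 2 DD_Poly by (intro Poly_add Poly_mult) auto
    show "d * e \<in> DD b r" using 1 2 by (intro DD_mult)
    show "x + y = Fract (p * e + q * d) (d * e)" using 1 2 by simp
  qed (use 1 2 in \<open>simp add: peval_add peval_mult polynomial_mult add_frac_eq\<close>)
qed

lemma rep_mult: assumes "rep b r x f" "rep b r y g" shows "rep b r (x * y) (\<lambda>w. f w * g w)"
proof -
  obtain p d where "repw b r x f p d" using assms(1) unfolding rep_repw by blast
  note 1 = repwD[OF this]
  obtain q e where "repw b r y g q e" using assms(2) unfolding rep_repw by blast
  note 2 = repwD[OF this]
  show ?thesis
  proof (rule repI[of "p * q" _ "d * e"])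
    show "p * q \<in> Poly r" using 1 2 by (intro Poly_mult)
    show "d * e \<in> DD b r" using 1 2 by (intro DD_mult)
    show "x * y = Fract (p * q) (d * e)" using 1 2 by simp
  qed (use 1 2 in \<open>simp add: peval_mult\<close>)
qed

lemma rep_const: "rep b r (to_fract (pconst c)) (\<lambda>w. c)"
  using rep_poly[of "pconst c" r b] by simp

lemma rep_zero: "rep b r 0 (\<lambda>w. 0)"
  using rep_poly[of 0 r b] by simp

lemma rep_one: "rep b r 1 (\<lambda>w. 1)"
  using rep_poly[of 1 r b] by simp

lemma to_fract_uminus: "to_fract (- p) = - to_fract p" by (simp add: to_fract_def)

lemma rep_uminus: "rep b r x f \<Longrightarrow> rep b r (- x) (\<lambda>w. - f w)"
  using rep_mult[OF rep_const[of b r "-1"], of x f] by (simp add: pconst_uminus pconst_1 to_fract_uminus)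

lemma rep_minus: "rep b r x f \<Longrightarrow> rep b r y g \<Longrightarrow> rep b r (x - y) (\<lambda>w. f w - g w)"
  using rep_add[OF _ rep_uminus, of b r x f y g] by simp

lemma rep_sum: "(\<And>i. i \<in> I \<Longrightarrow> rep b r (x i) (f i)) \<Longrightarrow> rep b r (sum x I) (\<lambda>w. \<Sum>i\<in>I. f i w)"
  by (induction I rule: infinite_finite_induct) (auto intro: rep_zero rep_add)

lemma rep_prod: "(\<And>i. i \<in> I \<Longrightarrow> rep b r (x i) (f i)) \<Longrightarrow> rep b r (prod x I) (\<lambda>w. \<Prod>i\<in>I. f i w)"
  by (induction I rule: infinite_finite_induct) (auto intro: rep_one rep_mult)

lemma rep_fX: "i \<in> {1..r} \<Longrightarrow> rep b r (fX i) (\<lambda>w. fst (w ! (i - 1)))"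
  using rep_poly[of "pvar (VX i)" r b] by (simp add: fX_def Poly_pvar vars_def)

lemma rep_fY: "i \<in> {1..r} \<Longrightarrow> rep b r (fY i) (\<lambda>w. snd (w ! (i - 1)))"
  using rep_poly[of "pvar (VY i)" r b] by (simp add: fY_def Poly_pvar vars_def)

lemma rep_inverse:
  assumes "d \<in> DD b r" shows "rep b r (1 / to_fract d) (\<lambda>w. 1 / peval (envw w) d)"
proof (rule repI[OF _ assms, of 1])
  show "1 / to_fract d = Fract 1 d"
    using DD_nz[OF assms] by (simp add: to_fract_def One_fract_def)
qed simp_all

definition DF :: "nat \<Rightarrow> linform set" where
  "DF r = {xf i | i. i \<in> {1..r}} \<union> {xf i - xf j | i j. i \<in> {1..r} \<and> j \<in> {1..r} \<and> i \<noteq> j}"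

definition okx :: "bool \<Rightarrow> nat \<Rightarrow> linform list \<Rightarrow> bool" where
  "okx b r xs \<longleftrightarrow> (\<forall>x\<in>set xs. keys x \<subseteq> vars r) \<and>
     (b \<longrightarrow> set xs \<subseteq> DF r \<and> (\<forall>i<length xs. \<forall>j<length xs. i \<noteq> j \<longrightarrow> xs ! i - xs ! j \<in> DF r))"

definition okf :: "nat \<Rightarrow> linform list \<Rightarrow> bool" where "okf r ys \<longleftrightarrow> (\<forall>y\<in>set ys. keys y \<subseteq> vars r)"

lemma keys_xf [simp]: "keys (xf i) = {VX i}" and keys_yf [simp]: "keys (yf i) = {VY i}"
  by (simp_all add: xf_def yf_def)

lemma keys_DF: "x \<in> DF r \<Longrightarrow> keys x \<subseteq> vars r"
  using keys_minus_subset[of "xf _" "xf _"] by (fastforce simp: DF_def vars_def)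

lemma plin_xf [simp]: "plin (xf i) = pvar (VX i)"
  by (simp add: plin_expand) (simp add: xf_def pconst_1)

lemma plin_minus: "plin (l - k) = plin l - plin k"
proof (rule pser_eqI)
  fix m
  have c: "pcoeff (plin l) m = (if mdeg m = 1 then lookup (lin_poly l) m else 0)" for l
    by (auto simp: pcoeff.rep_eq plin.rep_eq fps_mult_right_const_nth)
  have lp: "lookup (lin_poly l) m = (\<Sum>v | m = Poly_Mapping.single v (Suc 0). lookup l v)" for l
  proof -
    have "lookup (lin_poly l) m = (\<Sum>v\<in>keys l. if m = Poly_Mapping.single v (Suc 0) then lookup l v else 0)"
      by (auto simp: lin_poly_def lookup_sum lookup_single when_def intro!: sum.cong)
    also have "\<dots> = (\<Sum>v\<in>keys l \<inter> {v. m = Poly_Mapping.single v (Suc 0)}. lookup l v)"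
      by (simp add: sum.inter_restrict)
    also have "\<dots> = (\<Sum>v | m = Poly_Mapping.single v (Suc 0). lookup l v)"
    proof (rule sum.mono_neutral_left)
      have "{v. m = Poly_Mapping.single v (Suc 0)} \<subseteq> keys m" by auto
      then show "finite {v. m = Poly_Mapping.single v (Suc 0)}" by (rule finite_subset) simp
    qed (auto simp: in_keys_iff)
    finally show ?thesis .
  qed
  show "pcoeff (plin (l - k)) m = pcoeff (plin l - plin k) m"
    by (simp add: pcoeff_minus c lp lookup_minus sum_subtractf)
qed

lemma plin_DF: "x \<in> DF r \<Longrightarrow> d \<in> Den r \<Longrightarrow> d * plin x \<in> Den r"
  by (auto simp: DF_def plin_minus intro!: Den.var Den.diff)

lemma subst_DD:
  assumes "d \<in> DD b s" "length xs = s" "okx b r xs"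
  shows "pser_subst (arg_subst xs ys) d \<in> DD b r"
proof (cases b)
  case True
  have "d \<in> Den s" using assms True by (simp add: DD_def)
  then have "pser_subst (arg_subst xs ys) d \<in> Den r"
  proof (induction d rule: Den.induct)
    case one then show ?case by (simp add: Den.one)
  next
    case (var d i)
    then have "xs ! (i - 1) \<in> DF r" using assms True nth_mem[of "i - 1" xs] by (auto simp: okx_def)
    then show ?case using var assms(2) by (simp add: pser_subst_mult plin_DF)
  next
    case (diff d i j)
    then have "xs ! (i - 1) - xs ! (j - 1) \<in> DF r" using assms True by (auto simp: okx_def)
    then show ?case using diff assms(2)
      by (simp add: pser_subst_mult pser_subst_minus plin_minus[symmetric] plin_DF)
  qed
  then show ?thesis using True by (simp add: DD_def)
next
  case False
  then show ?thesis using assms by (simp add: DD_def)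
qed

definition evl :: "pt list \<Rightarrow> linform list \<Rightarrow> linform list \<Rightarrow> pt list" where
  "evl w xs ys = zip (map (lev (envw w)) xs) (map (lev (envw w)) ys)"

lemma lev_DF: "x \<in> DF r \<Longrightarrow> gen w \<Longrightarrow> length w = r \<Longrightarrow> lev (envw w) x \<noteq> 0"
  using gen_nth gen_nth_diff by (auto simp: DF_def lev_minus)

lemma good_evl:
  assumes "okx b r xs" "length ys = length xs" "good b w" "length w = r"
  shows "good b (evl w xs ys)"
proof -
  have "gen (evl w xs ys)" if b
  proof -
    have g: "gen w" using assms that by (simp add: good_def)
    have m: "map fst (evl w xs ys) = map (lev (envw w)) xs"
      using assms by (simp add: evl_def)
    have "distinct (map (lev (envw w)) xs)"
    proof (subst distinct_conv_nth, intro allI impI)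
      fix i j assume ij: "i < length (map (lev (envw w)) xs)" "j < length (map (lev (envw w)) xs)" "i \<noteq> j"
      then have "xs ! i - xs ! j \<in> DF r" using assms(1) that by (auto simp: okx_def)
      then have "lev (envw w) (xs ! i - xs ! j) \<noteq> 0" using lev_DF g assms(4) by blast
      then show "map (lev (envw w)) xs ! i \<noteq> map (lev (envw w)) xs ! j" using ij by (simp add: lev_minus)
    qed
    moreover have "0 \<notin> set (map fst (evl w xs ys))"
      unfolding m using assms(1) that lev_DF[OF _ g assms(4)] by (auto simp: okx_def)
    ultimately show ?thesis unfolding gen_def m[symmetric] by simp
  qed
  then show ?thesis by (simp add: good_def)
qed

text \<open>Substitution by linear forms whose differences are again admissible denominators. The
  junk value in the definition of substitution is not reached since the denominators stay
  nonzero.\<close>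

lemma rep_subst:
  assumes f: "rep b s a f" and l: "length xs = s" "length ys = s" and ok: "okx b r xs" "okf r ys"
  shows "rep b r (fract_subst (arg_subst xs ys) a) (\<lambda>w. f (evl w xs ys))"
proof -
  obtain p d where "repw b s a f p d" using f unfolding rep_repw by blast
  note 1 = repwD[OF this]
  let ?\<sigma> = "arg_subst xs ys"
  have d: "pser_subst ?\<sigma> d \<in> DD b r" by (rule subst_DD[OF 1(2) l(1) ok(1)])
  have k: "keys (?\<sigma> v) \<subseteq> vars r" if "v \<in> vars s" for v
  proof (cases v)
    case (VX i)
    then have i: "i \<in> {1..s}" using that by (auto simp: vars_def)
    then have "xs ! (i - 1) \<in> set xs" using l by (intro nth_mem) auto
    then have "keys (xs ! (i - 1)) \<subseteq> vars r" using ok(1) unfolding okx_def by blast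
    then show ?thesis using VX i l by simp
  next
    case (VY i)
    then have i: "i \<in> {1..s}" using that by (auto simp: vars_def)
    then have "ys ! (i - 1) \<in> set ys" using l by (intro nth_mem) auto
    then have "keys (ys ! (i - 1)) \<subseteq> vars r" using ok(2) unfolding okf_def by blast
    then show ?thesis using VY i l by simp
  qed
  show ?thesis
  proof (rule repI[OF _ d])
    show "pser_subst ?\<sigma> p \<in> Poly r" using 1(1) k by (rule Poly_subst)
    show "fract_subst ?\<sigma> a = Fract (pser_subst ?\<sigma> p) (pser_subst ?\<sigma> d)"
      unfolding 1(3) by (rule fract_subst_Fract) (rule DD_nz[OF d])
    fix w assume w: "length w = r" "good b w"
    have e: "lev (envw w) (?\<sigma> v) = envw (evl w xs ys) v" if "v \<in> vars s" for v
      using that l by (auto simp: vars_def evl_def)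
    have "peval (envw w) (pser_subst ?\<sigma> q) = peval (envw (evl w xs ys)) q" if "q \<in> Poly s" for q
      using that by (simp add: peval_subst Poly_polynomial) (rule peval_cong, auto simp: e)
    then show "f (evl w xs ys) = peval (envw w) (pser_subst ?\<sigma> p) / peval (envw w) (pser_subst ?\<sigma> d)"
      using 1(1,9) 1(4)[of "evl w xs ys"] good_evl[OF ok(1) _ w(2,1), of ys] l by (simp add: evl_def)
  qed
qed

text \<open>All components of a bimould are represented by one function on words of points.\<close>

definition BR :: "bool \<Rightarrow> bimould \<Rightarrow> (pt list \<Rightarrow> rat) \<Rightarrow> bool" where
  "BR b A f \<longleftrightarrow> (\<forall>r. rep b r (A r) f)"

lemma rep_bapp:
  assumes "BR b A f" "length ys = length xs" "okx b r xs" "okf r ys"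
  shows "rep b r (bapp A xs ys) (\<lambda>w. f (evl w xs ys))"
  unfolding bapp_def by (rule rep_subst) (use assms in \<open>auto simp: BR_def\<close>)

section \<open>Representation of the flexion operations\<close>

text \<open>The recursion unfolded to a sum over all factors, to be matched with the sums over pairs
  of indices in the flexion operations.\<close>

lemma der_closed:
  "der K f w = (\<Sum>p<length w. \<Sum>j<length w - p. K (take (Suc j) (drop p w)) (\<lambda>l. f (take p w @ l # drop (p + Suc j) w)))"
proof (induction w arbitrary: f)
  case (Cons c w)
  have "(\<Sum>p<length (c # w). \<Sum>j<length (c # w) - p. K (take (Suc j) (drop p (c # w))) (\<lambda>l. f (take p (c # w) @ l # drop (p + Suc j) (c # w))))
     = (\<Sum>j<Suc (length w). K (c # take j w) (\<lambda>l. f (l # drop j w)))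
       + (\<Sum>p<length w. \<Sum>j<length w - p. K (take (Suc j) (drop p w)) (\<lambda>l. f (c # take p w @ l # drop (p + Suc j) w)))"
    by (simp add: sum.lessThan_Suc_shift del: sum.lessThan_Suc)
  then show ?case by (simp only: Cons der.simps lessThan_Suc_atMost add.commute)
qed simp

lemma evl_append: "length xs = length ys \<Longrightarrow> evl w (xs @ xs') (ys @ ys') = evl w xs ys @ evl w xs' ys'"
  by (simp add: evl_def)

lemma evl_Cons [simp]: "evl w (x # xs) (y # ys) = (lev (envw w) x, lev (envw w) y) # evl w xs ys"
  by (simp add: evl_def)

lemma evl_upt: "1 \<le> a \<Longrightarrow> b \<le> length w + 1 \<Longrightarrow> evl w (map xf [a..<b]) (map yf [a..<b]) = take (b - a) (drop (a - 1) w)"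
  by (rule nth_equalityI) (auto simp: evl_def)

lemma evl_upt_tr: "1 \<le> a \<Longrightarrow> b \<le> length w + 1 \<Longrightarrow>
  evl w (map (\<lambda>i. xf i - xf c) [a..<b]) (map yf [a..<b]) = tr (fst (w ! (c - 1))) (take (b - a) (drop (a - 1) w))"
  by (rule nth_equalityI) (auto simp: evl_def tr_def lev_minus)

lemma okx_xf: "distinct is \<Longrightarrow> set is \<subseteq> {1..r} \<Longrightarrow> okx b r (map xf is)"
proof -
  assume *: "distinct is" "set is \<subseteq> {1..r}"
  have 1: "xf i \<in> DF r" if "i \<in> set is" for i
    unfolding DF_def using that * by blast
  have 2: "xf (is ! i) - xf (is ! j) \<in> DF r" if "i < length is" "j < length is" "i \<noteq> j" for i j
    unfolding DF_def using that * nth_eq_iff_index_eq[of "is" i j] nth_mem[of i "is"] nth_mem[of j "is"] by blast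
  have "keys (xf i) \<subseteq> vars r" if "i \<in> set is" for i using keys_DF[OF 1[OF that]] .
  then show ?thesis unfolding okx_def using 1 2 by auto
qed

lemma okx_diff: "distinct is \<Longrightarrow> set is \<subseteq> {1..r} \<Longrightarrow> c \<in> {1..r} \<Longrightarrow> c \<notin> set is \<Longrightarrow> okx b r (map (\<lambda>i. xf i - xf c) is)"
proof -
  assume *: "distinct is" "set is \<subseteq> {1..r}" "c \<in> {1..r}" "c \<notin> set is"
  have 1: "xf i - xf c \<in> DF r" if "i \<in> set is" for i
    unfolding DF_def using that * by blast
  have 2: "xf (is ! i) - xf (is ! j) \<in> DF r" if "i < length is" "j < length is" "i \<noteq> j" for i j
    unfolding DF_def using that * nth_eq_iff_index_eq[of "is" i j] nth_mem[of i "is"] nth_mem[of j "is"] by blast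
  have "keys (xf i - xf c) \<subseteq> vars r" if "i \<in> set is" for i using keys_DF[OF 1[OF that]] .
  then show ?thesis unfolding okx_def using 1 2 by auto
qed

lemma okf_yf: "set is \<subseteq> {1..r} \<Longrightarrow> okf r (map yf is)"
  by (auto simp: okf_def vars_def)

lemma keys_yspan: "1 \<le> a \<Longrightarrow> b \<le> r \<Longrightarrow> keys (yspan a b) \<subseteq> vars r"
  unfolding yspan_def using keys_sum[of yf "{a..b}"] by (force simp: vars_def)

lemma lev_yspan: "lev \<rho> (yspan a b) = (\<Sum>i=a..b. \<rho> (VY i))"
  by (simp add: yspan_def lev_sum)

lemma ysum_nth: "ysum w = (\<Sum>i<length w. snd (w ! i))"
  by (simp add: ysum_def sum_list_sum_nth atLeast0LessThan)

lemma yspan_block: "1 \<le> a \<Longrightarrow> a \<le> b \<Longrightarrow> b \<le> length w \<Longrightarrow> lev (envw w) (yspan a b) = ysum (take (Suc (b - a)) (drop (a - 1) w))"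
proof -
  assume *: "1 \<le> a" "a \<le> b" "b \<le> length w"
  have "(\<Sum>i=a..b. snd (w ! (i - 1))) = (\<Sum>i<Suc (b - a). snd (w ! (a - 1 + i)))"
    by (rule sum.reindex_bij_witness[of _ "\<lambda>i. a + i" "\<lambda>i. i - a"]) (use * in auto)
  moreover have "length (take (Suc (b - a)) (drop (a - 1) w)) = Suc (b - a)" using * by auto
  ultimately show ?thesis unfolding lev_yspan ysum_nth using * by simp
qed

lemma BR_mu:
  assumes "BR b A f" "BR b B g" shows "BR b (mu A B) (lmu f g)"
  unfolding BR_def
proof
  fix r
  have "rep b r (mu A B r) (\<lambda>w. \<Sum>i=0..r. f (evl w (map xf [1..<i+1]) (map yf [1..<i+1]))
      * g (evl w (map xf [i+1..<r+1]) (map yf [i+1..<r+1])))"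
    unfolding mu_def
    by (intro rep_sum rep_mult rep_bapp assms okx_xf okf_yf) auto
  then show "rep b r (mu A B r) (lmu f g)"
  proof (rule rep_cong)
    fix w :: "pt list" assume w: "length w = r"
    show "(\<Sum>i=0..r. f (evl w (map xf [1..<i+1]) (map yf [1..<i+1])) * g (evl w (map xf [i+1..<r+1]) (map yf [i+1..<r+1])))
       = lmu f g w"
      unfolding lmu_def w atLeast0AtMost by (intro sum.cong refl) (subst (1 2) evl_upt, use w in auto)
  qed
qed

definition kamit :: "(pt list \<Rightarrow> rat) \<Rightarrow> ker" where
  "kamit B m \<phi> = \<phi> (fst (last m), ysum m) * B (tr (fst (last m)) (butlast m))"

lemma karit_kamit: "karit B m \<phi> = kamit B m \<phi> - kan B m \<phi>"
  by (simp add: karit_def kamit_def kan_def)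

lemma sum_blocks:
  assumes "\<And>p. h p 0 = (0 :: rat)"
  shows "(\<Sum>(a, b) | 1 \<le> a \<and> a < b \<and> b \<le> r. h (a - 1) (b - a)) = (\<Sum>p<(r :: nat). \<Sum>j<r - p. h p j)"
proof -
  have "(\<Sum>p<r. \<Sum>j<r - p. h p j) = (\<Sum>(p, j)\<in>(SIGMA p:{..<r}. {..<r - p}). h p j)"
    by (subst sum.Sigma) auto
  also have "\<dots> = (\<Sum>(p, j)\<in>(SIGMA p:{..<r}. {1..<r - p}). h p j)"
    by (rule sum.mono_neutral_right) (use assms in \<open>auto simp: Suc_le_eq intro!: Nat.gr0I\<close>)
  also have "\<dots> = (\<Sum>(a, b) | 1 \<le> a \<and> a < b \<and> b \<le> r. h (a - 1) (b - a))"
    by (rule sum.reindex_bij_witness[of _ "\<lambda>(a, b). (a - 1, b - a)" "\<lambda>(p, j). (p + 1, p + 1 + j)"]) auto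
  finally show ?thesis by simp
qed

lemma okx_two: "1 \<le> a \<Longrightarrow> a \<le> c \<Longrightarrow> a \<le> r + 1 \<Longrightarrow> okx b r (map xf [1..<a] @ map xf [c..<r+1])"
  unfolding map_append[symmetric] by (rule okx_xf) auto

lemma take_drop_last: "p + j < length w \<Longrightarrow> last (take (Suc j) (drop p w)) = w ! (p + j)"
  "p + j < length w \<Longrightarrow> butlast (take (Suc j) (drop p w)) = take j (drop p w)"
  by (simp_all add: last_conv_nth butlast_take)

lemma butlast_tl_take1: "butlast (take (Suc 0) v) = []" "tl (take (Suc 0) v) = []"
  by (cases v; simp)+

lemma take_drop_hd: "p < length w \<Longrightarrow> hd (take (Suc j) (drop p w)) = w ! p"
  "p < length w \<Longrightarrow> tl (take (Suc j) (drop p w)) = take j (drop (Suc p) w)"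
  by (simp_all add: hd_drop_conv_nth tl_take drop_Suc tl_drop)

lemma BR_amit:
  assumes "BR b A f" "BR b B g" "g [] = 0" shows "BR b (amit B A) (der (kamit g) f)"
  unfolding BR_def
proof
  fix r
  let ?F = "\<lambda>w (a, c). f (evl w (map xf [1..<a] @ map xf [c..<r+1]) (map yf [1..<a] @ [yspan a c] @ map yf [c+1..<r+1]))
      * g (evl w (map (\<lambda>i. xf i - xf c) [a..<c]) (map yf [a..<c]))"
  have "rep b r (amit B A r) (\<lambda>w. \<Sum>(a, c) | 1 \<le> a \<and> a < c \<and> c \<le> r. ?F w (a, c))"
    unfolding amit_def
  proof -
    have "rep b r (bapp A (map xf [1..<a] @ map xf [c..<r+1]) (map yf [1..<a] @ [yspan a c] @ map yf [c+1..<r+1])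
        * bapp B (map (\<lambda>i. xf i - xf c) [a..<c]) (map yf [a..<c])) (\<lambda>w. ?F w (a, c))"
      if ac: "1 \<le> a" "a < c" "c \<le> r" for a c
    proof -
    have 1: "okx b r (map xf [1..<a] @ map xf [c..<r+1])" by (rule okx_two) (use ac in auto)
    have 2: "okf r (map yf [1..<a] @ [yspan a c] @ map yf [c+1..<r+1])"
      using keys_yspan[of a c r] ac by (auto simp: okf_def vars_def simp del: upt_Suc)
    have 3: "okx b r (map (\<lambda>i. xf i - xf c) [a..<c])" by (rule okx_diff) (use ac in auto)
    have 4: "okf r (map yf [a..<c])" by (rule okf_yf) (use ac in auto)
    show ?thesis
      by (simp only: prod.case, intro rep_mult rep_bapp assms 1 2 3 4) (use ac in auto)
    qed
    then show "rep b r (\<Sum>(a, c) | 1 \<le> a \<and> a < c \<and> c \<le> r. bapp A (map xf [1..<a] @ map xf [c..<r+1]) (map yf [1..<a] @ [yspan a c] @ map yf [c+1..<r+1])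
        * bapp B (map (\<lambda>i. xf i - xf c) [a..<c]) (map yf [a..<c])) (\<lambda>w. \<Sum>(a, c) | 1 \<le> a \<and> a < c \<and> c \<le> r. ?F w (a, c))"
      apply (intro rep_sum)
      subgoal for z by (cases z) (simp del: upt_Suc)
      done
  qed
  then show "rep b r (amit B A r) (der (kamit g) f)"
  proof (rule rep_cong)
    fix w :: "pt list" assume w: "length w = r"
    have "(\<Sum>(a, c) | 1 \<le> a \<and> a < c \<and> c \<le> r. ?F w (a, c))
      = (\<Sum>(a, c) | 1 \<le> a \<and> a < c \<and> c \<le> r. kamit g (take (Suc (c - a)) (drop (a - 1) w)) (\<lambda>l. f (take (a - 1) w @ l # drop (a - 1 + Suc (c - a)) w)))"
    proof (rule sum.cong[OF refl], clarify)
      fix a c assume ac: "1 \<le> a" "a < c" "c \<le> r"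
      have e1: "evl w (map xf [1..<a] @ map xf [c..<r+1]) (map yf [1..<a] @ [yspan a c] @ map yf [c+1..<r+1])
          = take (a - 1) w @ (fst (w ! (c - 1)), ysum (take (Suc (c - a)) (drop (a - 1) w))) # drop c w"
        using ac w by (subst evl_append) (simp_all add: evl_upt[of 1, simplified] upt_conv_Cons[of c] evl_upt yspan_block del: upt_Suc)
      have e2: "evl w (map (\<lambda>i. xf i - xf c) [a..<c]) (map yf [a..<c]) = tr (fst (w ! (c - 1))) (take (c - a) (drop (a - 1) w))"
        using ac w by (simp add: evl_upt_tr)
      have e3: "last (take (Suc (c - a)) (drop (a - 1) w)) = w ! (c - 1)" "butlast (take (Suc (c - a)) (drop (a - 1) w)) = take (c - a) (drop (a - 1) w)"
        using take_drop_last[of "a - 1" "c - a" w] ac w by (simp_all add: Suc_diff_le)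
      show "f (evl w (map xf [1..<a] @ map xf [c..<r+1]) (map yf [1..<a] @ [yspan a c] @ map yf [c+1..<r+1]))
          * g (evl w (map (\<lambda>i. xf i - xf c) [a..<c]) (map yf [a..<c]))
        = kamit g (take (Suc (c - a)) (drop (a - 1) w)) (\<lambda>l. f (take (a - 1) w @ l # drop (a - 1 + Suc (c - a)) w))"
        unfolding e1 e2 kamit_def e3 using ac by simp
    qed
    also have "\<dots> = der (kamit g) f w"
      unfolding der_closed w
      by (rule sum_blocks[of "\<lambda>p j. kamit g (take (Suc j) (drop p w)) (\<lambda>l. f (take p w @ l # drop (p + Suc j) w))"])
        (use assms(3) in \<open>simp add: kamit_def butlast_tl_take1\<close>)
    finally show "(\<Sum>(a, c) | 1 \<le> a \<and> a < c \<and> c \<le> r. ?F w (a, c)) = der (kamit g) f w" .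
  qed
qed

lemma BR_anit:
  assumes "BR b A f" "BR b B g" "g [] = 0" shows "BR b (anit B A) (der (kan g) f)"
  unfolding BR_def
proof
  fix r
  let ?F = "\<lambda>w (a, c). f (evl w (map xf [1..<a+1] @ map xf [c+1..<r+1]) (map yf [1..<a] @ [yspan a c] @ map yf [c+1..<r+1]))
      * g (evl w (map (\<lambda>i. xf i - xf a) [a+1..<c+1]) (map yf [a+1..<c+1]))"
  have "rep b r (anit B A r) (\<lambda>w. \<Sum>(a, c) | 1 \<le> a \<and> a < c \<and> c \<le> r. ?F w (a, c))"
    unfolding anit_def
  proof -
    have "rep b r (bapp A (map xf [1..<a+1] @ map xf [c+1..<r+1]) (map yf [1..<a] @ [yspan a c] @ map yf [c+1..<r+1])
        * bapp B (map (\<lambda>i. xf i - xf a) [a+1..<c+1]) (map yf [a+1..<c+1])) (\<lambda>w. ?F w (a, c))"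
      if ac: "1 \<le> a" "a < c" "c \<le> r" for a c
    proof -
    have 1: "okx b r (map xf [1..<a+1] @ map xf [c+1..<r+1])" by (rule okx_two) (use ac in auto)
    have 2: "okf r (map yf [1..<a] @ [yspan a c] @ map yf [c+1..<r+1])"
      using keys_yspan[of a c r] ac by (auto simp: okf_def vars_def simp del: upt_Suc)
    have 3: "okx b r (map (\<lambda>i. xf i - xf a) [a+1..<c+1])" by (rule okx_diff) (use ac in auto)
    have 4: "okf r (map yf [a+1..<c+1])" by (rule okf_yf) (use ac in auto)
    show ?thesis
      by (simp only: prod.case, intro rep_mult rep_bapp assms 1 2 3 4) (use ac in auto)
    qed
    then show "rep b r (\<Sum>(a, c) | 1 \<le> a \<and> a < c \<and> c \<le> r. bapp A (map xf [1..<a+1] @ map xf [c+1..<r+1]) (map yf [1..<a] @ [yspan a c] @ map yf [c+1..<r+1])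
        * bapp B (map (\<lambda>i. xf i - xf a) [a+1..<c+1]) (map yf [a+1..<c+1])) (\<lambda>w. \<Sum>(a, c) | 1 \<le> a \<and> a < c \<and> c \<le> r. ?F w (a, c))"
      apply (intro rep_sum)
      subgoal for z by (cases z) (simp del: upt_Suc)
      done
  qed
  then show "rep b r (anit B A r) (der (kan g) f)"
  proof (rule rep_cong)
    fix w :: "pt list" assume w: "length w = r"
    have "(\<Sum>(a, c) | 1 \<le> a \<and> a < c \<and> c \<le> r. ?F w (a, c))
      = (\<Sum>(a, c) | 1 \<le> a \<and> a < c \<and> c \<le> r. kan g (take (Suc (c - a)) (drop (a - 1) w)) (\<lambda>l. f (take (a - 1) w @ l # drop (a - 1 + Suc (c - a)) w)))"
    proof (rule sum.cong[OF refl], clarify)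
      fix a c assume ac: "1 \<le> a" "a < c" "c \<le> r"
      have e1: "evl w (map xf [1..<a+1] @ map xf [c+1..<r+1]) (map yf [1..<a] @ [yspan a c] @ map yf [c+1..<r+1])
          = take (a - 1) w @ (fst (w ! (a - 1)), ysum (take (Suc (c - a)) (drop (a - 1) w))) # drop c w"
        using ac w upt_Suc_append[of 1 a]
        by (simp add: evl_append evl_upt[of 1, simplified] evl_upt yspan_block del: upt_Suc)
      have e2: "evl w (map (\<lambda>i. xf i - xf a) [a+1..<c+1]) (map yf [a+1..<c+1]) = tr (fst (w ! (a - 1))) (take (c - a) (drop a w))"
        using ac w by (simp add: evl_upt_tr del: upt_Suc)
      have e3: "hd (take (Suc (c - a)) (drop (a - 1) w)) = w ! (a - 1)" "tl (take (Suc (c - a)) (drop (a - 1) w)) = take (c - a) (drop a w)"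
        using take_drop_hd[of "a - 1" w "c - a"] ac w by simp_all
      show "f (evl w (map xf [1..<a+1] @ map xf [c+1..<r+1]) (map yf [1..<a] @ [yspan a c] @ map yf [c+1..<r+1]))
          * g (evl w (map (\<lambda>i. xf i - xf a) [a+1..<c+1]) (map yf [a+1..<c+1]))
        = kan g (take (Suc (c - a)) (drop (a - 1) w)) (\<lambda>l. f (take (a - 1) w @ l # drop (a - 1 + Suc (c - a)) w))"
        unfolding e1 e2 kan_def e3 using ac by simp
    qed
    also have "\<dots> = der (kan g) f w"
      unfolding der_closed w
      by (rule sum_blocks[of "\<lambda>p j. kan g (take (Suc j) (drop p w)) (\<lambda>l. f (take p w @ l # drop (p + Suc j) w))"])
        (use assms(3) in \<open>simp add: kan_def butlast_tl_take1\<close>)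
    finally show "(\<Sum>(a, c) | 1 \<le> a \<and> a < c \<and> c \<le> r. ?F w (a, c)) = der (kan g) f w" .
  qed
qed

lemma der_diff: "der (\<lambda>m \<phi>. K m \<phi> - K' m \<phi>) f w = der K f w - der K' f w"
  by (induction w arbitrary: f) (simp_all add: sum_subtractf)

lemma BR_arit:
  assumes "BR b A f" "BR b B g" "g [] = 0" shows "BR b (arit B A) (larit g f)"
proof -
  have "larit g f = (\<lambda>w. der (kamit g) f w - der (kan g) f w)"
    by (simp add: larit_def fun_eq_iff der_diff[symmetric] karit_kamit[abs_def])
  then show ?thesis
    using BR_amit[OF assms] BR_anit[OF assms] by (simp add: BR_def arit_def bminus_def rep_minus)
qed

lemma BR_preari:
  assumes "BR b A f" "BR b B g" "g [] = 0" shows "BR b (preari A B) (rmul g f)"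
  using BR_arit[OF assms] BR_mu[OF assms(1,2)]
  by (simp add: BR_def preari_def bplus_def rmul_def[abs_def] rep_add)

lemma BR_ari:
  assumes "BR b A f" "BR b B g" "f [] = 0" "g [] = 0" shows "BR b (ari A B) (lari f g)"
proof -
  have "lari f g = (\<lambda>w. rmul g f w - rmul f g w)"
    by (simp add: lari_def rmul_def fun_eq_iff)
  then show ?thesis
    using BR_preari[OF assms(1,2,4)] BR_preari[OF assms(2,1,3)] by (simp add: BR_def ari_def bminus_def rep_minus)
qed

lemma BR_Qop:
  assumes "BR b A f" shows "BR b (Qop A) (lQ f)"
  unfolding BR_def
proof
  fix r
  have "rep b r (Qop A r) (\<lambda>w. (\<Sum>i=1..r. fst (w ! (i - 1)) * snd (w ! (i - 1))) * f w)"
    unfolding Qop_def using assms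
    by (intro rep_mult rep_sum rep_fX rep_fY) (auto simp: BR_def)
  then show "rep b r (Qop A r) (lQ f)"
  proof (rule rep_cong)
    fix w :: "pt list" assume w: "length w = r"
    have "(\<Sum>i=1..r. fst (w ! (i - 1)) * snd (w ! (i - 1))) = (\<Sum>i<r. fst (w ! i) * snd (w ! i))"
      by (rule sum.reindex_bij_witness[of _ Suc "\<lambda>i. i - 1"]) auto
    also have "\<dots> = qf w" by (simp add: qf_def sum_list_sum_nth atLeast0LessThan w)
    finally show "(\<Sum>i=1..r. fst (w ! (i - 1)) * snd (w ! (i - 1))) * f w = lQ f w" by (simp add: lQ_def)
  qed
qed

lemma BR_xi1: "BR b xi1 lxi"
  unfolding BR_def
proof
  fix r :: nat show "rep b r (xi1 r) lxi"
  proof (cases "r = 1")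
    case True
    show ?thesis unfolding xi1_def using True
      by (simp, intro rep_cong[OF rep_one]) (auto simp: length_Suc_conv)
  next
    case False
    show ?thesis unfolding xi1_def using False
      by (simp, intro rep_cong[OF rep_zero]) (auto simp: lxi_def dep1_def split: list.splits)
  qed
qed

lemma to_fract_pconst_numeral: "to_fract (pconst (1 / numeral n)) = 1 / numeral n"
proof -
  have n: "to_fract (pconst (of_nat k)) = of_nat k" for k
  proof (induction k)
    case (Suc k)
    have "pcoeff (pconst c) m = (if m = 0 then c else 0)" for c m
      using pcoeff_term[of c 0 m] by (simp add: pmon_zero)
    then have "pconst (1 + of_nat k) = pconst 1 + pconst (of_nat k)"
      by (intro pser_eqI) (simp add: pcoeff_add)
    then show ?case using Suc by (simp add: pconst_1)
  qed (simp add: pconst_0)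
  have "to_fract (pconst (numeral n)) = numeral n" using n[of "numeral n"] by simp
  moreover have "to_fract (pconst (1 / numeral n * numeral n)) = to_fract (pconst (1 / numeral n)) * to_fract (pconst (numeral n))"
    by (simp only: pconst_mult to_fract_mult)
  ultimately have *: "to_fract (pconst (1 / numeral n)) * numeral n = 1" by (simp add: pconst_1)
  then have "numeral n \<noteq> (0 :: pser fract)" by auto
  with * show ?thesis by (simp add: field_simps)
qed

lemma BR_Ebim: "BR b Ebim lE"
  unfolding BR_def
proof
  fix r :: nat
  consider "r = 1" | "r = 2" | "r \<noteq> 1" "r \<noteq> 2" by blast
  then show "rep b r (Ebim r) lE"
  proof cases
    case 1
    have e: "Ebim 1 = - (fX 1 + fY 1) * to_fract (pconst (1 / 2))"
      by (simp add: Ebim_def to_fract_pconst_numeral)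
    have "rep b 1 (- (fX 1 + fY 1) * to_fract (pconst (1 / 2))) (\<lambda>w. - (fst (w ! (1 - 1)) + snd (w ! (1 - 1))) * (1 / 2))"
      by (intro rep_mult rep_uminus rep_add rep_fX rep_fY rep_const) auto
    then show ?thesis unfolding 1 e by (rule rep_cong) (auto simp: length_Suc_conv)
  next
    case 2
    have e: "Ebim 2 = to_fract (pconst (1 / 4))"
      by (simp add: Ebim_def to_fract_pconst_numeral)
    show ?thesis unfolding 2 e
      by (rule rep_cong[OF rep_const]) (auto simp: length_Suc_conv numeral_2_eq_2)
  next
    case 3
    then show ?thesis unfolding Ebim_def
      by (simp, intro rep_cong[OF rep_zero]) (auto simp: lE_def split: list.splits)
  qed
qed

section \<open>Representation of ganit and uri\<close>

lemma cutsD: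
  assumes "q \<in> cuts s r"
  shows "length q = s + 1" "q ! 0 = 0" "q ! s = r" "sorted_wrt (<) q"
    "\<And>i j. i < j \<Longrightarrow> j \<le> s \<Longrightarrow> q ! i < q ! j" "\<And>i. i \<le> s \<Longrightarrow> q ! i \<le> r" "\<And>i. i \<le> s \<Longrightarrow> i \<le> q ! i"
proof -
  show 1: "length q = s + 1" "q ! 0 = 0" "q ! s = r" "sorted_wrt (<) q"
    using assms by (simp_all add: cuts_def)
  show 2: "q ! i < q ! j" if "i < j" "j \<le> s" for i j
    using 1 that by (intro sorted_wrt_nth_less[OF 1(4)]) auto
  show "q ! i \<le> r" if "i \<le> s" for i
    using 2[of i s] 1(3) that by (cases "i = s") auto
  show "i \<le> q ! i" if "i \<le> s" for i
    using that
  proof (induction i)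
    case (Suc i)
    then show ?case using 2[of i "Suc i"] by simp
  qed simp
qed

lemma cuts_empty: "s > r \<Longrightarrow> cuts s r = {}"
  using cutsD(7)[of _ s r s] cutsD(3)[of _ s r] by fastforce

lemma cuts_0: "cuts 0 r = (if r = 0 then {[0]} else {})"
  by (auto simp: cuts_def length_Suc_conv)

lemma sum_cuts_Suc:
  "(\<Sum>q\<in>cuts (Suc s) (Suc n). F q) = (\<Sum>j\<le>n. \<Sum>q\<in>cuts s (n - j). F (0 # map (\<lambda>t. t + Suc j) q))"
proof -
  have fin: "finite (cuts s r)" for s r
  proof (rule finite_subset)
    show "cuts s r \<subseteq> {q. set q \<subseteq> {..r} \<and> length q = s + 1}"
      using cutsD by (fastforce simp: in_set_conv_nth less_Suc_eq_le)
  qed (rule finite_lists_length_eq, simp)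
  have "(\<Sum>j\<le>n. \<Sum>q\<in>cuts s (n - j). F (0 # map (\<lambda>t. t + Suc j) q))
     = (\<Sum>(j, q)\<in>(SIGMA j:{..n}. cuts s (n - j)). F (0 # map (\<lambda>t. t + Suc j) q))"
    by (subst sum.Sigma) (auto simp: fin)
  also have "\<dots> = (\<Sum>q\<in>cuts (Suc s) (Suc n). F q)"
  proof (rule sum.reindex_bij_witness[of _ "\<lambda>q. (q ! 1 - 1, map (\<lambda>t. t - q ! 1) (tl q))" "\<lambda>(j, q). 0 # map (\<lambda>t. t + Suc j) q"])
    fix q assume q: "q \<in> cuts (Suc s) (Suc n)"
    note c = cutsD[OF q]
    obtain q' where q': "q = 0 # q'" using c(1,2) by (cases q) auto
    have pos: "0 < q ! 1" "q ! 1 \<le> Suc n" using c(5)[of 0 1] c(6)[of 1] by auto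
    have ge: "q ! 1 \<le> t" if "t \<in> set q'" for t
    proof -
      obtain i where i: "i < length q'" "t = q' ! i" using \<open>t \<in> set q'\<close> by (auto simp: in_set_conv_nth)
      then have "t = q ! Suc i" "Suc i \<le> Suc s" using c(1) by (auto simp: q')
      then show ?thesis using c(5)[of 1 "Suc i"] by (cases "i = 0") auto
    qed
    have m: "map (\<lambda>t. t - q ! 1 + Suc (q ! 1 - 1)) q' = q'"
      using ge pos by (intro map_idI) simp
    show "(case (q ! 1 - 1, map (\<lambda>t. t - q ! 1) (tl q)) of (j, q) \<Rightarrow> 0 # map (\<lambda>t. t + Suc j) q) = q"
      using m by (simp add: q' o_def)
    have sw: "sorted_wrt (<) (map (\<lambda>t. t - q ! 1) q')"
      unfolding sorted_wrt_map
    proof (rule sorted_wrt_mono_rel[where P = "(<)"])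
      show "sorted_wrt (<) q'" using c(4) by (simp add: q')
    qed (use ge in \<open>auto simp: diff_less_mono\<close>)
    show "(q ! 1 - 1, map (\<lambda>t. t - q ! 1) (tl q)) \<in> (SIGMA j:{..n}. cuts s (n - j))"
      using c(1,3) pos sw by (auto simp: cuts_def q')
  next
    fix p assume "p \<in> (SIGMA j:{..n}. cuts s (n - j))"
    then obtain j q where p: "p = (j, q)" "j \<le> n" "q \<in> cuts s (n - j)" by auto
    note c = cutsD[OF p(3)]
    show "((case p of (j, q) \<Rightarrow> 0 # map (\<lambda>t. t + Suc j) q) ! 1 - 1,
         map (\<lambda>t. t - (case p of (j, q) \<Rightarrow> 0 # map (\<lambda>t. t + Suc j) q) ! 1) (tl (case p of (j, q) \<Rightarrow> 0 # map (\<lambda>t. t + Suc j) q))) = p"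
      using c(1,2) by (simp add: p o_def)
    show "(case p of (j, q) \<Rightarrow> 0 # map (\<lambda>t. t + Suc j) q) \<in> cuts (Suc s) (Suc n)"
      using c(1-4) p(2) by (auto simp: p cuts_def sorted_wrt_map)
  qed auto
  finally show ?thesis by simp
qed

definition lt :: "pt list \<Rightarrow> nat \<Rightarrow> nat \<Rightarrow> pt" where
  "lt w a b = (fst (w ! a), ysum (take (b - a) (drop a w)))"

definition bt :: "pt list \<Rightarrow> nat \<Rightarrow> nat \<Rightarrow> pt list" where
  "bt w a b = tr (fst (w ! a)) (take (b - a - 1) (drop (Suc a) w))"

text \<open>The contribution of one cutting of the word to ganit.\<close>

definition gcut :: "(pt list \<Rightarrow> rat) \<Rightarrow> (pt list \<Rightarrow> rat) \<Rightarrow> pt list \<Rightarrow> nat \<Rightarrow> nat list \<Rightarrow> rat" where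
  "gcut c f w s q = f (map (\<lambda>i. lt w (q ! i) (q ! Suc i)) [0..<s]) * (\<Prod>i<s. c (bt w (q ! i) (q ! Suc i)))"

text \<open>The recursive endomorphism is the sum over all cuttings, which is the form used for
  bimoulds.\<close>

lemma gan_cuts: "gan (kan c) f w = (\<Sum>s\<le>length w. \<Sum>q\<in>cuts s (length w). gcut c f w s q)"
proof (induction "length w" arbitrary: f w rule: less_induct)
  case less
  show ?case
  proof (cases w)
    case Nil
    then show ?thesis by (simp add: cuts_0 gcut_def)
  next
    case (Cons a v)
    let ?n = "length v"
    let ?f = "\<lambda>j u. f ((fst a, snd a + ysum (take j v)) # u)"
    have g: "gcut c f w (Suc s) (0 # map (\<lambda>t. t + Suc j) q) = c (tr (fst a) (take j v)) * gcut c (?f j) (drop j v) s q"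
      if j: "j \<le> ?n" and q: "q \<in> cuts s (?n - j)" for j s q
    proof -
      note q = cutsD[OF q]
      have l: "lt w (t + Suc j) (t' + Suc j) = lt (drop j v) t t'" "bt w (t + Suc j) (t' + Suc j) = bt (drop j v) t t'" for t t'
        using j by (simp_all add: lt_def bt_def Cons add.commute)
      have z: "lt w 0 (Suc j) = (fst a, snd a + ysum (take j v))" "bt w 0 (Suc j) = tr (fst a) (take j v)"
        by (simp_all add: lt_def bt_def Cons)
      have "map (\<lambda>i. lt w ((0 # map (\<lambda>t. t + Suc j) q) ! i) ((0 # map (\<lambda>t. t + Suc j) q) ! Suc i)) [0..<Suc s]
         = lt w 0 (Suc j) # map (\<lambda>i. lt (drop j v) (q ! i) (q ! Suc i)) [0..<s]"
        unfolding upt_conv_Cons[OF zero_less_Suc] map_Suc_upt[symmetric]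
        using q(1,2) by (simp add: l[simplified])
      moreover have "(\<Prod>i<Suc s. c (bt w ((0 # map (\<lambda>t. t + Suc j) q) ! i) ((0 # map (\<lambda>t. t + Suc j) q) ! Suc i)))
         = c (bt w 0 (Suc j)) * (\<Prod>i<s. c (bt (drop j v) (q ! i) (q ! Suc i)))"
        unfolding prod.lessThan_Suc_shift using q(1,2) by (simp add: l[simplified])
      ultimately show ?thesis unfolding gcut_def z by simp
    qed
    have "(\<Sum>s\<le>length w. \<Sum>q\<in>cuts s (length w). gcut c f w s q) = (\<Sum>s\<le>?n. \<Sum>q\<in>cuts (Suc s) (Suc ?n). gcut c f w (Suc s) q)"
      by (simp add: Cons sum.atMost_Suc_shift cuts_0 del: sum.atMost_Suc)
    also have "\<dots> = (\<Sum>s\<le>?n. \<Sum>j\<le>?n. \<Sum>q\<in>cuts s (?n - j). c (tr (fst a) (take j v)) * gcut c (?f j) (drop j v) s q)"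
      unfolding sum_cuts_Suc by (intro sum.cong refl g) auto
    also have "\<dots> = (\<Sum>j\<le>?n. \<Sum>s\<le>?n. \<Sum>q\<in>cuts s (?n - j). c (tr (fst a) (take j v)) * gcut c (?f j) (drop j v) s q)"
      by (rule sum.swap)
    also have "\<dots> = (\<Sum>j\<le>?n. c (tr (fst a) (take j v)) * (\<Sum>s\<le>?n - j. \<Sum>q\<in>cuts s (?n - j). gcut c (?f j) (drop j v) s q))"
    proof (intro sum.cong refl)
      fix j assume "j \<in> {..?n}"
      have "(\<Sum>s\<le>?n. \<Sum>q\<in>cuts s (?n - j). c (tr (fst a) (take j v)) * gcut c (?f j) (drop j v) s q)
          = (\<Sum>s\<le>?n - j. \<Sum>q\<in>cuts s (?n - j). c (tr (fst a) (take j v)) * gcut c (?f j) (drop j v) s q)"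
        by (rule sum.mono_neutral_right) (auto simp: cuts_empty)
      then show "(\<Sum>s\<le>?n. \<Sum>q\<in>cuts s (?n - j). c (tr (fst a) (take j v)) * gcut c (?f j) (drop j v) s q)
         = c (tr (fst a) (take j v)) * (\<Sum>s\<le>?n - j. \<Sum>q\<in>cuts s (?n - j). gcut c (?f j) (drop j v) s q)"
        by (simp add: sum_distrib_left)
    qed
    also have "\<dots> = gan (kan c) f w"
      unfolding Cons gkan_Cons by (intro sum.cong refl) (simp add: less Cons)
    finally show ?thesis by simp
  qed
qed

lemma BR_ganit:
  assumes "BR b A f" "BR b C c" shows "BR b (ganit C A) (gan (kan c) f)"
  unfolding BR_def
proof
  fix r
  show "rep b r (ganit C A r) (gan (kan c) f)"
  proof (cases "r = 0")
    case True
    then show ?thesis using assms(1) unfolding BR_def ganit_def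
      by (auto intro: rep_cong)
  next
    case False
    let ?xs = "\<lambda>s q. map (\<lambda>i. xf (q ! (i - 1) + 1)) [1..<s+1]"
    let ?ys = "\<lambda>s q. map (\<lambda>i. yspan (q ! (i - 1) + 1) (q ! i)) [1..<s+1]"
    let ?xs' = "\<lambda>q i. map (\<lambda>j. xf j - xf (q ! (i - 1) + 1)) [q ! (i - 1) + 2..<q ! i + 1]"
    let ?ys' = "\<lambda>q i. map yf [q ! (i - 1) + 2..<q ! i + 1]"
    have "rep b r (\<Sum>s=1..r. \<Sum>q\<in>cuts s r. bapp A (?xs s q) (?ys s q) * (\<Prod>i=1..s. bapp C (?xs' q i) (?ys' q i)))
       (\<lambda>w. \<Sum>s=1..r. \<Sum>q\<in>cuts s r. f (evl w (?xs s q) (?ys s q)) * (\<Prod>i=1..s. c (evl w (?xs' q i) (?ys' q i))))"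
    proof (intro rep_sum rep_mult rep_prod rep_bapp assms)
      fix s q assume s: "s \<in> {1..r}" and q: "q \<in> cuts s r"
      note c = cutsD[OF q]
      have b: "q ! (i - 1) < q ! i \<and> q ! i \<le> r" if "i \<in> {1..s}" for i
        using c(5)[of "i - 1" i] c(6)[of i] that by auto
      have "inj_on (\<lambda>i. q ! (i - 1) + 1) {1..<s+1}"
      proof (rule inj_onI)
        fix i j assume ij: "i \<in> {1..<s+1}" "j \<in> {1..<s+1}" "q ! (i - 1) + 1 = q ! (j - 1) + 1"
        have "i - 1 \<le> s" "j - 1 \<le> s" using ij by auto
        then have "i - 1 = j - 1"
          using c(5)[of "i - 1" "j - 1"] c(5)[of "j - 1" "i - 1"] ij(3) by (cases "i - 1" "j - 1" rule: linorder_cases) auto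
        then show "i = j" using ij by auto
      qed
      then have "okx b r (map xf (map (\<lambda>i. q ! (i - 1) + 1) [1..<s+1]))"
        using b by (intro okx_xf) (auto simp: distinct_map simp del: upt_Suc, fastforce)
      then show "okx b r (?xs s q)" by (simp add: o_def del: upt_Suc)
      show "okf r (?ys s q)"
        unfolding okf_def
      proof
        fix y assume "y \<in> set (?ys s q)"
        then obtain i where i: "i \<in> set [1..<s+1]" "y = yspan (q ! (i - 1) + 1) (q ! i)"
          unfolding set_map by blast
        then have "i \<in> {1..s}" by auto
        with i(2) show "keys y \<subseteq> vars r" using b[of i] keys_yspan[of "q ! (i - 1) + 1" "q ! i" r] by simp
      qed
      fix i assume i: "i \<in> {1..s}"
      show "okx b r (?xs' q i)" by (rule okx_diff) (use b[OF i] in auto)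
      show "okf r (?ys' q i)" by (rule okf_yf) (use b[OF i] in auto)
    qed auto
    then have "rep b r (ganit C A r) (\<lambda>w. \<Sum>s=1..r. \<Sum>q\<in>cuts s r. f (evl w (?xs s q) (?ys s q)) * (\<Prod>i=1..s. c (evl w (?xs' q i) (?ys' q i))))"
      using False by (simp add: ganit_def)
    then show ?thesis
    proof (rule rep_cong)
      fix w :: "pt list" assume w: "length w = r"
      have e: "f (evl w (?xs s q) (?ys s q)) * (\<Prod>i=1..s. c (evl w (?xs' q i) (?ys' q i))) = gcut c f w s q"
        if s: "s \<in> {1..r}" and q: "q \<in> cuts s r" for s q
      proof -
        note c = cutsD[OF q]
        have b: "q ! i < q ! Suc i \<and> q ! Suc i \<le> r" if "i < s" for i
          using c(5)[of i "Suc i"] c(6)[of "Suc i"] that by auto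
        have 1: "evl w (?xs s q) (?ys s q) = map (\<lambda>i. lt w (q ! i) (q ! Suc i)) [0..<s]"
        proof (rule nth_equalityI)
          fix i assume "i < length (evl w (?xs s q) (?ys s q))"
          then have i: "i < s" by (simp add: evl_def del: upt_Suc)
          have "lev (envw w) (yspan (Suc (q ! i)) (q ! Suc i)) = ysum (take (q ! Suc i - q ! i) (drop (q ! i) w))"
            using b[OF i] w yspan_block[of "Suc (q ! i)" "q ! Suc i" w] by (simp add: Suc_diff_Suc)
          then show "evl w (?xs s q) (?ys s q) ! i = map (\<lambda>i. lt w (q ! i) (q ! Suc i)) [0..<s] ! i"
            using i by (simp add: evl_def lt_def del: upt_Suc)
        qed (simp add: evl_def del: upt_Suc)
        have 2: "evl w (?xs' q (Suc i)) (?ys' q (Suc i)) = bt w (q ! i) (q ! Suc i)" if "i < s" for i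
          using b[OF that] w by (subst evl_upt_tr) (auto simp: bt_def)
        have "(\<Prod>i=1..s. c (evl w (?xs' q i) (?ys' q i))) = (\<Prod>i<s. c (evl w (?xs' q (Suc i)) (?ys' q (Suc i))))"
          by (rule prod.reindex_bij_witness[of _ Suc "\<lambda>i. i - 1"]) auto
        also have "\<dots> = (\<Prod>i<s. c (bt w (q ! i) (q ! Suc i)))"
          by (intro prod.cong refl arg_cong[of _ _ c] 2) auto
        finally show ?thesis unfolding 1 gcut_def by simp
      qed
      have "(\<Sum>s=1..r. \<Sum>q\<in>cuts s r. f (evl w (?xs s q) (?ys s q)) * (\<Prod>i=1..s. c (evl w (?xs' q i) (?ys' q i))))
          = (\<Sum>s=1..r. \<Sum>q\<in>cuts s r. gcut c f w s q)"
        by (intro sum.cong refl e)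
      also have "\<dots> = (\<Sum>s\<le>r. \<Sum>q\<in>cuts s r. gcut c f w s q)"
        by (rule sum.mono_neutral_left) (use False in \<open>auto simp: cuts_0 not_less_eq_eq\<close>)
      finally show "(\<Sum>s=1..r. \<Sum>q\<in>cuts s r. f (evl w (?xs s q) (?ys s q)) * (\<Prod>i=1..s. c (evl w (?xs' q i) (?ys' q i))))
          = gan (kan c) f w"
        by (simp add: gan_cuts w)
    qed
  qed
qed

lemma lpic_nth: "lpic w = (\<Prod>i<length w. 1 / fst (w ! i))"
  by (induction w) (simp_all add: prod.lessThan_Suc_shift del: prod.lessThan_Suc)

lemma lkap_nth: "w \<noteq> [] \<Longrightarrow> lkap w = (\<Prod>i<length w - 1. 1 / (fst (w ! i) - fst (w ! Suc i)))"
  by (induction w rule: lkap.induct) (simp_all add: prod.lessThan_Suc_shift del: prod.lessThan_Suc)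

lemma rep_inverse_fX: "i \<in> {1..r} \<Longrightarrow> rep True r (1 / fX i) (\<lambda>w. 1 / fst (w ! (i - 1)))"
proof -
  assume i: "i \<in> {1..r}"
  have "pvar (VX i) \<in> DD True r" using Den.var[OF Den.one i] by (simp add: DD_def)
  from rep_inverse[OF this] show ?thesis by (simp add: fX_def)
qed

lemma rep_inverse_diff: "i \<in> {1..r} \<Longrightarrow> j \<in> {1..r} \<Longrightarrow> i \<noteq> j
    \<Longrightarrow> rep True r (1 / (fX i - fX j)) (\<lambda>w. 1 / (fst (w ! (i - 1)) - fst (w ! (j - 1))))"
proof -
  assume i: "i \<in> {1..r}" "j \<in> {1..r}" "i \<noteq> j"
  have "pvar (VX i) - pvar (VX j) \<in> DD True r" using Den.diff[OF Den.one i] by (simp add: DD_def)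
  from rep_inverse[OF this] show ?thesis by (simp add: fX_def peval_minus)
qed

lemma BR_pic: "BR True pic lpic"
  unfolding BR_def
proof
  fix r
  have "pic r = (\<Prod>i=1..r. 1 / fX i)" by (simp add: pic_def prod_dividef)
  moreover have "rep True r (\<Prod>i=1..r. 1 / fX i) (\<lambda>w. \<Prod>i=1..r. 1 / fst (w ! (i - 1)))"
    by (intro rep_prod rep_inverse_fX)
  ultimately have "rep True r (pic r) (\<lambda>w. \<Prod>i=1..r. 1 / fst (w ! (i - 1)))" by simp
  then show "rep True r (pic r) lpic"
  proof (rule rep_cong)
    fix w :: "pt list" assume "length w = r"
    then show "(\<Prod>i=1..r. 1 / fst (w ! (i - 1))) = lpic w"
      unfolding lpic_nth by (intro prod.reindex_bij_witness[of _ Suc "\<lambda>i. i - 1"]) auto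
  qed
qed

lemma BR_poc: "BR True poc lpoc"
  unfolding BR_def
proof
  fix r
  show "rep True r (poc r) lpoc"
  proof (cases "r = 0")
    case True
    then show ?thesis by (auto simp: poc_def lpoc_def intro: rep_cong[OF rep_one])
  next
    case False
    have e: "poc r = - (1 / fX 1) * (\<Prod>i=1..<r. 1 / (fX i - fX (i + 1)))"
      using False by (simp add: poc_def prod_dividef)
    have "rep True r (poc r) (\<lambda>w. - (1 / fst (w ! (1 - 1))) * (\<Prod>i=1..<r. 1 / (fst (w ! (i - 1)) - fst (w ! (i + 1 - 1)))))"
      unfolding e by (intro rep_mult rep_prod rep_uminus rep_inverse_fX rep_inverse_diff) (use False in auto)
    then show ?thesis
    proof (rule rep_cong)
      fix w :: "pt list" assume w: "length w = r"
      have "(\<Prod>i=1..<r. 1 / (fst (w ! (i - 1)) - fst (w ! (i + 1 - 1)))) = lkap w"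
        using False w by (subst lkap_nth) (auto intro!: prod.reindex_bij_witness[of _ Suc "\<lambda>i. i - 1"])
      then show "- (1 / fst (w ! (1 - 1))) * (\<Prod>i=1..<r. 1 / (fst (w ! (i - 1)) - fst (w ! (i + 1 - 1)))) = lpoc w"
        using False w by (auto simp: lpoc_def hd_conv_nth)
    qed
  qed
qed

lemma gan_Nil_simps [simp]: "gpic f [] = f []" "gpoc f [] = f []"
  by (simp_all add: gpic_def gpoc_def)

lemma BR_uri:
  assumes "BR True A f" "BR True B g" "f [] = 0" "g [] = 0" shows "BR True (uri A B) (luri f g)"
  unfolding uri_def luri_def gpic_def gpoc_def
  by (intro BR_ganit BR_ari assms BR_pic BR_poc) (simp_all add: assms)

lemma BR_delta:
  assumes "BR True A f" "f [] = 0" shows "BR True (delta_check A) (ldelta f)"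
proof -
  have "BR True (ganit pic (Qop (ganit poc A))) (gpic (lQ (gpoc f)))"
    unfolding gpic_def gpoc_def by (intro BR_ganit BR_Qop assms BR_pic BR_poc)
  moreover have "BR True (uri A Ebim) (luri f lE)"
    by (intro BR_uri assms BR_Ebim) simp
  ultimately show ?thesis
    by (simp add: BR_def delta_check_def bplus_def ldelta_def[abs_def] rep_add)
qed

lemma ldelta_Nil: "f [] = 0 \<Longrightarrow> ldelta f [] = 0"
  by (simp add: ldelta_def luri_def lQ_def lari_def)

lemma BR_delta_iterate: "BR True ((delta_check ^^ k) xi1) ((ldelta ^^ k) lxi)"
proof -
  have "BR True ((delta_check ^^ k) xi1) ((ldelta ^^ k) lxi) \<and> (ldelta ^^ k) lxi [] = 0"
    by (induction k) (auto simp: BR_xi1 BR_delta ldelta_Nil)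
  then show ?thesis by blast
qed

lemma BR_True_eqg: "BR True A f \<Longrightarrow> eqg f g \<Longrightarrow> BR True A g"
  unfolding BR_def by (auto intro: rep_cong simp: eqg_def good_def)

text \<open>At this stage the iterates are only known as localized bimoulds; polynomiality follows
  later by uniqueness of representation.\<close>

lemma BR_delta_xisq: "BR True ((delta_check ^^ k) xi1) (xisq k)"
  by (rule BR_True_eqg[OF BR_delta_iterate ldelta_iterate])

section \<open>Coefficients of a polynomial and its values\<close>

text \<open>The monomial belonging to one letter in the expansion that defines the coefficient
  map.\<close>

definition lm :: "nat \<times> nat \<Rightarrow> pt \<Rightarrow> rat" where
  "lm l c = fst c ^ (fst l - 1) * snd c ^ snd l / fact (snd l)"

text \<open>The value at a word of points of the polynomial with given coefficients, all letters
  being taken from a finite set.\<close>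

fun ev :: "(nat \<times> nat) set \<Rightarrow> (word \<Rightarrow> rat) \<Rightarrow> pt list \<Rightarrow> rat" where
  "ev B a [] = a []"
| "ev B a (c # w) = (\<Sum>l\<in>B. lm l c * ev B (\<lambda>W. a (l # W)) w)"

definition box :: "nat \<Rightarrow> (nat \<times> nat) set" where "box N = {1..N} \<times> {0..N}"

lemma finite_box [simp]: "finite (box N)" by (simp add: box_def)

definition wm :: "word \<Rightarrow> pt list \<Rightarrow> rat" where "wm W w = (\<Prod>i<length W. lm (W ! i) (w ! i))"

lemma wm_simps [simp]: "wm [] w = 1" "wm (l # W) (c # w) = lm l c * wm W w"
  by (simp_all add: wm_def prod.lessThan_Suc_shift del: prod.lessThan_Suc)

definition bwords :: "(nat \<times> nat) set \<Rightarrow> nat \<Rightarrow> word set" where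
  "bwords B n = {W. set W \<subseteq> B \<and> length W = n}"

lemma finite_bwords: "finite B \<Longrightarrow> finite (bwords B n)"
  unfolding bwords_def by (rule finite_lists_length_eq)

lemma bwords_0 [simp]: "bwords B 0 = {[]}" by (auto simp: bwords_def)

lemma sum_bwords_Suc: "finite B \<Longrightarrow> (\<Sum>W\<in>bwords B (Suc n). F W) = (\<Sum>l\<in>B. \<Sum>W\<in>bwords B n. F (l # W))"
proof -
  assume B: "finite B"
  have "(\<Sum>l\<in>B. \<Sum>W\<in>bwords B n. F (l # W)) = (\<Sum>(l, W)\<in>B \<times> bwords B n. F (l # W))"
    by (simp add: sum.cartesian_product)
  also have "\<dots> = (\<Sum>W\<in>bwords B (Suc n). F W)"
    by (rule sum.reindex_bij_witness[of _ "\<lambda>W. (hd W, tl W)" "\<lambda>(l, W). l # W"])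
      (auto simp: bwords_def length_Suc_conv)
  finally show ?thesis by simp
qed

lemma ev_closed: "finite B \<Longrightarrow> ev B a w = (\<Sum>W\<in>bwords B (length w). a W * wm W w)"
  by (induction w arbitrary: a) (simp_all add: sum_bwords_Suc sum_distrib_left mult_ac)

lemma ev_lin:
  "ev B (\<lambda>W. a W + a' W) w = ev B a w + ev B a' w"
  "ev B (\<lambda>W. k * a W) w = k * ev B a w"
  "ev B (\<lambda>W. 0) w = 0"
  by (induction w arbitrary: a a') (simp_all add: algebra_simps sum.distrib sum_distrib_left)

lemma ev_sum: "ev B (\<lambda>W. \<Sum>i\<in>I. a i W) w = (\<Sum>i\<in>I. ev B (a i) w)"
  by (induction I rule: infinite_finite_induct) (simp_all add: ev_lin)

lemma ev_cong:
  "(\<And>W. set W \<subseteq> B \<Longrightarrow> length W = length w \<Longrightarrow> a W = a' W) \<Longrightarrow> ev B a w = ev B a' w"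
proof (induction w arbitrary: a a')
  case (Cons c w)
  have "ev B (\<lambda>W. a (l # W)) w = ev B (\<lambda>W. a' (l # W)) w" if "l \<in> B" for l
    by (rule Cons.IH) (use that Cons.prems in auto)
  then show ?case by simp
qed simp

lemma poly_sum_zero:
  fixes k :: "nat \<Rightarrow> rat"
  assumes "finite I" "infinite X" "\<And>x. x \<in> X \<Longrightarrow> (\<Sum>i\<in>I. k i * x ^ i) = 0" "i \<in> I"
  shows "k i = 0"
proof -
  define p where "p = (\<Sum>i\<in>I. Polynomial.monom (k i) i)"
  have "poly p x = (\<Sum>i\<in>I. k i * x ^ i)" for x by (simp add: p_def poly_sum poly_monom)
  then have "X \<subseteq> {x. poly p x = 0}" using assms(3) by auto
  then have "p = 0" using assms(2) finite_subset poly_roots_finite by blast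
  moreover have "Polynomial.coeff p i = k i" using assms(1,4) by (simp add: p_def coeff_sum)
  ultimately show ?thesis by simp
qed

text \<open>A polynomial in two variables vanishing at infinitely many \<open>x\<close> and all
  \<open>y\<close> is zero.\<close>

lemma lm_sum_zero:
  fixes T :: "nat \<times> nat \<Rightarrow> rat"
  assumes X: "infinite X" and z: "\<And>x y. x \<in> X \<Longrightarrow> (\<Sum>l\<in>box N. lm l (x, y) * T l) = 0" and l: "l \<in> box N"
  shows "T l = 0"
proof -
  have 1: "(\<Sum>m\<in>{0..N}. (\<Sum>k\<in>{1..N}. T (k, m) * x ^ (k - 1)) / fact m * y ^ m) = 0" if "x \<in> X" for x y
  proof -
    have "(\<Sum>m\<in>{0..N}. (\<Sum>k\<in>{1..N}. T (k, m) * x ^ (k - 1)) / fact m * y ^ m) = (\<Sum>k\<in>{1..N}. \<Sum>m\<in>{0..N}. lm (k, m) (x, y) * T (k, m))"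
      by (subst sum.swap) (simp add: lm_def sum_divide_distrib sum_distrib_right sum_distrib_left mult_ac)
    also have "\<dots> = (\<Sum>l\<in>box N. lm l (x, y) * T l)"
      by (simp add: box_def sum.cartesian_product)
    finally show ?thesis using z[OF that] by simp
  qed
  have 2: "(\<Sum>k\<in>{1..N}. T (k, m) * x ^ (k - 1)) = 0" if "x \<in> X" "m \<in> {0..N}" for x m
    using poly_sum_zero[of "{0..N}" "UNIV :: rat set" "\<lambda>m. (\<Sum>k\<in>{1..N}. T (k, m) * x ^ (k - 1)) / fact m" m]
      1[OF that(1)] that(2) infinite_UNIV_char_0 by auto
  have 3: "(\<Sum>k<N. T (Suc k, m) * x ^ k) = 0" if "x \<in> X" "m \<in> {0..N}" for x m
  proof -
    have "(\<Sum>k\<in>{1..N}. T (k, m) * x ^ (k - 1)) = (\<Sum>k<N. T (Suc k, m) * x ^ k)"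
      by (rule sum.reindex_bij_witness[of _ Suc "\<lambda>k. k - 1"]) auto
    then show ?thesis using 2[OF that] by simp
  qed
  obtain k m where km: "l = (Suc k, m)" "k < N" "m \<in> {0..N}"
    using l by (cases l; cases "fst l") (auto simp: box_def)
  show ?thesis
    using poly_sum_zero[of "{..<N}" X "\<lambda>k. T (Suc k, m)" k] X 3 km by auto
qed

text \<open>One letter at a time, avoiding in each step the finitely many coordinates already
  used.\<close>

lemma ev_zero:
  assumes "finite S" "\<And>w. length w = n \<Longrightarrow> distx w \<Longrightarrow> fst ` set w \<inter> S = {} \<Longrightarrow> ev (box N) a w = 0"
    "set W \<subseteq> box N" "length W = n"
  shows "a W = 0"
  using assms(2-)
proof (induction n arbitrary: a W)
  case 0
  then show ?case using "0"(1)[of "[]"] by (simp add: distx_def)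
next
  case (Suc n)
  obtain l V where W: "W = l # V" using Suc.prems(3) by (cases W) auto
  show ?case unfolding W
  proof (rule Suc.IH[of "\<lambda>V. a (l # V)"])
    fix w assume w: "length w = n" "distx w" "fst ` set w \<inter> S = {}"
    let ?X = "UNIV - (S \<union> fst ` set w)"
    have "infinite ?X" using assms(1) infinite_UNIV_char_0[where ?'a = rat] by (intro Diff_infinite_finite) auto
    then show "ev (box N) (\<lambda>V. a (l # V)) w = 0"
    proof (rule lm_sum_zero[where N = N and T = "\<lambda>l. ev (box N) (\<lambda>V. a (l # V)) w"])
      fix x y assume "x \<in> ?X"
      then have "ev (box N) a ((x, y) # w) = 0" using w by (intro Suc.prems(1)) (auto simp: distx_def)
      then show "(\<Sum>l\<in>box N. lm l (x, y) * ev (box N) (\<lambda>V. a (l # V)) w) = 0" by simp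
    qed (use Suc.prems(2) W in auto)
  qed (use Suc.prems W in auto)
qed

text \<open>The monomial in the definition of the coefficients of a bimould.\<close>

definition wmon :: "word \<Rightarrow> monom" where
  "wmon w = (\<Sum>i<length w. Poly_Mapping.single (VX (i + 1)) (fst (w ! i) - 1)
                      + Poly_Mapping.single (VY (i + 1)) (snd (w ! i)))"

lemma wmon_lookup:
  "lookup (wmon W) (VX i) = (if i \<in> {1..length W} then fst (W ! (i - 1)) - 1 else 0)"
  "lookup (wmon W) (VY i) = (if i \<in> {1..length W} then snd (W ! (i - 1)) else 0)"
proof -
  have "lookup (wmon W) (VX i) = (\<Sum>j<length W. if j = i - 1 \<and> 1 \<le> i then fst (W ! j) - 1 else 0)"
    by (auto simp: wmon_def lookup_sum lookup_add lookup_single when_def intro!: sum.cong)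
  then show "lookup (wmon W) (VX i) = (if i \<in> {1..length W} then fst (W ! (i - 1)) - 1 else 0)"
    by (cases "1 \<le> i") auto
  have "lookup (wmon W) (VY i) = (\<Sum>j<length W. if j = i - 1 \<and> 1 \<le> i then snd (W ! j) else 0)"
    by (auto simp: wmon_def lookup_sum lookup_add lookup_single when_def intro!: sum.cong)
  then show "lookup (wmon W) (VY i) = (if i \<in> {1..length W} then snd (W ! (i - 1)) else 0)"
    by (cases "1 \<le> i") auto
qed

lemma vars_iff: "VX i \<in> vars r \<longleftrightarrow> i \<in> {1..r}" "VY i \<in> vars r \<longleftrightarrow> i \<in> {1..r}"
  by (auto simp: vars_def)

definition mword :: "nat \<Rightarrow> monom \<Rightarrow> word" where
  "mword r m = map (\<lambda>i. (Suc (lookup m (VX (Suc i))), lookup m (VY (Suc i)))) [0..<r]"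

lemma mword_props: "length (mword r m) = r" "\<forall>l\<in>set (mword r m). 1 \<le> fst l"
  by (auto simp: mword_def)

lemma wmon_mword: "keys m \<subseteq> vars r \<Longrightarrow> wmon (mword r m) = m"
proof (rule poly_mapping_eqI)
  fix v assume m: "keys m \<subseteq> vars r"
  have 0: "lookup m v = 0" if "v \<notin> vars r" using that m by (auto simp: in_keys_iff subset_iff)
  show "lookup (wmon (mword r m)) v = lookup m v"
    using 0 by (cases v) (auto simp: wmon_lookup mword_def vars_iff)
qed

lemma mword_wmon: "\<forall>l\<in>set W. 1 \<le> fst l \<Longrightarrow> mword (length W) (wmon W) = W"
proof (rule nth_equalityI)
  fix i assume *: "\<forall>l\<in>set W. 1 \<le> fst l" "i < length (mword (length W) (wmon W))"
  then have i: "i < length W" by (simp add: mword_def)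
  then have "1 \<le> fst (W ! i)" using *(1) nth_mem by blast
  then show "mword (length W) (wmon W) ! i = W ! i"
    using i by (simp add: mword_def wmon_lookup prod_eq_iff)
qed (simp add: mword_def)

lemma wm_meval: "length w = length W \<Longrightarrow> (\<Prod>i<length W. fact (snd (W ! i))) * wm W w = meval (envw w) (wmon W)"
proof -
  assume l: "length w = length W"
  have "meval (envw w) (wmon W) = (\<Prod>i<length W. fst (w ! i) ^ (fst (W ! i) - 1) * snd (w ! i) ^ snd (W ! i))"
    by (simp add: wmon_def meval_sum meval_add meval_single)
  then show ?thesis by (simp add: wm_def lm_def prod.distrib[symmetric])
qed

text \<open>The coefficients of a polynomial, indexed by words and extended by zero to words with a
  forbidden letter.\<close>

definition pw :: "pser \<Rightarrow> word \<Rightarrow> rat" where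
  "pw p W = (if \<forall>l\<in>set W. 1 \<le> fst l then (\<Prod>i<length W. fact (snd (W ! i))) * pcoeff p (wmon W) else 0)"

lemma pw_bound: "polynomial_pser p \<Longrightarrow> \<exists>N. \<forall>W. pw p W \<noteq> 0 \<longrightarrow> set W \<subseteq> box N"
proof -
  assume p: "polynomial_pser p"
  define N where "N = Suc (Max (insert 0 (mdeg ` {m. pcoeff p m \<noteq> 0})))"
  have N: "mdeg m < N" if "pcoeff p m \<noteq> 0" for m
    using p that unfolding N_def polynomial_pser_def by (intro le_imp_less_Suc Max_ge) auto
  have le: "lookup m v \<le> mdeg m" for m v
  proof (cases "v \<in> keys m")
    case True
    then show ?thesis unfolding mdeg_def by (intro member_le_sum) auto
  qed (simp add: in_keys_iff)
  have "set W \<subseteq> box N" if "pw p W \<noteq> 0" for W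
  proof
    fix l assume "l \<in> set W"
    then obtain i where i: "i < length W" "l = W ! i" by (auto simp: in_set_conv_nth)
    have a: "1 \<le> fst l" "pcoeff p (wmon W) \<noteq> 0" using that \<open>l \<in> set W\<close> by (auto simp: pw_def split: if_splits)
    have "fst l - 1 \<le> mdeg (wmon W)" "snd l \<le> mdeg (wmon W)"
      using le[of "wmon W" "VX (Suc i)"] le[of "wmon W" "VY (Suc i)"] i by (simp_all add: wmon_lookup)
    with N[OF a(2)] a(1) show "l \<in> box N" by (cases l) (auto simp: box_def)
  qed
  then show ?thesis by blast
qed

lemma peval_ev:
  assumes p: "p \<in> Poly r" and N: "\<And>W. length W = r \<Longrightarrow> pw p W \<noteq> 0 \<Longrightarrow> set W \<subseteq> box N" and w: "length w = r"
  shows "peval (envw w) p = ev (box N) (pw p) w"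
proof -
  let ?S = "{W \<in> bwords (box N) r. pcoeff p (wmon W) \<noteq> 0}"
  have pos: "\<forall>l\<in>set W. 1 \<le> fst l" if "set W \<subseteq> box N" for W using that by (auto simp: box_def)
  have "ev (box N) (pw p) w = (\<Sum>W\<in>bwords (box N) r. pcoeff p (wmon W) * meval (envw w) (wmon W))"
    unfolding ev_closed[OF finite_box] w
  proof (intro sum.cong refl)
    fix W assume "W \<in> bwords (box N) r"
    then have W: "set W \<subseteq> box N" "length w = length W" using w by (auto simp: bwords_def)
    show "pw p W * wm W w = pcoeff p (wmon W) * meval (envw w) (wmon W)"
      using pos[OF W(1)] wm_meval[OF W(2)] by (simp add: pw_def)
  qed
  also have "\<dots> = (\<Sum>W\<in>?S. pcoeff p (wmon W) * meval (envw w) (wmon W))"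
    by (rule sum.mono_neutral_right) (auto simp: finite_bwords)
  also have "\<dots> = (\<Sum>m | pcoeff p m \<noteq> 0. pcoeff p m * meval (envw w) m)"
  proof (rule sum.reindex_bij_witness[of _ "mword r" wmon])
    fix m assume "m \<in> {m. pcoeff p m \<noteq> 0}"
    then have m: "pcoeff p m \<noteq> 0" "keys m \<subseteq> vars r" using p by (auto simp: Poly_iff)
    then show "wmon (mword r m) = m" by (simp add: wmon_mword)
    have "set (mword r m) \<subseteq> box N"
      by (rule N) (use m mword_props[of r m] in \<open>auto simp: pw_def wmon_mword\<close>)
    then show "mword r m \<in> ?S" using m by (simp add: bwords_def wmon_mword mword_props)
  qed (use pos in \<open>auto simp: bwords_def mword_wmon\<close>)
  finally show ?thesis by (simp add: peval_def)
qed

lemma Poly_zeroI: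
  assumes p: "p \<in> Poly r" and z: "\<And>w. length w = r \<Longrightarrow> gen w \<Longrightarrow> peval (envw w) p = 0"
  shows "p = 0"
proof (rule pser_eqI)
  fix m
  obtain N where N: "\<And>W. pw p W \<noteq> 0 \<Longrightarrow> set W \<subseteq> box N" using pw_bound Poly_polynomial[OF p] by blast
  have *: "pw p W = 0" if "length W = r" for W
  proof (rule ccontr)
    assume W: "pw p W \<noteq> 0"
    have "pw p W = 0"
    proof (rule ev_zero[where S = "{0}" and n = r])
      fix w :: "pt list" assume "length w = r" "distx w" "fst ` set w \<inter> {0} = {}"
      then show "ev (box N) (pw p) w = 0"
        using peval_ev[OF p N] z[of w] by (auto simp: gen_def distx_def)
    qed (use N[OF W] that in auto)
    with W show False by simp
  qed
  show "pcoeff p m = pcoeff 0 m"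
  proof (rule ccontr)
    assume m: "pcoeff p m \<noteq> pcoeff 0 m"
    then have "keys m \<subseteq> vars r" using p by (auto simp: Poly_iff)
    then show False using m *[of "mword r m"] mword_props[of r m] by (auto simp: pw_def wmon_mword)
  qed
qed

text \<open>Generic points are dense enough to determine a fraction.\<close>

lemma rep_unique:
  assumes "rep b r x f" "rep b r y g" "\<And>w. length w = r \<Longrightarrow> gen w \<Longrightarrow> f w = g w"
  shows "x = y"
proof -
  obtain p d where "repw b r x f p d" using assms(1) unfolding rep_repw by blast
  note 1 = repwD[OF this]
  obtain q e where "repw b r y g q e" using assms(2) unfolding rep_repw by blast
  note 2 = repwD[OF this]
  have "p * e - q * d = 0"
  proof (rule Poly_zeroI)
    show "p * e - q * d \<in> Poly r" using 1 2 by (intro Poly_minus Poly_mult)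
    fix w :: "pt list" assume w: "length w = r" "gen w"
    then have g: "good b w" by (simp add: good_def)
    have "peval (envw w) p / peval (envw w) d = peval (envw w) q / peval (envw w) e"
      using assms(3)[OF w] 1(4)[OF w(1) g] 2(4)[OF w(1) g] by simp
    then show "peval (envw w) (p * e - q * d) = 0"
      using 1(6)[OF w(1) g] 2(6)[OF w(1) g] 1(7,8) 2(7,8)
      by (simp add: peval_minus peval_mult polynomial_mult frac_eq_eq)
  qed
  then show ?thesis using 1(3,5) 2(3,5) by (simp add: eq_fract)
qed

text \<open>Conversely, a fraction determines the values of its representing function.\<close>

lemma rep_fun_unique:
  assumes "rep b r x f" "rep b r x g" "length w = r" "good b w"
  shows "f w = g w"
proof -
  obtain p d where "repw b r x f p d" using assms(1) unfolding rep_repw by blast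
  note 1 = repwD[OF this]
  obtain q e where "repw b r x g q e" using assms(2) unfolding rep_repw by blast
  note 2 = repwD[OF this]
  have "p * e = q * d" using 1(3,5) 2(3,5) by (simp add: eq_fract)
  then have "peval (envw w) p * peval (envw w) e = peval (envw w) q * peval (envw w) d"
    using 1(7,8) 2(7,8) by (simp add: peval_mult[symmetric])
  then show ?thesis using 1(4,6) 2(4,6) assms(3,4) by (simp add: frac_eq_eq)
qed

lemma rep_polyE:
  assumes "rep False r x f"
  obtains p where "p \<in> Poly r" "x = to_fract p" "\<forall>w. length w = r \<longrightarrow> f w = peval (envw w) p"
  using assms unfolding rep_def by (auto simp: DD_def good_def to_fract_def)

definition polyfun :: "(pt list \<Rightarrow> rat) \<Rightarrow> bool" where "polyfun f \<longleftrightarrow> (\<exists>A. BR False A f)"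

lemma polyfun_lmu: "polyfun f \<Longrightarrow> polyfun g \<Longrightarrow> polyfun (lmu f g)"
  unfolding polyfun_def using BR_mu by blast

lemma polyfun_larit: "polyfun f \<Longrightarrow> polyfun g \<Longrightarrow> g [] = 0 \<Longrightarrow> polyfun (larit g f)"
  unfolding polyfun_def using BR_arit by blast

lemma polyfun_anit: "polyfun f \<Longrightarrow> polyfun g \<Longrightarrow> g [] = 0 \<Longrightarrow> polyfun (der (kan g) f)"
  unfolding polyfun_def using BR_anit by blast

lemma polyfun_lQ: "polyfun f \<Longrightarrow> polyfun (lQ f)"
  unfolding polyfun_def using BR_Qop by blast

lemma polyfun_add: "polyfun f \<Longrightarrow> polyfun g \<Longrightarrow> polyfun (\<lambda>w. f w + g w)"
proof -
  assume "polyfun f" "polyfun g"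
  then obtain A B where "BR False A f" "BR False B g" by (auto simp: polyfun_def)
  then have "BR False (\<lambda>r. A r + B r) (\<lambda>w. f w + g w)" by (simp add: BR_def rep_add)
  then show ?thesis by (auto simp: polyfun_def)
qed

lemma polyfun_diff: "polyfun f \<Longrightarrow> polyfun g \<Longrightarrow> polyfun (\<lambda>w. f w - g w)"
proof -
  assume "polyfun f" "polyfun g"
  then obtain A B where "BR False A f" "BR False B g" by (auto simp: polyfun_def)
  then have "BR False (\<lambda>r. A r - B r) (\<lambda>w. f w - g w)" by (simp add: BR_def rep_minus)
  then show ?thesis by (auto simp: polyfun_def)
qed

lemma polyfun_lxi: "polyfun lxi" unfolding polyfun_def using BR_xi1 by blast
lemma polyfun_lE: "polyfun lE" unfolding polyfun_def using BR_Ebim by blast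

lemma polyfun_lT: "polyfun lT"
proof -
  have "rep False r (if r = 1 then - fY 1 else 0) lT" for r :: nat
  proof (cases "r = 1")
    case True
    have "rep False 1 (- fY 1) (\<lambda>w. - snd (w ! (1 - 1)))" by (intro rep_uminus rep_fY) auto
    then have "rep False 1 (- fY 1) lT" by (rule rep_cong) (auto simp: length_Suc_conv)
    then show ?thesis using True by simp
  next
    case False
    then show ?thesis by (auto simp: lT_def dep1_def split: list.splits intro!: rep_cong[OF rep_zero])
  qed
  then show ?thesis unfolding polyfun_def BR_def by (intro exI[of _ "\<lambda>r. if r = 1 then - fY 1 else 0"] allI)
qed

lemma polyfun_unitf: "polyfun unitf"
proof -
  have "rep False r (if r = 0 then 1 else 0) unitf" for r :: nat
    by (cases "r = 0") (auto simp: unitf_def intro!: rep_cong[OF rep_zero] rep_cong[OF rep_one])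
  then show ?thesis unfolding polyfun_def BR_def by (intro exI[of _ "\<lambda>r. if r = 0 then 1 else 0"] allI)
qed

lemma polyfun_ld0: "polyfun f \<Longrightarrow> polyfun (ld0 f)"
proof -
  assume f: "polyfun f"
  have "ld0 f = (\<lambda>w. (lQ f w + der (kan lT) f w) + larit lE f w + lmu f lE w)"
    by (simp add: fun_eq_iff ld0_def kD_def[abs_def] der_add der_kQ larit_def)
  then show ?thesis
    using f by (simp add: polyfun_add polyfun_lQ polyfun_anit polyfun_lT polyfun_larit polyfun_lE polyfun_lmu)
qed

lemma polyfun_opsq: "polyfun f \<Longrightarrow> polyfun (opsq k f)"
proof (induction k arbitrary: f)
  case 0
  then show ?case
    by (simp add: rmul_def[abs_def] polyfun_add polyfun_larit polyfun_lxi polyfun_lmu)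
next
  case (Suc k)
  then show ?case by (simp add: polyfun_diff polyfun_ld0)
qed

text \<open>The iterated commutator is represented by some polynomial bimould, which agrees with the
  iterate of \<open>\<delta>\<close> by uniqueness of representation at generic points.\<close>

lemma BR_xisq: "BR False ((delta_check ^^ k) xi1) (xisq k)"
proof -
  obtain A where A: "BR False A (xisq k)"
    using polyfun_opsq[OF polyfun_unitf, of k] by (auto simp: polyfun_def xisq_def)
  have "(delta_check ^^ k) xi1 r = A r" for r
    by (rule rep_unique[of True r]) (use A BR_delta_xisq[of k] in \<open>auto simp: BR_def intro: rep_True\<close>)
  then show ?thesis using A by (simp add: BR_def)
qed

lemma der_length:
  assumes "\<And>m. finl (K m)" "\<And>m \<phi>. length m > d + 1 \<Longrightarrow> K m \<phi> = 0"
    "\<And>w. length w > n \<Longrightarrow> f w = 0" "length w > n + d"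
  shows "der K f w = 0"
proof -
  have "K (take (Suc j) (drop p w)) (\<lambda>l. f (take p w @ l # drop (p + Suc j) w)) = 0"
    if "p < length w" "j < length w - p" for p j
  proof (cases "j \<le> d")
    case True
    have "(\<lambda>l. f (take p w @ l # drop (p + Suc j) w)) = (\<lambda>l. 0)"
      by (rule ext, rule assms(3)) (use that True assms(4) in simp)
    then show ?thesis by (simp add: finlD[OF assms(1)])
  next
    case False
    then show ?thesis using that by (intro assms(2)) simp
  qed
  then show ?thesis unfolding der_closed by simp
qed

lemma lmu_length:
  assumes "\<And>w. length w > n \<Longrightarrow> f w = 0" "\<And>w. length w > d \<Longrightarrow> g w = 0" "length w > n + d"
  shows "lmu f g w = 0"
  unfolding lmu_def
proof (rule sum.neutral, rule ballI)
  fix i assume "i \<in> {..length w}"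
  then show "f (take i w) * g (drop i w) = 0"
    using assms(1)[of "take i w"] assms(2)[of "drop i w"] assms(3) by (cases "i > n") auto
qed

lemma lE_long: "length w > 2 \<Longrightarrow> lE w = 0" by (auto simp: lE_def split: list.splits)
lemma lxi_long: "length w > 1 \<Longrightarrow> lxi w = 0" by (auto simp: lxi_def dep1_def split: list.splits)

lemma ld0_length: "(\<And>w. length w > n \<Longrightarrow> f w = 0) \<Longrightarrow> length w > n + 2 \<Longrightarrow> ld0 f w = 0"
  unfolding ld0_def using der_length[of kD 2 n f w] lmu_length[of n f 2 lE w] by (auto simp: kD_long lE_long)

lemma rmul_xi_length: "(\<And>w. length w > n \<Longrightarrow> f w = 0) \<Longrightarrow> length w > n + 1 \<Longrightarrow> rmul lxi f w = 0"
  unfolding rmul_def larit_def using der_length[of "karit lxi" 1 n f w] lmu_length[of n f 1 lxi w]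
  by (auto simp: kxi3 lxi_long)

lemma opsq_length: "(\<And>w. length w > n \<Longrightarrow> f w = 0) \<Longrightarrow> length w > n + 2 * k + 1 \<Longrightarrow> opsq k f w = 0"
proof (induction k arbitrary: f n w)
  case 0
  show ?case unfolding opsq.simps by (rule rmul_xi_length[of n]) (use 0 in auto)
next
  case (Suc k)
  have 1: "ld0 (opsq k f) w = 0"
    by (rule ld0_length[of "n + 2 * k + 1"]) (use Suc in auto)
  have 2: "opsq k (ld0 f) w = 0"
    by (rule Suc.IH[of "n + 2"]) (use Suc.prems ld0_length[of n f] in auto)
  show ?case using 1 2 by simp
qed

lemma xisq_length: "length w > 2 * k + 1 \<Longrightarrow> xisq k w = 0"
  unfolding xisq_def by (rule opsq_length[of 0]) (auto simp: unitf_def)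

lemma opsq_depth1: "opsq k f [c] = (fst c * snd c) ^ k * f []"
proof (induction k arbitrary: f)
  case 0
  show ?case by (simp add: rmul_def larit_def kxi_simps lmu_Cons)
next
  case (Suc k)
  then show ?case by (simp add: ld0_def kD_simps lmu_Cons opsq_Nil)
qed

text \<open>In depth one only the multiplication by \<open>Q\<close> contributes to the
  commutators.\<close>

lemma xisq_depth1: "xisq k [c] = (fst c * snd c) ^ k"
  by (simp add: xisq_def opsq_depth1)

lemma xisq_Nil [simp]: "xisq k [] = 0"
  by (simp add: xisq_def opsq_Nil)

section \<open>Swap invariance\<close>

text \<open>The partial sums of the \<open>y\<close>-coordinates. In the coordinates given by
  \<open>x\<close> and these sums the swap is the exchange of the two sequences with reversal, and
  contracting neighbours deletes one entry of each sequence.\<close>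

definition zc :: "pt list \<Rightarrow> nat \<Rightarrow> rat" where "zc w i = ysum (take (Suc i) w)"

lemma zc_step: "i < length w \<Longrightarrow> zc w i = (if i = 0 then 0 else zc w (i - 1)) + snd (w ! i)"
  by (cases i) (simp_all add: zc_def take_Suc_conv_app_nth)

lemma pts_eqI:
  assumes "length w = length w'" "\<And>i. i < length w \<Longrightarrow> fst (w ! i) = fst (w' ! i)" "\<And>i. i < length w \<Longrightarrow> zc w i = zc w' i"
  shows "w = w'"
proof (rule nth_equalityI[OF assms(1)])
  fix i assume i: "i < length w"
  have "snd (w ! i) = snd (w' ! i)"
    using zc_step[OF i] zc_step[of i w'] i assms(1) assms(3)[OF i] assms(3)[of "i - 1"] by (cases i) auto
  then show "w ! i = w' ! i" using assms(2)[OF i] by (simp add: prod_eq_iff)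
qed

definition lswap :: "pt list \<Rightarrow> pt list" where
  "lswap w = rev (map (\<lambda>i. (zc w i, fst (w ! i) - (if Suc i < length w then fst (w ! Suc i) else 0))) [0..<length w])"

lemma lswap_length [simp]: "length (lswap w) = length w" by (simp add: lswap_def)

lemma upt_nth_rev: "i < n \<Longrightarrow> [0..<n] ! (n - Suc i) = n - Suc i"
  by (subst nth_upt) auto

lemma lswap_fst: "i < length w \<Longrightarrow> fst (lswap w ! i) = zc w (length w - Suc i)"
  using upt_nth_rev[of i "length w"] by (simp add: lswap_def rev_nth)

lemma lswap_snd: "i < length w \<Longrightarrow> snd (lswap w ! i) = fst (w ! (length w - Suc i)) - (if i = 0 then 0 else fst (w ! (length w - i)))"
  using upt_nth_rev[of i "length w"] by (auto simp: lswap_def rev_nth Suc_diff_Suc)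

lemma lswap_zc: "i < length w \<Longrightarrow> zc (lswap w) i = fst (w ! (length w - Suc i))"
proof (induction i)
  case (Suc i)
  then show ?case using zc_step[of "Suc i" "lswap w"] by (simp add: lswap_snd)
qed (simp add: zc_step lswap_snd)

text \<open>Contraction of a letter into its right neighbour; the last letter is deleted.\<close>

definition delM :: "nat \<Rightarrow> pt list \<Rightarrow> pt list" where
  "delM a w = take a w @ (case drop a w of c # d # v \<Rightarrow> (fst d, snd c + snd d) # v | _ \<Rightarrow> [])"

text \<open>Contraction of a letter with its right neighbour, keeping the left coordinate.\<close>

definition delN :: "nat \<Rightarrow> pt list \<Rightarrow> pt list" where
  "delN a w = take a w @ (case drop a w of c # d # v \<Rightarrow> (fst c, snd c + snd d) # v | _ \<Rightarrow> [])"

lemma drop_two: "Suc a < length w \<Longrightarrow> drop a w = w ! a # w ! Suc a # drop (Suc (Suc a)) w"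
  by (metis Cons_nth_drop_Suc Suc_lessD)

lemma drop_three: "Suc (Suc a) < length w \<Longrightarrow> drop a w = w ! a # w ! Suc a # w ! Suc (Suc a) # drop (Suc (Suc (Suc a))) w"
  by (metis Cons_nth_drop_Suc Suc_lessD)

lemma delM_last: "a = length w - 1 \<Longrightarrow> delM a w = take a w"
  by (cases w rule: rev_cases) (auto simp: delM_def)

lemma delM_eq: "Suc a < length w \<Longrightarrow> delM a w = take a w @ (fst (w ! Suc a), snd (w ! a) + snd (w ! Suc a)) # drop (Suc (Suc a)) w"
  by (simp add: delM_def drop_two)

lemma delN_eq: "Suc a < length w \<Longrightarrow> delN a w = take a w @ (fst (w ! a), snd (w ! a) + snd (w ! Suc a)) # drop (Suc (Suc a)) w"
  by (simp add: delN_def drop_two)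

lemma merged_nth:
  assumes "Suc a < length w" "i < length w - 1"
  shows "(take a w @ l # drop (Suc (Suc a)) w) ! i = (if i < a then w ! i else if i = a then l else w ! Suc i)"
  using assms by (auto simp: nth_append nth_Cons' min_def)

lemma merged_zc:
  assumes "Suc a < length w" "i < length w - 1" "snd l = snd (w ! a) + snd (w ! Suc a)"
  shows "zc (take a w @ l # drop (Suc (Suc a)) w) i = zc w (if i < a then i else Suc i)"
proof -
  let ?m = "take a w @ l # drop (Suc (Suc a)) w"
  have l: "length ?m = length w - 1" using assms by simp
  have "i < length w - 1 \<Longrightarrow> zc ?m i = zc w (if i < a then i else Suc i)" for i
  proof (induction i)
    case 0
    have "w \<noteq> []" using assms by auto
    with 0 show ?case using assms zc_step[of 0 ?m] zc_step[of 0 w] zc_step[of 1 w] l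
      by (cases "a = 0") (auto simp: merged_nth)
  next
    case (Suc i)
    then show ?case using assms zc_step[of "Suc i" ?m] zc_step[of "Suc i" w] zc_step[of "Suc (Suc i)" w] l
      by (cases "Suc i" a rule: linorder_cases) (auto simp: merged_nth)
  qed
  then show ?thesis using assms by blast
qed

lemma delM_facts:
  assumes "a < length w"
  shows "length (delM a w) = length w - 1"
    "\<And>i. i < length w - 1 \<Longrightarrow> fst (delM a w ! i) = fst (w ! (if i < a then i else Suc i))"
    "\<And>i. i < length w - 1 \<Longrightarrow> zc (delM a w) i = zc w (if i < a then i else Suc i)"
proof -
  consider (inner) "Suc a < length w" | (last) "a = length w - 1" using assms by linarith
  then have "length (delM a w) = length w - 1 \<and> (\<forall>i < length w - 1. fst (delM a w ! i) = fst (w ! (if i < a then i else Suc i))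
      \<and> zc (delM a w) i = zc w (if i < a then i else Suc i))"
  proof cases
    case inner
    show ?thesis unfolding delM_eq[OF inner]
      using inner merged_nth[OF inner] merged_zc[OF inner] by simp
  next
    case last
    show ?thesis unfolding delM_last[OF last] using last by (simp add: zc_def min_absorb1)
  qed
  then show "length (delM a w) = length w - 1"
    "\<And>i. i < length w - 1 \<Longrightarrow> fst (delM a w ! i) = fst (w ! (if i < a then i else Suc i))"
    "\<And>i. i < length w - 1 \<Longrightarrow> zc (delM a w) i = zc w (if i < a then i else Suc i)" by blast+
qed

lemma delN_facts:
  assumes "Suc a < length w"
  shows "length (delN a w) = length w - 1"
    "\<And>i. i < length w - 1 \<Longrightarrow> fst (delN a w ! i) = fst (w ! (if i \<le> a then i else Suc i))"
    "\<And>i. i < length w - 1 \<Longrightarrow> zc (delN a w) i = zc w (if i < a then i else Suc i)"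
proof -
  show "length (delN a w) = length w - 1" using assms by (simp add: delN_eq)
  show "fst (delN a w ! i) = fst (w ! (if i \<le> a then i else Suc i))" if "i < length w - 1" for i
    unfolding delN_eq[OF assms] merged_nth[OF assms that] by simp
  show "zc (delN a w) i = zc w (if i < a then i else Suc i)" if "i < length w - 1" for i
    unfolding delN_eq[OF assms] by (rule merged_zc[OF assms that]) simp
qed

text \<open>In the coordinates of \<open>x\<close> and partial sums, both sides delete the same
  entries.\<close>

lemma lswap_delM:
  assumes "a < length w"
  shows "lswap (delM a w) = delM (length w - Suc a) (lswap w)"
proof (rule pts_eqI)
  have a': "length w - Suc a < length (lswap w)" using assms by simp
  show "length (lswap (delM a w)) = length (delM (length w - Suc a) (lswap w))"
    using delM_facts(1)[OF assms] delM_facts(1)[OF a'] by simp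
  fix i assume "i < length (lswap (delM a w))"
  then have i: "i < length w - 1" using delM_facts(1)[OF assms] by simp
  have j: "length w - 1 - Suc i < length w - 1" using i by simp
  show "fst (lswap (delM a w) ! i) = fst (delM (length w - Suc a) (lswap w) ! i)"
    using i j assms delM_facts[OF assms] delM_facts[OF a'] by (auto simp: lswap_fst Suc_diff_Suc)
  show "zc (lswap (delM a w)) i = zc (delM (length w - Suc a) (lswap w)) i"
    using i j assms delM_facts[OF assms] delM_facts[OF a'] by (auto simp: lswap_zc Suc_diff_Suc)
qed

lemma lswap_delN:
  assumes "Suc a < length w"
  shows "lswap (delN a w) = delN (length w - 2 - a) (lswap w)"
proof (rule pts_eqI)
  have a': "Suc (length w - 2 - a) < length (lswap w)" using assms by simp
  show "length (lswap (delN a w)) = length (delN (length w - 2 - a) (lswap w))"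
    using delN_facts(1)[OF assms] delN_facts(1)[OF a'] by simp
  fix i assume "i < length (lswap (delN a w))"
  then have i: "i < length w - 1" using delN_facts(1)[OF assms] by simp
  have j: "length w - 1 - Suc i < length w - 1" using i by simp
  show "fst (lswap (delN a w) ! i) = fst (delN (length w - 2 - a) (lswap w) ! i)"
    using i j assms delN_facts[OF assms] delN_facts[OF a'] by (auto simp: lswap_fst Suc_diff_Suc)
  show "zc (lswap (delN a w)) i = zc (delN (length w - 2 - a) (lswap w)) i"
    using i j assms delN_facts[OF assms] delN_facts[OF a'] by (auto simp: lswap_zc Suc_diff_Suc)
qed

lemma delM_delM:
  assumes "Suc a < length w"
  shows "delM a (delM a w) = delM a (delM (Suc a) w)"
    "lswap (delM a (delM a w)) = delM (length w - 2 - a) (delM (length w - 2 - a) (lswap w))"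
proof -
  have swp: "delM a (delM a w) = delM a (delM (Suc a) w)" if "Suc a < length w" for a w
  proof (rule pts_eqI)
    have 1: "a < length w" "a < length (delM a w)" "a < length (delM (Suc a) w)"
      using that delM_facts(1)[of a w] delM_facts(1)[of "Suc a" w] by auto
    note f = delM_facts[OF 1(1)] delM_facts[OF that] delM_facts[OF 1(2)] delM_facts[OF 1(3)]
    show "length (delM a (delM a w)) = length (delM a (delM (Suc a) w))" using f(1,4,7,10) by simp
    fix i assume "i < length (delM a (delM a w))"
    then have i: "i < length w - 1 - 1" using f by simp
    show "fst (delM a (delM a w) ! i) = fst (delM a (delM (Suc a) w) ! i)"
      "zc (delM a (delM a w)) i = zc (delM a (delM (Suc a) w)) i"
      using i f by auto
  qed
  show "delM a (delM a w) = delM a (delM (Suc a) w)" by (rule swp[OF assms])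
  have l: "length (delM a w) = length w - 1" using assms by (simp add: delM_facts)
  have "lswap (delM a (delM a w)) = delM (length w - 2 - a) (delM (Suc (length w - 2 - a)) (lswap w))"
    using assms l by (simp add: lswap_delM Suc_diff_Suc numeral_2_eq_2)
  also have "\<dots> = delM (length w - 2 - a) (delM (length w - 2 - a) (lswap w))"
    by (rule swp[symmetric]) (use assms in simp)
  finally show "lswap (delM a (delM a w)) = delM (length w - 2 - a) (delM (length w - 2 - a) (lswap w))" .
qed

lemma delN_delN:
  assumes "Suc (Suc a) < length w"
  shows "lswap (delN a (delN a w)) = delN (length w - 3 - a) (delN (length w - 3 - a) (lswap w))"
proof -
  have swp: "delN a (delN a w) = delN a (delN (Suc a) w)" if "Suc (Suc a) < length w" for a w
  proof (rule pts_eqI)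
    have 1: "Suc a < length w" "Suc a < length (delN a w)" "Suc a < length (delN (Suc a) w)"
      using that delN_facts(1)[of a w] delN_facts(1)[of "Suc a" w] by auto
    note f = delN_facts[OF 1(1)] delN_facts[OF that] delN_facts[OF 1(2)] delN_facts[OF 1(3)]
    show "length (delN a (delN a w)) = length (delN a (delN (Suc a) w))" using f(1,4,7,10) by simp
    fix i assume "i < length (delN a (delN a w))"
    then have i: "i < length w - 1 - 1" using f by simp
    show "fst (delN a (delN a w) ! i) = fst (delN a (delN (Suc a) w) ! i)"
      "zc (delN a (delN a w)) i = zc (delN a (delN (Suc a) w)) i"
      using i f by auto
  qed
  have l: "length (delN a w) = length w - 1" using assms by (simp add: delN_facts)
  have "lswap (delN a (delN a w)) = delN (length w - 3 - a) (delN (Suc (length w - 3 - a)) (lswap w))"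
    using assms l by (simp add: lswap_delN Suc_diff_Suc numeral_eq_Suc)
  also have "\<dots> = delN (length w - 3 - a) (delN (length w - 3 - a) (lswap w))"
    by (rule swp[symmetric]) (use assms in simp)
  finally show ?thesis .
qed

lemma der_short_sum:
  assumes "\<And>m \<phi>. length m > 3 \<Longrightarrow> K m \<phi> = 0"
  shows "der K f w = (\<Sum>p<length w. K [w ! p] (\<lambda>l. f (take p w @ l # drop (Suc p) w)))
    + (\<Sum>p<length w - 1. K [w ! p, w ! Suc p] (\<lambda>l. f (take p w @ l # drop (Suc (Suc p)) w)))
    + (\<Sum>p<length w - 2. K [w ! p, w ! Suc p, w ! Suc (Suc p)] (\<lambda>l. f (take p w @ l # drop (Suc (Suc (Suc p))) w)))"
proof -
  let ?h = "\<lambda>p j. K (take (Suc j) (drop p w)) (\<lambda>l. f (take p w @ l # drop (p + Suc j) w))"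
  have t: "(\<Sum>p<r. \<Sum>j<r - p. h p j) = (\<Sum>j<r. \<Sum>p<r - j. h p j)" for r :: nat and h :: "nat \<Rightarrow> nat \<Rightarrow> rat"
  proof -
    have "(\<Sum>p<r. \<Sum>j<r - p. h p j) = (\<Sum>(p, j)\<in>(SIGMA p:{..<r}. {..<r - p}). h p j)"
      by (subst sum.Sigma) auto
    also have "\<dots> = (\<Sum>(j, p)\<in>(SIGMA j:{..<r}. {..<r - j}). h p j)"
      by (rule sum.reindex_bij_witness[of _ "\<lambda>(j, p). (p, j)" "\<lambda>(j, p). (p, j)"]) auto
    also have "\<dots> = (\<Sum>j<r. \<Sum>p<r - j. h p j)" by (subst sum.Sigma) auto
    finally show ?thesis .
  qed
  have "der K f w = (\<Sum>j<length w. \<Sum>p<length w - j. ?h p j)"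
    unfolding der_closed by (rule t)
  also have "\<dots> = (\<Sum>j<length w + 3. \<Sum>p<length w - j. ?h p j)"
    by (rule sum.mono_neutral_left) auto
  also have "\<dots> = (\<Sum>j\<in>{0, 1, 2}. \<Sum>p<length w - j. ?h p j)"
  proof (rule sum.mono_neutral_right)
    show "\<forall>j\<in>{..<length w + 3} - {0, 1, 2}. (\<Sum>p<length w - j. ?h p j) = 0"
      by (intro ballI sum.neutral assms) auto
  qed auto
  also have "\<dots> = (\<Sum>p<length w. ?h p 0) + (\<Sum>p<length w - 1. ?h p 1) + (\<Sum>p<length w - 2. ?h p 2)"
  proof -
    have "(\<Sum>j\<in>{0, 1, 2}. s j) = s 0 + s 1 + s 2" for s :: "nat \<Rightarrow> rat" by simp
    from this[of "\<lambda>j. \<Sum>p<length w - j. ?h p j"] show ?thesis by (simp only: minus_nat.diff_0)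
  qed
  also have "(\<Sum>p<length w. ?h p 0) = (\<Sum>p<length w. K [w ! p] (\<lambda>l. f (take p w @ l # drop (Suc p) w)))"
    by (intro sum.cong refl) (simp add: Cons_nth_drop_Suc[symmetric])
  also have "(\<Sum>p<length w - 1. ?h p 1) = (\<Sum>p<length w - 1. K [w ! p, w ! Suc p] (\<lambda>l. f (take p w @ l # drop (Suc (Suc p)) w)))"
    by (intro sum.cong refl) (simp add: drop_two)
  also have "(\<Sum>p<length w - 2. ?h p 2) = (\<Sum>p<length w - 2. K [w ! p, w ! Suc p, w ! Suc (Suc p)] (\<lambda>l. f (take p w @ l # drop (Suc (Suc (Suc p))) w)))"
  proof (intro sum.cong refl)
    fix p assume "p \<in> {..<length w - 2}"
    then have "Suc (Suc p) < length w" by auto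
    note drop_three[OF this]
    then have "take (Suc 2) (drop p w) = [w ! p, w ! Suc p, w ! Suc (Suc p)]" by simp
    moreover have "p + Suc 2 = Suc (Suc (Suc p))" by simp
    ultimately show "?h p 2 = K [w ! p, w ! Suc p, w ! Suc (Suc p)] (\<lambda>l. f (take p w @ l # drop (Suc (Suc (Suc p))) w))"
      by (simp only:)
  qed
  finally show ?thesis .
qed

lemma lmu_lxi_last: "lmu f lxi w = (if w = [] then 0 else f (take (length w - 1) w))"
  by (cases w rule: rev_cases) (simp_all add: lxi_def lmu_snoc_dep1)

text \<open>The boundary term of mu is the deletion of the last letter, which completes the first
  sum.\<close>

lemma rmul_xi_closed: "rmul lxi f w = (\<Sum>a<length w. f (delM a w)) - (\<Sum>a<length w - 1. f (delN a w))"
proof -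
  have "larit lxi f w = (\<Sum>p<length w - 1. f (delM p w) - f (delN p w))"
    unfolding larit_def by (subst der_short_sum) (simp_all add: kxi_long kxi_simps delM_eq delN_eq)
  moreover have "(\<Sum>a<length w. f (delM a w)) = (\<Sum>p<length w - 1. f (delM p w)) + lmu f lxi w"
    by (cases w rule: rev_cases) (simp_all add: lmu_lxi_last delM_last)
  ultimately show ?thesis by (simp add: rmul_def sum_subtractf)
qed

definition swapinv :: "(pt list \<Rightarrow> rat) \<Rightarrow> bool" where "swapinv f \<longleftrightarrow> (\<forall>w. f (lswap w) = f w)"

lemma sum_rev: "(\<Sum>a<n. g (n - Suc a)) = (\<Sum>a<(n::nat). g a :: rat)"
  by (rule sum.nat_diff_reindex)

text \<open>The swap permutes the deletions by reversal.\<close>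

lemma swapinv_rmul_xi: assumes "swapinv f" shows "swapinv (rmul lxi f)"
  unfolding swapinv_def
proof
  fix w
  have "(\<Sum>a<length w. f (delM a (lswap w))) = (\<Sum>a<length w. f (delM (length w - Suc a) (lswap w)))"
    by (rule sum_rev[symmetric])
  also have "\<dots> = (\<Sum>a<length w. f (delM a w))"
    using assms by (intro sum.cong refl) (simp add: lswap_delM[symmetric] swapinv_def)
  finally have 1: "(\<Sum>a<length w. f (delM a (lswap w))) = (\<Sum>a<length w. f (delM a w))" .
  have "(\<Sum>a<length w - 1. f (delN a (lswap w))) = (\<Sum>a<length w - 1. f (delN (length w - 1 - Suc a) (lswap w)))"
    by (rule sum_rev[symmetric])
  also have "\<dots> = (\<Sum>a<length w - 1. f (delN a w))"
  proof (intro sum.cong refl)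
    fix a assume "a \<in> {..<length w - 1}"
    then have a: "Suc a < length w" by auto
    have e: "length w - 1 - Suc a = length w - 2 - a" using a by simp
    show "f (delN (length w - 1 - Suc a) (lswap w)) = f (delN a w)"
      unfolding e lswap_delN[OF a, symmetric] using assms by (simp add: swapinv_def)
  qed
  finally show "rmul lxi f (lswap w) = rmul lxi f w" using 1 by (simp add: rmul_xi_closed)
qed

definition cM :: "pt list \<Rightarrow> nat \<Rightarrow> rat" where
  "cM w a = - (fst (w ! a) - (if Suc a < length w then fst (w ! Suc a) else 0) + snd (w ! a)) / 2"

definition cN :: "pt list \<Rightarrow> nat \<Rightarrow> rat" where
  "cN w a = (fst (w ! Suc a) - fst (w ! a) - snd (w ! Suc a)) / 2"

lemma delM_delM_eq: "Suc (Suc a) < length w \<Longrightarrow> delM a (delM a w)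
   = take a w @ (fst (w ! Suc (Suc a)), snd (w ! a) + snd (w ! Suc a) + snd (w ! Suc (Suc a))) # drop (Suc (Suc (Suc a))) w"
  by (simp add: delM_def drop_three)

lemma delN_delN_eq: "Suc (Suc a) < length w \<Longrightarrow> delN a (delN a w)
   = take a w @ (fst (w ! a), snd (w ! a) + snd (w ! Suc a) + snd (w ! Suc (Suc a))) # drop (Suc (Suc (Suc a))) w"
  by (simp add: delN_def drop_three)

lemma delM_delM_last: "length w = Suc (Suc a) \<Longrightarrow> delM a (delM a w) = take a w"
proof -
  assume l: "length w = Suc (Suc a)"
  then have "length (delM a w) = Suc a" by (simp add: delM_facts)
  then have "delM a (delM a w) = take a (delM a w)" by (simp add: delM_last)
  then show ?thesis using l by (simp add: delM_eq)
qed

lemma lmu_lE_snoc: "lmu f lE (v @ [a, b]) = f v / 4 + f (v @ [a]) * (- (fst b + snd b) / 2)"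
proof (induction v arbitrary: f)
  case (Cons c v)
  have "lE (c # v @ [a, b]) = 0" by (rule lE_long) simp
  then show ?case by (simp add: lmu_Cons Cons)
qed (simp add: lmu_Cons)

lemma lmu_lE_last: "lmu f lE w = (if w = [] then 0 else cM w (length w - 1) * f (delM (length w - 1) w))
    + (if length w < 2 then 0 else f (delM (length w - 2) (delM (length w - 2) w)) / 4)"
proof (cases w rule: rev_cases)
  case (snoc u b)
  show ?thesis
  proof (cases u rule: rev_cases)
    case Nil
    then show ?thesis by (simp add: snoc lmu_Cons cM_def delM_def)
  next
    case (snoc v a)
    then have w: "w = v @ [a, b]" using \<open>w = u @ [b]\<close> by simp
    have 1: "delM (Suc (length v)) w = v @ [a]" by (simp add: w delM_last)
    have 2: "delM (length v) (delM (length v) w) = v" by (subst delM_delM_last) (simp_all add: w)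
    have 3: "cM w (Suc (length v)) = - (fst b + snd b) / 2" by (simp add: cM_def w nth_append)
    show ?thesis using 1 2 3 by (simp add: lmu_lE_snoc w)
  qed
qed simp

text \<open>A sum over deletions with coefficients that are visibly symmetric under the
  swap.\<close>

lemma ld0_closed: "ld0 f w = qf w * f w + (\<Sum>a<length w. cM w a * f (delM a w)) + (\<Sum>a<length w - 1. cN w a * f (delN a w))
    + (\<Sum>a<length w - 1. f (delM a (delM a w))) / 4 - (\<Sum>a<length w - 2. f (delN a (delN a w))) / 4"
proof -
  have 1: "(\<Sum>p<length w. kD [w ! p] (\<lambda>l. f (take p w @ l # drop (Suc p) w))) = qf w * f w"
  proof -
    have "(\<Sum>p<length w. kD [w ! p] (\<lambda>l. f (take p w @ l # drop (Suc p) w))) = (\<Sum>p<length w. fst (w ! p) * snd (w ! p) * f w)"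
      by (intro sum.cong refl) (simp add: kD_simps id_take_nth_drop[symmetric])
    then show ?thesis by (simp add: qf_def sum_list_sum_nth atLeast0LessThan sum_distrib_right)
  qed
  have 2: "(\<Sum>p<length w - 1. kD [w ! p, w ! Suc p] (\<lambda>l. f (take p w @ l # drop (Suc (Suc p)) w)))
      = (\<Sum>p<length w - 1. cM w p * f (delM p w)) + (\<Sum>p<length w - 1. cN w p * f (delN p w))"
    unfolding sum.distrib[symmetric]
    by (intro sum.cong refl) (simp add: kD_simps delM_eq delN_eq cM_def cN_def)
  have 3: "(\<Sum>p<length w - 2. kD [w ! p, w ! Suc p, w ! Suc (Suc p)] (\<lambda>l. f (take p w @ l # drop (Suc (Suc (Suc p))) w)))
      = (\<Sum>p<length w - 2. f (delM p (delM p w))) / 4 - (\<Sum>p<length w - 2. f (delN p (delN p w))) / 4"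
    unfolding sum_divide_distrib sum_subtractf[symmetric]
    by (intro sum.cong refl) (simp add: kD_simps delM_delM_eq delN_delN_eq diff_divide_distrib)
  have 4: "(\<Sum>a<length w. cM w a * f (delM a w)) = (\<Sum>p<length w - 1. cM w p * f (delM p w))
      + (if w = [] then 0 else cM w (length w - 1) * f (delM (length w - 1) w))"
    by (cases "length w") auto
  have 5: "(\<Sum>a<length w - 1. f (delM a (delM a w))) = (\<Sum>p<length w - 2. f (delM p (delM p w)))
      + (if length w < 2 then 0 else f (delM (length w - 2) (delM (length w - 2) w)))"
    by (cases "length w"; cases "length w - 1") (auto simp: numeral_2_eq_2)
  have 6: "(\<Sum>a<length w - 1. f (delM a (delM a w))) / 4 = (\<Sum>p<length w - 2. f (delM p (delM p w))) / 4
      + (if length w < 2 then 0 else f (delM (length w - 2) (delM (length w - 2) w)) / 4)"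
    unfolding 5 by (simp add: add_divide_distrib)
  have 7: "der kD f w = qf w * f w + ((\<Sum>p<length w - 1. cM w p * f (delM p w)) + (\<Sum>p<length w - 1. cN w p * f (delN p w)))
      + ((\<Sum>p<length w - 2. f (delM p (delM p w))) / 4 - (\<Sum>p<length w - 2. f (delN p (delN p w))) / 4)"
    by (subst der_short_sum[OF kD_long], assumption) (simp only: 1 2 3)
  have 8: "lmu f lE w = (if w = [] then 0 else cM w (length w - 1) * f (delM (length w - 1) w))
    + (if length w < 2 then 0 else f (delM (length w - 2) (delM (length w - 2) w)) / 4)"
    unfolding lmu_lE_last by simp
  show ?thesis
    unfolding ld0_def 4 6 7 8 by (simp only: ac_simps diff_conv_add_uminus)
qed

text \<open>Summation by parts, which shows that the quadratic form \<open>\<Sum> x\<^sub>i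
  y\<^sub>i\<close> is swap invariant.\<close>

lemma sum_by_parts:
  fixes x z :: "nat \<Rightarrow> rat"
  shows "(\<Sum>i<r. x i * (z i - (if i = 0 then 0 else z (i - 1))))
    = (\<Sum>i<r. z i * (x i - (if Suc i < r then x (Suc i) else 0)))"
proof -
  have "(\<Sum>i<r. x i * (z i - (if i = 0 then 0 else z (i - 1)))) = (\<Sum>i<r. z i * (x i - x (Suc i))) + (if r = 0 then 0 else z (r - 1) * x r)"
  proof (induction r)
    case (Suc r)
    then show ?case by (cases r) (simp_all add: algebra_simps)
  qed simp
  also have "\<dots> = (\<Sum>i<r. z i * (x i - (if Suc i < r then x (Suc i) else 0)))"
    by (cases r) (simp_all add: algebra_simps)
  finally show ?thesis .
qed

lemma qf_lswap: "qf (lswap w) = qf w"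
proof -
  have "qf w = (\<Sum>i<length w. fst (w ! i) * (zc w i - (if i = 0 then 0 else zc w (i - 1))))"
    by (simp add: qf_def sum_list_sum_nth atLeast0LessThan zc_step)
  also have "\<dots> = (\<Sum>i<length w. zc w i * (fst (w ! i) - (if Suc i < length w then fst (w ! Suc i) else 0)))"
    by (rule sum_by_parts)
  also have "\<dots> = qf (lswap w)"
  proof -
    have "qf (lswap w) = sum_list (rev (map (\<lambda>i. zc w i * (fst (w ! i) - (if Suc i < length w then fst (w ! Suc i) else 0))) [0..<length w]))"
      by (simp add: qf_def lswap_def rev_map o_def)
    then show ?thesis by (simp add: interv_sum_list_conv_sum_set_nat atLeast0LessThan)
  qed
  finally show ?thesis by simp
qed

lemma cM_lswap: "a < length w \<Longrightarrow> cM (lswap w) a = cM w (length w - Suc a)"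
proof -
  assume a: "a < length w"
  have "length w - Suc (Suc a) = length w - Suc a - 1" by simp
  then show ?thesis
    using a zc_step[of "length w - Suc a" w] by (auto simp: cM_def lswap_fst lswap_snd Suc_diff_Suc)
qed

lemma cN_lswap: "Suc a < length w \<Longrightarrow> cN (lswap w) a = cN w (length w - 2 - a)"
proof -
  assume a: "Suc a < length w"
  define b where "b = length w - 2 - a"
  have b: "length w - Suc a = Suc b" "length w - Suc (Suc a) = b" "length w - a = Suc (Suc b)"
    "Suc b < length w"
    using a by (auto simp: b_def)
  show ?thesis
    using a zc_step[of "Suc b" w] by (simp add: cN_def lswap_fst lswap_snd b b_def[symmetric])
qed

lemma swapinv_ld0: assumes "swapinv f" shows "swapinv (ld0 f)"
  unfolding swapinv_def
proof
  fix w
  have f: "f (lswap w) = f w" for w using assms by (simp add: swapinv_def)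
  have "(\<Sum>a<length w. cM (lswap w) a * f (delM a (lswap w)))
      = (\<Sum>a<length w. cM (lswap w) (length w - Suc a) * f (delM (length w - Suc a) (lswap w)))"
    by (rule sum_rev[symmetric])
  also have "\<dots> = (\<Sum>a<length w. cM w a * f (delM a w))"
    by (intro sum.cong refl) (simp add: lswap_delM[symmetric] f cM_lswap Suc_diff_Suc)
  finally have 1: "(\<Sum>a<length w. cM (lswap w) a * f (delM a (lswap w))) = (\<Sum>a<length w. cM w a * f (delM a w))" .
  have "(\<Sum>a<length w - 1. cN (lswap w) a * f (delN a (lswap w)))
      = (\<Sum>a<length w - 1. cN (lswap w) (length w - 1 - Suc a) * f (delN (length w - 1 - Suc a) (lswap w)))"
    by (rule sum_rev[symmetric])
  also have "\<dots> = (\<Sum>a<length w - 1. cN w a * f (delN a w))"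
  proof (intro sum.cong refl)
    fix a assume "a \<in> {..<length w - 1}"
    then have a: "Suc a < length w" by auto
    have e: "length w - 1 - Suc a = length w - 2 - a" using a by simp
    have e': "length w - 2 - (length w - 2 - a) = a" "Suc (length w - 2 - a) < length w" using a by auto
    show "cN (lswap w) (length w - 1 - Suc a) * f (delN (length w - 1 - Suc a) (lswap w)) = cN w a * f (delN a w)"
      unfolding e lswap_delN[OF a, symmetric] f
      using cN_lswap[of "length w - 2 - a" w, unfolded e'(1), OF e'(2)] by simp
  qed
  finally have 2: "(\<Sum>a<length w - 1. cN (lswap w) a * f (delN a (lswap w))) = (\<Sum>a<length w - 1. cN w a * f (delN a w))" .
  have "(\<Sum>a<length w - 1. f (delM a (delM a (lswap w))))
      = (\<Sum>a<length w - 1. f (delM (length w - 1 - Suc a) (delM (length w - 1 - Suc a) (lswap w))))"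
    by (rule sum_rev[symmetric])
  also have "\<dots> = (\<Sum>a<length w - 1. f (delM a (delM a w)))"
  proof (intro sum.cong refl)
    fix a assume "a \<in> {..<length w - 1}"
    then have a: "Suc a < length w" by auto
    have e: "length w - 1 - Suc a = length w - 2 - a" using a by simp
    show "f (delM (length w - 1 - Suc a) (delM (length w - 1 - Suc a) (lswap w))) = f (delM a (delM a w))"
      unfolding e delM_delM(2)[OF a, symmetric] f ..
  qed
  finally have 3: "(\<Sum>a<length w - 1. f (delM a (delM a (lswap w)))) = (\<Sum>a<length w - 1. f (delM a (delM a w)))" .
  have "(\<Sum>a<length w - 2. f (delN a (delN a (lswap w))))
      = (\<Sum>a<length w - 2. f (delN (length w - 2 - Suc a) (delN (length w - 2 - Suc a) (lswap w))))"
    by (rule sum_rev[symmetric])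
  also have "\<dots> = (\<Sum>a<length w - 2. f (delN a (delN a w)))"
  proof (intro sum.cong refl)
    fix a assume "a \<in> {..<length w - 2}"
    then have a: "Suc (Suc a) < length w" by auto
    have e: "length w - 2 - Suc a = length w - 3 - a" using a by simp
    show "f (delN (length w - 2 - Suc a) (delN (length w - 2 - Suc a) (lswap w))) = f (delN a (delN a w))"
      unfolding e delN_delN[OF a, symmetric] f ..
  qed
  finally have 4: "(\<Sum>a<length w - 2. f (delN a (delN a (lswap w)))) = (\<Sum>a<length w - 2. f (delN a (delN a w)))" .
  show "ld0 f (lswap w) = ld0 f w"
    unfolding ld0_closed lswap_length 1 2 3 4 qf_lswap f ..
qed

lemma swapinv_opsq: "swapinv f \<Longrightarrow> swapinv (opsq k f)"
proof (induction k arbitrary: f)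
  case (Suc k)
  from swapinv_ld0[OF Suc.IH[OF Suc.prems]] Suc.IH[OF swapinv_ld0[OF Suc.prems]]
  show ?case by (simp add: swapinv_def)
qed (simp add: swapinv_rmul_xi)

lemma swapinv_xisq: "swapinv (xisq k)"
proof -
  have "lswap w = [] \<longleftrightarrow> w = []" for w by (metis length_0_conv lswap_length)
  then have "swapinv unitf" by (simp add: swapinv_def unitf_def)
  then show ?thesis unfolding xisq_def by (rule swapinv_opsq)
qed

lemma rep_swap:
  assumes "BR False A f" shows "rep False r (swap A r) (\<lambda>w. f (lswap w))"
proof -
  let ?xs = "map (\<lambda>i. yspan 1 i) (rev [1..<r+1])"
  let ?ys = "map (\<lambda>i. if i = r then xf r else xf i - xf (i + 1)) (rev [1..<r+1])"
  have "rep False r (swap A r) (\<lambda>w. f (evl w ?xs ?ys))"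
    unfolding swap_def
  proof (rule rep_bapp[OF assms])
    show "okx False r ?xs" unfolding okx_def using keys_yspan[of 1 _ r] by (auto simp del: upt_Suc)
    have "keys (if i = r then xf r else xf i - xf (i + 1)) \<subseteq> vars r" if "i \<in> set (rev [1..<r+1])" for i
      using that keys_minus_subset[of "xf i" "xf (i + 1)"] by (auto simp: vars_iff subset_iff)
    then show "okf r ?ys" unfolding okf_def set_map by blast
  qed simp
  then show ?thesis
  proof (rule rep_cong)
    fix w :: "pt list" assume w: "length w = r"
    have "evl w ?xs ?ys = lswap w"
    proof (rule nth_equalityI)
      fix i assume "i < length (evl w ?xs ?ys)"
      then have i: "i < r" by (simp add: evl_def del: upt_Suc)
      have y: "lev (envw w) (yspan (Suc 0) (r - i)) = zc w (r - Suc i)"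
        using yspan_block[of 1 "r - i" w] i w by (simp add: zc_def)
      have n: "rev [1..<r+1] ! i = r - i" using i by (simp add: rev_nth del: upt_Suc)
      show "evl w ?xs ?ys ! i = lswap w ! i"
        using i w y n by (auto simp: evl_def prod_eq_iff lswap_fst lswap_snd lev_minus simp del: upt_Suc)
    qed (simp add: evl_def w del: upt_Suc)
    then show "f (evl w ?xs ?ys) = f (lswap w)" by simp
  qed
qed

lemma swap_fixed_iff:
  assumes "BR False A f" shows "swap A = A \<longleftrightarrow> swapinv f"
proof
  assume sw: "swap A = A"
  show "swapinv f"
    unfolding swapinv_def
  proof
    fix w :: "pt list"
    have "rep False (length w) (A (length w)) (\<lambda>w. f (lswap w))"
      using rep_swap[OF assms, of "length w"] sw by simp
    moreover have "rep False (length w) (A (length w)) f" using assms by (simp add: BR_def)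
    ultimately show "f (lswap w) = f w"
      by (rule rep_fun_unique) (simp_all add: good_def)
  qed
next
  assume "swapinv f"
  then have "swap A r = A r" for r
    using rep_unique[OF rep_swap[OF assms, of r], of "A r" f] assms by (simp add: BR_def swapinv_def)
  then show "swap A = A" by (rule ext)
qed

section \<open>Membership in the Lie algebra\<close>

definition lin :: "(word \<Rightarrow> rat) \<Rightarrow> (word \<Rightarrow>\<^sub>0 rat) \<Rightarrow> rat" where
  "lin a P = (\<Sum>w\<in>keys P. lookup P w * a w)"

lemma lin_superset: "finite S \<Longrightarrow> keys P \<subseteq> S \<Longrightarrow> lin a P = (\<Sum>w\<in>S. lookup P w * a w)"
  unfolding lin_def by (rule sum.mono_neutral_left) (auto simp: in_keys_iff)

lemma lin_add: "lin a (P + Q) = lin a P + lin a Q"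
proof -
  let ?S = "keys P \<union> keys Q"
  have "lin a (P + Q) = (\<Sum>w\<in>?S. lookup (P + Q) w * a w)"
    by (rule lin_superset) (simp_all add: Poly_Mapping.keys_add)
  also have "\<dots> = (\<Sum>w\<in>?S. lookup P w * a w) + (\<Sum>w\<in>?S. lookup Q w * a w)"
    by (simp add: lookup_add algebra_simps sum.distrib)
  finally show ?thesis by (simp add: lin_superset[of ?S])
qed

lemma lin_single: "lin a (Poly_Mapping.single w c) = c * a w"
  by (subst lin_superset[of "{w}"]) auto

lemma lin_zero: "lin a 0 = 0" by (simp add: lin_def)

lemma lin_sum: "lin a (sum P I) = (\<Sum>i\<in>I. lin a (P i))"
  by (induction I rule: infinite_finite_induct) (auto simp: lin_add lin_zero)

lemma lin_prepend: "lin a (prepend l P) = lin (\<lambda>w. a (l # w)) P"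
  by (simp add: prepend_def lin_sum lin_single) (simp add: lin_def)

text \<open>The value of a functional on the bi-stuffle product of two words, by the recursion of
  that product.\<close>

fun bs :: "(word \<Rightarrow> rat) \<Rightarrow> word \<Rightarrow> word \<Rightarrow> rat" where
  "bs a [] V = a V"
| "bs a (l # U) [] = a (l # U)"
| "bs a (l # U) (l' # V) = bs (\<lambda>W. a (l # W)) U (l' # V) + bs (\<lambda>W. a (l' # W)) (l # U) V
     + bs (\<lambda>W. a ((fst l + fst l', snd l + snd l') # W)) U V"

lemma bs_Nil1 [simp]: "bs a [] = a" by (rule ext) simp

lemma bs_Nil2 [simp]: "bs a U [] = a U" by (cases U) simp_all

lemma lin_bistuffle: "lin a (bistuffle U V) = bs a U V"
proof (induction a U V rule: bs.induct)
  case (2 a l U)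
  then show ?case by (cases l) (simp add: lin_single)
next
  case (3 a l U l' V)
  then show ?case by (cases l; cases l') (simp add: lin_add lin_prepend)
qed (simp add: lin_single)

lemma bs_cong:
  assumes "\<And>W. \<forall>l\<in>set W. 1 \<le> fst l \<Longrightarrow> a W = a' W" "\<forall>l\<in>set U. 1 \<le> fst l" "\<forall>l\<in>set V. 1 \<le> fst l"
  shows "bs a U V = bs a' U V"
  using assms
proof (induction a U V arbitrary: a' rule: bs.induct)
  case (3 a l U l' V)
  have "bs (\<lambda>W. a (l # W)) U (l' # V) = bs (\<lambda>W. a' (l # W)) U (l' # V)"
    by (rule "3.IH"(1)) (use "3.prems" in auto)
  moreover have "bs (\<lambda>W. a (l' # W)) (l # U) V = bs (\<lambda>W. a' (l' # W)) (l # U) V"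
    by (rule "3.IH"(2)) (use "3.prems" in auto)
  moreover have "bs (\<lambda>W. a ((fst l + fst l', snd l + snd l') # W)) U V = bs (\<lambda>W. a' ((fst l + fst l', snd l + snd l') # W)) U V"
    by (rule "3.IH"(3)) (use "3.prems" in auto)
  ultimately show ?case by simp
qed auto

lemma bs_zero: "bs (\<lambda>W. 0) U = (\<lambda>V. 0)"
proof
  fix V show "bs (\<lambda>W. 0) U V = 0"
  proof (induction "\<lambda>W :: word. 0 :: rat" U V rule: bs.induct)
  qed simp_all
qed

text \<open>The monomials of two merged letters have the divided difference of the merged monomial
  as generating function: a geometric sum in \<open>x\<close> and the binomial theorem in
  \<open>y\<close>.\<close>

lemma merge_coeff:
  assumes "x \<noteq> x'" "L \<in> box N"
  shows "(lm L (x, y + y') - lm L (x', y + y')) / (x - x')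
    = (\<Sum>(l, l') | l \<in> box N \<and> l' \<in> box N \<and> (fst l + fst l', snd l + snd l') = L. lm l (x, y) * lm l' (x', y'))"
proof -
  obtain K M where L: "L = (Suc K, M)" "K < N" "M \<le> N" using assms(2) by (cases L; cases "fst L") (auto simp: box_def)
  have 1: "(x ^ K - x' ^ K) / (x - x') = (\<Sum>i<K. x' ^ (K - Suc i) * x ^ i)"
    using assms(1) by (simp add: power_diff_sumr2)
  have 2: "(y + y') ^ M / fact M = (\<Sum>j\<le>M. (y ^ j / fact j) * (y' ^ (M - j) / fact (M - j)))"
    by (simp add: binomial_ring sum_divide_distrib binomial_fact field_simps)
  have "(lm L (x, y + y') - lm L (x', y + y')) / (x - x') = (x ^ K - x' ^ K) / (x - x') * ((y + y') ^ M / fact M)"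
  proof -
    have "(a * c / d - b * c / d) / e = (a - b) / e * (c / d)" for a b c d e :: rat
    proof -
      have "a * c / d - b * c / d = (a - b) * (c / d)" by (simp add: left_diff_distrib diff_divide_distrib)
      then show ?thesis by (simp add: mult.commute)
    qed
    then show ?thesis by (simp only: L lm_def fst_conv snd_conv diff_Suc_1)
  qed
  also have "\<dots> = (\<Sum>(i, j)\<in>{..<K} \<times> {..M}. (x' ^ (K - Suc i) * x ^ i) * ((y ^ j / fact j) * (y' ^ (M - j) / fact (M - j))))"
    unfolding 1 2 sum_product sum.cartesian_product ..
  also have "\<dots> = (\<Sum>(l, l') | l \<in> box N \<and> l' \<in> box N \<and> (fst l + fst l', snd l + snd l') = L. lm l (x, y) * lm l' (x', y'))"
    by (rule sum.reindex_bij_witness[of _ "\<lambda>(l, l'). (fst l - 1, snd l)" "\<lambda>(i, j). ((Suc i, j), (K - i, M - j))"])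
      (use L in \<open>auto simp: box_def lm_def\<close>)
  finally show ?thesis .
qed

lemma merge_sum:
  assumes "x \<noteq> x'" "\<And>l. l \<notin> box N \<Longrightarrow> T l = 0"
  shows "((\<Sum>l\<in>box N. lm l (x, y + y') * T l) - (\<Sum>l\<in>box N. lm l (x', y + y') * T l)) / (x - x')
    = (\<Sum>l\<in>box N. \<Sum>l'\<in>box N. lm l (x, y) * lm l' (x', y') * T (fst l + fst l', snd l + snd l'))"
proof -
  let ?m = "\<lambda>(l, l'). (fst l + fst l', snd l + snd l')"
  let ?h = "\<lambda>(l, l'). lm l (x, y) * lm l' (x', y') * T (?m (l, l'))"
  let ?S = "{p \<in> box N \<times> box N. ?m p \<in> box N}"
  have T: "T (i, j) \<noteq> 0 \<Longrightarrow> (i, j) \<in> box N" for i j using assms(2) by blast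
  have "(\<Sum>l\<in>box N. \<Sum>l'\<in>box N. lm l (x, y) * lm l' (x', y') * T (fst l + fst l', snd l + snd l')) = sum ?h (box N \<times> box N)"
    by (simp add: sum.cartesian_product)
  also have "\<dots> = sum ?h ?S"
    by (rule sum.mono_neutral_right) (auto intro!: T)
  also have "\<dots> = (\<Sum>L\<in>box N. sum ?h {p \<in> ?S. ?m p = L})"
    by (rule sum.group[symmetric]) auto
  also have "\<dots> = (\<Sum>L\<in>box N. (lm L (x, y + y') - lm L (x', y + y')) / (x - x') * T L)"
  proof (intro sum.cong refl)
    fix L assume L: "L \<in> box N"
    have "sum ?h {p \<in> ?S. ?m p = L}
        = (\<Sum>(l, l') | l \<in> box N \<and> l' \<in> box N \<and> (fst l + fst l', snd l + snd l') = L. lm l (x, y) * lm l' (x', y') * T L)"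
      using L by (intro sum.cong) auto
    also have "\<dots> = (lm L (x, y + y') - lm L (x', y + y')) / (x - x') * T L"
      unfolding merge_coeff[OF assms(1) L] sum_distrib_right by (simp add: case_prod_unfold)
    finally show "sum ?h {p \<in> ?S. ?m p = L} = (lm L (x, y + y') - lm L (x', y + y')) / (x - x') * T L" .
  qed
  finally show ?thesis by (simp add: sum_subtractf[symmetric] sum_divide_distrib left_diff_distrib)
qed

text \<open>Taking generating functions turns the bi-stuffle product into the quasi-shuffle with
  divided differences.\<close>

lemma qs_ev:
  assumes "distx (u @ v)" "\<And>W. a W \<noteq> 0 \<Longrightarrow> set W \<subseteq> box N"
  shows "qs (ev (box N) a) u v = ev (box N) (\<lambda>U. ev (box N) (\<lambda>V. bs a U V) v) u"
  using assms
proof (induction "length u + length v" arbitrary: a u v rule: less_induct)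
  case less
  show ?case
  proof (cases "u = [] \<or> v = []")
    case False
    then obtain c u' d v' where uv: "u = c # u'" "v = d # v'" by (auto simp: neq_Nil_conv)
    let ?B = "box N"
    have sup: "a (l # W) \<noteq> 0 \<Longrightarrow> set W \<subseteq> ?B" for l W using less.prems(2)[of "l # W"] by auto
    have sup0: "(\<lambda>W. a (l # W)) = (\<lambda>W. 0)" if "l \<notin> ?B" for l using less.prems(2)[of "l # _"] that by (intro ext) auto
    have ne: "fst c \<noteq> fst d" using less.prems(1) by (auto simp: uv distx_def)
    have fc: "(\<lambda>w. ev ?B a (c # w)) = (\<lambda>w. \<Sum>l\<in>?B. lm l c * ev ?B (\<lambda>W. a (l # W)) w)" for c by simp
    have q: "qs (\<lambda>w. ev ?B a (c # w)) u v = (\<Sum>l\<in>?B. lm l c * ev ?B (\<lambda>U. ev ?B (\<lambda>V. bs (\<lambda>W. a (l # W)) U V) v) u)"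
      if "length u + length v < length (c' # u') + length (d' # v')" "length (c' # u') + length (d' # v') = length (c0 # u0) + length (d0 # v0)"
        "c0 # u0 = c1 # u'" "d0 # v0 = d1 # v'" "distx (u @ v)" for c u v c' d' c0 d0 u0 v0 c1 d1
    proof -
      have "qs (ev ?B (\<lambda>W. a (l # W))) u v = ev ?B (\<lambda>U. ev ?B (\<lambda>V. bs (\<lambda>W. a (l # W)) U V) v) u" for l
        by (rule less.hyps) (use that uv sup in auto)
      then show ?thesis unfolding fc finl_sumD[OF finl_qs] qs_lin by simp
    qed
    have d1: "distx (u' @ v)" "distx (u @ v')" "distx (u' @ v')" using less.prems(1) by (auto simp: uv distx_def)
    define T where "T l = ev ?B (\<lambda>U. ev ?B (\<lambda>V. bs (\<lambda>W. a (l # W)) U V) v') u'" for l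
    have T0: "T l = 0" if "l \<notin> ?B" for l unfolding T_def sup0[OF that] by (simp add: bs_zero ev_lin)
    have "qs (ev ?B a) u v = (\<Sum>l\<in>?B. lm l c * ev ?B (\<lambda>U. ev ?B (\<lambda>V. bs (\<lambda>W. a (l # W)) U V) v) u')
        + (\<Sum>l\<in>?B. lm l d * ev ?B (\<lambda>U. ev ?B (\<lambda>V. bs (\<lambda>W. a (l # W)) U V) v') u)
        + ((\<Sum>l\<in>?B. lm l (fst c, snd c + snd d) * T l) - (\<Sum>l\<in>?B. lm l (fst d, snd c + snd d) * T l)) / (fst c - fst d)"
    proof -
      have 1: "qs (\<lambda>w. ev ?B a (c # w)) u' v = (\<Sum>l\<in>?B. lm l c * ev ?B (\<lambda>U. ev ?B (\<lambda>V. bs (\<lambda>W. a (l # W)) U V) v) u')"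
        by (rule q[OF _ refl refl refl d1(1)]) (simp add: uv)
      have 2: "qs (\<lambda>w. ev ?B a (d # w)) u v' = (\<Sum>l\<in>?B. lm l d * ev ?B (\<lambda>U. ev ?B (\<lambda>V. bs (\<lambda>W. a (l # W)) U V) v') u)"
        by (rule q[OF _ refl refl refl d1(2)]) (simp add: uv)
      have 3: "qs (\<lambda>w. ev ?B a (e # w)) u' v' = (\<Sum>l\<in>?B. lm l e * T l)" for e
        unfolding T_def by (rule q[OF _ refl refl refl d1(3)]) (simp add: uv)
      have "qs (ev ?B a) u v = qs (\<lambda>w. ev ?B a (c # w)) u' v + qs (\<lambda>w. ev ?B a (d # w)) u v'
        + (qs (\<lambda>w. ev ?B a ((fst c, snd c + snd d) # w)) u' v' - qs (\<lambda>w. ev ?B a ((fst d, snd c + snd d) # w)) u' v') / (fst c - fst d)"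
        unfolding uv qs.simps ..
      then show ?thesis unfolding 1 2 3 .
    qed
    moreover have "((\<Sum>l\<in>?B. lm l (fst c, snd c + snd d) * T l) - (\<Sum>l\<in>?B. lm l (fst d, snd c + snd d) * T l)) / (fst c - fst d)
        = (\<Sum>l\<in>?B. \<Sum>l'\<in>?B. lm l c * lm l' d * T (fst l + fst l', snd l + snd l'))"
      using merge_sum[OF ne T0, where y = "snd c" and y' = "snd d"] by simp
    moreover have "ev ?B (\<lambda>U. ev ?B (\<lambda>V. bs a U V) v) u
        = (\<Sum>l\<in>?B. lm l c * ev ?B (\<lambda>U. ev ?B (\<lambda>V. bs (\<lambda>W. a (l # W)) U V) v) u')
        + (\<Sum>l\<in>?B. lm l d * ev ?B (\<lambda>U. ev ?B (\<lambda>V. bs (\<lambda>W. a (l # W)) U V) v') u)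
        + (\<Sum>l\<in>?B. \<Sum>l'\<in>?B. lm l c * lm l' d * T (fst l + fst l', snd l + snd l'))"
    proof -
      have 2: "(\<Sum>l\<in>?B. lm l d * ev ?B (\<lambda>U. ev ?B (\<lambda>V. bs (\<lambda>W. a (l # W)) U V) v') u)
          = (\<Sum>l\<in>?B. \<Sum>l'\<in>?B. lm l c * (lm l' d * ev ?B (\<lambda>U. ev ?B (\<lambda>V. bs (\<lambda>W. a (l' # W)) (l # U) V) v') u'))"
        unfolding uv ev.simps sum_distrib_left by (subst sum.swap) (simp add: mult_ac)
      have 3: "ev ?B (\<lambda>U. ev ?B (\<lambda>V. bs a U V) v) u
        = (\<Sum>l\<in>?B. \<Sum>l'\<in>?B. lm l c * (lm l' d * ev ?B (\<lambda>U. ev ?B (\<lambda>V. bs a (l # U) (l' # V)) v') u'))"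
        unfolding uv ev.simps ev_sum ev_lin sum_distrib_left
        by (subst sum.swap) (simp add: mult.left_commute)
      have 1: "(\<Sum>l\<in>?B. lm l c * ev ?B (\<lambda>U. ev ?B (\<lambda>V. bs (\<lambda>W. a (l # W)) U V) v) u')
         = (\<Sum>l\<in>?B. \<Sum>l'\<in>?B. lm l c * (lm l' d * ev ?B (\<lambda>U. ev ?B (\<lambda>V. bs (\<lambda>W. a (l # W)) U (l' # V)) v') u'))"
        unfolding uv ev.simps ev_sum ev_lin sum_distrib_left ..
      show ?thesis unfolding 1 2 3 T_def bs.simps
        by (simp add: ev_lin sum.distrib[symmetric] algebra_simps)
    qed
    ultimately show ?thesis by simp
  qed (auto)
qed

lemma ev_append: "ev B F (u @ v) = ev B (\<lambda>U. ev B (\<lambda>V. F (U @ V)) v) u"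
  by (induction u arbitrary: F) simp_all

text \<open>The values on the bi-stuffle products are the coefficients of a polynomial that vanishes
  at all points with distinct coordinates.\<close>

lemma bs_vanish:
  assumes "\<And>W. a W \<noteq> 0 \<Longrightarrow> set W \<subseteq> box N" "lalternil (ev (box N) a)"
    "U \<noteq> []" "V \<noteq> []" "set U \<subseteq> box N" "set V \<subseteq> box N"
  shows "bs a U V = 0"
proof -
  let ?F = "\<lambda>W. bs a (take (length U) W) (drop (length U) W)"
  have "?F (U @ V) = 0"
  proof (rule ev_zero[where S = "{}" and n = "length U + length V" and a = ?F])
    fix w :: "pt list" assume w: "length w = length U + length V" "distx w"
    define u v where uv: "u = take (length U) w" "v = drop (length U) w"
    then have l: "length u = length U" "length v = length V" "w = u @ v" using w by auto
    have "ev (box N) ?F w = ev (box N) (\<lambda>U'. ev (box N) (\<lambda>V'. ?F (U' @ V')) v) u"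
      unfolding l(3) by (rule ev_append)
    also have "\<dots> = ev (box N) (\<lambda>U'. ev (box N) (\<lambda>V'. bs a U' V') v) u"
      by (rule ev_cong) (simp add: l)
    also have "\<dots> = qs (ev (box N) a) u v" using w l assms(1) by (intro qs_ev[symmetric]) auto
    also have "\<dots> = 0"
      using assms(2-4) w(2) l unfolding lalternil_def by (metis length_0_conv)
    finally show "ev (box N) ?F w = 0" .
  qed (use assms in auto)
  then show ?thesis by simp
qed

text \<open>Since only finitely many depths occur, a common bound for all exponents exists, and any
  larger bound serves as well.\<close>

lemma coefficients:
  assumes A: "BR False A f" and L: "\<And>w. length w > L \<Longrightarrow> f w = 0"
  obtains a N where "\<And>W. a W \<noteq> 0 \<Longrightarrow> set W \<subseteq> box N" "f = ev (box N) a"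
    "\<And>W. \<forall>l\<in>set W. 1 \<le> fst l \<Longrightarrow> word_coeff A W = a W" "\<And>n. L < n \<Longrightarrow> A n = 0"
    "\<And>n. \<exists>p. p \<in> Poly n \<and> A n = to_fract p" "\<And>N'. N \<le> N' \<Longrightarrow> f = ev (box N') a"
proof -
  have "\<exists>p. p \<in> Poly n \<and> A n = to_fract p \<and> (\<forall>w. length w = n \<longrightarrow> f w = peval (envw w) p)" for n
    using A rep_polyE[of n "A n" f] unfolding BR_def by metis
  then obtain p where p: "p n \<in> Poly n" "A n = to_fract (p n)" "\<forall>w. length w = n \<longrightarrow> f w = peval (envw w) (p n)" for n
    by metis
  define a where "a W = pw (p (length W)) W" for W
  have z: "A n = 0" if "L < n" for n
    by (rule rep_unique[OF _ rep_zero[of False n], of _ f]) (use A that L in \<open>auto simp: BR_def\<close>)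
  have "\<exists>N. \<forall>W. pw (p n) W \<noteq> 0 \<longrightarrow> set W \<subseteq> box N" for n
    by (rule pw_bound[OF Poly_polynomial[OF p(1)]])
  then obtain M where M: "\<And>n W. pw (p n) W \<noteq> 0 \<Longrightarrow> set W \<subseteq> box (M n)" by metis
  define N where "N = Max (M ` {..L})"
  have sup: "set W \<subseteq> box N" if "a W \<noteq> 0" for W
  proof -
    have "length W \<le> L"
    proof (rule ccontr)
      assume "\<not> length W \<le> L"
      then have "p (length W) = 0" using z[of "length W"] p(2)[of "length W"] by simp
      then show False using that by (simp add: a_def pw_def pcoeff_zero split: if_splits)
    qed
    then have "M (length W) \<le> N" unfolding N_def by (intro Max_ge) auto
    then have "box (M (length W)) \<subseteq> box N" by (auto simp: box_def)
    then show ?thesis using M[of "length W" W] that by (auto simp: a_def)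
  qed
  have f: "f = ev (box N') a" if "N \<le> N'" for N'
  proof
    fix w
    have b: "box N \<subseteq> box N'" using that by (auto simp: box_def)
    have "f w = peval (envw w) (p (length w))" using p(3) by simp
    also have "\<dots> = ev (box N') (pw (p (length w))) w"
    proof (rule peval_ev[OF p(1) _ refl])
      fix W :: word assume "length W = length w" "pw (p (length w)) W \<noteq> 0"
      then show "set W \<subseteq> box N'" using sup[of W] b by (auto simp: a_def)
    qed
    also have "\<dots> = ev (box N') a w" by (rule ev_cong) (simp add: a_def)
    finally show "f w = ev (box N') a w" .
  qed
  have c: "word_coeff A W = a W" if "\<forall>l\<in>set W. 1 \<le> fst l" for W
  proof -
    have "(THE f. A (length W) = to_fract f) = p (length W)"
      using p(2)[of "length W"] by (intro the_equality) auto
    then show ?thesis using that by (simp add: word_coeff_def a_def pw_def wmon_def)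
  qed
  have ex: "\<exists>p. p \<in> Poly n \<and> A n = to_fract p" for n using p(1,2)[of n] by blast
  show thesis by (rule that[OF sup f[OF order_refl] c z ex f])
qed

text \<open>All defining conditions are read off from the values of the representing
  function.\<close>

lemma frakB_I:
  assumes A: "BR False A f" and f0: "f [] = 0" and L: "\<And>w. length w > L \<Longrightarrow> f w = 0"
    and alt: "lalternil f" and sw: "swapinv f" and even: "\<And>x y. f [(- x, - y)] = f [(x, y)]"
  shows "A \<in> frakB"
proof -
  obtain a N where a: "\<And>W. a W \<noteq> 0 \<Longrightarrow> set W \<subseteq> box N" "f = ev (box N) a"
    "\<And>W. \<forall>l\<in>set W. 1 \<le> fst l \<Longrightarrow> word_coeff A W = a W" "\<And>n. L < n \<Longrightarrow> A n = 0"
    "\<And>n. \<exists>p. p \<in> Poly n \<and> A n = to_fract p" "\<And>N'. N \<le> N' \<Longrightarrow> f = ev (box N') a"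
    using coefficients[OF A L] by metis
  have A0: "A 0 = 0"
    by (rule rep_unique[OF _ rep_zero[of False 0], of _ f]) (use A f0 in \<open>auto simp: BR_def\<close>)
  have loc: "A n \<in> Loc n" for n
    using a(5)[of n] Den.one[of n] unfolding Loc_def Poly_def to_fract_def by blast
  have fin: "finite {n. A n \<noteq> 0}"
    by (rule finite_subset[of _ "{..L}"]) (use a(4) in \<open>auto simp: not_less[symmetric]\<close>)
  have pol: "A \<in> BARI_pol"
    using A0 loc fin a(5) unfolding BARI_pol_def BARI_loc_def Poly_def by blast
  have al: "alternil A"
    unfolding alternil_def
  proof (intro ballI impI)
    fix U V assume UV: "U \<in> Words" "V \<in> Words" "U \<noteq> []" "V \<noteq> []"
    then have pos: "\<forall>l\<in>set U. 1 \<le> fst l" "\<forall>l\<in>set V. 1 \<le> fst l" by (auto simp: Words_def)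
    define N' where "N' = Max (insert N (fst ` set (U @ V) \<union> snd ` set (U @ V)))"
    have N': "n \<le> N'" if "n \<in> insert N (fst ` set (U @ V) \<union> snd ` set (U @ V))" for n
      unfolding N'_def by (rule Max_ge) (use that in auto)
    have NN: "N \<le> N'" by (rule N') simp
    have "l \<in> box N'" if "l \<in> set (U @ V)" for l
    proof -
      have "1 \<le> fst l" using that pos by auto
      moreover have "fst l \<le> N'" "snd l \<le> N'"
        using that N'[of "fst l"] N'[of "snd l"] by blast+
      ultimately show ?thesis by (simp add: box_def mem_Times_iff)
    qed
    then have sb: "set U \<subseteq> box N'" "set V \<subseteq> box N'" by auto
    have "coeff_map A (bistuffle U V) = bs (word_coeff A) U V"
      unfolding coeff_map_def lin_def[symmetric] by (rule lin_bistuffle)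
    also have "\<dots> = bs a U V" by (rule bs_cong[OF a(3) pos])
    also have "\<dots> = 0"
    proof (rule bs_vanish[OF _ _ UV(3,4) sb])
      show "set W \<subseteq> box N'" if "a W \<noteq> 0" for W using a(1)[OF that] NN by (auto simp: box_def)
      show "lalternil (ev (box N') a)" using alt a(6)[OF NN] by simp
    qed
    finally show "coeff_map A (bistuffle U V) = 0" .
  qed
  have ev: "bapp A [- xf 1] [- yf 1] = A 1"
  proof (rule rep_unique[of False 1 _ "\<lambda>w. f (evl w [- xf 1] [- yf 1])" _ f])
    show "rep False 1 (bapp A [- xf 1] [- yf 1]) (\<lambda>w. f (evl w [- xf 1] [- yf 1]))"
      by (rule rep_bapp[OF A]) (auto simp: okx_def okf_def vars_iff)
    show "rep False 1 (A 1) f" using A by (simp add: BR_def)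
    fix w :: "pt list" assume "length w = 1"
    then obtain x y where "w = [(x, y)]" by (cases w) auto
    then show "f (evl w [- xf 1] [- yf 1]) = f w"
      by (simp add: evl_def lev_uminus even)
  qed
  show ?thesis using pol al ev sw swap_fixed_iff[OF A] unfolding frakB_def by blast
qed

lemma frakB_E:
  assumes "A \<in> frakB"
  obtains f L where "BR False A f" "f [] = 0" "swapinv f" "\<And>w. length w > L \<Longrightarrow> f w = 0"
proof -
  have "\<exists>p. p \<in> Poly n \<and> A n = to_fract p" for n
    using assms unfolding frakB_def BARI_pol_def Poly_def by blast
  then obtain p where p: "p n \<in> Poly n" "A n = to_fract (p n)" for n by metis
  define f where "f w = peval (envw w) (p (length w))" for w
  have A: "BR False A f"
    unfolding BR_def
  proof
    fix r
    have "rep False r (to_fract (p r)) (\<lambda>w. peval (envw w) (p r))" by (rule rep_poly[OF p(1)])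
    then show "rep False r (A r) f"
      unfolding p(2) by (rule rep_cong) (simp add: f_def)
  qed
  have z: "p n = 0" if "A n = 0" for n using p(2)[of n] that by simp
  have "A 0 = 0" "finite {n. A n \<noteq> 0}"
    using assms unfolding frakB_def BARI_pol_def BARI_loc_def by blast+
  then obtain L where "\<And>n. A n \<noteq> 0 \<Longrightarrow> n \<le> L" using finite_nat_set_iff_bounded_le[of "{n. A n \<noteq> 0}"] by auto
  then have "p (length w) = 0" if "length w > L" for w :: "pt list"
    using z[of "length w"] that not_le by blast
  then have "f w = 0" if "length w > L" for w using that by (simp add: f_def)
  moreover have "f [] = 0" using z \<open>A 0 = 0\<close> by (simp add: f_def)
  moreover have "swapinv f" using assms swap_fixed_iff[OF A] by (simp add: frakB_def)
  ultimately show thesis using that A by blast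
qed

lemma bscale_xisq_frakB: "bscale c ((delta_check ^^ k) xi1) \<in> frakB \<and> BR False (bscale c ((delta_check ^^ k) xi1)) (\<lambda>w. c * xisq k w)"
proof
  show B: "BR False (bscale c ((delta_check ^^ k) xi1)) (\<lambda>w. c * xisq k w)"
    using BR_xisq[of k] rep_mult[OF rep_const] unfolding BR_def bscale_def by blast
  show "bscale c ((delta_check ^^ k) xi1) \<in> frakB"
  proof (rule frakB_I[OF B])
    show "c * xisq k w = 0" if "length w > 2 * k + 1" for w using xisq_length[OF that] by simp
    show "lalternil (\<lambda>w. c * xisq k w)" using lalternil_xisq[of k] by (simp add: lalternil_def qs_lin)
    show "swapinv (\<lambda>w. c * xisq k w)" using swapinv_xisq[of k] by (simp add: swapinv_def)
    show "c * xisq k [(- x, - y)] = c * xisq k [(x, y)]" for x y by (simp add: xisq_depth1)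
  qed simp
qed

section \<open>The equation for the component of lowest depth\<close>

definition phi :: "nat \<Rightarrow> pt \<Rightarrow> rat" where "phi m c = (fst c * snd c) ^ m"

text \<open>The following \<open>x\<close>-coordinate, with \<open>0\<close> after the end of the
  word. This convention absorbs the last summand of mu.\<close>

definition nx :: "pt list \<Rightarrow> nat \<Rightarrow> rat" where
  "nx w p = (if Suc p < length w then fst (w ! Suc p) else 0)"

text \<open>The bracket ari of \<open>(X\<^sub>1 Y\<^sub>1)\<^sup>m\<close> with \<open>b\<close>,
  written as a sum over contractions.\<close>

definition eqn :: "nat \<Rightarrow> (pt list \<Rightarrow> rat) \<Rightarrow> pt list \<Rightarrow> rat" where
  "eqn m b w = phi m (fst (last w), ysum w) * b (tr (fst (last w)) (butlast w))
     - phi m (fst (hd w), ysum w) * b (tr (fst (hd w)) (tl w)) + phi m (hd w) * b (tl w)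
     - (\<Sum>p<length w. ((fst (w ! p) - nx w p) * snd (w ! p)) ^ m * b (delM p w))
     + (\<Sum>p<length w - 1. ((fst (w ! Suc p) - fst (w ! p)) * snd (w ! Suc p)) ^ m * b (delN p w))"

lemma dep1_length: "length u \<noteq> 1 \<Longrightarrow> dep1 \<phi> u = 0"
  by (auto simp: dep1_def split: list.splits)

lemma karit_dep1: "length u \<noteq> 2 \<Longrightarrow> karit (dep1 \<phi>) u \<psi> = 0"
  "karit (dep1 \<phi>) [a, b] \<psi> = \<psi> (fst b, snd a + snd b) * \<phi> (fst a - fst b, snd a)
     - \<psi> (fst a, snd a + snd b) * \<phi> (fst b - fst a, snd b)"
  by (simp_all add: karit_def dep1_length)

lemma lari_eqn:
  assumes "2 \<le> length w" shows "lari (dep1 (phi m)) b w = eqn m b w"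
proof -
  have ne: "w \<noteq> []" using assms by auto
  obtain c v where w: "w = c # v" using ne by (cases w) auto
  obtain v' e where w': "w = v' @ [e]" using ne by (cases w rule: rev_cases) auto
  have 1: "larit b (dep1 (phi m)) w = karit b w (phi m)"
    unfolding larit_def by (rule der_dep1) (simp_all add: ne)
  have d: "(\<lambda>v. dep1 (phi m) (c # v)) = (\<lambda>v. phi m c * unitf v)" by (simp add: dep1_Cons)
  have 2: "lmu (dep1 (phi m)) b w = phi m (hd w) * b (tl w)"
    by (simp add: w lmu_Cons d lmu_lin)
  have 3: "lmu b (dep1 (phi m)) w = b (butlast w) * phi m (last w)"
    by (simp add: w' lmu_snoc_dep1)
  have 4: "larit (dep1 (phi m)) b w = (\<Sum>p<length w - 1. ((fst (w ! p) - nx w p) * snd (w ! p)) ^ m * b (delM p w))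
      - (\<Sum>p<length w - 1. ((fst (w ! Suc p) - fst (w ! p)) * snd (w ! Suc p)) ^ m * b (delN p w))"
    unfolding larit_def sum_subtractf[symmetric]
    by (subst der_short_sum) (auto simp: karit_dep1 delM_eq delN_eq phi_def nx_def intro!: sum.cong)
  have 5: "(\<Sum>p<length w. ((fst (w ! p) - nx w p) * snd (w ! p)) ^ m * b (delM p w))
      = (\<Sum>p<length w - 1. ((fst (w ! p) - nx w p) * snd (w ! p)) ^ m * b (delM p w)) + b (butlast w) * phi m (last w)"
  proof -
    have l: "length w = Suc (length w - 1)" using ne by simp
    have "delM (length w - 1) w = butlast w" by (simp add: delM_last butlast_conv_take)
    moreover have "nx w (length w - 1) = 0" using l by (simp add: nx_def)
    moreover have "w ! (length w - 1) = last w" using ne by (simp add: last_conv_nth)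
    ultimately show ?thesis by (subst l) (simp add: phi_def)
  qed
  show ?thesis unfolding lari_def 1 2 3 4 eqn_def 5 karit_def by simp
qed

text \<open>A term of ari of total depth \<open>d + 1\<close> has one argument of depth at most one
  or the other of depth below \<open>d\<close>.\<close>

lemma lari_leading:
  assumes F: "\<And>u. length u \<le> 1 \<Longrightarrow> F u = h u" "F [] = 0"
    and G: "\<And>u. length u \<le> d \<Longrightarrow> G u = b u" "\<And>u. length u < d \<Longrightarrow> b u = 0" and w: "length w = Suc d"
  shows "lari F G w = lari h b w"
proof -
  have h0: "h [] = 0" using F(1)[of "[]"] F(2) by simp
  have G0: "G u = 0" if "length u < d" for u using G that by simp
  have 1: "larit G F w = larit b h w"
    unfolding larit_def der_closed
  proof (intro sum.cong refl)
    fix p j assume "p \<in> {..<length w}" "j \<in> {..<length w - p}"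
    then have pj: "p < length w" "j < length w - p" by auto
    let ?m = "take (Suc j) (drop p w)"
    have l: "length (tr z (butlast ?m)) = j" "length (tr z (tl ?m)) = j" for z using pj by simp_all
    show "karit G ?m (\<lambda>l. F (take p w @ l # drop (p + Suc j) w)) = karit b ?m (\<lambda>l. h (take p w @ l # drop (p + Suc j) w))"
    proof (cases "j < d")
      case True
      then show ?thesis unfolding karit_def using G0 G(2) l by simp
    next
      case False
      then have j: "j = d" "p = 0" using pj w by auto
      then have "F (take p w @ l # drop (p + Suc j) w) = h (take p w @ l # drop (p + Suc j) w)" for l
        using w F(1)[of "[l]"] by simp
      then show ?thesis unfolding karit_def using G(1) l j by simp
    qed
  qed
  have 2: "larit F G w = larit h b w"
    unfolding larit_def der_closed
  proof (intro sum.cong refl)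
    fix p j assume "p \<in> {..<length w}" "j \<in> {..<length w - p}"
    then have pj: "p < length w" "j < length w - p" by auto
    let ?m = "take (Suc j) (drop p w)"
    have l: "length (tr z (butlast ?m)) = j" "length (tr z (tl ?m)) = j" for z using pj by simp_all
    have l': "length (take p w @ c # drop (p + Suc j) w) = Suc d - j" for c using pj w by simp
    consider "j = 0" | "j = 1" | "2 \<le> j" by linarith
    then show "karit F ?m (\<lambda>l. G (take p w @ l # drop (p + Suc j) w)) = karit h ?m (\<lambda>l. b (take p w @ l # drop (p + Suc j) w))"
    proof cases
      case 1
      then have "tr z (butlast ?m) = []" "tr z (tl ?m) = []" for z using l by (metis length_0_conv)+
      then show ?thesis unfolding karit_def by (simp only: F(2) h0 mult_zero_right)
    next
      case 2
      have "G (take p w @ c # drop (p + Suc j) w) = b (take p w @ c # drop (p + Suc j) w)" for c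
        by (rule G(1)) (use l' 2 in simp)
      moreover have "F (tr z (butlast ?m)) = h (tr z (butlast ?m))" "F (tr z (tl ?m)) = h (tr z (tl ?m))" for z
        using F(1) l 2 by auto
      ultimately show ?thesis unfolding karit_def by (simp only:)
    next
      case 3
      have "G (take p w @ c # drop (p + Suc j) w) = 0" "b (take p w @ c # drop (p + Suc j) w) = 0" for c
        using G0 G(2) l' 3 w pj by auto
      then show ?thesis unfolding karit_def by (simp only: mult_zero_left)
    qed
  qed
  have 3: "lmu F G w = lmu h b w"
    unfolding lmu_def
  proof (intro sum.cong refl)
    fix i assume "i \<in> {..length w}"
    then have i: "length (take i w) = i" "length (drop i w) = Suc d - i" using w by auto
    consider "i = 0" | "i = 1" | "2 \<le> i" by linarith
    then show "F (take i w) * G (drop i w) = h (take i w) * b (drop i w)"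
    proof cases
      case 3
      then have "G (drop i w) = 0" "b (drop i w) = 0" using G0 G(2) i w \<open>i \<in> _\<close> by auto
      then show ?thesis by simp
    next
      case 2
      then have "F (take i w) = h (take i w)" "G (drop i w) = b (drop i w)" using F(1) G(1) i by auto
      then show ?thesis by simp
    qed (simp add: F(2) h0)
  qed
  have 4: "lmu G F w = lmu b h w"
    unfolding lmu_def
  proof (intro sum.cong refl)
    fix i assume "i \<in> {..length w}"
    then have i: "length (take i w) = i" "length (drop i w) = Suc d - i" "i \<le> Suc d" using w by auto
    consider "i < d" | "i = d" | "i = Suc d" using i by linarith
    then show "G (take i w) * F (drop i w) = b (take i w) * h (drop i w)"
    proof cases
      case 1
      then show ?thesis using G0[of "take i w"] G(2)[of "take i w"] i by simp
    next
      case 2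
      then show ?thesis using F(1)[of "drop i w"] G(1)[of "take i w"] i by simp
    next
      case 3
      then have "drop i w = []" using w by simp
      then show ?thesis by (simp only: F(2) h0 mult_zero_right)
    qed
  qed
  show ?thesis unfolding lari_def 1 2 3 4 ..
qed

lemma gpoc_low: "(\<And>u. length u < d \<Longrightarrow> f u = 0) \<Longrightarrow> length u \<le> d \<Longrightarrow> gpoc f u = f u"
  unfolding gpoc_def by (rule gkan_leading) (auto simp: lpoc_def)

lemma xisq_low: "length u \<le> 1 \<Longrightarrow> xisq m u = dep1 (phi m) u"
  by (cases u; cases "tl u") (auto simp: xisq_depth1 phi_def)

lemma lari_of_uri_zero:
  assumes A: "BR False A f" and f0: "f [] = 0" and u: "uri ((delta_check ^^ m) xi1) A = bzero"
  shows "eqg (lari (gpoc (xisq m)) (gpoc f)) (\<lambda>w. 0)"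
proof (rule gpic_inj)
  let ?\<xi> = "(delta_check ^^ m) xi1"
  have T: "BR True ?\<xi> (xisq m)" "BR True A f" using BR_xisq A rep_True unfolding BR_def by blast+
  have B: "BR True (uri ?\<xi> A) (luri (xisq m) f)" by (rule BR_uri[OF T]) (simp_all add: f0)
  have "luri (xisq m) f w = 0" if "gen w" for w
  proof (rule rep_fun_unique[OF _ rep_zero[of True "length w"] refl])
    show "rep True (length w) 0 (luri (xisq m) f)" using B u by (simp add: BR_def bzero_def)
  qed (simp add: good_def that)
  then show "eqg (gpic (lari (gpoc (xisq m)) (gpoc f))) (gpic (\<lambda>w. 0))"
    unfolding eqg_def luri_def finlD(3)[OF finl_gpic(1)] by simp
qed

text \<open>The equation is known at generic points. As all terms are polynomial, it holds at every
  point.\<close>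

lemma eqn_zero:
  assumes A: "BR False A f" and z: "eqg (lari (gpoc (xisq m)) (gpoc f)) (\<lambda>w. 0)"
    and low: "\<And>u. length u < d \<Longrightarrow> f u = 0" and d: "1 \<le> d" and w: "length w = Suc d"
  shows "eqn m f w = 0"
proof -
  let ?\<xi> = "(delta_check ^^ m) xi1"
  have f0: "f [] = 0" using low[of "[]"] d by simp
  have lx: "gpoc (xisq m) u = xisq m u" if "length u \<le> 1" for u
    by (rule gpoc_low[of 1]) (use that in auto)
  have 1: "lari (xisq m) f w = 0" if "length w = Suc d" "gen w" for w
  proof -
    have "lari (gpoc (xisq m)) (gpoc f) w = lari (xisq m) f w"
      by (rule lari_leading[OF lx _ gpoc_low[OF low] low that(1)]) (simp_all add: lx)
    then show ?thesis using eqgD[OF z that(2)] by simp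
  qed
  have r: "rep False (Suc d) (ari ?\<xi> A (Suc d)) (lari (xisq m) f)"
    using BR_ari[OF BR_xisq A] f0 by (simp add: BR_def)
  have "ari ?\<xi> A (Suc d) = 0" by (rule rep_unique[OF r rep_zero]) (rule 1)
  then have "lari (xisq m) f w = 0"
    using r by (intro rep_fun_unique[OF _ rep_zero[of False "Suc d"] w]) (simp_all add: good_def)
  moreover have "lari (xisq m) f w = lari (dep1 (phi m)) f w"
    by (rule lari_leading[OF xisq_low _ refl low w]) simp_all
  ultimately show ?thesis using lari_eqn[of w m f] w d by simp
qed

definition scl :: "rat \<Rightarrow> rat \<Rightarrow> pt list \<Rightarrow> pt list" where
  "scl s t w = map (\<lambda>l. (s * fst l, t * snd l)) w"

lemma scl_simps [simp]: "scl s t [] = []" "scl s t (c # w) = (s * fst c, t * snd c) # scl s t w"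
  "length (scl s t w) = length w" "ysum (scl s t w) = t * ysum w" "scl s t w = [] \<longleftrightarrow> w = []"
  "tr (s * z) (scl s t w) = scl s t (tr z w)" "scl 1 1 w = w"
  "scl s t (scl s' t' w) = scl (s * s') (t * t') w"
  by (simp_all add: scl_def ysum_def tr_def o_def sum_list_const_mult algebra_simps)

lemma scl_list:
  "butlast (scl s t w) = scl s t (butlast w)" "tl (scl s t w) = scl s t (tl w)"
  "w \<noteq> [] \<Longrightarrow> hd (scl s t w) = (s * fst (hd w), t * snd (hd w))"
  "w \<noteq> [] \<Longrightarrow> last (scl s t w) = (s * fst (last w), t * snd (last w))"
  "i < length w \<Longrightarrow> scl s t w ! i = (s * fst (w ! i), t * snd (w ! i))"
  by (simp_all add: scl_def map_butlast map_tl hd_map last_map)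

lemma scl_del: "delM a (scl s t w) = scl s t (delM a w)" "delN a (scl s t w) = scl s t (delN a w)"
  by (auto simp: delM_def delN_def scl_def drop_map take_map algebra_simps split: list.splits)

lemma phi_scl: "phi m (s * x, t * y) = (s * t) ^ m * phi m (x, y)"
  by (simp add: phi_def power_mult_distrib mult_ac)

text \<open>The equation is bihomogeneous.\<close>

lemma eqn_scl:
  assumes b: "\<And>u. length u = d \<Longrightarrow> b (scl s t u) = k * b' u" and w: "length w = Suc d"
  shows "eqn m b (scl s t w) = (s * t) ^ m * k * eqn m b' w"
proof -
  have ne: "w \<noteq> []" using w by auto
  let ?K = "(s * t) ^ m * k"
  have 1: "phi m (fst (last (scl s t w)), ysum (scl s t w)) * b (tr (fst (last (scl s t w))) (butlast (scl s t w)))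
      = ?K * (phi m (fst (last w), ysum w) * b' (tr (fst (last w)) (butlast w)))"
    using ne w by (simp add: scl_list phi_scl b)
  have 2: "phi m (fst (hd (scl s t w)), ysum (scl s t w)) * b (tr (fst (hd (scl s t w))) (tl (scl s t w)))
      = ?K * (phi m (fst (hd w), ysum w) * b' (tr (fst (hd w)) (tl w)))"
    using ne w by (simp add: scl_list phi_scl b)
  have 3: "phi m (hd (scl s t w)) * b (tl (scl s t w)) = ?K * (phi m (hd w) * b' (tl w))"
    using ne w phi_scl[of m s "fst (hd w)" t "snd (hd w)"] by (simp add: scl_list b)
  have 4: "(\<Sum>p<length (scl s t w). ((fst (scl s t w ! p) - nx (scl s t w) p) * snd (scl s t w ! p)) ^ m * b (delM p (scl s t w)))
      = ?K * (\<Sum>p<length w. ((fst (w ! p) - nx w p) * snd (w ! p)) ^ m * b' (delM p w))"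
    unfolding sum_distrib_left
  proof (intro sum.cong)
    fix p assume "p \<in> {..<length w}"
    then have p: "p < length w" by simp
    have n: "nx (scl s t w) p = s * nx w p" by (simp add: nx_def scl_list)
    have e: "(fst (scl s t w ! p) - nx (scl s t w) p) * snd (scl s t w ! p) = (s * t) * ((fst (w ! p) - nx w p) * snd (w ! p))"
      using p by (simp add: n scl_list algebra_simps)
    have e': "b (delM p (scl s t w)) = k * b' (delM p w)" using p w delM_facts(1)[OF p] by (simp add: scl_del b)
    show "((fst (scl s t w ! p) - nx (scl s t w) p) * snd (scl s t w ! p)) ^ m * b (delM p (scl s t w))
        = ?K * (((fst (w ! p) - nx w p) * snd (w ! p)) ^ m * b' (delM p w))"
      unfolding e e' by (simp only: power_mult_distrib mult_ac)
  qed simp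
  have 5: "(\<Sum>p<length (scl s t w) - 1. ((fst (scl s t w ! Suc p) - fst (scl s t w ! p)) * snd (scl s t w ! Suc p)) ^ m * b (delN p (scl s t w)))
      = ?K * (\<Sum>p<length w - 1. ((fst (w ! Suc p) - fst (w ! p)) * snd (w ! Suc p)) ^ m * b' (delN p w))"
    unfolding sum_distrib_left
  proof (intro sum.cong)
    fix p assume "p \<in> {..<length w - 1}"
    then have p: "Suc p < length w" by auto
    have e: "(fst (scl s t w ! Suc p) - fst (scl s t w ! p)) * snd (scl s t w ! Suc p) = (s * t) * ((fst (w ! Suc p) - fst (w ! p)) * snd (w ! Suc p))"
      using p by (simp add: scl_list algebra_simps)
    have e': "b (delN p (scl s t w)) = k * b' (delN p w)" using p w delN_facts(1)[OF p] by (simp add: scl_del b)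
    show "((fst (scl s t w ! Suc p) - fst (scl s t w ! p)) * snd (scl s t w ! Suc p)) ^ m * b (delN p (scl s t w))
        = ?K * (((fst (w ! Suc p) - fst (w ! p)) * snd (w ! Suc p)) ^ m * b' (delN p w))"
      unfolding e e' by (simp only: power_mult_distrib mult_ac)
  qed simp
  show ?thesis unfolding eqn_def 1 2 3 4 5 by (simp add: algebra_simps)
qed

text \<open>A polynomial function of degree at most \<open>n\<close> with coefficient
  \<open>c\<close> in degree \<open>n\<close>.\<close>

definition lc :: "nat \<Rightarrow> (rat \<Rightarrow> rat) \<Rightarrow> rat \<Rightarrow> bool" where
  "lc n g c \<longleftrightarrow> (\<exists>P :: rat poly. degree P \<le> n \<and> Polynomial.coeff P n = c \<and> g = poly P)"

lemma lc_add: "lc n g c \<Longrightarrow> lc n g' c' \<Longrightarrow> lc n (\<lambda>y. g y + g' y) (c + c')"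
proof -
  assume "lc n g c" "lc n g' c'"
  then obtain P Q :: "rat poly" where "degree P \<le> n" "Polynomial.coeff P n = c" "g = poly P"
    "degree Q \<le> n" "Polynomial.coeff Q n = c'" "g' = poly Q" unfolding lc_def by blast
  then show ?thesis unfolding lc_def by (intro exI[of _ "P + Q"]) (auto simp: degree_add_le fun_eq_iff)
qed

lemma lc_const: "lc 0 (\<lambda>y. k) k"
  unfolding lc_def by (rule exI[of _ "[:k:]"]) auto

lemma lc_mult: assumes "lc n g c" "lc n' g' c'" shows "lc (n + n') (\<lambda>y. g y * g' y) (c * c')"
proof -
  obtain P Q :: "rat poly" where P: "degree P \<le> n" "Polynomial.coeff P n = c" "g = poly P"
    and Q: "degree Q \<le> n'" "Polynomial.coeff Q n' = c'" "g' = poly Q" using assms unfolding lc_def by blast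
  have "Polynomial.coeff (P * Q) (n + n') = (\<Sum>i\<le>n + n'. Polynomial.coeff P i * Polynomial.coeff Q (n + n' - i))"
    by (rule coeff_mult)
  also have "\<dots> = (\<Sum>i\<in>{n}. Polynomial.coeff P i * Polynomial.coeff Q (n + n' - i))"
  proof (rule sum.mono_neutral_right)
    show "\<forall>i\<in>{..n + n'} - {n}. Polynomial.coeff P i * Polynomial.coeff Q (n + n' - i) = 0"
    proof
      fix i assume "i \<in> {..n + n'} - {n}"
      then consider "degree P < i" | "degree Q < n + n' - i" using P(1) Q(1) by fastforce
      then show "Polynomial.coeff P i * Polynomial.coeff Q (n + n' - i) = 0" by cases (simp_all add: coeff_eq_0)
    qed
  qed auto
  finally have "Polynomial.coeff (P * Q) (n + n') = c * c'" using P Q by simp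
  moreover have "degree (P * Q) \<le> n + n'" using degree_mult_le[of P Q] P(1) Q(1) by linarith
  ultimately show ?thesis unfolding lc_def P(3) Q(3) by (intro exI[of _ "P * Q"]) auto
qed

lemma lc_cmult: "lc n g c \<Longrightarrow> lc n (\<lambda>y. k * g y) (k * c)"
  using lc_mult[OF lc_const[of k]] by simp

lemma lc_diff: "lc n g c \<Longrightarrow> lc n g' c' \<Longrightarrow> lc n (\<lambda>y. g y - g' y) (c - c')"
  using lc_add[OF _ lc_cmult[of n g' c' "-1"], of g c] by simp

lemma lc_raise: "lc n g c \<Longrightarrow> n < n' \<Longrightarrow> lc n' g 0"
proof -
  assume "lc n g c" "n < n'"
  then obtain P :: "rat poly" where "degree P \<le> n" "g = poly P" unfolding lc_def by blast
  then show ?thesis using \<open>n < n'\<close> unfolding lc_def by (intro exI[of _ P]) (auto intro: coeff_eq_0)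
qed

lemma lc_power: "lc k (\<lambda>y. (y + s) ^ k) 1"
proof (induction k)
  case 0
  then show ?case using lc_const[of 1] by simp
next
  case (Suc k)
  have "lc 1 (\<lambda>y. y + s) 1" unfolding lc_def by (rule exI[of _ "[:s, 1:]"]) (auto simp: add.commute)
  from lc_mult[OF this Suc] show ?case by simp
qed

lemma lc_sum_zero: "(\<And>i. i \<in> I \<Longrightarrow> lc n (g i) 0) \<Longrightarrow> lc n (\<lambda>y. \<Sum>i\<in>I. g i y) 0"
proof (induction I rule: infinite_finite_induct)
  case (insert i I)
  then show ?case using lc_add[of n "g i" 0 "\<lambda>y. \<Sum>i\<in>I. g i y" 0] by simp
qed (auto simp: lc_def intro!: exI[of _ 0])

lemma lc_unique: "lc n g c \<Longrightarrow> lc n g c' \<Longrightarrow> c = c'"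
  unfolding lc_def by (auto simp: poly_eq_poly_eq_iff)

text \<open>The coefficients of the expansion in the first \<open>y\<close>-coordinate.\<close>

definition ycoeff :: "nat \<Rightarrow> (word \<Rightarrow> rat) \<Rightarrow> nat \<Rightarrow> rat \<Rightarrow> pt list \<Rightarrow> rat" where
  "ycoeff N a j x w = (\<Sum>k\<in>{1..N}. x ^ (k - 1) / fact j * ev (box N) (\<lambda>W. a ((k, j) # W)) w)"

lemma ev_ycoeff: "ev (box N) a ((x, y) # w) = (\<Sum>j\<le>N. ycoeff N a j x w * y ^ j)"
proof -
  have "ev (box N) a ((x, y) # w) = (\<Sum>k\<in>{1..N}. \<Sum>j\<in>{0..N}. lm (k, j) (x, y) * ev (box N) (\<lambda>W. a ((k, j) # W)) w)"
    by (simp add: box_def sum.cartesian_product)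
  also have "\<dots> = (\<Sum>j\<le>N. ycoeff N a j x w * y ^ j)"
    unfolding ycoeff_def sum_distrib_right atLeast0AtMost[symmetric]
    by (subst sum.swap) (simp add: lm_def field_simps)
  finally show ?thesis .
qed

text \<open>The product \<open>(x\<^sub>1 - x\<^sub>2) \<dots> (x\<^sub>d\<^sub>-\<^sub>1 -
  x\<^sub>d) x\<^sub>d\<close>.\<close>

fun dp :: "pt list \<Rightarrow> rat" where
  "dp [] = 1"
| "dp [c] = fst c"
| "dp (c # c' # w) = (fst c - fst c') * dp (c' # w)"

lemma dp_cong: "map fst w = map fst w' \<Longrightarrow> dp w = dp w'"
proof (induction w arbitrary: w' rule: dp.induct)
  case (3 c c' w)
  then obtain e e' v where "w' = e # e' # v" by (cases w'; cases "tl w'") auto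
  with 3 show ?case by auto
qed (auto simp: Cons_eq_map_conv)

text \<open>The points \<open>i, \<dots>, 2, 1\<close> with vanishing \<open>y\<close>-coordinates,
  on which the recursion for leading coefficients ends.\<close>

fun stair :: "nat \<Rightarrow> pt list" where
  "stair 0 = []"
| "stair (Suc i) = tr (-1) (stair i) @ [(1, 0)]"

lemma length_stair [simp]: "length (stair i) = i" by (induction i) simp_all

lemma hd_stair: "fst (hd (stair (Suc i))) = of_nat (Suc i)"
proof (induction i)
  case (Suc i)
  have "stair (Suc i) \<noteq> []" by (simp del: stair.simps flip: length_0_conv)
  then show ?case using Suc by (subst stair.simps) (simp add: hd_append fst_hd_last_tr del: stair.simps)
qed simp

lemma delM_Cons: "delM (Suc p) (c # w) = c # delM p w" "delM 0 (c # c' # w) = (fst c', snd c + snd c') # w"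
  "delN (Suc p) (c # w) = c # delN p w" "delN 0 (c # c' # w) = (fst c, snd c + snd c') # w" "delM 0 [c] = []"
  by (simp_all add: delM_def delN_def)

lemma map_fst_tr: "map fst (tr z u) = map (\<lambda>a. a - z) (map fst u)" by (simp add: tr_def)

text \<open>The coefficient of \<open>y\<^sub>1\<close> to the power \<open>m + e\<close> in the
  equation. Only the terms in which \<open>y\<^sub>1\<close> occurs both in the factor of degree
  \<open>m\<close> and in the first letter of the argument contribute; in case \<open>e = 0\<close>
  two more terms do.\<close>

lemma leading_recursion:
  assumes m: "1 \<le> m" and V: "length V = d" "1 \<le> d"
    and EQ: "\<And>w. length w = Suc d \<Longrightarrow> eqn m b w = 0"
    and L: "\<And>x s w. length w = d - 1 \<Longrightarrow> lc e (\<lambda>y. b ((x, y + s) # w)) (lead x w)"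
  shows "fst (last V) ^ m * lead (x - fst (last V)) (tr (fst (last V)) (butlast V))
    = (x - fst (hd V)) ^ m * lead (fst (hd V)) (tl V) + (if e = 0 then x ^ m * (b (tr x V) - b V) else 0)"
proof -
  obtain c V' where Vc: "V = c # V'" using V by (cases V) auto
  define xr where "xr = fst (last V)"
  let ?w = "\<lambda>y. (x, y) # V"
  let ?\<delta> = "\<lambda>k. if e = 0 then k else 0 :: rat"
  have pw: "lc m (\<lambda>y. (z * (y + s)) ^ m) (z ^ m)" for z s
    using lc_cmult[OF lc_power[of m s], of "z ^ m"] by (simp add: power_mult_distrib)
  have L0: "lc e (\<lambda>y. b ((x, y) # w)) (lead x w)" if "length w = d - 1" for x w using L[OF that, of x 0] by simp
  have lo: "lc (m + e) g 0" if "lc e g k" for g k using lc_raise[OF that, of "m + e"] m by simp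
  have T1: "lc (m + e) (\<lambda>y. phi m (fst (last (?w y)), ysum (?w y)) * b (tr (fst (last (?w y))) (butlast (?w y))))
      (xr ^ m * lead (x - xr) (tr xr (butlast V)))"
  proof -
    have "lc (m + e) (\<lambda>y. (xr * (y + ysum V)) ^ m * b ((x - xr, y) # tr xr (butlast V))) (xr ^ m * lead (x - xr) (tr xr (butlast V)))"
      by (rule lc_mult[OF pw L0]) (simp add: V)
    then show ?thesis by (simp add: Vc phi_def xr_def)
  qed
  have raise: "lc (m + e) (\<lambda>y. (x * (y + s)) ^ m * k) (?\<delta> (x ^ m * k))" for s k
  proof -
    have "lc m (\<lambda>y. (x * (y + s)) ^ m * k) (x ^ m * k)"
      using lc_mult[OF pw[of x s] lc_const[of k]] by simp
    then show ?thesis using lc_raise[of m _ "x ^ m * k" "m + e"] by (cases "e = 0") auto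
  qed
  have T2: "lc (m + e) (\<lambda>y. phi m (fst (hd (?w y)), ysum (?w y)) * b (tr (fst (hd (?w y))) (tl (?w y)))) (?\<delta> (x ^ m * b (tr x V)))"
    using raise[of "ysum V" "b (tr x V)"] by (simp add: phi_def)
  have T3: "lc (m + e) (\<lambda>y. phi m (hd (?w y)) * b (tl (?w y))) (?\<delta> (x ^ m * b V))"
    using raise[of 0 "b V"] by (simp add: phi_def)
  have T4: "lc (m + e) (\<lambda>y. \<Sum>p<length (?w y). ((fst (?w y ! p) - nx (?w y) p) * snd (?w y ! p)) ^ m * b (delM p (?w y)))
      ((x - fst c) ^ m * lead (fst c) V')"
  proof -
    have 1: "lc (m + e) (\<lambda>y. ((x - fst c) * (y + 0)) ^ m * b ((fst c, y + snd c) # V')) ((x - fst c) ^ m * lead (fst c) V')"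
      by (rule lc_mult[OF pw L]) (use V Vc in simp)
    have 2: "lc (m + e) (\<lambda>y. \<Sum>p<d. ((fst (V ! p) - nx V p) * snd (V ! p)) ^ m * b ((x, y) # delM p V)) 0"
      by (rule lc_sum_zero) (rule lo, rule lc_cmult, rule L0, use V in \<open>simp add: delM_facts\<close>)
    have n: "nx (?w y) 0 = fst c" "nx (?w y) (Suc p) = nx V p" for y p by (simp_all add: nx_def Vc)
    have "(\<Sum>p<length (?w y). ((fst (?w y ! p) - nx (?w y) p) * snd (?w y ! p)) ^ m * b (delM p (?w y)))
        = ((x - fst c) * (y + 0)) ^ m * b ((fst c, y + snd c) # V')
          + (\<Sum>p<d. ((fst (V ! p) - nx V p) * snd (V ! p)) ^ m * b ((x, y) # delM p V))" for y
    proof -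
      have "length (?w y) = Suc d" using V by simp
      moreover have "delM 0 (?w y) = (fst c, y + snd c) # V'" by (simp add: Vc delM_Cons)
      ultimately show ?thesis by (simp only: sum.lessThan_Suc_shift n) (simp add: delM_Cons)
    qed
    then show ?thesis using lc_add[OF 1 2] by simp
  qed
  have T5: "lc (m + e) (\<lambda>y. \<Sum>p<length (?w y) - 1. ((fst (?w y ! Suc p) - fst (?w y ! p)) * snd (?w y ! Suc p)) ^ m * b (delN p (?w y))) 0"
  proof -
    have 1: "lc (m + e) (\<lambda>y. ((fst c - x) * snd c) ^ m * b ((x, y + snd c) # V')) 0"
      by (rule lo, rule lc_cmult, rule L) (use V Vc in simp)
    have 2: "lc (m + e) (\<lambda>y. \<Sum>p<d - 1. ((fst (V ! Suc p) - fst (V ! p)) * snd (V ! Suc p)) ^ m * b ((x, y) # delN p V)) 0"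
      by (rule lc_sum_zero) (rule lo, rule lc_cmult, rule L0, use V in \<open>simp add: delN_facts\<close>)
    have "(\<Sum>p<length (?w y) - 1. ((fst (?w y ! Suc p) - fst (?w y ! p)) * snd (?w y ! Suc p)) ^ m * b (delN p (?w y)))
        = ((fst c - x) * snd c) ^ m * b ((x, y + snd c) # V')
          + (\<Sum>p<d - 1. ((fst (V ! Suc p) - fst (V ! p)) * snd (V ! Suc p)) ^ m * b ((x, y) # delN p V))" for y
    proof -
      have "length (?w y) - 1 = Suc (d - 1)" using V by simp
      moreover have "delN 0 (?w y) = (x, y + snd c) # V'" by (simp add: Vc delM_Cons)
      moreover have "V ! 0 = c" by (simp add: Vc)
      ultimately show ?thesis by (simp only: sum.lessThan_Suc_shift) (simp add: delM_Cons)
    qed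
    then show ?thesis using lc_add[OF 1 2] by simp
  qed
  have "lc (m + e) (\<lambda>y. eqn m b (?w y)) (xr ^ m * lead (x - xr) (tr xr (butlast V)) - ?\<delta> (x ^ m * b (tr x V)) + ?\<delta> (x ^ m * b V)
      - (x - fst c) ^ m * lead (fst c) V' + 0)"
    unfolding eqn_def by (intro lc_add lc_diff T1 T2 T3 T4 T5)
  moreover have "lc (m + e) (\<lambda>y. eqn m b (?w y)) 0"
    using EQ V lc_sum_zero[of "{}" "m + e" "\<lambda>_ _. 0"] by simp
  ultimately have "xr ^ m * lead (x - xr) (tr xr (butlast V)) - ?\<delta> (x ^ m * b (tr x V)) + ?\<delta> (x ^ m * b V)
      - (x - fst c) ^ m * lead (fst c) V' + 0 = 0" by (rule lc_unique)
  moreover have hd: "hd V = c" "tl V = V'" by (simp_all add: Vc)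
  ultimately show ?thesis unfolding xr_def[symmetric] hd by (cases "e = 0") (simp_all add: algebra_simps)
qed

text \<open>The recursion for \<open>e = 0\<close> expresses a value by values on words whose
  \<open>y\<close>-coordinates are shifted by one place to the left, so independence of the first
  coordinates spreads to the right.\<close>

lemma independent_of_y:
  assumes m: "1 \<le> m" and d: "1 \<le> d" and EQ: "\<And>w. length w = Suc d \<Longrightarrow> eqn m b w = 0"
    and b1: "\<And>x y y' w. length w = d - 1 \<Longrightarrow> b ((x, y) # w) = b ((x, y') # w)"
    and w: "length w = d" "map fst w = map fst w'"
  shows "b w = b w'"
proof -
  have step: "b u = (fst (hd u) + 1) ^ m * (b (tr (fst (hd u) + 1) V) - b V) + (fst (hd u) + 1 - fst (hd V)) ^ m * b V"
    if u: "length u = d" "V = tr (-1) (tl u) @ [(1, 0)]" for u V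
  proof -
    have V: "length V = d" using u d by simp
    have L: "lc 0 (\<lambda>y. b ((x, y + s) # w)) (b ((x, 0) # w))" if "length w = d - 1" for x s w
    proof -
      have "(\<lambda>y. b ((x, y + s) # w)) = (\<lambda>y. b ((x, 0) # w))" by (rule ext) (rule b1[OF that])
      then show ?thesis by (simp only: lc_const)
    qed
    have "V \<noteq> []" "u \<noteq> []" using V u d by auto
    then have e: "b ((fst (hd V), 0) # tl V) = b V" "b ((fst (hd u), 0) # tl u) = b u"
      using b1[of "tl V" "fst (hd V)" 0 "snd (hd V)"] b1[of "tl u" "fst (hd u)" 0 "snd (hd u)"] V u by simp_all
    have f: "fst (last V) = 1" "tr 1 (butlast V) = tl u" using u by (simp_all add: tr_def o_def)
    show ?thesis
      using leading_recursion[OF m V d EQ L, of "fst (hd u) + 1"] unfolding f e by (simp add: e algebra_simps)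
  qed
  have "b w = b w'" if "j \<le> d" "1 \<le> j" "length w = d" "map fst w = map fst w'" "drop j w = drop j w'" for j w w'
    using that
  proof (induction j arbitrary: w w')
    case (Suc j)
    have l: "length w' = d" using Suc.prems by (metis length_map)
    obtain c v where w: "w = c # v" using Suc.prems d by (cases w) auto
    obtain c' v' where w': "w' = c' # v'" using l d by (cases w') auto
    show ?case
    proof (cases "j = 0")
      case True
      then have "v = v'" "fst c = fst c'" using Suc.prems by (auto simp: w w')
      then show ?thesis using b1[of v "fst c" "snd c" "snd c'"] Suc.prems(3) by (cases c; cases c') (auto simp: w w')
    next
      case False
      \<comment> \<open>words whose last \<open>x\<close>-coordinate is \<open>1\<close> and for which the recursion returns the given words\<close>
      define V V' where V: "V = tr (-1) (tl w) @ [(1, 0)]" "V' = tr (-1) (tl w') @ [(1, 0)]"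
      have lv: "length V = d" "length V' = d" using Suc.prems(3) l d by (simp_all add: V)
      have mf: "map fst V = map fst V'"
        using Suc.prems(4) by (simp add: V w w' map_fst_tr)
      have "tr z (drop j V) = tr z (drop j V')" for z
      proof -
        have "length v = length v'" using Suc.prems(3) l by (simp add: w w')
        then show ?thesis using Suc.prems(5) by (simp add: V w w' tr_take_drop(2))
      qed
      then have dr: "drop j (tr z V) = drop j (tr z V')" for z by (simp add: tr_take_drop)
      have mf': "map fst (tr z V) = map fst (tr z V')" for z
        using mf by (simp add: map_fst_tr)
      have IH: "b (tr z V) = b (tr z V')" for z
        by (rule Suc.IH) (use Suc.prems False lv mf' dr in auto)
      have t0: "tr 0 u = u" for u by (simp add: tr_def)
      have "b V = b V'" using IH[of 0] by (simp add: t0)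
      moreover have "fst (hd V) = fst (hd V')" using mf lv d hd_map[of V fst] hd_map[of V' fst] by fastforce
      moreover have "fst (hd w) = fst (hd w')" using Suc.prems(4) by (simp add: w w')
      ultimately show ?thesis using step[OF Suc.prems(3) V(1)] step[OF l V(2)] IH by simp
    qed
  qed simp
  moreover have "drop d w = drop d w'" using w map_eq_imp_length_eq[OF w(2)] by simp
  ultimately show ?thesis using w d by blast
qed

text \<open>Setting the last \<open>x\<close>-coordinate to \<open>1\<close> in the recursion
  replaces the word by its tail, shifted by one, with the letter \<open>(1, 0)\<close> appended.
  After \<open>d\<close> steps the word is used up, and the collected factors are the differences of
  neighbours.\<close>

lemma leading_product:
  assumes d: "1 \<le> d" and rec: "\<And>x V. length V = d \<Longrightarrow> fst (last V) ^ m * lead (x - fst (last V)) (tr (fst (last V)) (butlast V))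
      = (x - fst (hd V)) ^ m * lead (fst (hd V)) (tl V)"
    and u: "length u = d"
  shows "lead (fst (hd u)) (tl u) = dp u ^ m * lead (fst (hd (stair d))) (tl (stair d))"
proof -
  let ?L = "\<lambda>u. lead (fst (hd u)) (tl u)"
  \<comment> \<open>the recursion with last coordinate \<open>1\<close>, all coordinates being shifted back by \<open>1\<close>\<close>
  have step: "?L u = (fst (hd u) + 1 - fst (hd V)) ^ m * ?L V" if "length u = d" "V = tr (-1) (tl u) @ [(1, 0)]" for u V
  proof -
    have V: "length V = d" using that d by simp
    have f: "fst (last V) = 1" "tr 1 (butlast V) = tl u" using that by (simp_all add: tr_def o_def)
    show ?thesis using rec[OF V, of "fst (hd u) + 1"] unfolding f by simp
  qed
  have "?L (tr (- of_nat i) v @ stair i) = dp v ^ m * ?L (stair d)" if "i + length v = d" for v i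
    using that
  proof (induction v arbitrary: i)
    case (Cons c v)
    let ?u = "tr (- of_nat i) (c # v) @ stair i"
    let ?V = "tr (- of_nat (Suc i)) v @ stair (Suc i)"
    have V: "?V = tr (-1) (tl ?u) @ [(1, 0)]" by (simp add: add.commute)
    have "?L ?u = (fst c + of_nat i + 1 - fst (hd ?V)) ^ m * ?L ?V"
      using step[OF _ V] Cons.prems by simp
    moreover have "?L ?V = dp v ^ m * ?L (stair d)" by (rule Cons.IH) (use Cons.prems in simp)
    moreover have "dp (c # v) = (fst c + of_nat i + 1 - fst (hd ?V)) * dp v"
      by (cases v) (simp_all add: hd_stair del: stair.simps)
    ultimately show ?case by (simp add: power_mult_distrib)
  qed simp
  from this[of 0 u] u show ?thesis by (simp add: tr_def)
qed

section \<open>The shape of a bihomogeneous solution\<close>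

lemma scl_zero_y: "\<forall>l\<in>set w. snd l = 0 \<Longrightarrow> scl 1 t w = w"
  by (induction w) auto

lemma dp_scl: "dp (scl s t u) = s ^ length u * dp u"
  by (induction u rule: dp.induct) (simp_all add: algebra_simps)

lemma lc_0: "lc 0 g c \<Longrightarrow> g y = c"
  unfolding lc_def by (auto elim: degree_eq_zeroE)

text \<open>If the degree in \<open>y\<^sub>1\<close> were zero, there would be no dependence on
  \<open>y\<close> at all. Otherwise the leading coefficient is a product of differences; evaluating
  it where the other \<open>y\<close>-coordinates vanish identifies the degrees.\<close>

lemma kernel_shape:
  assumes bdef: "b = ev (box N) a" and m: "1 \<le> m" and d: "1 \<le> d"
    and EQ: "\<And>w. length w = Suc d \<Longrightarrow> eqn m b w = 0"
    and hom: "\<And>s t w. b (scl s t w) = s ^ p * t ^ q * b w"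
    and nz: "length w0 = d" "b w0 \<noteq> 0" and q: "1 \<le> q"
  obtains c where "c \<noteq> 0" "p = d * m"
    "\<And>x w. length w = d - 1 \<Longrightarrow> \<forall>l\<in>set w. snd l = 0 \<Longrightarrow> b ((x, 1) # w) = c * dp ((x, 1) # w) ^ m"
proof -
  let ?J = "{j. j \<le> N \<and> (\<exists>x w. length w = d - 1 \<and> ycoeff N a j x w \<noteq> 0)}"
  obtain x0 y0 v0 where w0: "w0 = (x0, y0) # v0" using nz(1) d by (cases w0) auto
  have "?J \<noteq> {}"
  proof
    assume J: "?J = {}"
    have "ycoeff N a j x0 v0 = 0" if "j \<le> N" for j using J that nz(1) w0 by auto
    then have "b w0 = 0" unfolding bdef w0 ev_ycoeff by simp
    with nz(2) show False by simp
  qed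
  define e where "e = Max ?J"
  have fJ: "finite ?J" by simp
  have eJ: "e \<in> ?J" unfolding e_def by (rule Max_in[OF fJ \<open>?J \<noteq> {}\<close>])
  have top: "ycoeff N a j x w = 0" if "e < j" "j \<le> N" "length w = d - 1" for j x w
    using that Max_ge[OF fJ, of j] unfolding e_def by fastforce
  define lead where "lead = ycoeff N a e"
  have L: "lc e (\<lambda>y. b ((x, y + s) # w)) (lead x w)" if l: "length w = d - 1" for x s w
  proof -
    have 1: "lc e (\<lambda>y. lead x w * (y + s) ^ e) (lead x w)" using lc_cmult[OF lc_power[of e s], of "lead x w"] by simp
    have 2: "lc e (\<lambda>y. \<Sum>j\<in>{..N} - {e}. ycoeff N a j x w * (y + s) ^ j) 0"
    proof (rule lc_sum_zero)
      fix j assume j: "j \<in> {..N} - {e}"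
      show "lc e (\<lambda>y. ycoeff N a j x w * (y + s) ^ j) 0"
      proof (cases "j < e")
        case True
        then show ?thesis using lc_raise[OF lc_cmult[OF lc_power]] by blast
      next
        case False
        then have "ycoeff N a j x w = 0" using top j l by auto
        then show ?thesis using lc_sum_zero[of "{}" e "\<lambda>_ _. 0"] by simp
      qed
    qed
    have "b ((x, y + s) # w) = lead x w * (y + s) ^ e + (\<Sum>j\<in>{..N} - {e}. ycoeff N a j x w * (y + s) ^ j)" for y
      unfolding bdef ev_ycoeff lead_def by (rule sum.remove) (use eJ in auto)
    then show ?thesis using lc_add[OF 1 2] by simp
  qed
  have e0: "e \<noteq> 0"
  proof
    assume e: "e = 0"
    have b1: "b ((x, y) # w) = b ((x, y') # w)" if "length w = d - 1" for x y y' w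
      using lc_0[OF L[OF that, of x 0, unfolded e]] by simp
    have "b w0 = b (scl 1 2 w0)"
      by (rule independent_of_y[OF m d EQ b1 nz(1)]) (simp_all add: scl_def)
    then have "(2 :: rat) ^ q = 1" using nz(2) hom[of 1 2 w0] by simp
    then show False using one_less_power[of "2 :: rat" q] q by simp
  qed
  have rec: "fst (last V) ^ m * lead (x - fst (last V)) (tr (fst (last V)) (butlast V))
      = (x - fst (hd V)) ^ m * lead (fst (hd V)) (tl V)" if "length V = d" for x V
    using leading_recursion[OF m that d EQ L, of x] e0 by simp
  define C where "C = lead (fst (hd (stair d))) (tl (stair d))"
  have prod: "lead x w = dp ((x, y) # w) ^ m * C" if "length w = d - 1" for x y w
    using leading_product[OF d rec, of "(x, y) # w"] that d by (simp add: C_def)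
  obtain x1 w1 where x1: "length w1 = d - 1" "lead x1 w1 \<noteq> 0" using eJ by (auto simp: lead_def)
  define w2 where "w2 = scl 1 0 w1"
  have w2: "length w2 = d - 1" "\<forall>l\<in>set w2. snd l = 0" using x1 by (auto simp: w2_def scl_def)
  have "dp ((x1, 1) # w2) = dp ((x1, 1) # w1)" by (rule dp_cong) (simp add: w2_def scl_def)
  then have lead2: "lead x1 w2 \<noteq> 0" using prod[OF x1(1), of x1 1] prod[OF w2(1), of x1 1] x1(2) by simp
  then have C0: "C \<noteq> 0" and dp0: "dp ((x1, 1) # w2) ^ m \<noteq> 0" using prod[OF w2(1), of x1 1] by auto
  have gq: "lc q (\<lambda>y. b ((x, y) # w)) (b ((x, 1) # w))" "b ((x, y) # w) = b ((x, 1) # w) * y ^ q"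
    if "\<forall>l\<in>set w. snd l = 0" for x y w
  proof -
    have g: "b ((x, y) # w) = b ((x, 1) # w) * y ^ q" for y
      using hom[of 1 y "(x, 1) # w"] scl_zero_y[OF that, of y] by simp
    then show "b ((x, y) # w) = b ((x, 1) # w) * y ^ q" by blast
    have "(\<lambda>y. b ((x, y) # w)) = (\<lambda>y. b ((x, 1) # w) * (y + 0) ^ q)"
      unfolding add_0_right by (rule ext) (rule g)
    then show "lc q (\<lambda>y. b ((x, y) # w)) (b ((x, 1) # w))"
      using lc_cmult[OF lc_power[of q 0], of "b ((x, 1) # w)"] by (simp only: mult_1_right)
  qed
  have ge: "lc e (\<lambda>y. b ((x, y) # w)) (lead x w)" if "length w = d - 1" for x w
    using L[OF that, of x 0] by simp
  have eq: "e = q"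
  proof (rule linorder_cases[of e q])
    assume "e < q"
    then have "b ((x1, 1) # w2) = 0" using lc_unique[OF lc_raise[OF ge[OF w2(1)]] gq(1)[OF w2(2)]] by simp
    then have z: "b ((x1, 1) # w2) * y ^ q = 0" for y by simp
    have "(\<lambda>y. b ((x1, y) # w2)) = (\<lambda>y. 0)" by (rule ext) (rule trans[OF gq(2)[OF w2(2)] z])
    then have "lc e (\<lambda>y. 0) (lead x1 w2)" using ge[OF w2(1), of x1] by simp
    then show ?thesis using lc_unique[OF _ lc_sum_zero[of "{}" e "\<lambda>_ _. 0"]] lead2 by auto
  next
    assume "q < e"
    then show ?thesis using lc_unique[OF lc_raise[OF gq(1)[OF w2(2)]] ge[OF w2(1)]] lead2 by metis
  qed
  have shape: "b ((x, 1) # w) = C * dp ((x, 1) # w) ^ m" if "length w = d - 1" "\<forall>l\<in>set w. snd l = 0" for x w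
    using lc_unique[OF gq(1)[OF that(2)] ge[OF that(1), unfolded eq]] prod[OF that(1), of x 1] by simp
  have p: "p = d * m"
  proof -
    have z: "\<forall>l\<in>set (scl 2 1 w2). snd l = 0" using w2 by (auto simp: scl_def)
    have "b (scl 2 1 ((x1, 1) # w2)) = 2 ^ p * (C * dp ((x1, 1) # w2) ^ m)"
      unfolding hom using shape[OF w2] by simp
    moreover have "b (scl 2 1 ((x1, 1) # w2)) = C * dp (scl 2 1 ((x1, 1) # w2)) ^ m"
      using shape[OF _ z, of "2 * x1"] w2 by simp
    moreover have "dp (scl 2 1 ((x1, 1) # w2)) ^ m = 2 ^ (d * m) * dp ((x1, 1) # w2) ^ m"
      unfolding dp_scl using w2 d by (simp add: power_mult_distrib power_mult[symmetric])
    ultimately have "(2 :: rat) ^ p = 2 ^ (d * m)" using C0 dp0 by (simp del: power_eq_0_iff)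
    then show ?thesis using power_inject_exp[of "2 :: rat" p "d * m"] by simp
  qed
  show thesis by (rule that[OF C0 p shape])
qed

definition polyfn :: "(rat \<Rightarrow> rat) \<Rightarrow> bool" where "polyfn g \<longleftrightarrow> (\<exists>P. g = poly P)"

lemma polyfn_intros:
  "polyfn (\<lambda>t. k)" "polyfn (\<lambda>t. t)"
  "polyfn g \<Longrightarrow> polyfn h \<Longrightarrow> polyfn (\<lambda>t. g t + h t)"
  "polyfn g \<Longrightarrow> polyfn h \<Longrightarrow> polyfn (\<lambda>t. g t - h t)"
  "polyfn g \<Longrightarrow> polyfn h \<Longrightarrow> polyfn (\<lambda>t. g t * h t)"
  "polyfn g \<Longrightarrow> polyfn (\<lambda>t. g t ^ n)"
proof -
  show "polyfn (\<lambda>t. k)" unfolding polyfn_def by (rule exI[of _ "[:k:]"]) auto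
  show "polyfn (\<lambda>t. t)" unfolding polyfn_def by (rule exI[of _ "[:0, 1:]"]) auto
  assume "polyfn g"
  then obtain P where P: "g = poly P" by (auto simp: polyfn_def)
  show "polyfn (\<lambda>t. g t ^ n)" unfolding polyfn_def by (rule exI[of _ "P ^ n"]) (auto simp: P)
  assume "polyfn h"
  then obtain Q where Q: "h = poly Q" by (auto simp: polyfn_def)
  show "polyfn (\<lambda>t. g t + h t)" unfolding polyfn_def by (rule exI[of _ "P + Q"]) (auto simp: P Q)
  show "polyfn (\<lambda>t. g t - h t)" unfolding polyfn_def by (rule exI[of _ "P - Q"]) (auto simp: P Q)
  show "polyfn (\<lambda>t. g t * h t)" unfolding polyfn_def by (rule exI[of _ "P * Q"]) (auto simp: P Q)
qed

lemma polyfn_sum: "(\<And>i. i \<in> I \<Longrightarrow> polyfn (g i)) \<Longrightarrow> polyfn (\<lambda>t. \<Sum>i\<in>I. g i t)"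
  by (induction I rule: infinite_finite_induct) (auto intro: polyfn_intros)

lemma polyfn_prod: "(\<And>i. i \<in> I \<Longrightarrow> polyfn (g i)) \<Longrightarrow> polyfn (\<lambda>t. \<Prod>i\<in>I. g i t)"
  by (induction I rule: infinite_finite_induct) (auto intro: polyfn_intros)

text \<open>A polynomial function vanishing outside one point vanishes there too.\<close>

lemma polyfn_zero:
  assumes "polyfn g" "\<And>t. t \<noteq> 0 \<Longrightarrow> g t = 0" shows "g 0 = 0"
proof -
  obtain P where P: "g = poly P" using assms(1) by (auto simp: polyfn_def)
  have "UNIV - {0} \<subseteq> {t. poly P t = 0}" using assms(2) by (auto simp: P)
  moreover have "infinite (UNIV - {0 :: rat})" by (rule Diff_infinite_finite) (simp_all add: infinite_UNIV_char_0)
  ultimately have "P = 0" using finite_subset poly_roots_finite by blast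
  then show ?thesis by (simp add: P)
qed

lemma polyfn_ev:
  assumes len: "\<And>t. length (P t) = n" and "\<And>i. i < n \<Longrightarrow> polyfn (\<lambda>t. fst (P t ! i))" "\<And>i. i < n \<Longrightarrow> polyfn (\<lambda>t. zc (P t) i)"
  shows "polyfn (\<lambda>t. ev (box N) a (P t))"
proof -
  have s: "polyfn (\<lambda>t. snd (P t ! i))" if "i < n" for i
  proof -
    have "snd (P t ! i) = zc (P t) i - (if i = 0 then 0 else zc (P t) (i - 1))" for t
      using zc_step[of i "P t"] that len by simp
    then show ?thesis using assms(3)[of i] assms(3)[of "i - 1"] that by (cases "i = 0") (auto intro: polyfn_intros)
  qed
  have "polyfn (\<lambda>t. \<Sum>W\<in>bwords (box N) n. a W * (\<Prod>i<n. fst (P t ! i) ^ (fst (W ! i) - 1) * snd (P t ! i) ^ snd (W ! i) * (1 / fact (snd (W ! i)))))"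
    by (intro polyfn_sum polyfn_intros polyfn_prod) (use s assms in auto)
  moreover have "ev (box N) a (P t) = (\<Sum>W\<in>bwords (box N) n. a W * (\<Prod>i<n. fst (P t ! i) ^ (fst (W ! i) - 1) * snd (P t ! i) ^ snd (W ! i) * (1 / fact (snd (W ! i)))))" for t
    unfolding ev_closed[OF finite_box] len by (intro sum.cong refl) (auto simp: wm_def lm_def bwords_def)
  ultimately show ?thesis by simp
qed

lemma dp_pos:
  "(\<And>i. Suc i < length w \<Longrightarrow> fst (w ! Suc i) < fst (w ! i)) \<Longrightarrow> (\<And>i. i < length w \<Longrightarrow> 0 < fst (w ! i)) \<Longrightarrow> 0 < dp w"
proof (induction w rule: dp.induct)
  case (2 c)
  then show ?case using "2.prems"(2)[of 0] by simp
next
  case (3 c c' w)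
  have "0 < dp (c' # w)"
  proof (rule "3.IH")
    show "fst ((c' # w) ! Suc i) < fst ((c' # w) ! i)" if "Suc i < length (c' # w)" for i
      using "3.prems"(1)[of "Suc i"] that by simp
    show "0 < fst ((c' # w) ! i)" if "i < length (c' # w)" for i
      using "3.prems"(2)[of "Suc i"] that by simp
  qed
  then show ?case using "3.prems"(1)[of 0] by simp
qed simp

lemma delM_delN_agree:
  assumes "Suc a < length w" "snd (w ! Suc a) = 0" shows "delM (Suc a) w = delN a w"
proof (rule pts_eqI)
  show "length (delM (Suc a) w) = length (delN a w)" using assms by (simp add: delM_facts delN_facts)
  fix i assume "i < length (delM (Suc a) w)"
  then have i: "i < length w - 1" using assms by (simp add: delM_facts)
  show "fst (delM (Suc a) w ! i) = fst (delN a w ! i)"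
    using delM_facts(2)[OF assms(1) i] delN_facts(2)[OF assms(1) i] by (auto simp: less_Suc_eq_le)
  show "zc (delM (Suc a) w) i = zc (delN a w) i"
    using delM_facts(3)[OF assms(1) i] delN_facts(3)[OF assms(1) i] zc_step[of "Suc a" w] assms by (auto simp: less_Suc_eq)
qed

text \<open>Along \<open>y = (1, 0, \<dots>, t, \<dots>, 0)\<close> the equation compares the values
  for neighbouring positions of \<open>t\<close>, up to a multiple of \<open>t\<^sup>m\<close>. The
  values for the first and the last position are known, and the weighted sum over all positions
  telescopes to zero. So the sum of the multipliers of \<open>t\<^sup>m\<close> vanishes at \<open>t
  = 0\<close>, but there all of them have the sign of \<open>c\<close>.\<close>

lemma kernel_depth_ge_2:
  assumes bdef: "b = ev (box N) a" and m: "1 \<le> m" and d: "2 \<le> d"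
    and EQ: "\<And>w. length w = Suc d \<Longrightarrow> eqn m b w = 0"
    and hom: "\<And>s t w. b (scl s t w) = s ^ (d * m) * t ^ (d * m) * b w"
    and c: "c \<noteq> 0" and shape: "\<And>x w. length w = d - 1 \<Longrightarrow> \<forall>l\<in>set w. snd l = 0 \<Longrightarrow> b ((x, 1) # w) = c * dp ((x, 1) # w) ^ m"
  shows False
proof -
  \<comment> \<open>Subtracting the last of these coordinates gives the same result as deleting the first one and halving.
    So the two terms without a factor \<open>t\<^sup>m\<close> are values at one and the same set of \<open>x\<close>-coordinates.\<close>
  define X :: "nat \<Rightarrow> rat" where "X i = 2 ^ Suc d - 2 ^ i" for i
  define Y :: "nat \<Rightarrow> rat \<Rightarrow> nat \<Rightarrow> rat" where "Y a t i = (if i = 0 then 1 else 0) + (if i = a then t else 0)" for a t i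
  define W where "W a t = map (\<lambda>i. (X i, Y a t i)) [0..<Suc d]" for a t
  define Z where "Z a t = map (\<lambda>i. (2 ^ d - 2 ^ i :: rat, Y a t i)) [0..<d]" for a t
  define U where "U a = map (\<lambda>i. (X (Suc i), if Suc i = a then 1 else 0 :: rat)) [0..<d]" for a
  define H where "H a t = (X 0 * (1 + t)) ^ m * t ^ (d * m - m) * b (tr (X 0) (U a)) - X 0 ^ m * t ^ (d * m - m) * b (U a)
      + (2 ^ a) ^ m * b (delM a (W a t)) - (- (2 ^ (a - 1))) ^ m * b (delN (a - 1) (W a t))" for a t
  have lW: "length (W a t) = Suc d" for a t by (simp add: W_def)
  have nW: "W a t ! i = (X i, Y a t i)" if "i \<le> d" for a t i
    using that by (simp add: W_def del: upt_Suc)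
  have Xd: "X d = 2 ^ d" by (simp add: X_def)
  have dm: "m < d * m" "m + (d * m - m) = d * m" using m d by simp_all
  have rel: "2 ^ (d * m) * ((1 + t) ^ m * b (Z a t) - b (Z (a - 1) t)) = t ^ m * H a t" if a: "1 \<le> a" "a \<le> d" for a t
  proof -
    have ne: "W a t \<noteq> []" using lW[of a t] by auto
    have last: "fst (last (W a t)) = 2 ^ d" using ne nW[of d a t] lW by (simp add: last_conv_nth Xd)
    have hd: "hd (W a t) = (X 0, 1)" using ne nW[of 0 a t] a by (simp add: hd_conv_nth Y_def)
    have ys: "ysum (W a t) = 1 + t"
    proof -
      have "ysum (W a t) = (\<Sum>i\<in>{0..<Suc d}. Y a t i)"
        unfolding ysum_def W_def map_map o_def snd_conv by (simp only: interv_sum_list_conv_sum_set_nat set_upt)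
      also have "\<dots> = 1 + t" unfolding Y_def sum.distrib using a by (simp add: sum.delta del: sum.op_ivl_Suc)
      finally show ?thesis .
    qed
    have bl: "tr (2 ^ d) (butlast (W a t)) = Z a t"
      by (simp add: W_def Z_def tr_def X_def o_def)
    have tl: "tl (W a t) = scl 1 t (U a)"
    proof (rule nth_equalityI)
      fix i assume "i < length (tl (W a t))"
      then have i: "i < d" by (simp add: lW)
      show "tl (W a t) ! i = scl 1 t (U a) ! i"
        using i nW[of "Suc i" a t] lW[of a t] by (simp add: nth_tl scl_list U_def Y_def)
    qed (simp add: lW U_def)
    have trs: "tr z (scl 1 t u) = scl 1 t (tr z u)" for z u using scl_simps(6)[of 1 z t u] by simp
    have nx: "fst (W a t ! i) - nx (W a t) i = 2 ^ i" if "i \<le> d" for i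
      using that nW[of i a t] nW[of "Suc i" a t] by (cases "i = d") (simp_all add: nx_def lW X_def)
    have dM0: "delM 0 (W a t) = scl 2 1 (Z (a - 1) t)"
    proof (rule nth_equalityI)
      show "length (delM 0 (W a t)) = length (scl 2 1 (Z (a - 1) t))" using lW[of a t] by (simp add: delM_facts Z_def)
      fix i assume "i < length (delM 0 (W a t))"
      then have i: "i < d" using lW[of a t] by (simp add: delM_facts)
      have l: "Suc 0 < length (W a t)" using lW d by simp
      have "delM 0 (W a t) ! i = (if i = 0 then (fst (W a t ! 1), snd (W a t ! 0) + snd (W a t ! 1)) else W a t ! Suc i)"
        unfolding delM_eq[OF l] using i l lW[of a t] by (cases i) auto
      also have "\<dots> = (X (Suc i), Y (a - 1) t i)"
        using i a d nW[of 0 a t] nW[of 1 a t] nW[of "Suc i" a t] by (auto simp: Y_def)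
      also have "\<dots> = scl 2 1 (Z (a - 1) t) ! i"
        using i by (simp add: scl_list Z_def X_def algebra_simps)
      finally show "delM 0 (W a t) ! i = scl 2 1 (Z (a - 1) t) ! i" .
    qed
    have SM: "(\<Sum>i<length (W a t). ((fst (W a t ! i) - nx (W a t) i) * snd (W a t ! i)) ^ m * b (delM i (W a t)))
        = 2 ^ (d * m) * b (Z (a - 1) t) + t ^ m * ((2 ^ a) ^ m * b (delM a (W a t)))"
    proof -
      have "(\<Sum>i<length (W a t). ((fst (W a t ! i) - nx (W a t) i) * snd (W a t ! i)) ^ m * b (delM i (W a t)))
          = (\<Sum>i<Suc d. (2 ^ i * Y a t i) ^ m * b (delM i (W a t)))"
        unfolding lW by (intro sum.cong refl) (simp add: nx, simp add: nW)
      also have "\<dots> = (\<Sum>i\<in>{0, a}. (2 ^ i * Y a t i) ^ m * b (delM i (W a t)))"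
        by (rule sum.mono_neutral_right) (use a m in \<open>auto simp: Y_def\<close>)
      also have "\<dots> = b (delM 0 (W a t)) + t ^ m * ((2 ^ a) ^ m * b (delM a (W a t)))"
        using a by (simp add: Y_def power_mult_distrib)
      finally show ?thesis unfolding dM0 hom by simp
    qed
    have SN: "(\<Sum>i<length (W a t) - 1. ((fst (W a t ! Suc i) - fst (W a t ! i)) * snd (W a t ! Suc i)) ^ m * b (delN i (W a t)))
        = t ^ m * ((- (2 ^ (a - 1))) ^ m * b (delN (a - 1) (W a t)))"
    proof -
      have "(\<Sum>i<length (W a t) - 1. ((fst (W a t ! Suc i) - fst (W a t ! i)) * snd (W a t ! Suc i)) ^ m * b (delN i (W a t)))
          = (\<Sum>i<d. (- (2 ^ i) * Y a t (Suc i)) ^ m * b (delN i (W a t)))"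
        unfolding lW by (intro sum.cong) (auto simp: nW X_def)
      also have "\<dots> = (\<Sum>i\<in>{a - 1}. (- (2 ^ i) * Y a t (Suc i)) ^ m * b (delN i (W a t)))"
        by (rule sum.mono_neutral_right) (use a m in \<open>auto simp: Y_def\<close>)
      also have "\<dots> = (- (2 ^ (a - 1)) * t) ^ m * b (delN (a - 1) (W a t))"
        using a by (simp add: Y_def)
      finally show ?thesis by (simp only: power_mult_distrib mult_ac)
    qed
    have "0 = eqn m b (W a t)" using EQ[OF lW] by simp
    also have "\<dots> = (2 ^ d * (1 + t)) ^ m * b (Z a t) - (X 0 * (1 + t)) ^ m * (t ^ (d * m) * b (tr (X 0) (U a)))
        + X 0 ^ m * (t ^ (d * m) * b (U a)) - (2 ^ (d * m) * b (Z (a - 1) t) + t ^ m * ((2 ^ a) ^ m * b (delM a (W a t))))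
        + t ^ m * ((- (2 ^ (a - 1))) ^ m * b (delN (a - 1) (W a t)))"
      unfolding eqn_def SM SN last hd ys bl tl trs hom by (simp add: phi_def)
    finally have "(2 ^ d * (1 + t)) ^ m * b (Z a t) - 2 ^ (d * m) * b (Z (a - 1) t)
        = (X 0 * (1 + t)) ^ m * (t ^ (d * m) * b (tr (X 0) (U a))) - X 0 ^ m * (t ^ (d * m) * b (U a))
        + t ^ m * ((2 ^ a) ^ m * b (delM a (W a t))) - t ^ m * ((- (2 ^ (a - 1))) ^ m * b (delN (a - 1) (W a t)))"
      by (simp only: algebra_simps)
    moreover have "t ^ (d * m) = t ^ m * t ^ (d * m - m)" using dm(2) by (metis power_add)
    moreover have "(2 ^ d * (1 + t)) ^ m = 2 ^ (d * m) * (1 + t) ^ m" by (simp add: power_mult_distrib power_mult)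
    ultimately show ?thesis unfolding H_def by (simp only: algebra_simps)
  qed
  have gd: "b (Z d t) = b (Z d 0)" for t
    by (rule arg_cong[where f = b]) (simp add: Z_def Y_def)
  have g0: "b (Z 0 t) = (1 + t) ^ (d * m) * b (Z d 0)" for t
  proof -
    have "Z 0 t = scl 1 (1 + t) (Z d 0)" by (simp add: Z_def Y_def scl_def o_def)
    then show ?thesis using hom[of 1 "1 + t"] by simp
  qed
  \<comment> \<open>the weights make the left hand sides of the relation telescope\<close>
  define G where "G t = (\<Sum>a<d. (1 + t) ^ (a * m) * H (Suc a) t)" for t
  have "t ^ m * G t = 0" for t
  proof -
    have "t ^ m * G t = (\<Sum>a<d. (1 + t) ^ (a * m) * (2 ^ (d * m) * ((1 + t) ^ m * b (Z (Suc a) t) - b (Z a t))))"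
      unfolding G_def sum_distrib_left using rel[of "Suc _" t] by (intro sum.cong refl) (simp add: mult.left_commute)
    also have "\<dots> = 2 ^ (d * m) * (\<Sum>a<d. (1 + t) ^ (Suc a * m) * b (Z (Suc a) t) - (1 + t) ^ (a * m) * b (Z a t))"
      unfolding sum_distrib_left by (intro sum.cong refl) (simp add: power_add algebra_simps)
    also have "\<dots> = 2 ^ (d * m) * ((1 + t) ^ (d * m) * b (Z d t) - (1 + t) ^ (0 * m) * b (Z 0 t))"
      by (subst sum_lessThan_telescope) simp
    also have "\<dots> = 0" using gd[of t] g0[of t] by simp
    finally show ?thesis .
  qed
  then have Gz: "G t = 0" if "t \<noteq> 0" for t using that m by (metis mult_eq_0_iff power_eq_0_iff)
  have pW: "polyfn (\<lambda>t. fst (W a t ! i))" "polyfn (\<lambda>t. zc (W a t) i)" if "i \<le> d" for a i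
  proof -
    show "polyfn (\<lambda>t. fst (W a t ! i))" using that by (simp add: nW polyfn_intros)
    have "zc (W a t) i = (\<Sum>j\<in>{0..<Suc i}. Y a t j)" for t
    proof -
      have "take (Suc i) [0..<Suc d] = [0..<Suc i]" using that by (subst take_upt) auto
      then have "zc (W a t) i = sum_list (map (Y a t) [0..<Suc i])"
        unfolding zc_def ysum_def W_def take_map by (simp add: o_def del: upt_Suc)
      then show ?thesis by (simp only: interv_sum_list_conv_sum_set_nat set_upt)
    qed
    moreover have "polyfn (\<lambda>t. \<Sum>j\<in>{0..<Suc i}. Y a t j)"
    proof (rule polyfn_sum)
      fix j
      show "polyfn (\<lambda>t. Y a t j)" unfolding Y_def by (cases "j = a") (auto intro!: polyfn_intros)
    qed
    ultimately show "polyfn (\<lambda>t. zc (W a t) i)" by simp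
  qed
  have pM: "polyfn (\<lambda>t. b (delM (Suc a) (W (Suc a) t)))" "polyfn (\<lambda>t. b (delN a (W (Suc a) t)))" if "a < d" for a
  proof -
    have 1: "Suc a < length (W (Suc a) t)" for t using that lW by simp
    note fM = delM_facts[OF 1, unfolded lW diff_Suc_1]
    note fN = delN_facts[OF 1, unfolded lW diff_Suc_1]
    show "polyfn (\<lambda>t. b (delM (Suc a) (W (Suc a) t)))"
      unfolding bdef by (rule polyfn_ev[OF fM(1)]) (use pW in \<open>auto simp: fM\<close>)
    show "polyfn (\<lambda>t. b (delN a (W (Suc a) t)))"
      unfolding bdef by (rule polyfn_ev[OF fN(1)]) (use pW in \<open>auto simp: fN\<close>)
  qed
  have "polyfn G"
    unfolding G_def[abs_def] H_def diff_Suc_1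
    by (intro polyfn_sum polyfn_intros pM) auto
  then have G0: "G 0 = 0" using polyfn_zero Gz by blast
  have Hpos: "0 < H (Suc a) 0 / c" if a: "a < d" for a
  proof -
    let ?w = "W (Suc a) 0"
    let ?u = "delM (Suc a) ?w"
    have l: "Suc a < length ?w" using a lW by simp
    note f = delM_facts[OF l, unfolded lW diff_Suc_1]
    have y0: "snd (?w ! Suc a) = 0" using a by (simp add: nW Y_def)
    have u: "delN a ?w = ?u" using delM_delN_agree[OF l y0] by simp
    define V where "V = tl ?w"
    have w: "?w = (X 0, 1) # V"
      using nW[of 0 "Suc a" 0] lW[of "Suc a" 0] unfolding V_def by (cases ?w) (simp_all add: Y_def)
    have V0: "scl 1 0 V = V"
    proof (rule nth_equalityI)
      fix i assume "i < length (scl 1 0 V)"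
      then have i: "i < d" by (simp add: V_def lW)
      then have "V ! i = (X (Suc i), 0)" using nW[of "Suc i" "Suc a" 0] by (simp add: w Y_def)
      then show "scl 1 0 V ! i = V ! i" using i by (simp add: scl_list V_def lW)
    qed simp
    have "?u = (X 0, 1) # delM a V" unfolding w by (simp add: delM_Cons)
    moreover have "delM a V = scl 1 0 (delM a V)" using scl_del(1)[of a 1 0 V] V0 by simp
    then have "\<forall>l\<in>set (delM a V). snd l = 0" by (metis (no_types, lifting) imageE list.set_map mult_zero_left scl_def snd_conv)
    moreover have "length (delM a V) = d - 1" using a by (simp add: delM_facts V_def lW)
    ultimately have bu: "b ?u = c * dp ?u ^ m" using shape by simp
    have D: "0 < dp ?u"
    proof (rule dp_pos)
      have X: "X i < X j" if "j < i" for i j using that by (simp add: X_def)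
      show "0 < fst (?u ! i)" if "i < length ?u" for i
        using that f power_strict_increasing[of i "Suc d" "2 :: rat"] power_strict_increasing[of "Suc i" "Suc d" "2 :: rat"]
        by (auto simp: nW X_def)
      show "fst (?u ! Suc i) < fst (?u ! i)" if "Suc i < length ?u" for i
        using that f(1) f(2)[of "Suc i"] f(2)[of i] by (auto simp: nW intro: X)
    qed
    have "H (Suc a) 0 = ((2 ^ Suc a) ^ m - (- (2 ^ a)) ^ m) * dp ?u ^ m * c"
      unfolding H_def diff_Suc_1 u bu using dm(1) by (simp add: algebra_simps)
    moreover have "(- (2 ^ a)) ^ m < (2 ^ Suc a :: rat) ^ m"
    proof -
      have "(- (2 ^ a)) ^ m \<le> (2 ^ a :: rat) ^ m"
        by (metis abs_ge_self abs_minus_cancel abs_of_nonneg power_abs zero_le_numeral zero_le_power)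
      also have "\<dots> < (2 ^ Suc a) ^ m" by (rule power_strict_mono) (use m in auto)
      finally show ?thesis .
    qed
    ultimately show ?thesis using c D by simp
  qed
  have "0 < (\<Sum>a<d. H (Suc a) 0 / c)" 
  proof (rule sum_pos)
    have "0 \<in> {..<d}" using d by simp
    then show "{..<d} \<noteq> {}" by blast
  qed (use Hpos in auto)
  also have "\<dots> = G 0 / c" by (simp add: G_def sum_divide_distrib)
  finally show False using G0 by simp
qed

section \<open>The kernel\<close>

definition dx :: "word \<Rightarrow> nat" where "dx W = (\<Sum>l\<leftarrow>W. fst l - 1)"
definition dy :: "word \<Rightarrow> nat" where "dy W = (\<Sum>l\<leftarrow>W. snd l)"
text \<open>The part of degree \<open>p\<close> in the \<open>x\<close>-coordinates and degree
  \<open>q\<close> in the \<open>y\<close>-coordinates.\<close>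

definition bipart :: "(word \<Rightarrow> rat) \<Rightarrow> nat \<Rightarrow> nat \<Rightarrow> word \<Rightarrow> rat" where
  "bipart a p q W = (if dx W = p \<and> dy W = q then a W else 0)"

lemma ev_scl_general: "ev B a (scl s t w) = ev B (\<lambda>W. (s ^ dx W * t ^ dy W) * a W) w"
proof (induction w arbitrary: a)
  case (Cons c w)
  have "ev B (\<lambda>W. (s ^ dx (l # W) * t ^ dy (l # W)) * a (l # W)) w
      = (s ^ (fst l - 1) * t ^ snd l) * ev B (\<lambda>W. (s ^ dx W * t ^ dy W) * a (l # W)) w" for l
    unfolding ev_lin(2)[symmetric] by (rule ev_cong) (simp add: dx_def dy_def power_add mult_ac)
  then show ?case by (simp add: Cons lm_def power_mult_distrib mult_ac)
qed (simp add: dx_def dy_def)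

lemma ev_comp_scl: "ev B (bipart a p q) (scl s t w) = s ^ p * t ^ q * ev B (bipart a p q) w"
  unfolding ev_scl_general ev_lin(2)[symmetric] by (rule ev_cong) (simp add: bipart_def)

lemma degree_bound: "set W \<subseteq> box N \<Longrightarrow> dx W \<le> N * length W \<and> dy W \<le> N * length W"
proof (induction W)
  case (Cons l W)
  then have "fst l - 1 \<le> N" "snd l \<le> N" by (auto simp: box_def)
  with Cons show ?case by (auto simp: dx_def dy_def)
qed (simp add: dx_def dy_def)

lemma ev_components:
  assumes "N * length w \<le> M" shows "ev (box N) a w = (\<Sum>p\<le>M. \<Sum>q\<le>M. ev (box N) (bipart a p q) w)"
proof -
  have "(\<Sum>p\<le>M. \<Sum>q\<le>M. ev (box N) (bipart a p q) w) = ev (box N) (\<lambda>W. \<Sum>p\<le>M. \<Sum>q\<le>M. bipart a p q W) w"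
    by (simp add: ev_sum)
  also have "\<dots> = ev (box N) a w"
  proof (rule ev_cong)
    fix W assume "set W \<subseteq> box N" "length W = length w"
    then have b: "dx W \<le> M" "dy W \<le> M" using degree_bound[of W N] assms by auto
    have "(\<Sum>q\<le>M. bipart a p q W) = (if p = dx W then a W else 0)" for p
    proof -
      have "(\<Sum>q\<le>M. bipart a p q W) = (\<Sum>q\<le>M. if q = dy W then (if p = dx W then a W else 0) else 0)"
        by (intro sum.cong) (auto simp: bipart_def)
      then show ?thesis using b by simp
    qed
    then show "(\<Sum>p\<le>M. \<Sum>q\<le>M. bipart a p q W) = a W" using b by simp
  qed
  finally show ?thesis by simp
qed

lemma two_variable_zero:
  fixes c :: "nat \<Rightarrow> nat \<Rightarrow> rat"
  assumes "\<And>s t. s \<noteq> 0 \<Longrightarrow> t \<noteq> 0 \<Longrightarrow> (\<Sum>p\<le>M. \<Sum>q\<le>M. s ^ p * t ^ q * c p q) = 0" "p \<le> M" "q \<le> M"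
  shows "c p q = 0"
proof -
  have inf: "infinite (UNIV - {0 :: rat})" by (rule Diff_infinite_finite) (simp_all add: infinite_UNIV_char_0)
  have "(\<Sum>q\<le>M. c p q * t ^ q) = 0" if "t \<in> UNIV - {0}" for t
  proof (rule poly_sum_zero[where I = "{..M}" and k = "\<lambda>p. \<Sum>q\<le>M. c p q * t ^ q", OF _ inf])
    fix s :: rat assume "s \<in> UNIV - {0}"
    then have "(\<Sum>p\<le>M. \<Sum>q\<le>M. s ^ p * t ^ q * c p q) = 0" using assms(1) that by simp
    then show "(\<Sum>p\<le>M. (\<Sum>q\<le>M. c p q * t ^ q) * s ^ p) = 0"
      by (simp add: sum_distrib_right sum_distrib_left mult_ac)
  qed (use assms in auto)
  then show ?thesis
    using poly_sum_zero[of "{..M}" "UNIV - {0}" "c p" q] inf assms(3) by auto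
qed

lemma zc_scl: "i < length w \<Longrightarrow> zc (scl s t w) i = t * zc w i"
  by (simp add: zc_def scl_def take_map ysum_def o_def sum_list_const_mult)

lemma lswap_scl: "lswap (scl s t w) = scl t s (lswap w)"
proof (rule nth_equalityI)
  fix i assume "i < length (lswap (scl s t w))"
  then have i: "i < length w" "length w - Suc i < length w" "i \<noteq> 0 \<Longrightarrow> length w - i < length w" by auto
  show "lswap (scl s t w) ! i = scl t s (lswap w) ! i"
    using i by (auto simp: prod_eq_iff lswap_fst lswap_snd scl_list zc_scl right_diff_distrib)
qed simp

lemma finl_eqn: "finl (\<lambda>b. eqn m b w)"
  unfolding eqn_def by (intro finl_add finl_diff finl_sum finl_cmult finl_eval)

text \<open>The bihomogeneous parts solve the equation separately and are exchanged by the swap. A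
  nonzero part of bidegree \<open>(p, q)\<close> with \<open>q > 0\<close> has \<open>p = d
  m\<close>, hence by the swap also \<open>q = d m\<close>; the swap excludes \<open>q = 0 <
  p\<close>, and constants do not solve the equation.\<close>

lemma lowest_component:
  assumes f: "f = ev (box N) a" and sw: "swapinv f" and m: "1 \<le> m" and d: "1 \<le> d"
    and EQ: "\<And>w. length w = Suc d \<Longrightarrow> eqn m f w = 0"
  shows "d = 1 \<Longrightarrow> f [c] = f [(1, 1)] * phi m c" "2 \<le> d \<Longrightarrow> length u = d \<Longrightarrow> f u = 0"
proof -
  define M where "M = N * d"
  define b where "b p q = ev (box N) (bipart a p q)" for p q
  have hom: "b p q (scl s t w) = s ^ p * t ^ q * b p q w" for p q s t w
    by (simp add: b_def ev_comp_scl)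
  have dec: "f u = (\<Sum>p\<le>M. \<Sum>q\<le>M. b p q u)" if "length u = d" for u
    using ev_components[of N u M a] that by (simp add: f b_def M_def)
  have dec': "f (scl s t u) = (\<Sum>p\<le>M. \<Sum>q\<le>M. s ^ p * t ^ q * b p q u)" if "length u = d" for s t u
    using dec[of "scl s t u"] that by (simp add: hom)
  have EQb: "eqn m (b p q) w = 0" if pq: "p \<le> M" "q \<le> M" and w: "length w = Suc d" for p q w
  proof (rule two_variable_zero[where c = "\<lambda>p q. eqn m (b p q) w", OF _ pq])
    fix s t :: rat assume st: "s \<noteq> 0" "t \<noteq> 0"
    have "0 = eqn m f (scl s t w)" using EQ w by simp
    also have "\<dots> = (s * t) ^ m * 1 * eqn m (\<lambda>u. \<Sum>p\<le>M. \<Sum>q\<le>M. s ^ p * t ^ q * b p q u) w"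
      by (rule eqn_scl[OF _ w]) (simp add: dec')
    also have "eqn m (\<lambda>u. \<Sum>p\<le>M. \<Sum>q\<le>M. s ^ p * t ^ q * b p q u) w = (\<Sum>p\<le>M. \<Sum>q\<le>M. s ^ p * t ^ q * eqn m (b p q) w)"
      by (simp only: finl_sumD[OF finl_eqn] finlD(2)[OF finl_eqn])
    finally show "(\<Sum>p\<le>M. \<Sum>q\<le>M. s ^ p * t ^ q * eqn m (b p q) w) = 0" using st by simp
  qed
  have swb: "b p q (lswap u) = b q p u" if pq: "p \<le> M" "q \<le> M" and u: "length u = d" for p q u
  proof -
    have "b p q (lswap u) - b q p u = 0"
    proof (rule two_variable_zero[where c = "\<lambda>p q. b p q (lswap u) - b q p u", OF _ pq])
      fix s t :: rat
      have "f (scl s t (lswap u)) = f (scl t s u)" using sw unfolding lswap_scl[symmetric] swapinv_def by blast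
      then have "(\<Sum>p\<le>M. \<Sum>q\<le>M. s ^ p * t ^ q * b p q (lswap u)) = (\<Sum>p\<le>M. \<Sum>q\<le>M. t ^ p * s ^ q * b p q u)"
        using dec' u by simp
      also have "\<dots> = (\<Sum>p\<le>M. \<Sum>q\<le>M. s ^ p * t ^ q * b q p u)" by (subst sum.swap) (simp add: mult_ac)
      finally show "(\<Sum>p\<le>M. \<Sum>q\<le>M. s ^ p * t ^ q * (b p q (lswap u) - b q p u)) = 0"
        by (simp add: right_diff_distrib sum_subtractf)
    qed
    then show ?thesis by simp
  qed
  \<comment> \<open>the shape lemma, for all bihomogeneous parts at once\<close>
  have shape: thesis if "p \<le> M" "q \<le> M" "length w = d" "b p q w \<noteq> 0" "1 \<le> q"
    "\<And>c. c \<noteq> 0 \<Longrightarrow> p = d * m \<Longrightarrow> (\<And>x w. length w = d - 1 \<Longrightarrow> \<forall>l\<in>set w. snd l = 0 \<Longrightarrow> b p q ((x, 1) # w) = c * dp ((x, 1) # w) ^ m) \<Longrightarrow> thesis"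
    for p q w thesis
    using kernel_shape[of "b p q" N "bipart a p q" m d p q w thesis] EQb hom that m d by (simp add: b_def)
  have bideg: "p = d * m \<and> q = d * m" if pq: "p \<le> M" "q \<le> M" and w: "length w = d" and nz: "b p q w \<noteq> 0" for p q w
  proof -
    have nz': "b q p (lswap w) \<noteq> 0" "length (lswap w) = d" using swb[OF pq(2,1)] w nz by simp_all
    have dm: "1 \<le> d * m" using d m by simp
    have P: "p = d * m" if "1 \<le> q" using shape[OF pq w nz that] by blast
    have Q: "q = d * m" if "1 \<le> p" using shape[OF pq(2,1) nz'(2,1) that] by blast
    show ?thesis
    proof (cases "p = 0 \<and> q = 0")
      case True
      have const: "b 0 0 u = b 0 0 v" if "length u = d" "length v = d" for u v
      proof -
        have "scl 0 0 u = scl 0 0 v" unfolding scl_def using that by (simp add: list_eq_iff_nth_eq)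
        then show ?thesis using hom[of 0 0 0 0 u] hom[of 0 0 0 0 v] by simp
      qed
      define k where "k = b 0 0 w"
      have k: "b 0 0 u = k" if "length u = d" for u unfolding k_def by (rule const[OF that w])
      \<comment> \<open>at this word the equation for a constant \<open>k\<close> reads \<open>- k = 0\<close>\<close>
      let ?v = "replicate d (0, 0) :: pt list"
      let ?w = "(1, 1) # ?v"
      have lv: "length ?w = Suc d" by simp
      have last: "last ?w = (0, 0)" using d by simp
      have ys: "ysum ?w = 1" by (simp add: ysum_def sum_list_replicate)
      have z: "snd (?w ! Suc i) = 0" if "i < d" for i using that by simp
      have "(\<Sum>i<length ?w. ((fst (?w ! i) - nx ?w i) * snd (?w ! i)) ^ m * b 0 0 (delM i ?w)) = k"
      proof -
        have "(\<Sum>i<length ?w. ((fst (?w ! i) - nx ?w i) * snd (?w ! i)) ^ m * b 0 0 (delM i ?w))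
            = (\<Sum>i\<in>{0}. ((fst (?w ! i) - nx ?w i) * snd (?w ! i)) ^ m * b 0 0 (delM i ?w))"
        proof (rule sum.mono_neutral_right)
          show "\<forall>i\<in>{..<length ?w} - {0}. ((fst (?w ! i) - nx ?w i) * snd (?w ! i)) ^ m * b 0 0 (delM i ?w) = 0"
          proof
            fix i assume "i \<in> {..<length ?w} - {0}"
            then have "snd (?w ! i) = 0" by (cases i) auto
            then show "((fst (?w ! i) - nx ?w i) * snd (?w ! i)) ^ m * b 0 0 (delM i ?w) = 0" using m by simp
          qed
        qed auto
        also have "\<dots> = k" using d by (simp add: nx_def k delM_facts)
        finally show ?thesis .
      qed
      moreover have "(\<Sum>i<length ?w - 1. ((fst (?w ! Suc i) - fst (?w ! i)) * snd (?w ! Suc i)) ^ m * b 0 0 (delN i ?w)) = 0"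
        by (rule sum.neutral) (use z m in auto)
      ultimately have "eqn m (b 0 0) ?w = - k"
        unfolding eqn_def last ys using m d by (simp add: phi_def k)
      then show ?thesis using EQb[of 0 0 ?w] nz True by (simp add: k_def)
    next
      case False
      then show ?thesis using P Q dm by (cases "q = 0"; cases "p = 0") auto
    qed
  qed
  show "f u = 0" if d2: "2 \<le> d" and u: "length u = d"
  proof -
    have "b p q u = 0" if pq: "p \<le> M" "q \<le> M" for p q
    proof (rule ccontr)
      assume nz: "b p q u \<noteq> 0"
      have e: "p = d * m" "q = d * m" using bideg[OF pq u nz] by simp_all
      have "1 \<le> q" using e d m by simp
      from shape[OF pq u nz this] obtain c where c: "c \<noteq> 0"
        "\<And>x w. length w = d - 1 \<Longrightarrow> \<forall>l\<in>set w. snd l = 0 \<Longrightarrow> b p q ((x, 1) # w) = c * dp ((x, 1) # w) ^ m" by blast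
      show False
        by (rule kernel_depth_ge_2[OF _ m d2 EQb[OF pq] _ c]) (simp_all add: b_def ev_comp_scl e)
    qed
    then show ?thesis using dec[OF u] by simp
  qed
  show "f [c] = f [(1, 1)] * phi m c" if d1: "d = 1"
  proof -
    have "f [c] = (\<Sum>p\<le>M. \<Sum>q\<le>M. fst c ^ p * snd c ^ q * b p q [(1, 1)])"
      using dec'[of "[(1, 1)]" "fst c" "snd c"] d1 by simp
    also have "\<dots> = (\<Sum>p\<le>M. \<Sum>q\<le>M. phi m c * b p q [(1, 1)])"
    proof (intro sum.cong refl)
      fix p q assume "p \<in> {..M}" "q \<in> {..M}"
      then show "fst c ^ p * snd c ^ q * b p q [(1, 1)] = phi m c * b p q [(1, 1)]"
        using bideg[of p q "[(1, 1)]"] d1 by (cases "b p q [(1, 1)] = 0") (auto simp: phi_def power_mult_distrib)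
    qed
    also have "\<dots> = phi m c * f [(1, 1)]"
      using dec[of "[(1, 1)]"] d1 by (simp add: sum_distrib_left)
    finally show ?thesis by simp
  qed
qed

lemma lari_self: "lari A A w = 0" by (simp add: lari_def)

lemma lari_right_lin:
  "lari A (\<lambda>u. B u - k * B' u) w = lari A B w - k * lari A B' w"
proof -
  have 1: "larit (\<lambda>u. B u - k * B' u) A w = larit B A w - k * larit B' A w"
    using larit_add[of B "\<lambda>u. (- k) * B' u" A w] larit_cmult[of "- k" B' A w] by simp
  show ?thesis
    unfolding lari_def 1 by (simp add: finlD[OF finl_larit] lmu_lin algebra_simps)
qed

lemma gpoc_right_lin: "gpoc (\<lambda>u. f u - k * g u) w = gpoc f w - k * gpoc g w"
  by (simp add: finlD[OF finl_gpic(2)])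

text \<open>The bracket is alternating by definition.\<close>

lemma uri_multiple_zero: "uri ((delta_check ^^ m) xi1) (bscale c ((delta_check ^^ m) xi1)) = bzero"
proof
  fix r
  let ?\<xi> = "(delta_check ^^ m) xi1"
  have T: "BR True ?\<xi> (xisq m)" "BR True (bscale c ?\<xi>) (\<lambda>w. c * xisq m w)"
    using BR_xisq bscale_xisq_frakB rep_True unfolding BR_def by blast+
  have B: "BR True (uri ?\<xi> (bscale c ?\<xi>)) (luri (xisq m) (\<lambda>w. c * xisq m w))"
    by (rule BR_uri[OF T]) simp_all
  have "lari (gpoc (xisq m)) (gpoc (\<lambda>w. c * xisq m w)) w = 0" for w
  proof -
    have "gpoc (\<lambda>w. c * xisq m w) = (\<lambda>w. gpoc (\<lambda>w. 0) w - (- c) * gpoc (xisq m) w)"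
      by (intro ext) (simp add: finlD[OF finl_gpic(2)])
    moreover have "gpoc (\<lambda>w. 0) w = 0 * gpoc (xisq m) w" for w by (simp add: finlD[OF finl_gpic(2)])
    ultimately have "gpoc (\<lambda>w. c * xisq m w) = (\<lambda>w. gpoc (xisq m) w - (1 - c) * gpoc (xisq m) w)"
      by (simp add: left_diff_distrib)
    then show ?thesis by (simp only: lari_right_lin lari_self)
  qed
  then have "lari (gpoc (xisq m)) (gpoc (\<lambda>w. c * xisq m w)) = (\<lambda>w. 0)" by (rule ext)
  then have z: "luri (xisq m) (\<lambda>w. c * xisq m w) w = 0" for w
    by (simp only: luri_def finlD[OF finl_gpic(1)])
  have "uri ?\<xi> (bscale c ?\<xi>) r = 0"
  proof (rule rep_unique[OF _ rep_zero])
    show "rep True r (uri ?\<xi> (bscale c ?\<xi>) r) (luri (xisq m) (\<lambda>w. c * xisq m w))" using B by (simp add: BR_def)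
  qed (rule z)
  then show "uri ?\<xi> (bscale c ?\<xi>) r = bzero r" by (simp add: bzero_def)
qed

text \<open>Subtract the multiple determined in depth one; the difference lies in the kernel as
  well, and its lowest component, if any, would have depth at least two.\<close>

lemma kernel_is_multiple:
  assumes m: "1 \<le> m" and A: "A \<in> frakB" and u: "uri ((delta_check ^^ m) xi1) A = bzero"
  shows "\<exists>c. A = bscale c ((delta_check ^^ m) xi1)"
proof -
  obtain f L where f: "BR False A f" "f [] = 0" "swapinv f" "\<And>w. length w > L \<Longrightarrow> f w = 0"
    using frakB_E[OF A] by metis
  have z: "eqg (lari (gpoc (xisq m)) (gpoc f)) (\<lambda>w. 0)" by (rule lari_of_uri_zero[OF f(1,2) u])
  obtain a N where a: "f = ev (box N) a" using coefficients[OF f(1,4)] by metis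
  define k where "k = f [(1, 1)]"
  have k: "f [c] = k * phi m c" for c
    unfolding k_def
  proof (rule lowest_component(1)[OF a f(3) m order_refl _ refl])
    show "eqn m f w = 0" if "length w = Suc 1" for w
      by (rule eqn_zero[OF f(1) z _ order_refl that]) (simp add: f(2))
  qed
  define g where "g w = f w - k * xisq m w" for w
  define A' where "A' r = A r - bscale k ((delta_check ^^ m) xi1) r" for r
  have kx: "BR False (bscale k ((delta_check ^^ m) xi1)) (\<lambda>w. k * xisq m w)" using bscale_xisq_frakB by blast
  have A': "BR False A' g"
    using f(1) kx rep_minus unfolding BR_def A'_def g_def by blast
  have g_long: "g w = 0" if "length w > max L (2 * m + 1)" for w
    using that f(4) xisq_length[of m w] by (simp add: g_def)
  obtain a' N' where a': "g = ev (box N') a'" using coefficients[OF A' g_long] by metis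
  have gs: "swapinv g" using f(3) swapinv_xisq[of m] by (simp add: g_def swapinv_def)
  have "lari (gpoc (xisq m)) (gpoc g) w = lari (gpoc (xisq m)) (gpoc f) w" for w
  proof -
    have "gpoc g = (\<lambda>w. gpoc f w - k * gpoc (xisq m) w)"
      unfolding g_def[abs_def] by (rule ext) (rule gpoc_right_lin)
    then show ?thesis by (simp only: lari_right_lin lari_self)
  qed
  then have zg: "eqg (lari (gpoc (xisq m)) (gpoc g)) (\<lambda>w. 0)" using z by (simp add: eqg_def)
  have "g w = 0" for w
  proof (induction "length w" arbitrary: w rule: less_induct)
    case less
    consider "w = []" | c where "w = [c]" | "2 \<le> length w" by (cases w; cases "tl w") auto
    then show ?case
    proof cases
      case 1
      then show ?thesis by (simp add: g_def f(2))
    next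
      case 2
      then show ?thesis by (simp add: g_def k xisq_depth1 phi_def)
    next
      case 3
      have "1 \<le> length w" using 3 by simp
      then show ?thesis
        using lowest_component(2)[OF a' gs m _ eqn_zero[OF A' zg less.hyps] 3 refl] by simp
    qed
  qed
  then have fe: "f w = k * xisq m w" for w by (simp add: g_def)
  have "A r = bscale k ((delta_check ^^ m) xi1) r" for r
    using f(1) kx fe unfolding BR_def by (intro rep_unique[of False r "A r" f _ "\<lambda>w. k * xisq m w"]) auto
  then show ?thesis by blast
qed

theorem theorem8p6:
  fixes r :: nat
  assumes "r \<ge> 1"
  shows "ker_on frakB (partial_odd r) = {bscale c ((delta_check ^^ r) xi1) | c :: rat. True}"
proof
  show "ker_on frakB (partial_odd r) \<subseteq> {bscale c ((delta_check ^^ r) xi1) | c :: rat. True}"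
    using kernel_is_multiple[OF assms] by (auto simp: ker_on_def partial_odd_def)
  show "{bscale c ((delta_check ^^ r) xi1) | c :: rat. True} \<subseteq> ker_on frakB (partial_odd r)"
    using bscale_xisq_frakB uri_multiple_zero by (auto simp: ker_on_def partial_odd_def)
qed

end
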